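(* Let $Q$ be the Bondal quiver and $P^\perp\subset D^b(Q)$ the right orthogonal of the exceptional object $P$. There exists no Serre-invariant Bridgeland stability condition on $P^\perp$.
   Context: Let $k$ be an algebraically closed field of characteristic $0$. The Bondal quiver $Q$ has vertices $1,2,3$, arrows $\alpha_1,\beta_1\colon 1\to 2$ and $\alpha_2,\beta_2\colon 2\to 3$, and relations $\beta_2\alpha_1=0$, $\alpha_2\beta_1=0$. Let $I$ be the ideal of $kQ$ generated by $\beta_2\alpha_1,\alpha_2\beta_1$, and let $D^b(Q)$ be the bounded derived category of finite-dimensional right $kQ/I$-modules, identified with finite-dimensional representations $V_1\rightrightarrows V_2\rightrightarrows V_3$ of $Q$ satisfying the relations. The representation $P$ is $V_1=V_2=V_3=k$ with $\alpha_1=\alpha_2=1$, $\beta_1=\beta_2=0$; it is an exceptional object of $D^b(Q)$. $P^\perp=\{T\in D^b(Q) : \mathrm{Hom}(P,T[i])=0\ \forall i\in\mathbb{Z}\}$; it is an admissible subcategory, hence has a Serre functor $S_{P^\perp}$. The group of autoequivalences acts on the left, and $\widetilde{GL}{}_2^+(\mathbb{R})$ (the universal cover of $GL_2^+(\mathbb{R})$) acts on the right, on the set of Bridgeland stability conditions on $P^\perp$ in the usual way. A Bridgeland stability condition $\sigma$ on $P^\perp$ is Serre-invariant if $S_{P^\perp}\cdot\sigma=\sigma\cdot g$ for some $g\in\widetilde{GL}{}_2^+(\mathbb{R})$. *)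

theory Defs
  imports
    Complex_Main
    "HOL-Library.FuncSet"
    "HOL-Library.Poly_Mapping"
    "HOL-Computational_Algebra.Polynomial"
    "HOL-Algebra.Free_Abelian_Groups"
    "Jordan_Normal_Form.Matrix"
begin

section \<open>Linear categories with shifts and distinguished triangles\<close>

text \<open>The data of a triangulated category, linear over a field. Objects have type \<open>'o\<close>,
  morphisms type \<open>'m\<close>, scalars type \<open>'k\<close>. \<open>shift C i X\<close> is $X[i]$, \<open>shiftm C i f\<close> is $f[i]$, and
  \<open>cmp C g f\<close> is $g \circ f$. An element \<open>(X, Y, Z, f, g, h)\<close> of \<open>dtri C\<close> is a
  distinguished triangle $X \to Y \to Z \to X[1]$.\<close>

record ('o, 'm, 'k) tricat =
  obj :: "'o set"
  mor :: "'o \<Rightarrow> 'o \<Rightarrow> 'm set"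
  idt :: "'o \<Rightarrow> 'm"
  cmp :: "'m \<Rightarrow> 'm \<Rightarrow> 'm"
  mzero :: "'o \<Rightarrow> 'o \<Rightarrow> 'm"
  madd :: "'m \<Rightarrow> 'm \<Rightarrow> 'm"
  mscale :: "'k \<Rightarrow> 'm \<Rightarrow> 'm"
  shift :: "int \<Rightarrow> 'o \<Rightarrow> 'o"
  shiftm :: "int \<Rightarrow> 'm \<Rightarrow> 'm"
  dtri :: "('o \<times> 'o \<times> 'o \<times> 'm \<times> 'm \<times> 'm) set"

definition is_iso_mor :: "('o, 'm, 'k) tricat \<Rightarrow> 'o \<Rightarrow> 'o \<Rightarrow> 'm \<Rightarrow> bool" where
  "is_iso_mor C X Y f \<longleftrightarrow>
     f \<in> mor C X Y \<and> (\<exists>g \<in> mor C Y X. cmp C g f = idt C X \<and> cmp C f g = idt C Y)"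

definition isomorphic :: "('o, 'm, 'k) tricat \<Rightarrow> 'o \<Rightarrow> 'o \<Rightarrow> bool" where
  "isomorphic C X Y \<longleftrightarrow> (\<exists>f. is_iso_mor C X Y f)"

definition zero_object :: "('o, 'm, 'k) tricat \<Rightarrow> 'o \<Rightarrow> bool" where
  "zero_object C X \<longleftrightarrow> X \<in> obj C \<and> idt C X = mzero C X X"

definition is_biproduct :: "('o, 'm, 'k) tricat \<Rightarrow> 'o \<Rightarrow> 'o \<Rightarrow> 'o \<Rightarrow> bool" where
  "is_biproduct C X Y B \<longleftrightarrow> B \<in> obj C \<and>
     (\<exists>i \<in> mor C X B. \<exists>j \<in> mor C Y B. \<exists>p \<in> mor C B X. \<exists>q \<in> mor C B Y.
        cmp C p i = idt C X \<and> cmp C q j = idt C Y \<and>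
        cmp C p j = mzero C Y X \<and> cmp C q i = mzero C X Y \<and>
        madd C (cmp C i p) (cmp C j q) = idt C B)"

text \<open>The full subcategory on a set of objects closed under shifts and cones.\<close>

definition full_sub :: "('o, 'm, 'k) tricat \<Rightarrow> 'o set \<Rightarrow> ('o, 'm, 'k) tricat" where
  "full_sub C A = C\<lparr>obj := obj C \<inter> A,
     dtri := {(X, Y, Z, f, g, h). (X, Y, Z, f, g, h) \<in> dtri C \<and> X \<in> A \<and> Y \<in> A \<and> Z \<in> A}\<rparr>"

definition right_orth :: "('o, 'm, 'k) tricat \<Rightarrow> 'o \<Rightarrow> ('o, 'm, 'k) tricat" where
  "right_orth C E =
     full_sub C {T \<in> obj C. \<forall>i. mor C E (shift C i T) = {mzero C E (shift C i T)}}"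

section \<open>Exact autoequivalences and Serre functors\<close>

record ('o, 'm) endo =
  fob :: "'o \<Rightarrow> 'o"
  fmor :: "'m \<Rightarrow> 'm"

definition linear_functor :: "('o, 'm, 'k) tricat \<Rightarrow> ('o, 'm) endo \<Rightarrow> bool" where
  "linear_functor C F \<longleftrightarrow>
     (\<forall>X \<in> obj C. fob F X \<in> obj C \<and> fmor F (idt C X) = idt C (fob F X)) \<and>
     (\<forall>X \<in> obj C. \<forall>Y \<in> obj C. \<forall>f \<in> mor C X Y.
        fmor F f \<in> mor C (fob F X) (fob F Y) \<and>
        (\<forall>c. fmor F (mscale C c f) = mscale C c (fmor F f)) \<and>
        (\<forall>f' \<in> mor C X Y. fmor F (madd C f f') = madd C (fmor F f) (fmor F f')) \<and>
        (\<forall>Z \<in> obj C. \<forall>g \<in> mor C Y Z. fmor F (cmp C g f) = cmp C (fmor F g) (fmor F f)))"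

text \<open>Exactness: the functor commutes with $[1]$ up to a natural isomorphism
  $\eta_X : F(X[1]) \to F(X)[1]$ and, using it, preserves distinguished triangles.\<close>

definition exact_functor :: "('o, 'm, 'k) tricat \<Rightarrow> ('o, 'm) endo \<Rightarrow> bool" where
  "exact_functor C F \<longleftrightarrow> linear_functor C F \<and>
     (\<exists>\<eta>. (\<forall>X \<in> obj C. is_iso_mor C (fob F (shift C 1 X)) (shift C 1 (fob F X)) (\<eta> X)) \<and>
          (\<forall>X \<in> obj C. \<forall>Y \<in> obj C. \<forall>f \<in> mor C X Y.
             cmp C (shiftm C 1 (fmor F f)) (\<eta> X) = cmp C (\<eta> Y) (fmor F (shiftm C 1 f))) \<and>
          (\<forall>X Y Z f g h. (X, Y, Z, f, g, h) \<in> dtri C \<longrightarrow>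
             (fob F X, fob F Y, fob F Z, fmor F f, fmor F g, cmp C (\<eta> X) (fmor F h)) \<in> dtri C))"

definition autoequivalence :: "('o, 'm, 'k) tricat \<Rightarrow> ('o, 'm) endo \<Rightarrow> bool" where
  "autoequivalence C F \<longleftrightarrow> exact_functor C F \<and>
     (\<forall>X \<in> obj C. \<forall>Y \<in> obj C. bij_betw (fmor F) (mor C X Y) (mor C (fob F X) (fob F Y))) \<and>
     (\<forall>Y \<in> obj C. \<exists>X \<in> obj C. isomorphic C (fob F X) Y)"

definition dual_mor :: "('o, 'm, 'k :: field) tricat \<Rightarrow> 'o \<Rightarrow> 'o \<Rightarrow> ('m \<Rightarrow> 'k) set" where
  "dual_mor C X Y = {\<xi> \<in> extensional (mor C X Y).
     \<forall>f \<in> mor C X Y. (\<forall>g \<in> mor C X Y. \<xi> (madd C f g) = \<xi> f + \<xi> g) \<and>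
                      (\<forall>c. \<xi> (mscale C c f) = c * \<xi> f)}"

text \<open>A Serre functor is an autoequivalence $S$ with linear isomorphisms
  $\theta_{X,Y} : \mathrm{Hom}(X,Y) \to \mathrm{Hom}(Y,SX)^*$ natural in $X$ and $Y$.\<close>

definition serre_functor :: "('o, 'm, 'k :: field) tricat \<Rightarrow> ('o, 'm) endo \<Rightarrow> bool" where
  "serre_functor C S \<longleftrightarrow> autoequivalence C S \<and>
     (\<exists>\<theta>. \<forall>X \<in> obj C. \<forall>Y \<in> obj C.
        bij_betw (\<theta> X Y) (mor C X Y) (dual_mor C Y (fob S X)) \<and>
        (\<forall>f \<in> mor C X Y. \<forall>g \<in> mor C Y (fob S X).
           (\<forall>f' \<in> mor C X Y. \<theta> X Y (madd C f f') g = \<theta> X Y f g + \<theta> X Y f' g) \<and>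
           (\<forall>c. \<theta> X Y (mscale C c f) g = c * \<theta> X Y f g)) \<and>
        (\<forall>X' \<in> obj C. \<forall>Y' \<in> obj C. \<forall>u \<in> mor C X' X. \<forall>f \<in> mor C X Y. \<forall>v \<in> mor C Y Y'.
           \<forall>g \<in> mor C Y' (fob S X').
             \<theta> X' Y' (cmp C v (cmp C f u)) g = \<theta> X Y f (cmp C (fmor S u) (cmp C g v))))"

section \<open>The Grothendieck group\<close>

definition K0_relations :: "('o, 'm, 'k) tricat \<Rightarrow> ('o \<Rightarrow>\<^sub>0 int) set" where
  "K0_relations C = generate (free_Abelian_group (obj C))
     {frag_of Y - frag_of X - frag_of Z | X Y Z. \<exists>f g h. (X, Y, Z, f, g, h) \<in> dtri C}"

definition K0 :: "('o, 'm, 'k) tricat \<Rightarrow> ('o \<Rightarrow>\<^sub>0 int) set monoid" where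
  "K0 C = free_Abelian_group (obj C) Mod K0_relations C"

definition K0_class :: "('o, 'm, 'k) tricat \<Rightarrow> 'o \<Rightarrow> ('o \<Rightarrow>\<^sub>0 int) set" where
  "K0_class C X = K0_relations C #>\<^bsub>free_Abelian_group (obj C)\<^esub> frag_of X"

text \<open>The map $[X] \mapsto [FX]$ induced by an exact functor, on cosets.\<close>

definition K0_map :: "('o, 'm, 'k) tricat \<Rightarrow> ('o, 'm) endo \<Rightarrow> ('o \<Rightarrow>\<^sub>0 int) set \<Rightarrow> ('o \<Rightarrow>\<^sub>0 int) set" where
  "K0_map C F \<kappa> = (\<Union>a \<in> \<kappa>. K0_relations C #>\<^bsub>free_Abelian_group (obj C)\<^esub>
                               frag_extend (\<lambda>X. frag_of (fob F X)) a)"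

definition complex_additive_group :: "complex monoid" where
  "complex_additive_group = \<lparr>carrier = UNIV, monoid.mult = (+), one = 0\<rparr>"

section \<open>Bridgeland stability conditions\<close>

text \<open>Central charges are kept extensional on the Grothendieck group and slices closed under
  isomorphism, so that equality of records is equality of stability conditions.\<close>

record 'o stab =
  charge :: "('o \<Rightarrow>\<^sub>0 int) set \<Rightarrow> complex"
  slice :: "real \<Rightarrow> 'o set"

definition additive_strict_subcat :: "('o, 'm, 'k) tricat \<Rightarrow> 'o set \<Rightarrow> bool" where
  "additive_strict_subcat C A \<longleftrightarrow> A \<subseteq> obj C \<and>
     (\<forall>X \<in> obj C. zero_object C X \<longrightarrow> X \<in> A) \<and>
     (\<forall>X \<in> A. \<forall>Y \<in> obj C. isomorphic C X Y \<longrightarrow> Y \<in> A) \<and>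
     (\<forall>X \<in> A. \<forall>Y \<in> A. \<forall>B. is_biproduct C X Y B \<longrightarrow> B \<in> A)"

text \<open>A Harder--Narasimhan filtration $0 = E_0 \to E_1 \to \dots \to E_n = X$ with factors
  $A_i \in P(\phi_i)$ and $\phi_0 > \phi_1 > \dots > \phi_{n-1}$.\<close>

definition hn_filtration ::
  "('o, 'm, 'k) tricat \<Rightarrow> (real \<Rightarrow> 'o set) \<Rightarrow> 'o \<Rightarrow> nat \<Rightarrow> (nat \<Rightarrow> real) \<Rightarrow> (nat \<Rightarrow> 'o) \<Rightarrow> (nat \<Rightarrow> 'o) \<Rightarrow> bool"
  where
  "hn_filtration C P X n \<phi> E A \<longleftrightarrow>
     zero_object C (E 0) \<and> E n = X \<and>
     (\<forall>i j. i < j \<and> j < n \<longrightarrow> \<phi> i > \<phi> j) \<and>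
     (\<forall>i < n. A i \<in> P (\<phi> i) \<and> (\<exists>f g h. (E i, E (Suc i), A i, f, g, h) \<in> dtri C))"

text \<open>Bridgeland's definition of a stability condition $(Z, P)$, with no finiteness or support
  condition imposed.\<close>

definition stability_condition :: "('o, 'm, 'k) tricat \<Rightarrow> 'o stab \<Rightarrow> bool" where
  "stability_condition C \<sigma> \<longleftrightarrow>
     charge \<sigma> \<in> Group.hom (K0 C) complex_additive_group \<and>
     charge \<sigma> \<in> extensional (carrier (K0 C)) \<and>
     (\<forall>\<phi>. additive_strict_subcat C (slice \<sigma> \<phi>)) \<and>
     (\<forall>\<phi>. \<forall>X \<in> slice \<sigma> \<phi>. \<not> zero_object C X \<longrightarrow>
        (\<exists>m > 0. charge \<sigma> (K0_class C X) = of_real m * exp (\<i> * of_real (pi * \<phi>)))) \<and>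
     (\<forall>\<phi>. slice \<sigma> (\<phi> + 1) = shift C 1 ` slice \<sigma> \<phi>) \<and>
     (\<forall>\<phi> \<psi>. \<phi> > \<psi> \<longrightarrow> (\<forall>X \<in> slice \<sigma> \<phi>. \<forall>Y \<in> slice \<sigma> \<psi>. mor C X Y = {mzero C X Y})) \<and>
     (\<forall>X \<in> obj C. \<not> zero_object C X \<longrightarrow> (\<exists>n \<phi> E A. hn_filtration C (slice \<sigma>) X n \<phi> E A))"

text \<open>$\Phi \cdot (Z, P) = (Z \circ \Phi_*^{-1}, \Phi(P))$, where $\Phi(P(\phi))$ is the
  essential image.\<close>

definition auteq_act :: "('o, 'm, 'k) tricat \<Rightarrow> ('o, 'm) endo \<Rightarrow> 'o stab \<Rightarrow> 'o stab" where
  "auteq_act C \<Phi> \<sigma> =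
     \<lparr>charge = (\<lambda>\<kappa> \<in> carrier (K0 C).
                  charge \<sigma> (inv_into (carrier (K0 C)) (K0_map C \<Phi>) \<kappa>)),
      slice = (\<lambda>\<phi>. {X \<in> obj C. \<exists>Y \<in> slice \<sigma> \<phi>. isomorphic C (fob \<Phi> Y) X})\<rparr>"

text \<open>Elements of the universal cover of $GL_2^+(\mathbb{R})$, in Bridgeland's description: pairs
  $(T, f)$ of an orientation-preserving real-linear automorphism $T$ of
  $\mathbb{C} = \mathbb{R}^2$ and an increasing $f : \mathbb{R} \to \mathbb{R}$ with
  $f(\phi + 1) = f(\phi) + 1$ inducing the same map on the circle of rays. The second conjunct
  says that the determinant of $T$ in the basis $1, i$ is positive.\<close>

definition GL2plus_cover :: "((complex \<Rightarrow> complex) \<times> (real \<Rightarrow> real)) set" where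
  "GL2plus_cover = {(T, f). linear T \<and>
     Re (T 1) * Im (T \<i>) - Im (T 1) * Re (T \<i>) > 0 \<and>
     strict_mono f \<and> (\<forall>\<phi>. f (\<phi> + 1) = f \<phi> + 1) \<and>
     (\<forall>\<phi>. \<exists>r > 0. T (exp (\<i> * of_real (pi * \<phi>))) = of_real r * exp (\<i> * of_real (pi * f \<phi>)))}"

text \<open>$(Z, P) \cdot (T, f) = (T^{-1} \circ Z, P \circ f)$.\<close>

definition GL2plus_act ::
  "('o, 'm, 'k) tricat \<Rightarrow> 'o stab \<Rightarrow> (complex \<Rightarrow> complex) \<times> (real \<Rightarrow> real) \<Rightarrow> 'o stab" where
  "GL2plus_act C \<sigma> = (\<lambda>(T, f).
     \<lparr>charge = (\<lambda>\<kappa> \<in> carrier (K0 C). inv_into UNIV T (charge \<sigma> \<kappa>)),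
      slice = (\<lambda>\<phi>. slice \<sigma> (f \<phi>))\<rparr>)"

text \<open>A Serre functor is unique up to isomorphism and isomorphic functors act in the same way on
  stability conditions, so the choice of \<open>S\<close> does not matter.\<close>

definition serre_invariant :: "('o, 'm, 'k :: field) tricat \<Rightarrow> 'o stab \<Rightarrow> bool" where
  "serre_invariant C \<sigma> \<longleftrightarrow>
     (\<exists>S g. serre_functor C S \<and> g \<in> GL2plus_cover \<and> auteq_act C S \<sigma> = GL2plus_act C \<sigma> g)"

section \<open>Representations of the Bondal quiver\<close>

datatype vertex = V1 | V2 | V3

datatype arrow = Alpha1 | Beta1 | Alpha2 | Beta2

fun src :: "arrow \<Rightarrow> vertex" where
  "src Alpha1 = V1" | "src Beta1 = V1" | "src Alpha2 = V2" | "src Beta2 = V2"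

fun tgt :: "arrow \<Rightarrow> vertex" where
  "tgt Alpha1 = V2" | "tgt Beta1 = V2" | "tgt Alpha2 = V3" | "tgt Beta2 = V3"

text \<open>A finite-dimensional representation with chosen bases: \<open>rdim M v\<close> is the dimension at
  the vertex \<open>v\<close>, and an arrow acts by a matrix on column vectors.\<close>

record 'k rep =
  rdim :: "vertex \<Rightarrow> nat"
  rmap :: "arrow \<Rightarrow> 'k mat"

definition is_rep :: "'k :: field rep \<Rightarrow> bool" where
  "is_rep M \<longleftrightarrow>
     (\<forall>a. rmap M a \<in> carrier_mat (rdim M (tgt a)) (rdim M (src a))) \<and>
     rmap M Beta2 * rmap M Alpha1 = 0\<^sub>m (rdim M V3) (rdim M V1) \<and>
     rmap M Alpha2 * rmap M Beta1 = 0\<^sub>m (rdim M V3) (rdim M V1)"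

definition is_rep_hom :: "'k :: field rep \<Rightarrow> 'k rep \<Rightarrow> (vertex \<Rightarrow> 'k mat) \<Rightarrow> bool" where
  "is_rep_hom M N f \<longleftrightarrow>
     (\<forall>v. f v \<in> carrier_mat (rdim N v) (rdim M v)) \<and>
     (\<forall>a. f (tgt a) * rmap M a = rmap N a * f (src a))"

definition rep_sum :: "'k :: field rep \<Rightarrow> 'k rep \<Rightarrow> 'k rep" where
  "rep_sum M N =
     \<lparr>rdim = (\<lambda>v. rdim M v + rdim N v),
      rmap = (\<lambda>a. four_block_mat (rmap M a) (0\<^sub>m (rdim M (tgt a)) (rdim N (src a)))
                                 (0\<^sub>m (rdim N (tgt a)) (rdim M (src a))) (rmap N a))\<rparr>"

definition zero_rep :: "'k :: field rep" where
  "zero_rep = \<lparr>rdim = (\<lambda>_. 0), rmap = (\<lambda>_. 0\<^sub>m 0 0)\<rparr>"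

section \<open>Bounded complexes of representations\<close>

record 'k cpx =
  cob :: "int \<Rightarrow> 'k rep"
  cdf :: "int \<Rightarrow> vertex \<Rightarrow> 'k mat"

type_synonym 'k cmap = "int \<Rightarrow> vertex \<Rightarrow> 'k mat"

abbreviation cdim :: "'k cpx \<Rightarrow> int \<Rightarrow> vertex \<Rightarrow> nat" where
  "cdim X n v \<equiv> rdim (cob X n) v"

definition is_cpx :: "'k :: field cpx \<Rightarrow> bool" where
  "is_cpx X \<longleftrightarrow>
     (\<forall>n. is_rep (cob X n) \<and> is_rep_hom (cob X n) (cob X (n + 1)) (cdf X n)) \<and>
     (\<forall>n v. cdf X (n + 1) v * cdf X n v = 0\<^sub>m (cdim X (n + 2) v) (cdim X n v)) \<and>
     finite {n. \<exists>v. cdim X n v \<noteq> 0}"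

definition is_cmap :: "'k :: field cpx \<Rightarrow> 'k cpx \<Rightarrow> 'k cmap \<Rightarrow> bool" where
  "is_cmap X Y f \<longleftrightarrow>
     (\<forall>n. is_rep_hom (cob X n) (cob Y n) (f n)) \<and>
     (\<forall>n v. f (n + 1) v * cdf X n v = cdf Y n v * f n v)"

definition cmap_comp :: "'k :: field cmap \<Rightarrow> 'k cmap \<Rightarrow> 'k cmap" where
  "cmap_comp g f = (\<lambda>n v. g n v * f n v)"

definition cmap_id :: "'k :: field cpx \<Rightarrow> 'k cmap" where
  "cmap_id X = (\<lambda>n v. 1\<^sub>m (cdim X n v))"

definition cmap_zero :: "'k :: field cpx \<Rightarrow> 'k cpx \<Rightarrow> 'k cmap" where
  "cmap_zero X Y = (\<lambda>n v. 0\<^sub>m (cdim Y n v) (cdim X n v))"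

definition homotopic :: "'k :: field cpx \<Rightarrow> 'k cpx \<Rightarrow> 'k cmap \<Rightarrow> 'k cmap \<Rightarrow> bool" where
  "homotopic X Y f g \<longleftrightarrow>
     (\<exists>h. (\<forall>n. is_rep_hom (cob X n) (cob Y (n - 1)) (h n)) \<and>
          (\<forall>n v. f n v - g n v = cdf Y (n - 1) v * h n v + h (n + 1) v * cdf X n v))"

definition cocycles :: "'k :: field cpx \<Rightarrow> int \<Rightarrow> vertex \<Rightarrow> 'k vec set" where
  "cocycles X n v = {x \<in> carrier_vec (cdim X n v). cdf X n v *\<^sub>v x = 0\<^sub>v (cdim X (n + 1) v)}"

definition coboundaries :: "'k :: field cpx \<Rightarrow> int \<Rightarrow> vertex \<Rightarrow> 'k vec set" where
  "coboundaries X n v = (\<lambda>w. cdf X (n - 1) v *\<^sub>v w) ` carrier_vec (cdim X (n - 1) v)"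

text \<open>The two conditions are injectivity and surjectivity of $H^n(f)$ at the vertex \<open>v\<close>.\<close>

definition quasi_iso :: "'k :: field cpx \<Rightarrow> 'k cpx \<Rightarrow> 'k cmap \<Rightarrow> bool" where
  "quasi_iso X Y f \<longleftrightarrow> is_cmap X Y f \<and>
     (\<forall>n v. (\<forall>x \<in> cocycles X n v. f n v *\<^sub>v x \<in> coboundaries Y n v \<longrightarrow> x \<in> coboundaries X n v) \<and>
            (\<forall>y \<in> cocycles Y n v. \<exists>x \<in> cocycles X n v. y - f n v *\<^sub>v x \<in> coboundaries Y n v))"

definition cpx_shift :: "int \<Rightarrow> 'k :: field cpx \<Rightarrow> 'k cpx" where
  "cpx_shift i X =
     \<lparr>cob = (\<lambda>n. cob X (n + i)),
      cdf = (\<lambda>n v. if even i then cdf X (n + i) v else - cdf X (n + i) v)\<rparr>"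

definition cmap_shift :: "int \<Rightarrow> 'k cmap \<Rightarrow> 'k cmap" where
  "cmap_shift i f = (\<lambda>n. f (n + i))"

text \<open>The mapping cone of $u : X \to Y$: in degree $n$ it is $X^{n+1} \oplus Y^n$.\<close>

definition cone :: "'k :: field cpx \<Rightarrow> 'k cpx \<Rightarrow> 'k cmap \<Rightarrow> 'k cpx" where
  "cone X Y u =
     \<lparr>cob = (\<lambda>n. rep_sum (cob X (n + 1)) (cob Y n)),
      cdf = (\<lambda>n v. four_block_mat (- cdf X (n + 1) v) (0\<^sub>m (cdim X (n + 2) v) (cdim Y n v))
                                  (u (n + 1) v) (cdf Y n v))\<rparr>"

definition cone_in :: "'k :: field cpx \<Rightarrow> 'k cpx \<Rightarrow> 'k cmap" where
  "cone_in X Y = (\<lambda>n v. four_block_mat (0\<^sub>m (cdim X (n + 1) v) (cdim Y n v)) (0\<^sub>m (cdim X (n + 1) v) 0)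
                                        (1\<^sub>m (cdim Y n v)) (0\<^sub>m (cdim Y n v) 0))"

definition cone_out :: "'k :: field cpx \<Rightarrow> 'k cpx \<Rightarrow> 'k cmap" where
  "cone_out X Y = (\<lambda>n v. four_block_mat (1\<^sub>m (cdim X (n + 1) v)) (0\<^sub>m (cdim X (n + 1) v) (cdim Y n v))
                                         (0\<^sub>m 0 (cdim X (n + 1) v)) (0\<^sub>m 0 (cdim Y n v)))"

section \<open>The bounded derived category\<close>

text \<open>The localisation of the homotopy category of bounded complexes at quasi-isomorphisms, by
  the calculus of fractions. A roof \<open>(W, s, f)\<close> from \<open>X\<close> to \<open>Y\<close> stands for $f s^{-1}$, where
  $s : W \to X$ is a quasi-isomorphism and $f : W \to Y$. A morphism is a triple of its domain,
  its codomain and an equivalence class of roofs.\<close>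

type_synonym 'k roof = "'k cpx \<times> 'k cmap \<times> 'k cmap"
type_synonym 'k dmor = "'k cpx \<times> 'k cpx \<times> 'k roof set"

definition roofs :: "'k :: field cpx \<Rightarrow> 'k cpx \<Rightarrow> 'k roof set" where
  "roofs X Y = {(W, s, f). is_cpx W \<and> quasi_iso W X s \<and> is_cmap W Y f}"

definition roof_rel :: "'k :: field cpx \<Rightarrow> 'k cpx \<Rightarrow> ('k roof \<times> 'k roof) set" where
  "roof_rel X Y = {((W1, s1, f1), (W2, s2, f2)).
     (W1, s1, f1) \<in> roofs X Y \<and> (W2, s2, f2) \<in> roofs X Y \<and>
     (\<exists>W u1 u2. is_cpx W \<and> is_cmap W W1 u1 \<and> is_cmap W W2 u2 \<and>
        quasi_iso W X (cmap_comp s1 u1) \<and>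
        homotopic W X (cmap_comp s1 u1) (cmap_comp s2 u2) \<and>
        homotopic W Y (cmap_comp f1 u1) (cmap_comp f2 u2))}"

definition Db_mor :: "'k :: field cpx \<Rightarrow> 'k cpx \<Rightarrow> 'k dmor set" where
  "Db_mor X Y = {(X, Y, c) | c. c \<in> roofs X Y // roof_rel X Y}"

definition Db_of_cmap :: "'k :: field cpx \<Rightarrow> 'k cpx \<Rightarrow> 'k cmap \<Rightarrow> 'k dmor" where
  "Db_of_cmap X Y f = (X, Y, roof_rel X Y `` {(X, cmap_id X, f)})"

text \<open>Composition and addition take the union over all choices of representatives and of Ore
  squares; all these choices give the same class.\<close>

definition Db_comp :: "'k :: field dmor \<Rightarrow> 'k dmor \<Rightarrow> 'k dmor" where
  "Db_comp = (\<lambda>(Y', Z, d) (X, Y, c).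
     (X, Z, roof_rel X Z ``
        {(W, cmap_comp s u, cmap_comp g v) | W u v W1 s f W2 t g.
           (W1, s, f) \<in> c \<and> (W2, t, g) \<in> d \<and> is_cpx W \<and> quasi_iso W W1 u \<and> is_cmap W W2 v \<and>
           homotopic W Y (cmap_comp f u) (cmap_comp t v)}))"

definition Db_add :: "'k :: field dmor \<Rightarrow> 'k dmor \<Rightarrow> 'k dmor" where
  "Db_add = (\<lambda>(X, Y, c) (X', Y', d).
     (X, Y, roof_rel X Y ``
        {(W, cmap_comp s u, \<lambda>n v. cmap_comp f u n v + cmap_comp g w n v) | W u w W1 s f W2 t g.
           (W1, s, f) \<in> c \<and> (W2, t, g) \<in> d \<and> is_cpx W \<and> quasi_iso W W1 u \<and> is_cmap W W2 w \<and>
           homotopic W X (cmap_comp s u) (cmap_comp t w)}))"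

definition Db_scale :: "'k :: field \<Rightarrow> 'k dmor \<Rightarrow> 'k dmor" where
  "Db_scale a = (\<lambda>(X, Y, c).
     (X, Y, roof_rel X Y `` {(W, s, \<lambda>n v. a \<cdot>\<^sub>m f n v) | W s f. (W, s, f) \<in> c}))"

definition Db_shiftm :: "int \<Rightarrow> 'k :: field dmor \<Rightarrow> 'k dmor" where
  "Db_shiftm i = (\<lambda>(X, Y, c).
     (cpx_shift i X, cpx_shift i Y,
      (\<lambda>(W, s, f). (cpx_shift i W, cmap_shift i s, cmap_shift i f)) ` c))"

definition Db_pretri :: "('k :: field cpx, 'k dmor, 'k) tricat" where
  "Db_pretri =
     \<lparr>obj = {X. is_cpx X},
      mor = Db_mor,
      idt = (\<lambda>X. Db_of_cmap X X (cmap_id X)),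
      cmp = Db_comp,
      mzero = (\<lambda>X Y. Db_of_cmap X Y (cmap_zero X Y)),
      madd = Db_add,
      mscale = Db_scale,
      shift = cpx_shift,
      shiftm = Db_shiftm,
      dtri = {}\<rparr>"

text \<open>The distinguished triangles are those isomorphic to a mapping cone triangle.\<close>

definition Db :: "('k :: field cpx, 'k dmor, 'k) tricat" where
  "Db = Db_pretri\<lparr>dtri :=
     {(X, Y, Z, f, g, h). is_cpx X \<and> is_cpx Y \<and> is_cpx Z \<and>
        f \<in> Db_mor X Y \<and> g \<in> Db_mor Y Z \<and> h \<in> Db_mor Z (cpx_shift 1 X) \<and>
        (\<exists>A B u a b c. is_cpx A \<and> is_cpx B \<and> is_cmap A B u \<and>
           is_iso_mor Db_pretri X A a \<and> is_iso_mor Db_pretri Y B b \<and>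
           is_iso_mor Db_pretri Z (cone A B u) c \<and>
           Db_comp b f = Db_comp (Db_of_cmap A B u) a \<and>
           Db_comp c g = Db_comp (Db_of_cmap B (cone A B u) (cone_in A B)) b \<and>
           Db_comp (Db_shiftm 1 a) h =
             Db_comp (Db_of_cmap (cone A B u) (cpx_shift 1 A) (cone_out A B)) c)}\<rparr>"

section \<open>The exceptional object\<close>

definition P_rep :: "'k :: field rep" where
  "P_rep =
     \<lparr>rdim = (\<lambda>_. 1),
      rmap = (\<lambda>a. case a of Alpha1 \<Rightarrow> 1\<^sub>m 1 | Alpha2 \<Rightarrow> 1\<^sub>m 1 | Beta1 \<Rightarrow> 0\<^sub>m 1 1 | Beta2 \<Rightarrow> 0\<^sub>m 1 1)\<rparr>"

definition P_cpx :: "'k :: field cpx" where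
  "P_cpx =
     \<lparr>cob = (\<lambda>n. if n = 0 then P_rep else zero_rep),
      cdf = (\<lambda>n v. 0\<^sub>m (if n + 1 = 0 then 1 else 0) (if n = 0 then 1 else 0))\<rparr>"

definition P_perp :: "('k :: field cpx, 'k dmor, 'k) tricat" where
  "P_perp = right_orth Db P_cpx"

end

theory Submission
  imports Defs
begin

text \<open>The argument uses only the slices \<open>P(\<phi>)\<close> of a stability condition. Let $S$ be the Serre functor of $P^\perp$. The module $M$ with
  $V_1 = V_2 = k$, $V_3 = 0$ and $\alpha_1 = \beta_1 = 1$ satisfies $SM = M[1]$, and a two-term complex $B$, an extension of
  $P[-1]$ by the mirror image of $P$, satisfies $SB = B[3]$. Let $U$ be the set of phases \<open>\<phi>\<close> such that
  $\mathrm{Hom}(A, M) \neq 0$ for some $A$ in \<open>P(\<phi>)\<close>, and $L$ the set of phases such that $\mathrm{Hom}(B, A) \neq 0$ for some $A$ in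
  \<open>P(\<phi>)\<close>. Harder--Narasimhan filtrations show that $U$ is nonempty and bounded above and $L$ is nonempty and bounded below. If the
  Serre functor acts as $(T, f)$, then Serre duality gives $f(U) - 1 \subseteq U$ and $f(L) - 3 \subseteq L$. So $f$ raises
  $\sup U$ by at most 1 and $\inf L$ by at least 3, up to errors below 1/2, which is impossible for an increasing $f$ commuting with
  integer translations.

  Only vanishing of morphism spaces has to be controlled. For an object with a resolution of length at most two by indecomposable
  projectives, vanishing is exactness of an explicit total complex at one place, and transposing that complex yields Serre
  duality.\<close>

section \<open>Block matrices\<close>

text \<open>The constants come from transposing resolutions. In all of the derived category, duality
  exchanges P and its mirror image P' with a shift by 2; M, whose dual resolution lacks its last
  term, returns with a shift by 1. B is P' reflected into P^perp: an exact sequence 0 -> P' -> E0 ->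
  E1 -> P -> 0 gives a triangle P' -> B -> P[-1]. For Y in P^perp, maps B -> Y see only P' and maps
  Y -> B see only P[-1], so 2 becomes 2 + 1. The gap 3 - 1 = 2 is exactly what rounding to integer
  translations can absorb.

  The obstacle is that morphisms are bare equivalence classes of roofs, with none of the laws of a
  triangulated category at hand. Vanishing can instead be stated on chain maps: every numerator dies
  after a further quasi-isomorphism. In this form it passes through quasi-isomorphisms, shifts,
  cones and transposition. The Serre functor is never computed; its defining bijection serves for
  one implication, that Hom(Y, SX) = 0 forces Hom(X, Y) = 0.\<close>

lemma mat_mult_assoc: "dim_col A = dim_row B \<Longrightarrow> dim_col B = dim_row C \<Longrightarrow> A * B * C = A * (B * (C :: 'a :: semiring_0 mat))"
  by (rule assoc_mult_mat[of A "dim_row A" "dim_row B" B "dim_row C" C "dim_col C"]) auto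

lemma mat_distribs:
  fixes A B C :: "'a :: ring mat"
  shows "dim_row A = dim_row B \<Longrightarrow> dim_col A = dim_col B \<Longrightarrow> dim_col B = dim_row C \<Longrightarrow> (A + B) * C = A * C + B * C"
    and "dim_row A = dim_row B \<Longrightarrow> dim_col A = dim_col B \<Longrightarrow> dim_col B = dim_row C \<Longrightarrow> (A - B) * C = A * C - B * C"
    and "dim_row B = dim_row C \<Longrightarrow> dim_col B = dim_col C \<Longrightarrow> dim_col A = dim_row C \<Longrightarrow> A * (B + C) = A * B + A * C"
    and "dim_row B = dim_row C \<Longrightarrow> dim_col B = dim_col C \<Longrightarrow> dim_col A = dim_row C \<Longrightarrow> A * (B - C) = A * B - A * C"
     apply (rule add_mult_distrib_mat[of _ "dim_row A" "dim_col A" _ _ "dim_col C"]; auto)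
    apply (rule minus_mult_distrib_mat[of _ "dim_row A" "dim_col A" _ _ "dim_col C"]; auto)
   apply (rule mult_add_distrib_mat[of _ "dim_row A" "dim_col A" _ "dim_col C"]; auto)
  apply (rule mult_minus_distrib_mat[of _ "dim_row A" "dim_col A" _ "dim_col C"]; auto)
  done

lemma mat_vec_assoc: "dim_col A = dim_row B \<Longrightarrow> dim_col B = dim_vec x \<Longrightarrow> A * B *\<^sub>v x = A *\<^sub>v (B *\<^sub>v (x :: 'a :: semiring_0 vec))"
  by (rule assoc_mult_mat_vec[of A "dim_row A" "dim_row B" B "dim_vec x" x]) (auto intro: carrier_vecI)

lemma mat_vec_distribs:
  fixes A B :: "'a :: ring mat"
  shows "dim_row A = dim_row B \<Longrightarrow> dim_col A = dim_col B \<Longrightarrow> dim_col B = dim_vec x \<Longrightarrow> (A + B) *\<^sub>v x = A *\<^sub>v x + B *\<^sub>v x"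
    and "dim_row A = dim_row B \<Longrightarrow> dim_col A = dim_col B \<Longrightarrow> dim_col B = dim_vec x \<Longrightarrow> (A - B) *\<^sub>v x = A *\<^sub>v x - B *\<^sub>v x"
    and "dim_col A = dim_vec y \<Longrightarrow> dim_vec x = dim_vec y \<Longrightarrow> A *\<^sub>v (x + y) = A *\<^sub>v x + A *\<^sub>v y"
    and "dim_col A = dim_vec y \<Longrightarrow> dim_vec x = dim_vec y \<Longrightarrow> A *\<^sub>v (x - y) = A *\<^sub>v x - A *\<^sub>v y"
    and "dim_col A = dim_vec x \<Longrightarrow> A *\<^sub>v (- x) = - (A *\<^sub>v x)"
     apply (rule add_mult_distrib_mat_vec[of _ "dim_row A" "dim_col A"]; auto intro: carrier_vecI)
    apply (rule minus_mult_distrib_mat_vec[of _ "dim_row A" "dim_col A"]; auto intro: carrier_vecI)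
   apply (rule mult_add_distrib_mat_vec[of _ "dim_row A" "dim_col A"]; auto intro: carrier_vecI)
   apply (rule mult_minus_distrib_mat_vec[of _ "dim_row A" "dim_col A"]; auto intro: carrier_vecI)
  apply (rule eq_vecI; auto)
  done

lemma zero_mat_mult_vec [simp]: "dim_vec x = c \<Longrightarrow> 0\<^sub>m r c *\<^sub>v x = 0\<^sub>v r"
  by (rule eq_vecI) (auto simp: scalar_prod_def)

lemma mat_mult_zero_vec [simp]: "dim_col A = n \<Longrightarrow> A *\<^sub>v 0\<^sub>v n = 0\<^sub>v (dim_row A)"
  by (rule eq_vecI) (auto simp: scalar_prod_def)

text \<open>Blocks are stacked in one direction at a time, so that nested block matrices are
  multiplied by plain rewriting. The column count is read off the upper block alone, which is why
  the rules ask for matching dimensions.\<close>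

definition vst :: "'a mat \<Rightarrow> 'a mat \<Rightarrow> 'a mat" where
  "vst A B = mat (dim_row A + dim_row B) (dim_col A)
     (\<lambda>(i, j). if i < dim_row A then A $$ (i, j) else B $$ (i - dim_row A, j))"

definition hst :: "'a mat \<Rightarrow> 'a mat \<Rightarrow> 'a mat" where
  "hst A B = mat (dim_row A) (dim_col A + dim_col B)
     (\<lambda>(i, j). if j < dim_col A then A $$ (i, j) else B $$ (i, j - dim_col A))"

definition upper :: "nat \<Rightarrow> 'a mat \<Rightarrow> 'a mat" where
  "upper r A = mat r (dim_col A) (\<lambda>(i, j). A $$ (i, j))"

definition lower :: "nat \<Rightarrow> 'a mat \<Rightarrow> 'a mat" where
  "lower r A = mat (dim_row A - r) (dim_col A) (\<lambda>(i, j). A $$ (i + r, j))"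

definition leftc :: "nat \<Rightarrow> 'a mat \<Rightarrow> 'a mat" where
  "leftc c A = mat (dim_row A) c (\<lambda>(i, j). A $$ (i, j))"

definition rightc :: "nat \<Rightarrow> 'a mat \<Rightarrow> 'a mat" where
  "rightc c A = mat (dim_row A) (dim_col A - c) (\<lambda>(i, j). A $$ (i, j + c))"

lemma block_dims [simp]:
  "dim_row (vst A B) = dim_row A + dim_row B" "dim_col (vst A B) = dim_col A"
  "dim_row (hst A B) = dim_row A" "dim_col (hst A B) = dim_col A + dim_col B"
  "dim_row (upper r A) = r" "dim_col (upper r A) = dim_col A"
  "dim_row (lower r A) = dim_row A - r" "dim_col (lower r A) = dim_col A"
  "dim_row (leftc c A) = dim_row A" "dim_col (leftc c A) = c"
  "dim_row (rightc c A) = dim_row A" "dim_col (rightc c A) = dim_col A - c"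
  by (simp_all add: vst_def hst_def upper_def lower_def leftc_def rightc_def)

lemma vst_upper_lower: "r \<le> dim_row A \<Longrightarrow> vst (upper r A) (lower r A) = A"
  by (rule eq_matI) (auto simp: vst_def upper_def lower_def)

lemma hst_left_right: "c \<le> dim_col A \<Longrightarrow> hst (leftc c A) (rightc c A) = A"
  by (rule eq_matI) (auto simp: hst_def leftc_def rightc_def)

lemma vst_eq_iff:
  assumes "dim_row A = dim_row A'" "dim_row B = dim_row B'"
    "dim_col B = dim_col A" "dim_col B' = dim_col A'"
  shows "vst A B = vst A' B' \<longleftrightarrow> A = A' \<and> B = B'"
proof
  assume eq: "vst A B = vst A' B'"
  have c: "dim_col A = dim_col A'" using arg_cong[OF eq, of dim_col] by simp
  have e: "vst A B $$ (i, j) = vst A' B' $$ (i, j)" for i j using eq by simp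
  have "A = A'"
  proof (rule eq_matI)
    fix i j assume "i < dim_row A'" "j < dim_col A'"
    then show "A $$ (i, j) = A' $$ (i, j)" using e[of i j] assms c by (simp add: vst_def)
  qed (use assms c in auto)
  moreover have "B = B'"
  proof (rule eq_matI)
    fix i j assume "i < dim_row B'" "j < dim_col B'"
    then show "B $$ (i, j) = B' $$ (i, j)" using e[of "i + dim_row A'" j] assms c by (simp add: vst_def)
  qed (use assms c in auto)
  ultimately show "A = A' \<and> B = B'" ..
qed simp

lemma transpose_vst: "dim_col B = dim_col A \<Longrightarrow> transpose_mat (vst A B) = hst (transpose_mat A) (transpose_mat B)"
  by (rule eq_matI) (auto simp: vst_def hst_def)

lemma transpose_hst: "dim_row B = dim_row A \<Longrightarrow> transpose_mat (hst A B) = vst (transpose_mat A) (transpose_mat B)"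
  by (rule eq_matI) (auto simp: vst_def hst_def)

lemma hst_eq_iff:
  assumes "dim_col A = dim_col A'" "dim_col B = dim_col B'"
    "dim_row B = dim_row A" "dim_row B' = dim_row A'"
  shows "hst A B = hst A' B' \<longleftrightarrow> A = A' \<and> B = B'"
proof -
  have "hst A B = hst A' B' \<longleftrightarrow> transpose_mat (hst A B) = transpose_mat (hst A' B')"
    by (metis transpose_transpose)
  also have "\<dots> \<longleftrightarrow> transpose_mat A = transpose_mat A' \<and> transpose_mat B = transpose_mat B'"
    using assms by (simp add: transpose_hst vst_eq_iff)
  finally show ?thesis by (metis transpose_transpose)
qed

text \<open>Splits a scalar product at a block boundary.\<close>

lemma sum_split_add:
  fixes g :: "nat \<Rightarrow> 'a :: comm_monoid_add"
  shows "sum g {0..<m + n} = sum g {0..<m} + (\<Sum>i = 0..<n. g (i + m))"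
  by (induction n) (simp_all add: add.assoc add.commute add.left_commute)

lemma hst_mult_vst:
  fixes A :: "'a :: semiring_0 mat"
  assumes "dim_col A = dim_row C" "dim_col B = dim_row D" "dim_row B = dim_row A" "dim_col D = dim_col C"
  shows "hst A B * vst C D = A * C + B * D"
  using assms by (intro eq_matI) (auto simp: scalar_prod_def sum_split_add hst_def vst_def)

lemma mult_hst:
  fixes A :: "'a :: semiring_0 mat"
  assumes "dim_col F = dim_row A" "dim_row B = dim_row A"
  shows "F * hst A B = hst (F * A) (F * B)"
  using assms by (intro eq_matI) (auto simp: scalar_prod_def hst_def)

lemma vst_mult:
  fixes A :: "'a :: semiring_0 mat"
  assumes "dim_col A = dim_row F" "dim_col B = dim_col A"
  shows "vst A B * F = vst (A * F) (B * F)"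
  using assms by (intro eq_matI) (auto simp: scalar_prod_def vst_def)

lemma vst_arith:
  fixes A B C D :: "'a :: ring mat"
  assumes "dim_row A = dim_row C" "dim_row B = dim_row D" "dim_col B = dim_col A" "dim_col C = dim_col A" "dim_col D = dim_col A"
  shows "vst A B + vst C D = vst (A + C) (B + D)" "vst A B - vst C D = vst (A - C) (B - D)"
    "- vst A B = vst (- A) (- B)"
  using assms by (auto intro!: eq_matI simp: vst_def)

lemma hst_arith:
  fixes A B C D :: "'a :: ring mat"
  assumes "dim_col A = dim_col C" "dim_col B = dim_col D" "dim_row B = dim_row A" "dim_row C = dim_row A" "dim_row D = dim_row A"
  shows "hst A B + hst C D = hst (A + C) (B + D)" "hst A B - hst C D = hst (A - C) (B - D)"
    "- hst A B = hst (- A) (- B)"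
  using assms by (auto intro!: eq_matI simp: hst_def)

lemma vst_hst:
  assumes "dim_row B = dim_row A" "dim_col C = dim_col A" "dim_row D = dim_row C" "dim_col D = dim_col B"
  shows "vst (hst A B) (hst C D) = hst (vst A C) (vst B D)"
  using assms by (intro eq_matI) (auto simp: hst_def vst_def)

lemma four_block_vst_hst:
  assumes "dim_row B = dim_row A" "dim_col C = dim_col A" "dim_row D = dim_row C" "dim_col D = dim_col B"
  shows "four_block_mat A B C D = vst (hst A B) (hst C D)"
  using assms by (intro eq_matI) (auto simp: hst_def vst_def)

lemma vst_zero: "vst (0\<^sub>m r c) (0\<^sub>m r' c) = 0\<^sub>m (r + r') c"
  by (rule eq_matI) (auto simp: vst_def)

lemma hst_zero: "hst (0\<^sub>m r c) (0\<^sub>m r c') = 0\<^sub>m r (c + c')"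
  by (rule eq_matI) (auto simp: hst_def)

lemma vst_mult_vec:
  fixes A :: "'a :: semiring_0 mat"
  assumes "dim_col A = dim_vec x" "dim_col B = dim_col A"
  shows "vst A B *\<^sub>v x = (A *\<^sub>v x) @\<^sub>v (B *\<^sub>v x)"
  using assms by (intro eq_vecI) (auto simp: vst_def scalar_prod_def)

lemma hst_mult_vec:
  fixes A :: "'a :: semiring_0 mat"
  assumes "dim_col A = dim_vec x" "dim_col B = dim_vec y" "dim_row B = dim_row A"
  shows "hst A B *\<^sub>v (x @\<^sub>v y) = A *\<^sub>v x + B *\<^sub>v y"
  using assms by (intro eq_vecI) (auto simp: hst_def scalar_prod_def sum_split_add)

section \<open>Chain maps and homotopies\<close>

lemma rep_carrier:
  assumes "is_rep M"
  shows "rmap M a \<in> carrier_mat (rdim M (tgt a)) (rdim M (src a))"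
    "dim_row (rmap M a) = rdim M (tgt a)" "dim_col (rmap M a) = rdim M (src a)"
  using assms by (auto simp: is_rep_def dest: spec[of _ a])

lemma hom_carrier:
  assumes "is_rep_hom M N f"
  shows "f v \<in> carrier_mat (rdim N v) (rdim M v)" "dim_row (f v) = rdim N v" "dim_col (f v) = rdim M v"
  using assms by (auto simp: is_rep_hom_def)

lemma hom_comm: "is_rep_hom M N f \<Longrightarrow> f (tgt a) * rmap M a = rmap N a * f (src a)"
  by (simp add: is_rep_hom_def)

lemma hom_comp:
  assumes "is_rep M" "is_rep N" "is_rep L" and f: "is_rep_hom M N f" and g: "is_rep_hom N L g"
  shows "is_rep_hom M L (\<lambda>v. g v * f v)"
proof -
  note [simp] = rep_carrier[OF assms(1)] rep_carrier[OF assms(2)] rep_carrier[OF assms(3)]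
    hom_carrier[OF f] hom_carrier[OF g]
  have "g (tgt a) * f (tgt a) * rmap M a = rmap L a * (g (src a) * f (src a))" for a
  proof -
    have "g (tgt a) * f (tgt a) * rmap M a = g (tgt a) * (rmap N a * f (src a))"
      by (simp add: mat_mult_assoc hom_comm[OF f])
    also have "\<dots> = (rmap L a * g (src a)) * f (src a)"
      by (simp add: mat_mult_assoc[symmetric] hom_comm[OF g])
    finally show ?thesis by (simp add: mat_mult_assoc)
  qed
  then show ?thesis by (auto simp: is_rep_hom_def)
qed

lemma hom_add:
  assumes "is_rep M" "is_rep N" and f: "is_rep_hom M N f" and g: "is_rep_hom M N g"
  shows "is_rep_hom M N (\<lambda>v. f v + g v)" "is_rep_hom M N (\<lambda>v. f v - g v)" "is_rep_hom M N (\<lambda>v. - f v)"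
proof -
  note [simp] = rep_carrier[OF assms(1)] rep_carrier[OF assms(2)] hom_carrier[OF f] hom_carrier[OF g]
    hom_comm[OF f] hom_comm[OF g]
  show "is_rep_hom M N (\<lambda>v. f v + g v)" "is_rep_hom M N (\<lambda>v. f v - g v)" "is_rep_hom M N (\<lambda>v. - f v)"
    by (auto simp: is_rep_hom_def mat_distribs minus_carrier_mat)
qed

lemma hom_id: "is_rep M \<Longrightarrow> is_rep_hom M M (\<lambda>v. 1\<^sub>m (rdim M v))"
  using rep_carrier[of M] by (auto simp: is_rep_hom_def)

lemma hom_zero: "is_rep M \<Longrightarrow> is_rep N \<Longrightarrow> is_rep_hom M N (\<lambda>v. 0\<^sub>m (rdim N v) (rdim M v))"
  using rep_carrier[of M] rep_carrier[of N] by (auto simp: is_rep_hom_def)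

lemma cpx_rep: "is_cpx X \<Longrightarrow> is_rep (cob X n)"
  by (simp add: is_cpx_def)

lemma cpx_hom: "is_cpx X \<Longrightarrow> is_rep_hom (cob X n) (cob X (n + 1)) (cdf X n)"
  by (simp add: is_cpx_def)

lemma cpx_carrier:
  assumes "is_cpx X"
  shows "cdf X n v \<in> carrier_mat (cdim X (n + 1) v) (cdim X n v)"
    "dim_row (cdf X n v) = cdim X (n + 1) v" "dim_col (cdf X n v) = cdim X n v"
  using hom_carrier[OF cpx_hom[OF assms]] by auto

lemma cpx_carrier':
  assumes "is_cpx X"
  shows "cdf X (n - 1) v \<in> carrier_mat (cdim X n v) (cdim X (n - 1) v)"
    "dim_row (cdf X (n - 1) v) = cdim X n v" "dim_col (cdf X (n - 1) v) = cdim X (n - 1) v"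
  using cpx_carrier[OF assms, of "n - 1" v] by auto

lemma cpx_sq: "is_cpx X \<Longrightarrow> cdf X (n + 1) v * cdf X n v = 0\<^sub>m (cdim X (n + 2) v) (cdim X n v)"
  by (simp add: is_cpx_def)

lemma cpx_sq': "is_cpx X \<Longrightarrow> cdf X n v * cdf X (n - 1) v = 0\<^sub>m (cdim X (n + 1) v) (cdim X (n - 1) v)"
  using cpx_sq[of X "n - 1" v] by (simp add: add.commute)

lemma cmap_hom: "is_cmap X Y f \<Longrightarrow> is_rep_hom (cob X n) (cob Y n) (f n)"
  by (simp add: is_cmap_def)

lemma cmap_carrier:
  assumes "is_cmap X Y f"
  shows "f n v \<in> carrier_mat (cdim Y n v) (cdim X n v)" "dim_row (f n v) = cdim Y n v" "dim_col (f n v) = cdim X n v"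
  using hom_carrier[OF cmap_hom[OF assms]] by auto

lemma cmap_comm: "is_cmap X Y f \<Longrightarrow> f (n + 1) v * cdf X n v = cdf Y n v * f n v"
  by (simp add: is_cmap_def)

lemma cmap_comm': "is_cmap X Y f \<Longrightarrow> f n v * cdf X (n - 1) v = cdf Y (n - 1) v * f (n - 1) v"
  using cmap_comm[of X Y f "n - 1" v] by simp

definition cmap_add :: "'k :: field cmap \<Rightarrow> 'k cmap \<Rightarrow> 'k cmap" where
  "cmap_add f g = (\<lambda>n v. f n v + g n v)"

definition cmap_minus :: "'k :: field cmap \<Rightarrow> 'k cmap \<Rightarrow> 'k cmap" where
  "cmap_minus f g = (\<lambda>n v. f n v - g n v)"

lemma cmap_comp_is_cmap:
  assumes "is_cpx X" "is_cpx Y" "is_cpx Z" and f: "is_cmap X Y f" and g: "is_cmap Y Z g"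
  shows "is_cmap X Z (cmap_comp g f)"
proof -
  note [simp] = cpx_carrier[OF assms(1)] cpx_carrier[OF assms(2)] cpx_carrier[OF assms(3)]
    cmap_carrier[OF f] cmap_carrier[OF g]
  have "g (n + 1) v * f (n + 1) v * cdf X n v = cdf Z n v * (g n v * f n v)" for n v
  proof -
    have "g (n + 1) v * f (n + 1) v * cdf X n v = g (n + 1) v * (cdf Y n v * f n v)"
      by (simp add: mat_mult_assoc cmap_comm[OF f])
    also have "\<dots> = (cdf Z n v * g n v) * f n v"
      by (simp add: mat_mult_assoc[symmetric] cmap_comm[OF g])
    finally show ?thesis by (simp add: mat_mult_assoc)
  qed
  then show ?thesis
    using assms by (auto simp: is_cmap_def cmap_comp_def intro: hom_comp cpx_rep)
qed

lemma cmap_id_is_cmap: "is_cpx X \<Longrightarrow> is_cmap X X (cmap_id X)"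
  using cpx_carrier[of X] by (auto simp: is_cmap_def cmap_id_def intro: hom_id cpx_rep)

lemma cmap_zero_is_cmap: "is_cpx X \<Longrightarrow> is_cpx Y \<Longrightarrow> is_cmap X Y (cmap_zero X Y)"
  using cpx_carrier[of X] cpx_carrier[of Y] by (auto simp: is_cmap_def cmap_zero_def intro: hom_zero cpx_rep)

lemma cmap_comp_id:
  assumes "is_cmap X Y f"
  shows "cmap_comp f (cmap_id X) = f" "cmap_comp (cmap_id Y) f = f"
  using cmap_carrier[OF assms] by (auto simp: cmap_comp_def cmap_id_def intro!: ext)

lemma cmap_comp_zero:
  "is_cmap X Y f \<Longrightarrow> cmap_comp f (cmap_zero W X) = cmap_zero W Y"
  "is_cmap X Y f \<Longrightarrow> cmap_comp (cmap_zero Y Z) f = cmap_zero X Z"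
  using cmap_carrier[of X Y f] by (auto simp: cmap_comp_def cmap_zero_def intro!: ext)

lemma cmap_comp_assoc:
  assumes "is_cmap X Y f" "is_cmap Y Z g" "is_cmap Z T h"
  shows "cmap_comp (cmap_comp h g) f = cmap_comp h (cmap_comp g f)"
  using cmap_carrier[OF assms(1)] cmap_carrier[OF assms(2)] cmap_carrier[OF assms(3)]
  by (auto simp: cmap_comp_def mat_mult_assoc intro!: ext)

lemma cmap_comp_minus:
  assumes "is_cmap X Y f" "is_cmap X Y g" "is_cmap Y Z h" "is_cmap W X k"
  shows "cmap_comp h (cmap_minus f g) = cmap_minus (cmap_comp h f) (cmap_comp h g)"
    "cmap_comp (cmap_minus f g) k = cmap_minus (cmap_comp f k) (cmap_comp g k)"
  using cmap_carrier[OF assms(1)] cmap_carrier[OF assms(2)] cmap_carrier[OF assms(3)] cmap_carrier[OF assms(4)]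
  by (auto simp: cmap_comp_def cmap_minus_def mat_distribs intro!: ext)

text \<open>Names the homotopy and speaks of one map in place of a difference: closure of
  null-homotopic maps under sums and composition then yields that homotopy is a congruence.\<close>

definition htpy :: "'k :: field cpx \<Rightarrow> 'k cpx \<Rightarrow> 'k cmap \<Rightarrow> 'k cmap \<Rightarrow> bool" where
  "htpy X Y h f \<longleftrightarrow> (\<forall>n. is_rep_hom (cob X n) (cob Y (n - 1)) (h n)) \<and>
     (\<forall>n v. f n v = cdf Y (n - 1) v * h n v + h (n + 1) v * cdf X n v)"

definition null_homotopic :: "'k :: field cpx \<Rightarrow> 'k cpx \<Rightarrow> 'k cmap \<Rightarrow> bool" where
  "null_homotopic X Y f \<longleftrightarrow> (\<exists>h. htpy X Y h f)"

lemma homotopic_iff: "homotopic X Y f g \<longleftrightarrow> null_homotopic X Y (cmap_minus f g)"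
  by (simp add: homotopic_def null_homotopic_def htpy_def cmap_minus_def)

lemma homotopic_zero_iff: "is_cmap X Y f \<Longrightarrow> homotopic X Y f (cmap_zero X Y) \<longleftrightarrow> null_homotopic X Y f"
proof -
  assume f: "is_cmap X Y f"
  have "cmap_minus f (cmap_zero X Y) = f"
    using cmap_carrier[OF f] by (auto simp: cmap_minus_def cmap_zero_def intro!: ext eq_matI)
  then show ?thesis by (simp add: homotopic_iff)
qed

lemma htpy_carrier:
  assumes "htpy X Y h f"
  shows "h n v \<in> carrier_mat (cdim Y (n - 1) v) (cdim X n v)"
    "dim_row (h n v) = cdim Y (n - 1) v" "dim_col (h n v) = cdim X n v"
  using assms hom_carrier[of "cob X n" "cob Y (n - 1)" "h n" v] by (auto simp: htpy_def)

lemma htpy_carrier':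
  assumes "htpy X Y h f"
  shows "h (n + 1) v \<in> carrier_mat (cdim Y n v) (cdim X (n + 1) v)"
    "dim_row (h (n + 1) v) = cdim Y n v" "dim_col (h (n + 1) v) = cdim X (n + 1) v"
  using htpy_carrier[OF assms, of "n + 1" v] by auto

lemma htpy_hom: "htpy X Y h f \<Longrightarrow> is_rep_hom (cob X n) (cob Y (n - 1)) (h n)"
  by (simp add: htpy_def)

lemma htpy_hom': "htpy X Y h f \<Longrightarrow> is_rep_hom (cob X (n + 1)) (cob Y n) (h (n + 1))"
  using htpy_hom[of X Y h f "n + 1"] by simp

lemma htpy_eq: "htpy X Y h f \<Longrightarrow> f n v = cdf Y (n - 1) v * h n v + h (n + 1) v * cdf X n v"
  by (simp add: htpy_def)

text \<open>Since \<open>g\<close> commutes with the differentials, it can be pushed onto the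
  homotopy, where it enters one degree lower.\<close>

lemma null_comp_left:
  assumes X: "is_cpx X" and Y: "is_cpx Y" and Z: "is_cpx Z" and g: "is_cmap Y Z g" and "null_homotopic X Y f"
  shows "null_homotopic X Z (cmap_comp g f)"
proof -
  obtain h where h: "htpy X Y h f" using assms by (auto simp: null_homotopic_def)
  note [simp] = cpx_carrier[OF X] cpx_carrier'[OF Y] cpx_carrier'[OF Z] cmap_carrier[OF g]
    htpy_carrier[OF h] htpy_carrier'[OF h]
  have "g n v * f n v = cdf Z (n - 1) v * (g (n - 1) v * h n v) + g n v * h (n + 1) v * cdf X n v" for n v
    by (simp add: htpy_eq[OF h] mat_distribs mat_mult_assoc[symmetric] cmap_comm'[OF g])
  then have "htpy X Z (\<lambda>n v. g (n - 1) v * h n v) (cmap_comp g f)"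
    by (auto simp: htpy_def cmap_comp_def
      intro!: hom_comp[OF cpx_rep[OF X] cpx_rep[OF Y] cpx_rep[OF Z] htpy_hom[OF h] cmap_hom[OF g]])
  then show ?thesis by (auto simp: null_homotopic_def)
qed

lemma null_comp_right:
  assumes X: "is_cpx X" and Y: "is_cpx Y" and Z: "is_cpx Z" and g: "is_cmap X Y g" and "null_homotopic Y Z f"
  shows "null_homotopic X Z (cmap_comp f g)"
proof -
  obtain h where h: "htpy Y Z h f" using assms by (auto simp: null_homotopic_def)
  note [simp] = cpx_carrier[OF X] cpx_carrier[OF Y] cpx_carrier'[OF Z] cmap_carrier[OF g]
    htpy_carrier[OF h] htpy_carrier'[OF h]
  have "f n v * g n v = cdf Z (n - 1) v * (h n v * g n v) + h (n + 1) v * g (n + 1) v * cdf X n v" for n v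
    by (simp add: htpy_eq[OF h] mat_distribs mat_mult_assoc cmap_comm[OF g])
  then have "htpy X Z (\<lambda>n v. h n v * g n v) (cmap_comp f g)"
    by (auto simp: htpy_def cmap_comp_def
      intro!: hom_comp[OF cpx_rep[OF X] cpx_rep[OF Y] cpx_rep[OF Z] cmap_hom[OF g] htpy_hom[OF h]])
  then show ?thesis by (auto simp: null_homotopic_def)
qed

lemma null_arith:
  assumes X: "is_cpx X" and Y: "is_cpx Y" and "null_homotopic X Y f" "null_homotopic X Y g"
  shows "null_homotopic X Y (cmap_add f g)" "null_homotopic X Y (cmap_minus f g)"
proof -
  obtain h k where h: "htpy X Y h f" and k: "htpy X Y k g" using assms by (auto simp: null_homotopic_def)
  note [simp] = cpx_carrier[OF X] cpx_carrier'[OF Y] htpy_carrier[OF h] htpy_carrier'[OF h]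
    htpy_carrier[OF k] htpy_carrier'[OF k]
  have "f n v + g n v = cdf Y (n - 1) v * (h n v + k n v) + (h (n + 1) v + k (n + 1) v) * cdf X n v"
    "f n v - g n v = cdf Y (n - 1) v * (h n v - k n v) + (h (n + 1) v - k (n + 1) v) * cdf X n v" for n v
    by (simp_all add: htpy_eq[OF h] htpy_eq[OF k] mat_distribs; rule eq_matI; simp del: index_mult_mat(1))+
  then have "htpy X Y (\<lambda>n v. h n v + k n v) (cmap_add f g)" "htpy X Y (\<lambda>n v. h n v - k n v) (cmap_minus f g)"
    using X Y by (auto simp: htpy_def cmap_add_def cmap_minus_def intro!: hom_add htpy_hom[OF h] htpy_hom[OF k] cpx_rep)
  then show "null_homotopic X Y (cmap_add f g)" "null_homotopic X Y (cmap_minus f g)"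
    by (auto simp: null_homotopic_def)
qed

lemma null_zero: "is_cpx X \<Longrightarrow> is_cpx Y \<Longrightarrow> null_homotopic X Y (cmap_zero X Y)"
  using cpx_carrier[of X] cpx_carrier'[of Y]
  by (auto simp: null_homotopic_def htpy_def cmap_zero_def intro!: exI[of _ "\<lambda>n v. 0\<^sub>m (cdim Y (n - 1) v) (cdim X n v)"] hom_zero cpx_rep)

lemma cmap_minus_self: "is_cmap X Y f \<Longrightarrow> cmap_minus f f = cmap_zero X Y"
  using cmap_carrier[of X Y f] by (auto simp: cmap_minus_def cmap_zero_def intro!: ext)

lemma homotopic_refl: "is_cpx X \<Longrightarrow> is_cpx Y \<Longrightarrow> is_cmap X Y f \<Longrightarrow> homotopic X Y f f"
  by (simp add: homotopic_iff cmap_minus_self null_zero)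

lemma homotopic_sym:
  assumes "is_cpx X" "is_cpx Y" "is_cmap X Y f" "is_cmap X Y g" "homotopic X Y f g"
  shows "homotopic X Y g f"
proof -
  have "cmap_minus g f = cmap_minus (cmap_zero X Y) (cmap_minus f g)"
    using cmap_carrier[OF assms(3)] cmap_carrier[OF assms(4)]
    by (auto simp: cmap_minus_def cmap_zero_def intro!: ext eq_matI)
  then show ?thesis using assms null_arith[OF assms(1,2) null_zero] by (simp add: homotopic_iff)
qed

lemma homotopic_trans:
  assumes "is_cpx X" "is_cpx Y" "is_cmap X Y f" "is_cmap X Y g" "is_cmap X Y k"
    "homotopic X Y f g" "homotopic X Y g k"
  shows "homotopic X Y f k"
proof -
  have "cmap_minus f k = cmap_add (cmap_minus f g) (cmap_minus g k)"
    using cmap_carrier[OF assms(3)] cmap_carrier[OF assms(4)] cmap_carrier[OF assms(5)]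
    by (auto simp: cmap_minus_def cmap_add_def intro!: ext eq_matI)
  then show ?thesis using assms null_arith[OF assms(1,2)] by (simp add: homotopic_iff)
qed

lemma homotopic_null:
  assumes "is_cpx X" "is_cpx Y" "is_cmap X Y f" "is_cmap X Y g"
    "homotopic X Y f g" "null_homotopic X Y g"
  shows "null_homotopic X Y f"
proof -
  have "f = cmap_add (cmap_minus f g) g"
    using cmap_carrier[OF assms(3)] cmap_carrier[OF assms(4)]
    by (auto simp: cmap_minus_def cmap_add_def intro!: ext eq_matI)
  then show ?thesis using assms null_arith(1)[OF assms(1,2)] by (metis homotopic_iff)
qed

lemma homotopic_comp_left:
  assumes "is_cpx X" "is_cpx Y" "is_cpx Z" "is_cmap X Y f" "is_cmap X Y g" "is_cmap Y Z k" "homotopic X Y f g"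
  shows "homotopic X Z (cmap_comp k f) (cmap_comp k g)"
proof -
  have "null_homotopic X Z (cmap_comp k (cmap_minus f g))"
    using assms null_comp_left by (simp add: homotopic_iff)
  then show ?thesis
    using cmap_comp_minus(1)[OF assms(4,5,6) cmap_id_is_cmap[OF assms(1)]] by (simp add: homotopic_iff)
qed

lemma homotopic_comp_right:
  assumes "is_cpx X" "is_cpx Y" "is_cpx Z" "is_cmap Y Z f" "is_cmap Y Z g" "is_cmap X Y k" "homotopic Y Z f g"
  shows "homotopic X Z (cmap_comp f k) (cmap_comp g k)"
proof -
  have "null_homotopic X Z (cmap_comp (cmap_minus f g) k)"
    using assms null_comp_right by (simp add: homotopic_iff)
  then show ?thesis
    using cmap_comp_minus(2)[OF assms(4,5) cmap_id_is_cmap[OF assms(3)] assms(6)] by (simp add: homotopic_iff)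
qed

section \<open>Quasi-isomorphisms\<close>

text \<open>Quasi-isomorphism is split in two halves because an inverse in the derived category
  delivers them separately: one composite gives injectivity on cohomology, the other
  surjectivity.\<close>

definition coh_inj :: "'k :: field cpx \<Rightarrow> 'k cpx \<Rightarrow> 'k cmap \<Rightarrow> bool" where
  "coh_inj X Y f \<longleftrightarrow> (\<forall>n v. \<forall>x \<in> cocycles X n v. f n v *\<^sub>v x \<in> coboundaries Y n v \<longrightarrow> x \<in> coboundaries X n v)"

definition coh_surj :: "'k :: field cpx \<Rightarrow> 'k cpx \<Rightarrow> 'k cmap \<Rightarrow> bool" where
  "coh_surj X Y f \<longleftrightarrow> (\<forall>n v. \<forall>y \<in> cocycles Y n v. \<exists>x \<in> cocycles X n v. y - f n v *\<^sub>v x \<in> coboundaries Y n v)"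

definition acyclic :: "'k :: field cpx \<Rightarrow> bool" where
  "acyclic X \<longleftrightarrow> (\<forall>n v. cocycles X n v \<subseteq> coboundaries X n v)"

lemma quasi_iso_iff: "quasi_iso X Y f \<longleftrightarrow> is_cmap X Y f \<and> coh_inj X Y f \<and> coh_surj X Y f"
  by (auto simp: quasi_iso_def coh_inj_def coh_surj_def)

lemma cocycleD: "x \<in> cocycles X n v \<Longrightarrow> dim_vec x = cdim X n v"
  "x \<in> cocycles X n v \<Longrightarrow> cdf X n v *\<^sub>v x = 0\<^sub>v (cdim X (n + 1) v)"
  by (auto simp: cocycles_def)

lemma coboundaries_cocycles: "is_cpx X \<Longrightarrow> x \<in> coboundaries X n v \<Longrightarrow> x \<in> cocycles X n v"
  using cpx_carrier[of X n v] cpx_carrier'[of X n v]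
  by (auto simp: coboundaries_def cocycles_def mat_vec_assoc[symmetric] cpx_sq')

lemma coboundaryI: "w \<in> carrier_vec (cdim X (n - 1) v) \<Longrightarrow> cdf X (n - 1) v *\<^sub>v w \<in> coboundaries X n v"
  by (auto simp: coboundaries_def)

lemma zero_coboundary: "is_cpx X \<Longrightarrow> 0\<^sub>v (cdim X n v) \<in> coboundaries X n v"
  using cpx_carrier'[of X n v] coboundaryI[of "0\<^sub>v (cdim X (n - 1) v)" X n v] by simp

lemma coboundary_arith:
  assumes "is_cpx X" "x \<in> coboundaries X n v" "y \<in> coboundaries X n v"
  shows "x + y \<in> coboundaries X n v" "x - y \<in> coboundaries X n v"
  using assms cpx_carrier'[of X n v]
  by (auto simp: coboundaries_def mat_vec_distribs[symmetric] image_iff intro!: bexI minus_carrier_vec)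

lemma cocycle_arith:
  assumes "is_cpx X" "x \<in> cocycles X n v" "y \<in> cocycles X n v"
  shows "x + y \<in> cocycles X n v" "x - y \<in> cocycles X n v" "- x \<in> cocycles X n v"
  using assms cpx_carrier[of X n v]
  by (auto simp: cocycles_def mat_vec_distribs minus_carrier_vec)

lemma cmap_cocycle:
  assumes "is_cpx X" "is_cpx Y" "is_cmap X Y f" "x \<in> cocycles X n v"
  shows "f n v *\<^sub>v x \<in> cocycles Y n v"
proof -
  note [simp] = cpx_carrier[OF assms(1)] cpx_carrier[OF assms(2)] cmap_carrier[OF assms(3)] cocycleD(1)[OF assms(4)]
  have "cdf Y n v *\<^sub>v (f n v *\<^sub>v x) = f (n + 1) v *\<^sub>v (cdf X n v *\<^sub>v x)"
    by (simp add: mat_vec_assoc[symmetric] cmap_comm[OF assms(3)])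
  then show ?thesis by (auto simp: cocycles_def cocycleD(2)[OF assms(4)] intro: carrier_vecI)
qed

lemma cmap_coboundary:
  assumes "is_cpx X" "is_cpx Y" "is_cmap X Y f" "x \<in> coboundaries X n v"
  shows "f n v *\<^sub>v x \<in> coboundaries Y n v"
proof -
  note [simp] = cpx_carrier'[OF assms(1)] cpx_carrier'[OF assms(2)] cmap_carrier[OF assms(3)]
  obtain w where w: "w \<in> carrier_vec (cdim X (n - 1) v)" "x = cdf X (n - 1) v *\<^sub>v w"
    using assms by (auto simp: coboundaries_def)
  have "f n v *\<^sub>v x = cdf Y (n - 1) v *\<^sub>v (f (n - 1) v *\<^sub>v w)"
    using w by (simp add: mat_vec_assoc[symmetric] cmap_comm'[OF assms(3)])
  then show ?thesis using w by (auto intro!: coboundaryI carrier_vecI)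
qed

lemma null_coboundary:
  assumes X: "is_cpx X" and Y: "is_cpx Y" and "null_homotopic X Y f" "x \<in> cocycles X n v"
  shows "f n v *\<^sub>v x \<in> coboundaries Y n v"
proof -
  obtain h where h: "htpy X Y h f" using assms by (auto simp: null_homotopic_def)
  note [simp] = cpx_carrier[OF X] cpx_carrier'[OF Y] htpy_carrier[OF h] htpy_carrier'[OF h] cocycleD[OF assms(4)]
  have "f n v *\<^sub>v x = cdf Y (n - 1) v *\<^sub>v (h n v *\<^sub>v x)"
    by (simp add: htpy_eq[OF h] mat_vec_distribs mat_vec_assoc carrier_vecI)
  then show ?thesis by (auto intro!: coboundaryI carrier_vecI)
qed

lemma homotopic_coboundary:
  assumes "is_cpx X" "is_cpx Y" "is_cmap X Y f" "is_cmap X Y g" "homotopic X Y f g" "x \<in> cocycles X n v"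
  shows "f n v *\<^sub>v x - g n v *\<^sub>v x \<in> coboundaries Y n v"
  using null_coboundary[OF assms(1,2) assms(5)[unfolded homotopic_iff] assms(6)]
    cmap_carrier[OF assms(3), of n v] cmap_carrier[OF assms(4), of n v] cocycleD[OF assms(6)]
  by (simp add: cmap_minus_def mat_vec_distribs)

lemma cmap_comp_vec:
  assumes "is_cmap X Y f" "is_cmap Y Z g" "dim_vec x = cdim X n v"
  shows "cmap_comp g f n v *\<^sub>v x = g n v *\<^sub>v (f n v *\<^sub>v x)"
  using cmap_carrier[OF assms(1), of n v] cmap_carrier[OF assms(2), of n v] assms(3)
  by (simp add: cmap_comp_def mat_vec_assoc)

lemma coh_surjD: "coh_surj X Y f \<Longrightarrow> y \<in> cocycles Y n v \<Longrightarrow> \<exists>x \<in> cocycles X n v. y - f n v *\<^sub>v x \<in> coboundaries Y n v"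
  by (simp add: coh_surj_def)

lemma coh_injD: "coh_inj X Y f \<Longrightarrow> x \<in> cocycles X n v \<Longrightarrow> f n v *\<^sub>v x \<in> coboundaries Y n v \<Longrightarrow> x \<in> coboundaries X n v"
  by (simp add: coh_inj_def)

lemma vec_telescope:
  fixes a :: "'a :: ring vec"
  assumes "dim_vec a = n" "dim_vec b = n" "dim_vec c = n"
  shows "(a - b) + (b - c) = a - c"
  using assms by (intro eq_vecI) auto

lemma cocycle_carrier: "x \<in> cocycles X n v \<Longrightarrow> x \<in> carrier_vec (cdim X n v)"
  by (simp add: cocycles_def)

lemma coboundary_cancel:
  assumes "is_cpx X" "x - y \<in> coboundaries X n v" "y \<in> coboundaries X n v" "dim_vec x = cdim X n v"
  shows "x \<in> coboundaries X n v"
proof -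
  have "dim_vec y = cdim X n v" using cocycleD(1)[OF coboundaries_cocycles[OF assms(1,3)]] .
  then have "x = (x - y) + y" using assms(4) by auto
  then show ?thesis using coboundary_arith(1)[OF assms(1-3)] by simp
qed

lemma coboundary_cancel':
  assumes "is_cpx X" "x - y \<in> coboundaries X n v" "x \<in> coboundaries X n v" "dim_vec y = cdim X n v"
  shows "y \<in> coboundaries X n v"
proof -
  have "dim_vec x = cdim X n v" using cocycleD(1)[OF coboundaries_cocycles[OF assms(1,3)]] .
  then have "y = x - (x - y)" using assms(4) by auto
  then show ?thesis using coboundary_arith(2)[OF assms(1,3,2)] by simp
qed

context
  fixes X Y Z :: "'k :: field cpx" and f g
  assumes X: "is_cpx X" and Y: "is_cpx Y" and Z: "is_cpx Z" and f: "is_cmap X Y f" and g: "is_cmap Y Z g"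
begin

lemma coh_inj_comp: "coh_inj X Y f \<Longrightarrow> coh_inj Y Z g \<Longrightarrow> coh_inj X Z (cmap_comp g f)"
  unfolding coh_inj_def by (auto simp: cmap_comp_vec[OF f g] cocycleD(1) cmap_cocycle[OF X Y f])

lemma coh_inj_first: "coh_inj X Z (cmap_comp g f) \<Longrightarrow> coh_inj X Y f"
  unfolding coh_inj_def by (auto simp: cmap_comp_vec[OF f g] cocycleD(1) cmap_coboundary[OF Y Z g])

lemma cmap_comp_diff:
  assumes "x \<in> cocycles X n v" "y \<in> cocycles Y n v"
  shows "g n v *\<^sub>v (y - f n v *\<^sub>v x) = g n v *\<^sub>v y - cmap_comp g f n v *\<^sub>v x"
  using assms cmap_carrier[OF f, of n v] cmap_carrier[OF g, of n v] cocycleD(1)[OF assms(1)] cocycleD(1)[OF assms(2)]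
  by (simp add: cmap_comp_vec[OF f g] mat_vec_distribs)

lemma coh_surj_second:
  assumes "coh_surj X Z (cmap_comp g f)" shows "coh_surj Y Z g"
  unfolding coh_surj_def
proof (intro allI ballI)
  fix n v z assume "z \<in> cocycles Z n v"
  then obtain x where x: "x \<in> cocycles X n v" "z - cmap_comp g f n v *\<^sub>v x \<in> coboundaries Z n v"
    using coh_surjD[OF assms] by blast
  then show "\<exists>y\<in>cocycles Y n v. z - g n v *\<^sub>v y \<in> coboundaries Z n v"
    using cmap_cocycle[OF X Y f x(1)] by (auto simp: cmap_comp_vec[OF f g] cocycleD(1))
qed

lemma coh_surj_comp:
  assumes "coh_surj X Y f" "coh_surj Y Z g" shows "coh_surj X Z (cmap_comp g f)"
  unfolding coh_surj_def
proof (intro allI ballI)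
  fix n v z assume z: "z \<in> cocycles Z n v"
  then obtain y where y: "y \<in> cocycles Y n v" "z - g n v *\<^sub>v y \<in> coboundaries Z n v"
    using coh_surjD[OF assms(2)] by blast
  then obtain x where x: "x \<in> cocycles X n v" "y - f n v *\<^sub>v x \<in> coboundaries Y n v"
    using coh_surjD[OF assms(1)] by blast
  have "g n v *\<^sub>v y - cmap_comp g f n v *\<^sub>v x \<in> coboundaries Z n v"
    using cmap_coboundary[OF Y Z g x(2)] by (simp add: cmap_comp_diff x y)
  from coboundary_arith(1)[OF Z y(2) this]
  have "z - cmap_comp g f n v *\<^sub>v x \<in> coboundaries Z n v"
    using cocycleD(1)[OF z] cmap_carrier[OF g, of n v] cmap_carrier[OF f, of n v]
    by (simp add: cmap_comp_def vec_telescope[of _ "cdim Z n v"])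
  then show "\<exists>x\<in>cocycles X n v. z - cmap_comp g f n v *\<^sub>v x \<in> coboundaries Z n v" using x by blast
qed

text \<open>Up to a coboundary a cocycle of \<open>Y\<close> is the image of a cocycle
  \<open>x\<close> of \<open>X\<close>; if \<open>g\<close> kills its class, then the composite
  kills the class of \<open>x\<close>.\<close>

lemma coh_inj_second:
  assumes "coh_inj X Z (cmap_comp g f)" "coh_surj X Y f" shows "coh_inj Y Z g"
  unfolding coh_inj_def
proof (intro allI ballI impI)
  fix n v y assume y: "y \<in> cocycles Y n v" and gy: "g n v *\<^sub>v y \<in> coboundaries Z n v"
  then obtain x where x: "x \<in> cocycles X n v" "y - f n v *\<^sub>v x \<in> coboundaries Y n v"
    using coh_surjD[OF assms(2)] by blast
  have "g n v *\<^sub>v y - cmap_comp g f n v *\<^sub>v x \<in> coboundaries Z n v"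
    using cmap_coboundary[OF Y Z g x(2)] by (simp add: cmap_comp_diff x y)
  then have "cmap_comp g f n v *\<^sub>v x \<in> coboundaries Z n v"
    using coboundary_cancel'[OF Z _ gy] cmap_carrier[OF g, of n v] by (simp add: cmap_comp_def)
  then have "x \<in> coboundaries X n v" using assms(1) x by (auto simp: coh_inj_def)
  then have "f n v *\<^sub>v x \<in> coboundaries Y n v" by (rule cmap_coboundary[OF X Y f])
  then show "y \<in> coboundaries Y n v" using coboundary_cancel[OF Y x(2)] cocycleD(1)[OF y] by simp
qed

text \<open>Lift \<open>g y\<close> through the composite and compare in \<open>Y\<close>;
  injectivity of \<open>g\<close> on cohomology turns equality of images into equality of
  classes.\<close>

lemma coh_surj_first:
  assumes "coh_surj X Z (cmap_comp g f)" "coh_inj Y Z g" shows "coh_surj X Y f"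
  unfolding coh_surj_def
proof (intro allI ballI)
  fix n v y assume y: "y \<in> cocycles Y n v"
  then obtain x where x: "x \<in> cocycles X n v" "g n v *\<^sub>v y - cmap_comp g f n v *\<^sub>v x \<in> coboundaries Z n v"
    using coh_surjD[OF assms(1) cmap_cocycle[OF Y Z g y]] by blast
  then have "y - f n v *\<^sub>v x \<in> coboundaries Y n v"
    using assms(2) cocycle_arith(2)[OF Y y cmap_cocycle[OF X Y f x(1)]]
    by (auto simp: coh_inj_def cmap_comp_diff y)
  then show "\<exists>x\<in>cocycles X n v. y - f n v *\<^sub>v x \<in> coboundaries Y n v" using x by blast
qed

lemma quasi_iso_comp: "quasi_iso X Y f \<Longrightarrow> quasi_iso Y Z g \<Longrightarrow> quasi_iso X Z (cmap_comp g f)"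
  by (simp add: quasi_iso_iff coh_inj_comp coh_surj_comp cmap_comp_is_cmap[OF X Y Z f g])

lemma quasi_iso_second: "quasi_iso X Y f \<Longrightarrow> quasi_iso X Z (cmap_comp g f) \<Longrightarrow> quasi_iso Y Z g"
  using coh_inj_second coh_surj_second by (simp add: quasi_iso_iff g)

lemma quasi_iso_first: "quasi_iso Y Z g \<Longrightarrow> quasi_iso X Z (cmap_comp g f) \<Longrightarrow> quasi_iso X Y f"
  using coh_inj_first coh_surj_first by (simp add: quasi_iso_iff f)

end

context
  fixes X Y :: "'k :: field cpx" and f g
  assumes X: "is_cpx X" and Y: "is_cpx Y" and f: "is_cmap X Y f" and g: "is_cmap X Y g" and fg: "homotopic X Y f g"
begin

lemma coh_inj_homotopic: "coh_inj X Y f \<Longrightarrow> coh_inj X Y g"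
  unfolding coh_inj_def
  using coboundary_cancel[OF Y homotopic_coboundary[OF X Y f g fg]] cmap_carrier[OF f] by fastforce

lemma coh_surj_homotopic:
  assumes "coh_surj X Y f" shows "coh_surj X Y g"
  unfolding coh_surj_def
proof (intro allI ballI)
  fix n v y assume y: "y \<in> cocycles Y n v"
  then obtain x where x: "x \<in> cocycles X n v" "y - f n v *\<^sub>v x \<in> coboundaries Y n v"
    using coh_surjD[OF assms(1)] by blast
  from coboundary_arith(1)[OF Y x(2) homotopic_coboundary[OF X Y f g fg x(1)]]
  have "y - g n v *\<^sub>v x \<in> coboundaries Y n v"
    using cocycleD(1)[OF y] cmap_carrier[OF g, of n v] cmap_carrier[OF f, of n v]
    by (simp add: vec_telescope[of _ "cdim Y n v"])
  then show "\<exists>x\<in>cocycles X n v. y - g n v *\<^sub>v x \<in> coboundaries Y n v" using x by blast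
qed

lemma quasi_iso_homotopic: "quasi_iso X Y f \<Longrightarrow> quasi_iso X Y g"
  using coh_inj_homotopic coh_surj_homotopic by (simp add: quasi_iso_iff g)

end

lemma quasi_iso_id: "is_cpx X \<Longrightarrow> quasi_iso X X (cmap_id X)"
proof -
  assume X: "is_cpx X"
  have id: "cmap_id X n v *\<^sub>v x = x" if "x \<in> cocycles X n v" for n v x
    using cocycle_carrier[OF that] by (simp add: cmap_id_def)
  have "x - x \<in> coboundaries X n v" if "x \<in> cocycles X n v" for n v x
    using zero_coboundary[OF X, of n v] cocycle_carrier[OF that] by simp
  then have "coh_surj X X (cmap_id X)" unfolding coh_surj_def using id by force
  moreover have "coh_inj X X (cmap_id X)" unfolding coh_inj_def by (simp add: id)
  ultimately show ?thesis using cmap_id_is_cmap[OF X] by (simp add: quasi_iso_iff)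
qed

lemma quasi_iso_acyclic:
  assumes "is_cpx X" "is_cpx Y" "quasi_iso X Y f"
  shows "acyclic X \<longleftrightarrow> acyclic Y"
proof
  have f: "is_cmap X Y f" using assms by (simp add: quasi_iso_iff)
  assume a: "acyclic X"
  show "acyclic Y" unfolding acyclic_def
  proof (intro allI subsetI)
    fix n v y assume y: "y \<in> cocycles Y n v"
    then obtain x where x: "x \<in> cocycles X n v" "y - f n v *\<^sub>v x \<in> coboundaries Y n v"
      using assms(3) coh_surjD unfolding quasi_iso_iff by blast
    then have "f n v *\<^sub>v x \<in> coboundaries Y n v" using a cmap_coboundary[OF assms(1,2) f] unfolding acyclic_def by blast
    then show "y \<in> coboundaries Y n v" using coboundary_cancel[OF assms(2) x(2)] cocycleD(1)[OF y] by simp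
  qed
next
  have f: "is_cmap X Y f" using assms by (simp add: quasi_iso_iff)
  assume "acyclic Y"
  then show "acyclic X" using assms cmap_cocycle[OF assms(1,2) f]
    unfolding acyclic_def quasi_iso_iff coh_inj_def by (meson subset_iff)
qed

section \<open>Shifts\<close>

lemma shift_idx: "(n :: int) + 1 + i = n + i + 1" "(n :: int) - 1 + i = n + i - 1" "(n :: int) + 2 + i = n + i + 2"
  by simp_all

lemma cpx_shift_sel [simp]:
  "cob (cpx_shift i X) n = cob X (n + i)"
  "cdf (cpx_shift i X) n v = (if even i then cdf X (n + i) v else - cdf X (n + i) v)"
  by (simp_all add: cpx_shift_def)

lemma cpx_shift_shift: "cpx_shift i (cpx_shift j X) = cpx_shift (i + j) X"
  by (auto simp: cpx_shift_def add.assoc intro!: ext)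

lemma cpx_shift_0: "cpx_shift 0 X = X"
  by (simp add: cpx_shift_def)

lemma is_cpx_shift: "is_cpx X \<Longrightarrow> is_cpx (cpx_shift i X)"
proof -
  assume X: "is_cpx X"
  note [simp] = cpx_carrier[OF X]
  have "{n. \<exists>v. cdim X (n + i) v \<noteq> 0} = (\<lambda>n. n - i) ` {n. \<exists>v. cdim X n v \<noteq> 0}"
    by (auto simp: image_iff intro!: exI[of _ "_ + i"])
  moreover have "is_rep_hom (cob X (n + i)) (cob X (n + i + 1)) (\<lambda>v. - cdf X (n + i) v)" for n
    using hom_add(3)[OF cpx_rep[OF X] cpx_rep[OF X] cpx_hom[OF X] cpx_hom[OF X]] by simp
  moreover have "(\<lambda>v. if even i then cdf X m v else - cdf X m v) = (if even i then cdf X m else (\<lambda>v. - cdf X m v))" for m by auto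
  ultimately show ?thesis using X
    by (auto simp: is_cpx_def shift_idx is_rep_hom_def)
qed

lemma cmap_shift_shift: "cmap_shift i (cmap_shift j f) = cmap_shift (i + j) f"
  by (auto simp: cmap_shift_def add.assoc)

lemma cmap_shift_0: "cmap_shift 0 f = f"
  by (simp add: cmap_shift_def)

lemma cmap_shift_comp: "cmap_shift i (cmap_comp g f) = cmap_comp (cmap_shift i g) (cmap_shift i f)"
  by (simp add: cmap_shift_def cmap_comp_def)

lemma is_cmap_shift:
  assumes "is_cpx X" "is_cpx Y" "is_cmap X Y f"
  shows "is_cmap (cpx_shift i X) (cpx_shift i Y) (cmap_shift i f)"
proof -
  note [simp] = cpx_carrier[OF assms(1)] cpx_carrier[OF assms(2)] cmap_carrier[OF assms(3)]
  show ?thesis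
    using cmap_hom[OF assms(3)] cmap_comm[OF assms(3)] by (auto simp: is_cmap_def cmap_shift_def shift_idx)
qed

lemma null_shift:
  assumes X: "is_cpx X" and Y: "is_cpx Y" and "null_homotopic X Y f"
  shows "null_homotopic (cpx_shift i X) (cpx_shift i Y) (cmap_shift i f)"
proof -
  obtain h where h: "htpy X Y h f" using assms by (auto simp: null_homotopic_def)
  note [simp] = cpx_carrier[OF X] cpx_carrier'[OF Y] htpy_carrier[OF h] htpy_carrier'[OF h]
  have "is_rep_hom (cob X (n + i)) (cob Y (n + i - 1)) (\<lambda>v. - h (n + i) v)" for n
    using hom_add(3)[OF cpx_rep[OF X] cpx_rep[OF Y] htpy_hom[OF h] htpy_hom[OF h]] .
  moreover have "(\<lambda>v. if even i then h m v else - h m v) = (if even i then h m else (\<lambda>v. - h m v))" for m by auto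
  \<comment> \<open>The shifted differential carries the sign $(-1)^i$ while
    \<open>cmap_shift\<close> carries none, so the homotopy has to absorb the sign.\<close>
  ultimately have "htpy (cpx_shift i X) (cpx_shift i Y) (\<lambda>n v. if even i then h (n + i) v else - h (n + i) v) (cmap_shift i f)"
    using htpy_hom[OF h] by (auto simp: htpy_def cmap_shift_def shift_idx htpy_eq[OF h])
  then show ?thesis by (auto simp: null_homotopic_def)
qed

lemma cocycles_shift: "is_cpx X \<Longrightarrow> cocycles (cpx_shift i X) n v = cocycles X (n + i) v"
proof -
  assume X: "is_cpx X"
  have "- cdf X (n + i) v *\<^sub>v x = 0\<^sub>v (cdim X (n + i + 1) v) \<longleftrightarrow> cdf X (n + i) v *\<^sub>v x = 0\<^sub>v (cdim X (n + i + 1) v)"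
    if "x \<in> carrier_vec (cdim X (n + i) v)" for x
    using cpx_carrier[OF X, of "n + i" v] that
    by (simp add: uminus_zero_vec_eq[OF carrier_vecI])
  then show ?thesis by (auto simp: cocycles_def shift_idx)
qed

lemma coboundaries_shift: "is_cpx X \<Longrightarrow> coboundaries (cpx_shift i X) n v = coboundaries X (n + i) v"
proof -
  assume X: "is_cpx X"
  note [simp] = cpx_carrier'[OF X]
  have "(\<lambda>w. - cdf X (n + i - 1) v *\<^sub>v w) ` carrier_vec (cdim X (n + i - 1) v) =
    (\<lambda>w. cdf X (n + i - 1) v *\<^sub>v w) ` uminus ` carrier_vec (cdim X (n + i - 1) v)"
    by (auto simp: image_image mat_vec_distribs)
  also have "uminus ` carrier_vec m = (carrier_vec m :: 'a vec set)" for m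
  proof (intro equalityI subsetI)
    fix x :: "'a vec" assume "x \<in> carrier_vec m"
    then show "x \<in> uminus ` carrier_vec m" by (intro image_eqI[of _ _ "- x"]) auto
  qed auto
  finally show ?thesis by (auto simp: coboundaries_def shift_idx)
qed

lemma quasi_iso_shift:
  assumes "is_cpx X" "is_cpx Y" "quasi_iso X Y f"
  shows "quasi_iso (cpx_shift i X) (cpx_shift i Y) (cmap_shift i f)"
  using assms is_cmap_shift[OF assms(1,2)]
  by (auto simp: quasi_iso_iff coh_inj_def coh_surj_def cocycles_shift coboundaries_shift cmap_shift_def)

section \<open>Mapping cones\<close>

lemma mat_add_zeros [simp]:
  fixes A :: "'a :: ring mat"
  shows "dim_row A = r \<Longrightarrow> dim_col A = c \<Longrightarrow> A + 0\<^sub>m r c = A" "dim_row A = r \<Longrightarrow> dim_col A = c \<Longrightarrow> 0\<^sub>m r c + A = A"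
    "dim_row A = r \<Longrightarrow> dim_col A = c \<Longrightarrow> A - 0\<^sub>m r c = A" "dim_row A = r \<Longrightarrow> dim_col A = c \<Longrightarrow> 0\<^sub>m r c - A = - A"
    "- (0\<^sub>m r c) = (0\<^sub>m r c :: 'a mat)" "- A + A = 0\<^sub>m (dim_row A) (dim_col A)" "A + - A = 0\<^sub>m (dim_row A) (dim_col A)"
    "A - A = 0\<^sub>m (dim_row A) (dim_col A)"
  by (auto intro!: eq_matI)

lemma vec_add_zeros [simp]:
  fixes x :: "'a :: ring vec"
  shows "dim_vec x = r \<Longrightarrow> x + 0\<^sub>v r = x" "dim_vec x = r \<Longrightarrow> 0\<^sub>v r + x = x"
    "dim_vec x = r \<Longrightarrow> x - 0\<^sub>v r = x" "dim_vec x = r \<Longrightarrow> 0\<^sub>v r - x = - x"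
  by (auto intro!: eq_vecI)

lemma int_idx [simp]: "(n :: int) + 1 + 1 = n + 2" "(n :: int) + 1 + 2 = n + 3" "(n :: int) + 2 + 1 = n + 3" "(n :: int) + 2 - 1 = n + 1" "(n :: int) - 1 + 2 = n + 1"
  by simp_all

lemma block_uminus:
  fixes A B :: "'a :: ring mat"
  shows "dim_col B = dim_col A \<Longrightarrow> - vst A B = vst (- A) (- B)" "dim_row B = dim_row A \<Longrightarrow> - hst A B = hst (- A) (- B)"
  using vst_arith(3)[of A A B B] hst_arith(3)[of A A B B] by auto

lemma append_vecE:
  assumes "t \<in> carrier_vec (m + n)"
  obtains w z where "w \<in> carrier_vec m" "z \<in> carrier_vec n" "t = w @\<^sub>v z"
  using vec_first_last_append[OF assms] vec_first_carrier vec_last_carrier by metis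

lemma rep_sum_sel [simp]:
  "rdim (rep_sum M N) v = rdim M v + rdim N v"
  by (simp add: rep_sum_def)

lemma rep_sum_rmap:
  assumes "is_rep M" "is_rep N"
  shows "rmap (rep_sum M N) a = vst (hst (rmap M a) (0\<^sub>m (rdim M (tgt a)) (rdim N (src a))))
    (hst (0\<^sub>m (rdim N (tgt a)) (rdim M (src a))) (rmap N a))"
  using rep_carrier[OF assms(1)] rep_carrier[OF assms(2)]
  by (simp add: rep_sum_def four_block_vst_hst)

lemma rep_sum_mult_vst:
  assumes "is_rep M" "is_rep N" "dim_row b = rdim N (src a)" "dim_row x = rdim M (src a)" "dim_col b = dim_col x"
  shows "rmap (rep_sum M N) a * vst x b = vst (rmap M a * x) (rmap N a * b)"
  using rep_carrier[OF assms(1), of a] rep_carrier[OF assms(2), of a] assms(3-)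
  by (simp add: rep_sum_rmap[OF assms(1,2)] vst_mult hst_mult_vst)

lemma hst_mult_rep_sum:
  assumes "is_rep M" "is_rep N" "dim_col b = rdim N (tgt a)" "dim_col x = rdim M (tgt a)" "dim_row b = dim_row x"
  shows "hst x b * rmap (rep_sum M N) a = hst (x * rmap M a) (b * rmap N a)"
  using rep_carrier[OF assms(1), of a] rep_carrier[OF assms(2), of a] assms(3-)
  by (simp add: rep_sum_rmap[OF assms(1,2)] hst_mult_vst mult_hst hst_arith)

lemma rep_sum_is_rep:
  assumes "is_rep M" "is_rep N" shows "is_rep (rep_sum M N)"
proof -
  note [simp] = rep_carrier[OF assms(1)] rep_carrier[OF assms(2)]
  have r: "rmap M Beta2 * rmap M Alpha1 = 0\<^sub>m (rdim M V3) (rdim M V1)"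
    "rmap M Alpha2 * rmap M Beta1 = 0\<^sub>m (rdim M V3) (rdim M V1)"
    "rmap N Beta2 * rmap N Alpha1 = 0\<^sub>m (rdim N V3) (rdim N V1)"
    "rmap N Alpha2 * rmap N Beta1 = 0\<^sub>m (rdim N V3) (rdim N V1)"
    using assms by (auto simp: is_rep_def)
  have "rmap (rep_sum M N) a \<in> carrier_mat (rdim M (tgt a) + rdim N (tgt a)) (rdim M (src a) + rdim N (src a))" for a
    by (rule carrier_matI) (simp_all add: rep_sum_rmap[OF assms])
  moreover have "rmap (rep_sum M N) b * rmap (rep_sum M N) a = 0\<^sub>m (rdim M V3 + rdim N V3) (rdim M V1 + rdim N V1)"
    if "(b, a) \<in> {(Beta2, Alpha1), (Alpha2, Beta1)}" for a b
    using that
    by (auto simp: rep_sum_rmap[OF assms] vst_mult hst_mult_vst mult_hst hst_arith vst_arith r hst_zero vst_zero)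
  ultimately show ?thesis by (auto simp: is_rep_def)
qed

lemma hom_vst_iff:
  assumes "is_rep W" "is_rep M" "is_rep N"
    "\<And>v. a v \<in> carrier_mat (rdim M v) (rdim W v)" "\<And>v. b v \<in> carrier_mat (rdim N v) (rdim W v)"
  shows "is_rep_hom W (rep_sum M N) (\<lambda>v. vst (a v) (b v)) \<longleftrightarrow> is_rep_hom W M a \<and> is_rep_hom W N b"
proof -
  note c = rep_carrier[OF assms(1)] rep_carrier[OF assms(2)] rep_carrier[OF assms(3)]
  have d: "dim_row (a v) = rdim M v" "dim_col (a v) = rdim W v" "dim_row (b v) = rdim N v" "dim_col (b v) = rdim W v" for v
    using assms(4)[of v] assms(5)[of v] by auto
  have "vst (a (tgt x)) (b (tgt x)) * rmap W x = rmap (rep_sum M N) x * vst (a (src x)) (b (src x)) \<longleftrightarrow>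
    a (tgt x) * rmap W x = rmap M x * a (src x) \<and> b (tgt x) * rmap W x = rmap N x * b (src x)" for x
    by (simp add: vst_mult rep_sum_mult_vst[OF assms(2,3)] c d vst_eq_iff)
  moreover have "vst (a v) (b v) \<in> carrier_mat (rdim M v + rdim N v) (rdim W v)" for v
    by (rule carrier_matI) (simp_all add: d)
  ultimately show ?thesis using assms(4,5) by (auto simp: is_rep_hom_def)
qed

lemma hom_hst_iff:
  assumes "is_rep W" "is_rep M" "is_rep N"
    "\<And>v. a v \<in> carrier_mat (rdim W v) (rdim M v)" "\<And>v. b v \<in> carrier_mat (rdim W v) (rdim N v)"
  shows "is_rep_hom (rep_sum M N) W (\<lambda>v. hst (a v) (b v)) \<longleftrightarrow> is_rep_hom M W a \<and> is_rep_hom N W b"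
proof -
  note c = rep_carrier[OF assms(1)] rep_carrier[OF assms(2)] rep_carrier[OF assms(3)]
  have d: "dim_row (a v) = rdim W v" "dim_col (a v) = rdim M v" "dim_row (b v) = rdim W v" "dim_col (b v) = rdim N v" for v
    using assms(4)[of v] assms(5)[of v] by auto
  have "hst (a (tgt x)) (b (tgt x)) * rmap (rep_sum M N) x = rmap W x * hst (a (src x)) (b (src x)) \<longleftrightarrow>
    a (tgt x) * rmap M x = rmap W x * a (src x) \<and> b (tgt x) * rmap N x = rmap W x * b (src x)" for x
    by (simp add: mult_hst hst_mult_rep_sum[OF assms(2,3)] c d hst_eq_iff)
  moreover have "hst (a v) (b v) \<in> carrier_mat (rdim W v) (rdim M v + rdim N v)" for v
    by (rule carrier_matI) (simp_all add: d)
  ultimately show ?thesis using assms(4,5) by (auto simp: is_rep_hom_def)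
qed

lemma hom_vst_split:
  assumes "is_rep W" "is_rep M" "is_rep N" and f: "is_rep_hom W (rep_sum M N) f"
  shows "is_rep_hom W M (\<lambda>v. upper (rdim M v) (f v))" "is_rep_hom W N (\<lambda>v. lower (rdim M v) (f v))"
    "vst (upper (rdim M v) (f v)) (lower (rdim M v) (f v)) = f v"
proof -
  have d: "dim_row (f v) = rdim M v + rdim N v" "dim_col (f v) = rdim W v" for v
    using hom_carrier[OF f, of v] by simp_all
  show e: "vst (upper (rdim M v) (f v)) (lower (rdim M v) (f v)) = f v" for v
    by (rule vst_upper_lower) (simp add: d)
  have "is_rep_hom W (rep_sum M N) (\<lambda>v. vst (upper (rdim M v) (f v)) (lower (rdim M v) (f v)))"
    by (simp add: e f)
  then show "is_rep_hom W M (\<lambda>v. upper (rdim M v) (f v))" "is_rep_hom W N (\<lambda>v. lower (rdim M v) (f v))"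
    by (subst (asm) hom_vst_iff[OF assms(1-3)]; auto intro!: carrier_matI simp: d)+
qed

context
  fixes X Y :: "'k :: field cpx" and u
  assumes X: "is_cpx X" and Y: "is_cpx Y" and u: "is_cmap X Y u"
begin

private lemmas cone_dims [simp] = cpx_carrier[OF X] cpx_carrier[OF Y] cmap_carrier[OF u] cpx_carrier'[OF X] cpx_carrier'[OF Y]

lemma cone_sel:
  "cob (cone X Y u) n = rep_sum (cob X (n + 1)) (cob Y n)"
  "cdf (cone X Y u) n v = vst (hst (- cdf X (n + 1) v) (0\<^sub>m (cdim X (n + 2) v) (cdim Y n v))) (hst (u (n + 1) v) (cdf Y n v))"
  by (simp_all add: cone_def four_block_vst_hst)

lemma cone_mult_vst:
  assumes "dim_row a = cdim X (n + 1) v" "dim_row b = cdim Y n v" "dim_col b = dim_col a"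
  shows "cdf (cone X Y u) n v * vst a b = vst (- (cdf X (n + 1) v * a)) (u (n + 1) v * a + cdf Y n v * b)"
proof -
  have "- (cdf X (n + 1) v * a) + 0\<^sub>m (cdim X (n + 2) v) (dim_col a) = - (cdf X (n + 1) v * a)"
    by (rule eq_matI) (simp_all del: index_mult_mat(1))
  then show ?thesis using assms by (simp add: cone_sel vst_mult hst_mult_vst)
qed

lemma cone_mult_vst':
  assumes "dim_row a = cdim X n v" "dim_row b = cdim Y (n - 1) v" "dim_col b = dim_col a"
  shows "cdf (cone X Y u) (n - 1) v * vst a b = vst (- (cdf X n v * a)) (u n v * a + cdf Y (n - 1) v * b)"
  using cone_mult_vst[of a "n - 1" v b] assms by simp

lemma hst_mult_cone:
  assumes "dim_col a = cdim X (n + 2) v" "dim_col b = cdim Y (n + 1) v" "dim_row b = dim_row a"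
  shows "hst a b * cdf (cone X Y u) n v = hst (b * u (n + 1) v - a * cdf X (n + 1) v) (b * cdf Y n v)"
proof -
  have "- (a * cdf X (n + 1) v) + b * u (n + 1) v = b * u (n + 1) v - a * cdf X (n + 1) v"
    using assms by (intro eq_matI) (simp_all del: index_mult_mat(1))
  moreover have "0\<^sub>m (dim_row a) (cdim Y n v) + b * cdf Y n v = b * cdf Y n v"
    using assms by (intro eq_matI) (simp_all del: index_mult_mat(1))
  ultimately show ?thesis using assms by (simp add: cone_sel mult_hst hst_mult_vst hst_arith)
qed

lemma is_cpx_cone: "is_cpx (cone X Y u)"
  unfolding is_cpx_def
proof (intro conjI allI)
  fix n v
  show "is_rep (cob (cone X Y u) n)"
    by (simp add: cone_sel rep_sum_is_rep cpx_rep[OF X] cpx_rep[OF Y])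
  have r: "is_rep (cob X n)" "is_rep (cob Y n)" for n by (simp_all add: cpx_rep[OF X] cpx_rep[OF Y])
  have cmp: "is_rep_hom (rep_sum (cob X (n + 1)) (cob Y n)) (rep_sum (cob X (n + 1 + 1)) (cob Y (n + 1)))
     (\<lambda>v. vst (hst (- cdf X (n + 1) v) (0\<^sub>m (cdim X (n + 2) v) (cdim Y n v))) (hst (u (n + 1) v) (cdf Y n v)))"
    using hom_zero[of "cob Y n" "cob X (n + 1 + 1)"] hom_add(3)[OF r(1) r(1) cpx_hom[OF X] cpx_hom[OF X], of "n + 1"]
      cmap_hom[OF u, of "n + 1"] cpx_hom[OF Y, of n] cpx_carrier[OF X, of "n + 1"]
    by (subst hom_vst_iff) (auto intro!: carrier_matI r rep_sum_is_rep simp: hom_hst_iff r)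
  then show "is_rep_hom (cob (cone X Y u) n) (cob (cone X Y u) (n + 1)) (cdf (cone X Y u) n)"
    by (simp add: cone_sel[abs_def])
  have "cdf (cone X Y u) (n + 1) v * cdf (cone X Y u) n v =
    hst (cdf (cone X Y u) (n + 1) v * vst (- cdf X (n + 1) v) (u (n + 1) v))
        (cdf (cone X Y u) (n + 1) v * vst (0\<^sub>m (cdim X (n + 2) v) (cdim Y n v)) (cdf Y n v))"
    by (subst (2) cone_sel(2)) (simp add: vst_hst mult_hst cone_sel(2))
  also have "\<dots> = hst (0\<^sub>m (cdim X (n + 3) v + cdim Y (n + 2) v) (cdim X (n + 1) v)) (0\<^sub>m (cdim X (n + 3) v + cdim Y (n + 2) v) (cdim Y n v))"
    using cpx_sq[OF X, of "n + 1" v] cpx_sq[OF Y, of n v] cmap_comm[OF u, of "n + 1" v]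
    by (auto intro!: arg_cong2[where f = hst] simp: cone_mult_vst vst_zero[symmetric] vst_eq_iff)
  finally show "cdf (cone X Y u) (n + 1) v * cdf (cone X Y u) n v = 0\<^sub>m (cdim (cone X Y u) (n + 2) v) (cdim (cone X Y u) n v)"
    by (simp add: hst_zero cone_sel)
next
  have "{n. \<exists>v. cdim (cone X Y u) n v \<noteq> 0} \<subseteq> (\<lambda>n. n - 1) ` {n. \<exists>v. cdim X n v \<noteq> 0} \<union> {n. \<exists>v. cdim Y n v \<noteq> 0}"
  proof
    fix n assume "n \<in> {n. \<exists>v. cdim (cone X Y u) n v \<noteq> 0}"
    then obtain v where "cdim X (n + 1) v \<noteq> 0 \<or> cdim Y n v \<noteq> 0" by (auto simp: cone_sel)
    then show "n \<in> (\<lambda>n. n - 1) ` {n. \<exists>v. cdim X n v \<noteq> 0} \<union> {n. \<exists>v. cdim Y n v \<noteq> 0}"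
      by (auto intro: rev_image_eqI[of "n + 1"])
  qed
  moreover have "finite ((\<lambda>n. n - 1) ` {n. \<exists>v. cdim X n v \<noteq> 0} \<union> {n. \<exists>v. cdim Y n v \<noteq> 0})"
    using X Y by (auto simp: is_cpx_def)
  ultimately show "finite {n. \<exists>v. cdim (cone X Y u) n v \<noteq> 0}" by (rule finite_subset)
qed

lemma cone_in_sel: "cone_in X Y n v = vst (0\<^sub>m (cdim X (n + 1) v) (cdim Y n v)) (1\<^sub>m (cdim Y n v))"
  by (rule eq_matI) (auto simp: cone_in_def vst_def)

lemma cone_out_sel: "cone_out X Y n v = hst (1\<^sub>m (cdim X (n + 1) v)) (0\<^sub>m (cdim X (n + 1) v) (cdim Y n v))"
  by (rule eq_matI) (auto simp: cone_out_def hst_def)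

lemma cone_in_cmap: "is_cmap Y (cone X Y u) (cone_in X Y)"
proof -
  have "is_rep_hom (cob Y n) (rep_sum (cob X (n + 1)) (cob Y n)) (\<lambda>v. vst (0\<^sub>m (cdim X (n + 1) v) (cdim Y n v)) (1\<^sub>m (cdim Y n v)))" for n
    by (subst hom_vst_iff) (auto simp: hom_id hom_zero cpx_rep[OF X] cpx_rep[OF Y])
  then show ?thesis
    by (auto simp: is_cmap_def cone_in_sel[abs_def] vst_mult cone_mult_vst vst_eq_iff) (auto simp: cone_sel)
qed

lemma cone_out_cmap: "is_cmap (cone X Y u) (cpx_shift 1 X) (cone_out X Y)"
proof -
  have "is_rep_hom (rep_sum (cob X (n + 1)) (cob Y n)) (cob X (n + 1)) (\<lambda>v. hst (1\<^sub>m (cdim X (n + 1) v)) (0\<^sub>m (cdim X (n + 1) v) (cdim Y n v)))" for n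
    by (subst hom_hst_iff) (auto simp: hom_id hom_zero cpx_rep[OF X] cpx_rep[OF Y])
  moreover have "hst (1\<^sub>m (cdim X (n + 2) v)) (0\<^sub>m (cdim X (n + 2) v) (cdim Y (n + 1) v)) * cdf (cone X Y u) n v
    = - (cdf X (n + 1) v * hst (1\<^sub>m (cdim X (n + 1) v)) (0\<^sub>m (cdim X (n + 1) v) (cdim Y n v)))" for n v
    by (simp add: hst_mult_cone mult_hst hst_arith block_uminus hst_eq_iff)
  ultimately show ?thesis
    by (auto simp: is_cmap_def cone_out_sel[abs_def]) (auto simp: cone_sel add.assoc)
qed

text \<open>The projection of the cone to its \<open>Y\<close> summand is not a chain map, but it is
  the homotopy.\<close>

lemma cone_out_null: "null_homotopic (cone X Y u) (cpx_shift 1 Y) (cmap_comp (cmap_shift 1 u) (cone_out X Y))"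
proof -
  let ?h = "\<lambda>n v. hst (0\<^sub>m (cdim Y n v) (cdim X (n + 1) v)) (1\<^sub>m (cdim Y n v))"
  have "is_rep_hom (rep_sum (cob X (n + 1)) (cob Y n)) (cob Y n) (?h n)" for n
    by (subst hom_hst_iff) (auto simp: hom_id hom_zero cpx_rep[OF X] cpx_rep[OF Y])
  moreover have "u (n + 1) v * hst (1\<^sub>m (cdim X (n + 1) v)) (0\<^sub>m (cdim X (n + 1) v) (cdim Y n v)) =
    - (cdf Y n v * ?h n v) + ?h (n + 1) v * cdf (cone X Y u) n v" for n v
    by (simp add: hst_mult_cone mult_hst hst_arith block_uminus hst_eq_iff)
  ultimately have "htpy (cone X Y u) (cpx_shift 1 Y) ?h (cmap_comp (cmap_shift 1 u) (cone_out X Y))"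
    by (auto simp: htpy_def cmap_comp_def cmap_shift_def cone_out_sel) (auto simp: cone_sel)
  then show ?thesis by (auto simp: null_homotopic_def)
qed

text \<open>A null-homotopy into the cone splits at the block boundary: its \<open>X\<close> part is
  a chain map \<open>k\<close>, its \<open>Y\<close> part a homotopy from \<open>f\<close> to
  \<open>u\<close> after \<open>k\<close>.\<close>

lemma cone_lift_through:
  assumes V: "is_cpx V" and f: "is_cmap V Y f" and "null_homotopic V (cone X Y u) (cmap_comp (cone_in X Y) f)"
  obtains k where "is_cmap V X k" "homotopic V Y f (cmap_comp u k)"
proof -
  obtain h where h: "htpy V (cone X Y u) h (cmap_comp (cone_in X Y) f)" using assms(3) by (auto simp: null_homotopic_def)
  note [simp] = cpx_carrier[OF V] cmap_carrier[OF f]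
  define a where "a = (\<lambda>n v. upper (cdim X n v) (h n v))"
  define b where "b = (\<lambda>n v. lower (cdim X n v) (h n v))"
  have "is_rep_hom (cob V n) (rep_sum (cob X n) (cob Y (n - 1))) (h n)" for n
    using htpy_hom[OF h, of n] by (simp add: cone_sel)
  from hom_vst_split[OF cpx_rep[OF V] cpx_rep[OF X] cpx_rep[OF Y] this]
  have ha: "is_rep_hom (cob V n) (cob X n) (a n)" and hb: "is_rep_hom (cob V n) (cob Y (n - 1)) (b n)"
    and hab: "h n v = vst (a n v) (b n v)" for n v by (simp_all add: a_def b_def)
  note [simp] = hom_carrier[OF ha] hom_carrier[OF hb]
  have b1: "b (n + 1) v \<in> carrier_mat (cdim Y n v) (cdim V (n + 1) v)" "dim_row (b (n + 1) v) = cdim Y n v"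
    "dim_col (b (n + 1) v) = cdim V (n + 1) v" for n v
    using hom_carrier[OF hb, of "n + 1" v] by auto
  note [simp] = b1
  have "vst (0\<^sub>m (cdim X (n + 1) v) (cdim V n v)) (f n v) =
    vst (- (cdf X n v * a n v) + a (n + 1) v * cdf V n v)
        ((u n v * a n v + cdf Y (n - 1) v * b n v) + b (n + 1) v * cdf V n v)" for n v
    using htpy_eq[OF h, of n v]
    by (simp add: cmap_comp_def cone_in_sel vst_mult hab cone_mult_vst' vst_arith)
  then have e: "0\<^sub>m (cdim X (n + 1) v) (cdim V n v) = - (cdf X n v * a n v) + a (n + 1) v * cdf V n v"
    "f n v = (u n v * a n v + cdf Y (n - 1) v * b n v) + b (n + 1) v * cdf V n v" for n v
    by (auto simp: vst_eq_iff)
  have "a (n + 1) v * cdf V n v = cdf X n v * a n v" for n v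
  proof (rule eq_matI)
    fix i j assume "i < dim_row (cdf X n v * a n v)" "j < dim_col (cdf X n v * a n v)"
    then show "(a (n + 1) v * cdf V n v) $$ (i, j) = (cdf X n v * a n v) $$ (i, j)"
      using arg_cong[OF e(1)[of n v], of "\<lambda>M. M $$ (i, j)"] by (simp del: index_mult_mat(1))
  qed auto
  then have "is_cmap V X a" by (simp add: is_cmap_def ha)
  moreover have "cmap_minus f (cmap_comp u a) n v = cdf Y (n - 1) v * b n v + b (n + 1) v * cdf V n v" for n v
    unfolding cmap_minus_def cmap_comp_def e(2) by (rule eq_matI) (simp_all del: index_mult_mat(1))
  then have "homotopic V Y f (cmap_comp u a)"
    unfolding homotopic_iff null_homotopic_def htpy_def using hb by blast
  ultimately show ?thesis by (rule that)
qed

text \<open>The null-homotopy is the missing \<open>Y\<close> component of the lift.\<close>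

lemma cone_lift:
  assumes W: "is_cpx W" and f: "is_cmap W (cpx_shift 1 X) f"
    and "null_homotopic W (cpx_shift 1 Y) (cmap_comp (cmap_shift 1 u) f)"
  obtains F where "is_cmap W (cone X Y u) F" "cmap_comp (cone_out X Y) F = f"
proof -
  obtain h where h: "htpy W (cpx_shift 1 Y) h (cmap_comp (cmap_shift 1 u) f)" using assms(3) by (auto simp: null_homotopic_def)
  note [simp] = cpx_carrier[OF W]
  have [simp]: "f n v \<in> carrier_mat (cdim X (n + 1) v) (cdim W n v)" "dim_row (f n v) = cdim X (n + 1) v" "dim_col (f n v) = cdim W n v"
    "h n v \<in> carrier_mat (cdim Y n v) (cdim W n v)" "dim_row (h n v) = cdim Y n v" "dim_col (h n v) = cdim W n v" for n v
    using cmap_carrier[OF f, of n v] htpy_carrier[OF h, of n v] by simp_all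
  let ?F = "\<lambda>n v. vst (f n v) (h n v)"
  have "is_rep_hom (cob W n) (rep_sum (cob X (n + 1)) (cob Y n)) (?F n)" for n
    using cmap_hom[OF f, of n] htpy_hom[OF h, of n]
    by (subst hom_vst_iff) (auto simp: cpx_rep[OF X] cpx_rep[OF Y] cpx_rep[OF W])
  moreover have "h (n + 1) v * cdf W n v = u (n + 1) v * f n v + cdf Y n v * h n v" for n v
  proof -
    have "u (n + 1) v * f n v = - (cdf Y n v * h n v) + h (n + 1) v * cdf W n v"
      using htpy_eq[OF h, of n v] by (simp add: cmap_comp_def cmap_shift_def)
    then show ?thesis by (auto intro!: eq_matI simp del: index_mult_mat(1))
  qed
  then have "?F (n + 1) v * cdf W n v = cdf (cone X Y u) n v * ?F n v" for n v
    using cmap_comm[OF f, of n v] by (simp add: vst_mult cone_mult_vst)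
  ultimately have "is_cmap W (cone X Y u) ?F"
    by (simp add: is_cmap_def) (simp add: cone_sel)
  moreover have "cmap_comp (cone_out X Y) ?F = f"
    by (auto simp: cmap_comp_def cone_out_sel hst_mult_vst intro!: ext)
  ultimately show ?thesis by (rule that)
qed

text \<open>The null-homotopy, moved by one degree, is the missing component on the \<open>X\<close>
  summand.\<close>

lemma cone_extend:
  assumes A: "is_cpx A" and f: "is_cmap Y A f" and "null_homotopic X A (cmap_comp f u)"
  obtains F where "is_cmap (cone X Y u) A F" "cmap_comp F (cone_in X Y) = f"
proof -
  obtain h where h: "htpy X A h (cmap_comp f u)" using assms(3) by (auto simp: null_homotopic_def)
  note [simp] = cpx_carrier[OF A] cmap_carrier[OF f] htpy_carrier'[OF h]
  have [simp]: "h (n + 2) v \<in> carrier_mat (cdim A (n + 1) v) (cdim X (n + 2) v)" "dim_row (h (n + 2) v) = cdim A (n + 1) v"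
    "dim_col (h (n + 2) v) = cdim X (n + 2) v" for n v
    using htpy_carrier'[OF h, of "n + 1" v] by (simp_all add: add.assoc)
  let ?F = "\<lambda>n v. hst (h (n + 1) v) (f n v)"
  have "is_rep_hom (rep_sum (cob X (n + 1)) (cob Y n)) (cob A n) (?F n)" for n
    using cmap_hom[OF f, of n] htpy_hom'[OF h, of n]
    by (subst hom_hst_iff) (auto simp: cpx_rep[OF X] cpx_rep[OF Y] cpx_rep[OF A])
  moreover have "cdf A n v * h (n + 1) v = f (n + 1) v * u (n + 1) v - h (n + 2) v * cdf X (n + 1) v" for n v
  proof -
    have "f (n + 1) v * u (n + 1) v = cdf A n v * h (n + 1) v + h (n + 2) v * cdf X (n + 1) v"
      using htpy_eq[OF h, of "n + 1" v] by (simp add: cmap_comp_def add.assoc)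
    then show ?thesis by (auto intro!: eq_matI simp del: index_mult_mat(1))
  qed
  then have "?F (n + 1) v * cdf (cone X Y u) n v = cdf A n v * ?F n v" for n v
    using cmap_comm[OF f, of n v] by (simp add: mult_hst hst_mult_cone add.assoc)
  ultimately have "is_cmap (cone X Y u) A ?F"
    by (simp add: is_cmap_def) (simp add: cone_sel)
  moreover have "cmap_comp ?F (cone_in X Y) = f"
    by (auto simp: cmap_comp_def cone_in_sel hst_mult_vst intro!: ext)
  ultimately show ?thesis by (rule that)
qed

text \<open>Exactness of maps into a cone at the cone itself. A null-homotopy of the
  \<open>X\<close> component allows that component to be moved away; what remains of the
  \<open>Y\<close> component factors through \<open>cone_in\<close>.\<close>

lemma cone_factor:
  assumes W: "is_cpx W" and f: "is_cmap W (cone X Y u) f"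
    and "null_homotopic W (cpx_shift 1 X) (cmap_comp (cone_out X Y) f)"
  obtains k where "is_cmap W Y k" "homotopic W (cone X Y u) f (cmap_comp (cone_in X Y) k)"
proof -
  obtain h where h: "htpy W (cpx_shift 1 X) h (cmap_comp (cone_out X Y) f)" using assms(3) by (auto simp: null_homotopic_def)
  note [simp] = cpx_carrier[OF W]
  have [simp]: "h n v \<in> carrier_mat (cdim X n v) (cdim W n v)" "dim_row (h n v) = cdim X n v" "dim_col (h n v) = cdim W n v" for n v
    using htpy_carrier[OF h, of n v] by simp_all
  have hh: "is_rep_hom (cob W n) (cob X n) (h n)" for n using htpy_hom[OF h, of n] by simp
  define p where "p = (\<lambda>n v. upper (cdim X (n + 1) v) (f n v))"
  define q where "q = (\<lambda>n v. lower (cdim X (n + 1) v) (f n v))"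
  have "is_rep_hom (cob W n) (rep_sum (cob X (n + 1)) (cob Y n)) (f n)" for n
    using cmap_hom[OF f, of n] by (simp add: cone_sel)
  from hom_vst_split[OF cpx_rep[OF W] cpx_rep[OF X] cpx_rep[OF Y] this]
  have hp: "is_rep_hom (cob W n) (cob X (n + 1)) (p n)" and hq: "is_rep_hom (cob W n) (cob Y n) (q n)"
    and fpq: "f n v = vst (p n v) (q n v)" for n v by (simp_all add: p_def q_def)
  note [simp] = hom_carrier[OF hp] hom_carrier[OF hq]
  have p: "p n v = - (cdf X n v * h n v) + h (n + 1) v * cdf W n v" for n v
    using htpy_eq[OF h, of n v] by (simp add: cmap_comp_def cone_out_sel fpq hst_mult_vst)
  have q: "q (n + 1) v * cdf W n v = u (n + 1) v * p n v + cdf Y n v * q n v" for n v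
    using cmap_comm[OF f, of n v] by (simp add: fpq vst_mult cone_mult_vst vst_eq_iff)
  \<comment> \<open>The component \<open>q\<close> fails to be a chain map by \<open>u\<close> after
    \<open>p\<close>, and \<open>p\<close> is the boundary of \<open>h\<close>; subtracting
    \<open>u\<close> after \<open>h\<close> repairs it. The pair consisting of \<open>h\<close> and
    0 is then the homotopy.\<close>
  define k where "k = (\<lambda>n v. q n v - u n v * h n v)"
  have hk: "is_rep_hom (cob W n) (cob Y n) (k n)" for n
    unfolding k_def by (intro hom_add hom_comp[OF cpx_rep[OF W] cpx_rep[OF X] cpx_rep[OF Y] hh cmap_hom[OF u]] cpx_rep[OF W] cpx_rep[OF Y] hq)
  have "k (n + 1) v * cdf W n v = cdf Y n v * k n v" for n v
  proof -
    have "u (n + 1) v * p n v = - (cdf Y n v * (u n v * h n v)) + u (n + 1) v * (h (n + 1) v * cdf W n v)"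
      by (simp add: p mat_distribs mat_mult_assoc[symmetric] cmap_comm[OF u])
    then show ?thesis
      by (auto simp: k_def mat_distribs q mat_mult_assoc intro!: eq_matI simp del: index_mult_mat(1))
  qed
  with hk have k: "is_cmap W Y k" by (simp add: is_cmap_def)
  let ?h = "\<lambda>n v. vst (h n v) (0\<^sub>m (cdim Y (n - 1) v) (cdim W n v))"
  have "is_rep_hom (cob W n) (rep_sum (cob X n) (cob Y (n - 1))) (?h n)" for n
    by (subst hom_vst_iff) (auto simp: cpx_rep[OF X] cpx_rep[OF Y] cpx_rep[OF W] hh hom_zero)
  moreover have "f n v - cone_in X Y n v * k n v = cdf (cone X Y u) (n - 1) v * ?h n v + ?h (n + 1) v * cdf W n v" for n v
  proof -
    have [simp]: "dim_row (k n v) = cdim Y n v" "dim_col (k n v) = cdim W n v" for n v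
      using hom_carrier[OF hk, of n v] by auto
    have "f n v - cone_in X Y n v * k n v = vst (p n v) (q n v - k n v)"
      by (auto simp: fpq cone_in_sel vst_mult vst_arith vst_eq_iff intro!: eq_matI)
    moreover have "q n v - k n v = u n v * h n v" unfolding k_def
      by (rule eq_matI) (simp_all del: index_mult_mat(1))
    moreover have "cdf (cone X Y u) (n - 1) v * ?h n v + ?h (n + 1) v * cdf W n v = vst (p n v) (u n v * h n v)"
      by (auto simp: cone_mult_vst' vst_mult vst_arith p vst_eq_iff intro!: eq_matI simp del: index_mult_mat(1))
    ultimately show ?thesis by simp
  qed
  ultimately have "htpy W (cone X Y u) ?h (cmap_minus f (cmap_comp (cone_in X Y) k))"
    by (simp add: htpy_def cmap_minus_def cmap_comp_def) (simp add: cone_sel)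
  then have "homotopic W (cone X Y u) f (cmap_comp (cone_in X Y) k)"
    by (auto simp: homotopic_iff null_homotopic_def)
  with k show ?thesis by (rule that)
qed

lemma cone_cocycle_iff:
  assumes "x \<in> carrier_vec (cdim X (n + 1) v)" "y \<in> carrier_vec (cdim Y n v)"
  shows "x @\<^sub>v y \<in> cocycles (cone X Y u) n v \<longleftrightarrow>
    cdf X (n + 1) v *\<^sub>v x = 0\<^sub>v (cdim X (n + 2) v) \<and> u (n + 1) v *\<^sub>v x + cdf Y n v *\<^sub>v y = 0\<^sub>v (cdim Y (n + 1) v)"
proof -
  let ?a = "- cdf X (n + 1) v *\<^sub>v x + 0\<^sub>m (cdim X (n + 2) v) (cdim Y n v) *\<^sub>v y" and ?b = "u (n + 1) v *\<^sub>v x + cdf Y n v *\<^sub>v y"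
  have a: "?a = - (cdf X (n + 1) v *\<^sub>v x)" using assms by (intro eq_vecI) simp_all
  have "cdf (cone X Y u) n v *\<^sub>v (x @\<^sub>v y) = ?a @\<^sub>v ?b"
    using assms by (simp add: cone_sel vst_mult_vec hst_mult_vec)
  also have "\<dots> = 0\<^sub>v (cdim X (n + 2) v) @\<^sub>v 0\<^sub>v (cdim Y (n + 1) v) \<longleftrightarrow> ?a = 0\<^sub>v (cdim X (n + 2) v) \<and> ?b = 0\<^sub>v (cdim Y (n + 1) v)"
    by (rule append_vec_eq) (use assms in \<open>auto intro!: carrier_vecI\<close>)
  also have "0\<^sub>v (cdim X (n + 2) v) @\<^sub>v 0\<^sub>v (cdim Y (n + 1) v) = 0\<^sub>v (cdim (cone X Y u) (n + 1) v)"
    by (auto simp: cone_sel)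
  finally show ?thesis using assms by (simp add: cocycles_def a cone_sel(1) uminus_zero_vec_eq[OF carrier_vecI])
qed

lemma cone_coboundary_iff:
  assumes "x \<in> carrier_vec (cdim X (n + 1) v)" "y \<in> carrier_vec (cdim Y n v)"
  shows "x @\<^sub>v y \<in> coboundaries (cone X Y u) n v \<longleftrightarrow>
    (\<exists>w \<in> carrier_vec (cdim X n v). \<exists>z \<in> carrier_vec (cdim Y (n - 1) v).
       x = - (cdf X n v *\<^sub>v w) \<and> y = u n v *\<^sub>v w + cdf Y (n - 1) v *\<^sub>v z)"
proof -
  have d: "cdf (cone X Y u) (n - 1) v *\<^sub>v (w @\<^sub>v z) = - (cdf X n v *\<^sub>v w) @\<^sub>v (u n v *\<^sub>v w + cdf Y (n - 1) v *\<^sub>v z)"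
    if "w \<in> carrier_vec (cdim X n v)" "z \<in> carrier_vec (cdim Y (n - 1) v)" for w z
  proof -
    have "- cdf X n v *\<^sub>v w + 0\<^sub>m (cdim X (n + 1) v) (cdim Y (n - 1) v) *\<^sub>v z = - (cdf X n v *\<^sub>v w)"
      using that by (intro eq_vecI) simp_all
    then show ?thesis using that by (simp add: cone_sel vst_mult_vec hst_mult_vec)
  qed
  have e: "x @\<^sub>v y = - (cdf X n v *\<^sub>v w) @\<^sub>v (u n v *\<^sub>v w + cdf Y (n - 1) v *\<^sub>v z) \<longleftrightarrow>
      x = - (cdf X n v *\<^sub>v w) \<and> y = u n v *\<^sub>v w + cdf Y (n - 1) v *\<^sub>v z"
    if "w \<in> carrier_vec (cdim X n v)" "z \<in> carrier_vec (cdim Y (n - 1) v)" for w z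
    by (rule append_vec_eq[OF assms(1)]) (auto intro!: carrier_vecI)
  show ?thesis
  proof
    assume "x @\<^sub>v y \<in> coboundaries (cone X Y u) n v"
    then obtain t where t: "t \<in> carrier_vec (cdim X n v + cdim Y (n - 1) v)" "x @\<^sub>v y = cdf (cone X Y u) (n - 1) v *\<^sub>v t"
      by (auto simp: coboundaries_def cone_sel(1))
    from t(1) obtain w z where wz: "w \<in> carrier_vec (cdim X n v)" "z \<in> carrier_vec (cdim Y (n - 1) v)" "t = w @\<^sub>v z"
      by (rule append_vecE)
    show "\<exists>w \<in> carrier_vec (cdim X n v). \<exists>z \<in> carrier_vec (cdim Y (n - 1) v).
       x = - (cdf X n v *\<^sub>v w) \<and> y = u n v *\<^sub>v w + cdf Y (n - 1) v *\<^sub>v z"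
      using t(2) wz(1,2) unfolding wz(3) d[OF wz(1,2)] e[OF wz(1,2)] by blast
  next
    assume "\<exists>w \<in> carrier_vec (cdim X n v). \<exists>z \<in> carrier_vec (cdim Y (n - 1) v).
       x = - (cdf X n v *\<^sub>v w) \<and> y = u n v *\<^sub>v w + cdf Y (n - 1) v *\<^sub>v z"
    then obtain w z where wz: "w \<in> carrier_vec (cdim X n v)" "z \<in> carrier_vec (cdim Y (n - 1) v)"
      and "x = - (cdf X n v *\<^sub>v w) \<and> y = u n v *\<^sub>v w + cdf Y (n - 1) v *\<^sub>v z" by blast
    then have "x @\<^sub>v y = cdf (cone X Y u) (n - 1) v *\<^sub>v (w @\<^sub>v z)" by (simp add: d)
    then show "x @\<^sub>v y \<in> coboundaries (cone X Y u) n v"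
      using wz by (simp add: cone_sel(1) coboundaryI)
  qed
qed

end

lemma cmap_comm_vec:
  assumes "is_cpx X" "is_cpx Y" "is_cmap X Y f" "dim_vec x = cdim X n v"
  shows "cdf Y n v *\<^sub>v (f n v *\<^sub>v x) = f (n + 1) v *\<^sub>v (cdf X n v *\<^sub>v x)"
proof -
  note [simp] = cpx_carrier[OF assms(1)] cpx_carrier[OF assms(2)] cmap_carrier[OF assms(3)] assms(4)
  show ?thesis by (simp add: mat_vec_assoc[symmetric] cmap_comm[OF assms(3)])
qed

context
  fixes X Y :: "'k :: field cpx" and u
  assumes X: "is_cpx X" and Y: "is_cpx Y" and u: "is_cmap X Y u"
begin

private lemmas dims [simp] = cpx_carrier[OF X] cpx_carrier[OF Y] cmap_carrier[OF u] cpx_carrier'[OF X] cpx_carrier'[OF Y]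

lemma cone_out_vec:
  assumes "x \<in> carrier_vec (cdim X (n + 1) v)" "y \<in> carrier_vec (cdim Y n v)"
  shows "cone_out X Y n v *\<^sub>v (x @\<^sub>v y) = x"
  using assms by (simp add: cone_out_sel[OF X Y u] hst_mult_vec)

lemma cone_cocycleE:
  assumes "t \<in> cocycles (cone X Y u) n v"
  obtains x y where "x \<in> carrier_vec (cdim X (n + 1) v)" "y \<in> carrier_vec (cdim Y n v)" "t = x @\<^sub>v y"
    "cdf X (n + 1) v *\<^sub>v x = 0\<^sub>v (cdim X (n + 2) v)" "u (n + 1) v *\<^sub>v x + cdf Y n v *\<^sub>v y = 0\<^sub>v (cdim Y (n + 1) v)"
proof -
  have "t \<in> carrier_vec (cdim X (n + 1) v + cdim Y n v)"
    using cocycle_carrier[OF assms] by (simp add: cone_sel[OF X Y u])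
  then obtain x y where xy: "x \<in> carrier_vec (cdim X (n + 1) v)" "y \<in> carrier_vec (cdim Y n v)" "t = x @\<^sub>v y"
    by (rule append_vecE)
  show ?thesis using assms that[OF xy] cone_cocycle_iff[OF X Y u xy(1,2)] xy(3) by simp
qed

lemma vec_add_zero_iff: "dim_vec a = n \<Longrightarrow> dim_vec b = n \<Longrightarrow> a + b = 0\<^sub>v n \<longleftrightarrow> a = - (b :: 'a :: ring vec)"
  by (auto simp: vec_eq_iff eq_neg_iff_add_eq_0)

text \<open>A chase on cohomology classes: once the \<open>X\<close> component is a boundary, the
  corrected \<open>Y\<close> component is a cocycle of \<open>Y\<close> and therefore a
  boundary.\<close>

lemma cone_out_quasi_iso:
  assumes a: "acyclic Y"
  shows "quasi_iso (cone X Y u) (cpx_shift 1 X) (cone_out X Y)"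
proof -
  have "coh_inj (cone X Y u) (cpx_shift 1 X) (cone_out X Y)"
    unfolding coh_inj_def
  proof (intro allI ballI impI)
    fix n v t assume t: "t \<in> cocycles (cone X Y u) n v" and b: "cone_out X Y n v *\<^sub>v t \<in> coboundaries (cpx_shift 1 X) n v"
    from t obtain x y where xy [simp]: "x \<in> carrier_vec (cdim X (n + 1) v)" "y \<in> carrier_vec (cdim Y n v)" "t = x @\<^sub>v y"
      and c: "cdf X (n + 1) v *\<^sub>v x = 0\<^sub>v (cdim X (n + 2) v)" "u (n + 1) v *\<^sub>v x + cdf Y n v *\<^sub>v y = 0\<^sub>v (cdim Y (n + 1) v)"
      by (rule cone_cocycleE)
    have "x \<in> coboundaries X (n + 1) v" using b by (simp add: coboundaries_shift[OF X] cone_out_vec[OF xy(1,2)])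
    then obtain w' where w': "w' \<in> carrier_vec (cdim X n v)" "x = cdf X n v *\<^sub>v w'" by (auto simp: coboundaries_def)
    \<comment> \<open>The sign undoes the minus on the differential of \<open>X\<close> inside the
      cone.\<close>
    define w where "w = - w'"
    have w [simp]: "w \<in> carrier_vec (cdim X n v)" and xw: "x = - (cdf X n v *\<^sub>v w)"
      using w' by (auto simp: w_def mat_vec_distribs)
    have "cdf Y n v *\<^sub>v (y - u n v *\<^sub>v w) = cdf Y n v *\<^sub>v y - cdf Y n v *\<^sub>v (u n v *\<^sub>v w)"
      using carrier_vecD[OF xy(2)] by (simp add: mat_vec_distribs)
    also have "cdf Y n v *\<^sub>v (u n v *\<^sub>v w) = u (n + 1) v *\<^sub>v (cdf X n v *\<^sub>v w)"
      by (rule cmap_comm_vec[OF X Y u]) (rule carrier_vecD[OF w])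
    also have "cdf Y n v *\<^sub>v y - u (n + 1) v *\<^sub>v (cdf X n v *\<^sub>v w) = u (n + 1) v *\<^sub>v x + cdf Y n v *\<^sub>v y"
      unfolding xw by (rule eq_vecI) (simp_all add: mat_vec_distribs del: index_mult_mat_vec)
    finally have yc: "y - u n v *\<^sub>v w \<in> cocycles Y n v"
      using c(2) by (auto simp: cocycles_def intro!: minus_carrier_vec carrier_vecI)
    then obtain z where z: "z \<in> carrier_vec (cdim Y (n - 1) v)" "y - u n v *\<^sub>v w = cdf Y (n - 1) v *\<^sub>v z"
      using a yc unfolding acyclic_def coboundaries_def by blast
    have "y = u n v *\<^sub>v w + (y - u n v *\<^sub>v w)"
      using carrier_vecD[OF xy(2)] by (intro eq_vecI) (simp_all del: index_mult_mat_vec)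
    then have "y = u n v *\<^sub>v w + cdf Y (n - 1) v *\<^sub>v z" by (simp add: z(2))
    with xw z(1) w show "t \<in> coboundaries (cone X Y u) n v"
      unfolding xy(3) cone_coboundary_iff[OF X Y u xy(1,2)] by blast
  qed
  moreover have "coh_surj (cone X Y u) (cpx_shift 1 X) (cone_out X Y)"
    unfolding coh_surj_def
  proof (intro allI ballI)
    fix n v x assume "x \<in> cocycles (cpx_shift 1 X) n v"
    then have x: "x \<in> cocycles X (n + 1) v" by (simp add: cocycles_shift[OF X])
    then have "u (n + 1) v *\<^sub>v x \<in> coboundaries Y (n + 1) v"
      using cmap_cocycle[OF X Y u] a unfolding acyclic_def by blast
    then obtain y where y: "y \<in> carrier_vec (cdim Y n v)" "u (n + 1) v *\<^sub>v x = cdf Y n v *\<^sub>v y"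
      by (auto simp: coboundaries_def)
    note xc = cocycle_carrier[OF x]
    have "x @\<^sub>v (- y) \<in> cocycles (cone X Y u) n v"
      using y cocycleD(2)[OF x]
      by (subst cone_cocycle_iff[OF X Y u xc]) (auto simp: mat_vec_distribs)
    moreover have "x - cone_out X Y n v *\<^sub>v (x @\<^sub>v (- y)) \<in> coboundaries (cpx_shift 1 X) n v"
      using zero_coboundary[OF X, of "n + 1" v] xc y(1)
      by (simp add: cone_out_vec coboundaries_shift[OF X])
    ultimately show "\<exists>t\<in>cocycles (cone X Y u) n v. x - cone_out X Y n v *\<^sub>v t \<in> coboundaries (cpx_shift 1 X) n v" by blast
  qed
  ultimately show ?thesis by (simp add: quasi_iso_iff cone_out_cmap[OF X Y u])
qed

text \<open>For a cocycle of the cone, injectivity on cohomology makes the \<open>X\<close>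
  component a boundary, and surjectivity makes the rest of the \<open>Y\<close> component
  one.\<close>

lemma cone_acyclic:
  assumes q: "quasi_iso X Y u"
  shows "acyclic (cone X Y u)"
  unfolding acyclic_def
proof (intro allI subsetI)
  fix n v t assume t: "t \<in> cocycles (cone X Y u) n v"
  then obtain x y where xy [simp]: "x \<in> carrier_vec (cdim X (n + 1) v)" "y \<in> carrier_vec (cdim Y n v)" "t = x @\<^sub>v y"
    and c: "cdf X (n + 1) v *\<^sub>v x = 0\<^sub>v (cdim X (n + 2) v)" "u (n + 1) v *\<^sub>v x + cdf Y n v *\<^sub>v y = 0\<^sub>v (cdim Y (n + 1) v)"
    by (rule cone_cocycleE)
  have "u (n + 1) v *\<^sub>v x = cdf Y n v *\<^sub>v (- y)"
    using c(2) mat_vec_distribs(5)[of "cdf Y n v" y] carrier_vecD[OF xy(2)] by (simp add: vec_add_zero_iff)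
  then have "u (n + 1) v *\<^sub>v x \<in> coboundaries Y (n + 1) v"
    using coboundaryI[of "- y" Y "n + 1" v] by simp
  moreover have "x \<in> cocycles X (n + 1) v" using c(1) by (simp add: cocycles_def)
  ultimately have "x \<in> coboundaries X (n + 1) v"
    using q coh_injD by (auto simp: quasi_iso_iff)
  then obtain w' where w': "w' \<in> carrier_vec (cdim X n v)" "x = cdf X n v *\<^sub>v w'" by (auto simp: coboundaries_def)
  define w where "w = - w'"
  have w [simp]: "w \<in> carrier_vec (cdim X n v)" and xw: "x = - (cdf X n v *\<^sub>v w)"
    using w' by (auto simp: w_def mat_vec_distribs)
  have "cdf Y n v *\<^sub>v (y - u n v *\<^sub>v w) = cdf Y n v *\<^sub>v y - cdf Y n v *\<^sub>v (u n v *\<^sub>v w)"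
    using carrier_vecD[OF xy(2)] by (simp add: mat_vec_distribs)
  also have "cdf Y n v *\<^sub>v (u n v *\<^sub>v w) = u (n + 1) v *\<^sub>v (cdf X n v *\<^sub>v w)"
    by (rule cmap_comm_vec[OF X Y u]) (rule carrier_vecD[OF w])
  also have "cdf Y n v *\<^sub>v y - u (n + 1) v *\<^sub>v (cdf X n v *\<^sub>v w) = u (n + 1) v *\<^sub>v x + cdf Y n v *\<^sub>v y"
    unfolding xw by (rule eq_vecI) (simp_all add: mat_vec_distribs del: index_mult_mat_vec)
  finally have yc: "y - u n v *\<^sub>v w \<in> cocycles Y n v"
    using c(2) by (auto simp: cocycles_def intro!: minus_carrier_vec carrier_vecI)
  \<comment> \<open>The class of \<open>y\<close> minus \<open>u w\<close> need not vanish, but it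
    is hit by a cocycle \<open>x0\<close>; adding \<open>x0\<close> to \<open>w\<close> leaves the
    \<open>X\<close> component unchanged.\<close>
  have "coh_surj X Y u" using q by (simp add: quasi_iso_iff)
  from coh_surjD[OF this yc]
  obtain x0 where x0: "x0 \<in> cocycles X n v" "(y - u n v *\<^sub>v w) - u n v *\<^sub>v x0 \<in> coboundaries Y n v" by blast
  then obtain z where z: "z \<in> carrier_vec (cdim Y (n - 1) v)" "(y - u n v *\<^sub>v w) - u n v *\<^sub>v x0 = cdf Y (n - 1) v *\<^sub>v z"
    by (auto simp: coboundaries_def)
  note x0c = cocycle_carrier[OF x0(1)]
  have "x = - (cdf X n v *\<^sub>v (w + x0))"
    using x0c xw carrier_vecD[OF w] by (simp add: mat_vec_distribs cocycleD(2)[OF x0(1)])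
  moreover have "y = u n v *\<^sub>v (w + x0) + cdf Y (n - 1) v *\<^sub>v z"
    unfolding z(2)[symmetric] using x0c carrier_vecD[OF xy(2)] carrier_vecD[OF w]
    by (intro eq_vecI) (simp_all add: mat_vec_distribs del: index_mult_mat_vec)
  ultimately show "t \<in> coboundaries (cone X Y u) n v"
    unfolding xy(3) cone_coboundary_iff[OF X Y u xy(1,2)] using z(1) add_carrier_vec[OF w x0c] by blast
qed

end

section \<open>Ore conditions for quasi-isomorphisms\<close>

text \<open>The new source is the cone of \<open>g\<close> shifted by -1. Its projection to
  \<open>V\<close> is a quasi-isomorphism as \<open>N\<close> is acyclic, and \<open>g\<close> after
  it is null-homotopic for any cone.\<close>

lemma kill_into_acyclic:
  assumes V: "is_cpx V" and N: "is_cpx N" and "acyclic N" and g: "is_cmap V N g"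
  obtains V' u where "is_cpx V'" "quasi_iso V' V u" "null_homotopic V' N (cmap_comp g u)"
proof
  let ?V = "cpx_shift (-1) (cone V N g)" and ?u = "cmap_shift (-1) (cone_out V N)"
  have C: "is_cpx (cone V N g)" by (rule is_cpx_cone[OF V N g])
  show "is_cpx ?V" by (rule is_cpx_shift[OF C])
  show "quasi_iso ?V V ?u"
    using quasi_iso_shift[OF C is_cpx_shift[OF V] cone_out_quasi_iso[OF V N g \<open>acyclic N\<close>], of "-1"]
    by (simp add: cpx_shift_shift cpx_shift_0)
  show "null_homotopic ?V N (cmap_comp g ?u)"
    using null_shift[OF C is_cpx_shift[OF N] cone_out_null[OF V N g], of "-1"]
    by (simp add: cpx_shift_shift cpx_shift_0 cmap_shift_comp cmap_shift_shift cmap_shift_0)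
qed

text \<open>The obstruction to lifting \<open>f\<close> through \<open>s\<close> is its image in the
  cone of \<open>s\<close>, an acyclic complex, so a quasi-isomorphism on the source removes
  it.\<close>

lemma ore_square:
  assumes W: "is_cpx W" and X: "is_cpx X" and V: "is_cpx V" and s: "quasi_iso W X s" and f: "is_cmap V X f"
  obtains V' u k where "is_cpx V'" "quasi_iso V' V u" "is_cmap V' W k" "homotopic V' X (cmap_comp f u) (cmap_comp s k)"
proof -
  have sc: "is_cmap W X s" using s by (simp add: quasi_iso_iff)
  let ?C = "cone W X s"
  have C: "is_cpx ?C" by (rule is_cpx_cone[OF W X sc])
  have i: "is_cmap X ?C (cone_in W X)" by (rule cone_in_cmap[OF W X sc])
  obtain V' u where V': "is_cpx V'" and u: "quasi_iso V' V u" and n: "null_homotopic V' ?C (cmap_comp (cmap_comp (cone_in W X) f) u)"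
    using kill_into_acyclic[OF V C cone_acyclic[OF W X sc s] cmap_comp_is_cmap[OF V X C f i]] .
  have uc: "is_cmap V' V u" using u by (simp add: quasi_iso_iff)
  from n have "null_homotopic V' ?C (cmap_comp (cone_in W X) (cmap_comp f u))"
    by (simp add: cmap_comp_assoc[OF uc f i])
  from cone_lift_through[OF W X sc V' cmap_comp_is_cmap[OF V' V X uc f] this]
  show ?thesis using that V' u by blast
qed

text \<open>As \<open>s\<close> after \<open>f\<close> is null-homotopic, the shift of
  \<open>f\<close> factors through the acyclic cone of \<open>s\<close> and can be killed there. The
  shift by 1 appears because \<open>cone_out\<close> ends in the shifted source.\<close>

lemma ore_cancel:
  assumes W: "is_cpx W" and A: "is_cpx A" and V: "is_cpx V" and s: "quasi_iso A V s" and f: "is_cmap W A f"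
    and n: "null_homotopic W V (cmap_comp s f)"
  obtains W' u where "is_cpx W'" "quasi_iso W' W u" "null_homotopic W' A (cmap_comp f u)"
proof -
  have sc: "is_cmap A V s" using s by (simp add: quasi_iso_iff)
  let ?C = "cone A V s" and ?f = "cmap_shift 1 f"
  have C: "is_cpx ?C" by (rule is_cpx_cone[OF A V sc])
  note W1 = is_cpx_shift[OF W, of 1] and A1 = is_cpx_shift[OF A, of 1]
  have "null_homotopic (cpx_shift 1 W) (cpx_shift 1 V) (cmap_comp (cmap_shift 1 s) ?f)"
    using null_shift[OF W V n, of 1] by (simp add: cmap_shift_comp)
  then obtain F where F: "is_cmap (cpx_shift 1 W) ?C F" and oF: "cmap_comp (cone_out A V) F = ?f"
    by (rule cone_lift[OF A V sc W1 is_cmap_shift[OF W A f]])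
  obtain V' u where V': "is_cpx V'" and u: "quasi_iso V' (cpx_shift 1 W) u" and nF: "null_homotopic V' ?C (cmap_comp F u)"
    using kill_into_acyclic[OF W1 C cone_acyclic[OF A V sc s] F] .
  have uc: "is_cmap V' (cpx_shift 1 W) u" using u by (simp add: quasi_iso_iff)
  have "null_homotopic V' (cpx_shift 1 A) (cmap_comp (cone_out A V) (cmap_comp F u))"
    by (rule null_comp_left[OF V' C A1 cone_out_cmap[OF A V sc] nF])
  then have nf: "null_homotopic V' (cpx_shift 1 A) (cmap_comp ?f u)"
    by (simp add: cmap_comp_assoc[OF uc F cone_out_cmap[OF A V sc], symmetric] oF)
  show ?thesis
  proof
    show "is_cpx (cpx_shift (-1) V')" by (rule is_cpx_shift[OF V'])
    show "quasi_iso (cpx_shift (-1) V') W (cmap_shift (-1) u)"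
      using quasi_iso_shift[OF V' W1 u, of "-1"] by (simp add: cpx_shift_shift cpx_shift_0)
    show "null_homotopic (cpx_shift (-1) V') A (cmap_comp f (cmap_shift (-1) u))"
      using null_shift[OF V' A1 nf, of "-1"]
      by (simp add: cpx_shift_shift cpx_shift_0 cmap_shift_comp cmap_shift_shift cmap_shift_0)
  qed
qed

section \<open>Transposing exact sequences\<close>

text \<open>Replaces the choice of complements and dual bases. Induction on columns: the last column
  either lies in the span of the others or can be separated from them by a functional.\<close>

lemma generalized_inverse:
  fixes A :: "'k :: field mat"
  shows "A \<in> carrier_mat r c \<Longrightarrow> \<exists>G \<in> carrier_mat c r. A * (G * A) = A"
proof (induction c arbitrary: A)
  case 0
  then show ?case by (auto intro!: bexI[of _ "0\<^sub>m 0 r"] eq_matI)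
next
  case (Suc c)
  define A' where "A' = leftc c A"
  define b where "b = rightc c A"
  have A: "A = hst A' b" using Suc.prems by (simp add: A'_def b_def hst_left_right)
  have [simp]: "dim_row A' = r" "dim_col A' = c" "dim_row b = r" "dim_col b = 1"
    using Suc.prems by (simp_all add: A'_def b_def)
  obtain G' where G': "G' \<in> carrier_mat c r" "A' * (G' * A') = A'"
    using Suc.IH[of A'] by (metis \<open>dim_row A' = r\<close> \<open>dim_col A' = c\<close> carrier_mat_triv)
  note [simp] = carrier_matD[OF G'(1)]
  \<comment> \<open>By the induction hypothesis \<open>A' * G'\<close> projects onto the column
    space of \<open>A'\<close>, so \<open>R\<close> vanishes exactly when \<open>b\<close> lies in
    that space.\<close>
  define R where "R = b - A' * (G' * b)"
  have [simp]: "dim_row R = r" "dim_col R = 1" by (simp_all add: R_def)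
  show ?case
  proof (cases "R = 0\<^sub>m r 1")
    case True
    have b: "A' * (G' * b) = b"
    proof (rule eq_matI)
      fix i j assume "i < dim_row b" "j < dim_col b"
      then show "(A' * (G' * b)) $$ (i, j) = b $$ (i, j)"
        using arg_cong[OF True, of "\<lambda>M. M $$ (i, j)"] by (simp add: R_def del: index_mult_mat(1))
    qed simp_all
    have "A * (vst G' (0\<^sub>m 1 r) * A) = A"
      by (simp add: A vst_mult mult_hst hst_mult_vst G'(2) b hst_eq_iff)
    then show ?thesis by (intro bexI[of _ "vst G' (0\<^sub>m 1 r)"]) (auto intro: carrier_matI)
  next
    case False
    then obtain i where i: "i < r" "R $$ (i, 0) \<noteq> 0"
      by (auto simp: mat_eq_iff)
    define \<rho>0 where "\<rho>0 = mat 1 r (\<lambda>(_, j). if j = i then inverse (R $$ (i, 0)) else 0)"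
    have [simp]: "dim_row \<rho>0 = 1" "dim_col \<rho>0 = r" by (simp_all add: \<rho>0_def)
    have \<rho>0R: "\<rho>0 * R = 1\<^sub>m 1"
      using i by (intro eq_matI) (auto simp: \<rho>0_def scalar_prod_def sum.delta if_distrib[of "\<lambda>x. x * _"] cong: if_cong)
    \<comment> \<open>\<open>\<rho>0\<close> reads off a nonzero entry of \<open>R\<close>, rescaled
      to 1; composing it with the complementary projection makes it vanish on \<open>A'\<close> and
      keeps the value 1 on \<open>b\<close>.\<close>
    define \<rho> where "\<rho> = \<rho>0 - \<rho>0 * (A' * G')"
    have [simp]: "dim_row \<rho> = 1" "dim_col \<rho> = r" by (simp_all add: \<rho>_def)
    have \<rho>A: "\<rho> * A' = 0\<^sub>m 1 c"
      by (simp add: \<rho>_def mat_distribs mat_mult_assoc G'(2))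
    have \<rho>b: "\<rho> * b = 1\<^sub>m 1"
      using \<rho>0R by (simp add: \<rho>_def R_def mat_distribs mat_mult_assoc)
    define G where "G = vst (G' - G' * (b * \<rho>)) \<rho>"
    have "G * A = hst (vst (G' * A') (0\<^sub>m 1 c)) (vst (0\<^sub>m c 1) (1\<^sub>m 1))"
      by (simp add: G_def A vst_mult mult_hst mat_distribs mat_mult_assoc \<rho>A \<rho>b vst_hst)
    then have "A * (G * A) = A"
      by (simp add: A mult_hst hst_mult_vst G'(2))
    then show ?thesis by (intro bexI[of _ G]) (auto simp: G_def intro: carrier_matI)
  qed
qed

text \<open>The matrix \<open>P\<close> has image the kernel of \<open>B\<close>, so exactness gives
  \<open>P = A * (E * P)\<close>. A vector killed by the transpose of \<open>A\<close> is hence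
  killed by the transpose of \<open>P\<close>, which says that it is its own image under the
  transpose of \<open>G * B\<close>.\<close>

lemma exact_transpose:
  fixes A B :: "'k :: field mat"
  assumes A: "A \<in> carrier_mat n m" and B: "B \<in> carrier_mat p n"
    and ex: "\<And>x. x \<in> carrier_vec n \<Longrightarrow> B *\<^sub>v x = 0\<^sub>v p \<Longrightarrow> \<exists>y \<in> carrier_vec m. x = A *\<^sub>v y"
    and \<xi>: "\<xi> \<in> carrier_vec n" "transpose_mat A *\<^sub>v \<xi> = 0\<^sub>v m"
  shows "\<exists>\<eta> \<in> carrier_vec p. \<xi> = transpose_mat B *\<^sub>v \<eta>"
proof -
  obtain G where G: "G \<in> carrier_mat n p" "B * (G * B) = B" using generalized_inverse[OF B] by blast
  obtain E where E: "E \<in> carrier_mat m n" "A * (E * A) = A" using generalized_inverse[OF A] by blast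
  note [simp] = carrier_matD[OF A] carrier_matD[OF B] carrier_matD[OF G(1)] carrier_matD[OF E(1)]
  define P where "P = 1\<^sub>m n - G * B"
  have [simp]: "dim_row P = n" "dim_col P = n" by (simp_all add: P_def)
  have BP: "B * P = 0\<^sub>m p n" by (simp add: P_def mat_distribs G(2))
  have AEP: "A * (E * P) = P"
  proof (rule mat_col_eqI)
    fix j assume j: "j < dim_col P"
    have "B *\<^sub>v col P j = col (B * P) j" using j by (intro eq_vecI) simp_all
    then have "B *\<^sub>v col P j = 0\<^sub>v p" using j by (simp add: BP)
    then obtain y where y: "y \<in> carrier_vec m" "col P j = A *\<^sub>v y"
      using ex[of "col P j"] col_dim[of P j] by auto
    have "col (A * (E * P)) j = A *\<^sub>v (E *\<^sub>v col P j)"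
      using j by (intro eq_vecI) (auto simp: scalar_prod_def)
    also have "\<dots> = (A * (E * A)) *\<^sub>v y" using y by (simp add: mat_vec_assoc)
    also have "\<dots> = col P j" by (simp add: E(2) y(2))
    finally show "col (A * (E * P)) j = col P j" .
  qed simp_all
  have "transpose_mat P = transpose_mat P * (transpose_mat E * transpose_mat A)"
    using arg_cong[OF AEP, of transpose_mat]
    by (simp add: transpose_mult[of _ n m _ n] transpose_mult[of _ m n _ n] carrier_matI mat_mult_assoc)
  then have "transpose_mat P *\<^sub>v \<xi> = transpose_mat P *\<^sub>v (transpose_mat E *\<^sub>v (transpose_mat A *\<^sub>v \<xi>))"
    using \<xi>(1) by (metis (no_types, lifting) carrier_vecD mat_vec_assoc index_mult_mat(2,3) index_transpose_mat(2,3)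
        carrier_matD[OF A] carrier_matD[OF E(1)] \<open>dim_row P = n\<close> \<open>dim_col P = n\<close>)
  then have P0: "transpose_mat P *\<^sub>v \<xi> = 0\<^sub>v n" by (simp add: \<xi>(2))
  have "transpose_mat P = 1\<^sub>m n - transpose_mat B * transpose_mat G"
    unfolding P_def by (subst transpose_minus[of _ n n]) (auto simp: transpose_mult[of _ n p _ n] G(1) B)
  with P0 have "\<xi> - transpose_mat B *\<^sub>v (transpose_mat G *\<^sub>v \<xi>) = 0\<^sub>v n"
    using \<xi>(1) by (simp add: mat_vec_distribs mat_vec_assoc)
  then have "\<xi> = transpose_mat B *\<^sub>v (transpose_mat G *\<^sub>v \<xi>)"
    using \<xi>(1) by (auto simp: vec_eq_iff simp del: index_mult_mat_vec)
  then show ?thesis by (intro bexI[of _ "transpose_mat G *\<^sub>v \<xi>"]) (auto intro: carrier_vecI)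
qed

section \<open>The transposition duality\<close>

fun opv :: "vertex \<Rightarrow> vertex" where
  "opv V1 = V3" | "opv V2 = V2" | "opv V3 = V1"

fun opa :: "arrow \<Rightarrow> arrow" where
  "opa Alpha1 = Alpha2" | "opa Beta1 = Beta2" | "opa Alpha2 = Alpha1" | "opa Beta2 = Beta1"

lemma op_simps [simp]: "opv (opv v) = v" "opa (opa a) = a" "src (opa a) = opv (tgt a)" "tgt (opa a) = opv (src a)"
  by (cases v; simp) (cases a; simp)+

definition dual_rep :: "'k :: field rep \<Rightarrow> 'k rep" where
  "dual_rep M = \<lparr>rdim = (\<lambda>v. rdim M (opv v)), rmap = (\<lambda>a. transpose_mat (rmap M (opa a)))\<rparr>"

text \<open>No sign is put on the transposed differential, so that dualising twice is an equality
  and not merely an isomorphism.\<close>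

definition dual_cpx :: "'k :: field cpx \<Rightarrow> 'k cpx" where
  "dual_cpx X = \<lparr>cob = (\<lambda>n. dual_rep (cob X (- n))), cdf = (\<lambda>n v. transpose_mat (cdf X (- n - 1) (opv v)))\<rparr>"

definition dual_cmap :: "'k :: field cmap \<Rightarrow> 'k cmap" where
  "dual_cmap f = (\<lambda>n v. transpose_mat (f (- n) (opv v)))"

lemma dual_rep_sel [simp]: "rdim (dual_rep M) v = rdim M (opv v)" "rmap (dual_rep M) a = transpose_mat (rmap M (opa a))"
  by (simp_all add: dual_rep_def)

lemma dual_cpx_sel [simp]: "cob (dual_cpx X) n = dual_rep (cob X (- n))"
  "cdf (dual_cpx X) n = (\<lambda>v. transpose_mat (cdf X (- n - 1) (opv v)))"
  by (simp_all add: dual_cpx_def)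

lemma dual_rep_dual [simp]: "dual_rep (dual_rep M) = M"
  by (simp add: dual_rep_def)

lemma dual_cpx_dual [simp]: "dual_cpx (dual_cpx X) = X"
  by (simp add: dual_cpx_def)

lemma dual_cmap_dual [simp]: "dual_cmap (dual_cmap f) = f"
  by (simp add: dual_cmap_def)

lemma transpose_times: "dim_col A = dim_row B \<Longrightarrow> transpose_mat (A * B) = transpose_mat B * (transpose_mat A :: 'a :: comm_semiring_0 mat)"
  by (rule transpose_mult[of _ "dim_row A" "dim_row B" _ "dim_col B"]) (auto intro: carrier_matI)

lemma transpose_plus: "dim_row A = dim_row B \<Longrightarrow> dim_col A = dim_col B \<Longrightarrow> transpose_mat (A + B) = transpose_mat A + transpose_mat B"
  by (rule eq_matI) auto

lemma is_rep_dual: "is_rep M \<Longrightarrow> is_rep (dual_rep M)"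
proof -
  assume M: "is_rep M"
  have "transpose_mat (rmap M Beta1) * transpose_mat (rmap M Alpha2) = 0\<^sub>m (rdim M V1) (rdim M V3)"
    "transpose_mat (rmap M Alpha1) * transpose_mat (rmap M Beta2) = 0\<^sub>m (rdim M V1) (rdim M V3)"
    using M rep_carrier[OF M] by (simp_all add: transpose_times[symmetric] is_rep_def)
  moreover have "rmap M (opa a) \<in> carrier_mat (rdim M (opv (src a))) (rdim M (opv (tgt a)))" for a
    using rep_carrier(1)[OF M, of "opa a"] by simp
  ultimately show ?thesis by (auto simp: is_rep_def)
qed

lemma is_rep_hom_dual:
  assumes M: "is_rep M" and N: "is_rep N" and f: "is_rep_hom M N f"
  shows "is_rep_hom (dual_rep N) (dual_rep M) (\<lambda>v. transpose_mat (f (opv v)))"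
proof -
  note [simp] = rep_carrier[OF M] rep_carrier[OF N] hom_carrier[OF f]
  have "transpose_mat (f (opv (tgt a))) * transpose_mat (rmap N (opa a)) = transpose_mat (rmap M (opa a)) * transpose_mat (f (opv (src a)))" for a
    using hom_comm[OF f, of "opa a"] by (simp add: transpose_times[symmetric])
  then show ?thesis by (simp add: is_rep_hom_def)
qed

lemma is_cpx_dual: "is_cpx X \<Longrightarrow> is_cpx (dual_cpx X)"
proof -
  assume X: "is_cpx X"
  note [simp] = cpx_carrier[OF X]
  have [simp]: "cdf X (- n - 1) v \<in> carrier_mat (cdim X (- n) v) (cdim X (- n - 1) v)" for n v
    using cpx_carrier[OF X, of "- n - 1" v] by simp
  have "is_rep_hom (dual_rep (cob X (- n))) (dual_rep (cob X (- n - 1))) (\<lambda>v. transpose_mat (cdf X (- n - 1) (opv v)))" for n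
    using is_rep_hom_dual[OF cpx_rep[OF X] cpx_rep[OF X] cpx_hom[OF X, of "- n - 1"]] by simp
  moreover have "transpose_mat (cdf X (- n - 2) v) * transpose_mat (cdf X (- n - 1) v) = 0\<^sub>m (cdim X (- n - 2) v) (cdim X (- n) v)" for n v
  proof -
    have e: "(- n - 1) - 1 = - n - 2" "(- n - 2) + 1 = - n - 1" "- n - 1 + 1 = - n" by simp_all
    show ?thesis
      using cpx_sq'[OF X, of "- n - 1" v, unfolded e] cpx_carrier(2)[OF X, of "- n - 2" v, unfolded e]
      by (simp add: transpose_times[symmetric])
  qed
  moreover have "{n. \<exists>v. cdim X (- n) (opv v) \<noteq> 0} \<subseteq> uminus ` {n. \<exists>v. cdim X n v \<noteq> 0}"
  proof
    fix n assume "n \<in> {n. \<exists>v. cdim X (- n) (opv v) \<noteq> 0}"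
    then show "n \<in> uminus ` {n. \<exists>v. cdim X n v \<noteq> 0}" by (intro image_eqI[of _ _ "- n"]) auto
  qed
  then have "finite {n. \<exists>v. cdim X (- n) (opv v) \<noteq> 0}"
    by (rule finite_subset) (use X in \<open>simp add: is_cpx_def\<close>)
  ultimately show ?thesis
    using is_rep_dual[OF cpx_rep[OF X]] by (simp add: is_cpx_def algebra_simps)
qed

lemma is_cmap_dual:
  assumes "is_cpx X" "is_cpx Y" and f: "is_cmap X Y f"
  shows "is_cmap (dual_cpx Y) (dual_cpx X) (dual_cmap f)"
proof -
  note [simp] = cpx_carrier[OF assms(1)] cpx_carrier[OF assms(2)] cmap_carrier[OF f]
  have "transpose_mat (f (- n - 1) v) * transpose_mat (cdf Y (- n - 1) v) = transpose_mat (cdf X (- n - 1) v) * transpose_mat (f (- n) v)" for n v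
    using cmap_comm[OF f, of "- n - 1" v] by (simp add: transpose_times[symmetric])
  then show ?thesis
    using is_rep_hom_dual[OF cpx_rep[OF assms(1)] cpx_rep[OF assms(2)] cmap_hom[OF f]]
    by (simp add: is_cmap_def dual_cmap_def)
qed

lemma dual_cmap_comp:
  assumes "is_cmap X Y f" "is_cmap Y Z g"
  shows "dual_cmap (cmap_comp g f) = cmap_comp (dual_cmap f) (dual_cmap g)"
  using cmap_carrier[OF assms(1)] cmap_carrier[OF assms(2)]
  by (simp add: dual_cmap_def cmap_comp_def transpose_times)

text \<open>Degrees are reversed and a homotopy lowers them by one, so in degree \<open>n\<close>
  the transpose of the homotopy at \<open>1 - n\<close> is taken.\<close>

lemma null_dual:
  assumes X: "is_cpx X" and Y: "is_cpx Y" and "null_homotopic X Y f"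
  shows "null_homotopic (dual_cpx Y) (dual_cpx X) (dual_cmap f)"
proof -
  obtain h where h: "htpy X Y h f" using assms by (auto simp: null_homotopic_def)
  note [simp] = cpx_carrier[OF X] cpx_carrier'[OF Y] htpy_carrier[OF h] htpy_carrier'[OF h]
  have "is_rep_hom (dual_rep (cob Y (- n))) (dual_rep (cob X (1 - n))) (\<lambda>v. transpose_mat (h (1 - n) (opv v)))" for n
    using is_rep_hom_dual[OF cpx_rep[OF X] cpx_rep[OF Y] htpy_hom[OF h, of "1 - n"]] by simp
  moreover have "transpose_mat (f (- n) v) = transpose_mat (cdf X (- n) v) * transpose_mat (h (1 - n) v) + transpose_mat (h (- n) v) * transpose_mat (cdf Y (- n - 1) v)" for n v
  proof -
    have [simp]: "dim_row (h (1 - n) v) = cdim Y (- n) v" "dim_col (h (1 - n) v) = cdim X (1 - n) v"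
      using htpy_carrier[OF h, of "1 - n" v] by simp_all
    have [simp]: "dim_row (cdf X (- n) v) = cdim X (1 - n) v" using cpx_carrier[OF X, of "- n" v] by simp
    have "f (- n) v = cdf Y (- n - 1) v * h (- n) v + h (1 - n) v * cdf X (- n) v"
      using htpy_eq[OF h, of "- n" v] by simp
    then show ?thesis
      by (simp add: transpose_plus transpose_times comm_add_mat[of _ "cdim X (- n) v" "cdim Y (- n) v"] carrier_matI)
  qed
  ultimately have "htpy (dual_cpx Y) (dual_cpx X) (\<lambda>n v. transpose_mat (h (1 - n) (opv v))) (dual_cmap f)"
    by (simp add: htpy_def dual_cmap_def)
  then show ?thesis by (auto simp: null_homotopic_def)
qed

text \<open>Cohomology of the dual is never identified. The cone of \<open>f\<close> is exact, its
  transpose is exact by linear algebra, and both halves of the claim are read off the transposed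
  cone.\<close>

lemma quasi_iso_dual:
  assumes X: "is_cpx X" and Y: "is_cpx Y" and q: "quasi_iso X Y f"
  shows "quasi_iso (dual_cpx Y) (dual_cpx X) (dual_cmap f)"
proof -
  have f: "is_cmap X Y f" using q by (simp add: quasi_iso_iff)
  let ?C = "cone X Y f"
  have C: "is_cpx ?C" by (rule is_cpx_cone[OF X Y f])
  note [simp] = cpx_carrier[OF X] cpx_carrier[OF Y] cmap_carrier[OF f] cpx_carrier'[OF X] cpx_carrier'[OF Y]
  have DT: "transpose_mat (cdf ?C m v) *\<^sub>v (x @\<^sub>v y) =
    (transpose_mat (f (m + 1) v) *\<^sub>v y - transpose_mat (cdf X (m + 1) v) *\<^sub>v x) @\<^sub>v (transpose_mat (cdf Y m v) *\<^sub>v y)"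
    if xy: "x \<in> carrier_vec (cdim X (m + 2) v)" "y \<in> carrier_vec (cdim Y (m + 1) v)" for m v x y
  proof -
    note [simp] = carrier_vecD[OF xy(1)] carrier_vecD[OF xy(2)]
    have "transpose_mat (cdf ?C m v) *\<^sub>v (x @\<^sub>v y) =
      vst (- transpose_mat (cdf X (m + 1) v)) (0\<^sub>m (cdim Y m v) (cdim X (m + 2) v)) *\<^sub>v x
      + vst (transpose_mat (f (m + 1) v)) (transpose_mat (cdf Y m v)) *\<^sub>v y"
      by (simp add: cone_sel[OF X Y f] transpose_vst transpose_hst transpose_uminus hst_mult_vec)
    also have "\<dots> = (- transpose_mat (cdf X (m + 1) v) *\<^sub>v x @\<^sub>v 0\<^sub>v (cdim Y m v))
      + (transpose_mat (f (m + 1) v) *\<^sub>v y @\<^sub>v transpose_mat (cdf Y m v) *\<^sub>v y)"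
      by (simp add: vst_mult_vec)
    also have "\<dots> = (- transpose_mat (cdf X (m + 1) v) *\<^sub>v x + transpose_mat (f (m + 1) v) *\<^sub>v y) @\<^sub>v (transpose_mat (cdf Y m v) *\<^sub>v y)"
      by (subst append_vec_add[of _ "cdim X (m + 1) v" _ _ "cdim Y m v"]) (auto intro: carrier_vecI)
    also have "- transpose_mat (cdf X (m + 1) v) *\<^sub>v x + transpose_mat (f (m + 1) v) *\<^sub>v y =
      transpose_mat (f (m + 1) v) *\<^sub>v y - transpose_mat (cdf X (m + 1) v) *\<^sub>v x"
      by (intro eq_vecI) (simp_all del: index_mult_mat_vec)
    finally show ?thesis .
  qed
  \<comment> \<open>Exactness of the transposed cone, spelled out on the two blocks.\<close>
  have ex: "\<exists>x' \<in> carrier_vec (cdim X (m + 2) v). \<exists>y' \<in> carrier_vec (cdim Y (m + 1) v).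
      x = transpose_mat (f (m + 1) v) *\<^sub>v y' - transpose_mat (cdf X (m + 1) v) *\<^sub>v x' \<and> y = transpose_mat (cdf Y m v) *\<^sub>v y'"
    if xy: "x \<in> carrier_vec (cdim X (m + 1) v)" "y \<in> carrier_vec (cdim Y m v)"
      "transpose_mat (f m v) *\<^sub>v y = transpose_mat (cdf X m v) *\<^sub>v x" "transpose_mat (cdf Y (m - 1) v) *\<^sub>v y = 0\<^sub>v (cdim Y (m - 1) v)" for m v x y
  proof -
    have A: "cdf ?C (m - 1) v \<in> carrier_mat (cdim ?C m v) (cdim ?C (m - 1) v)" by (rule cpx_carrier'(1)[OF C])
    have B: "cdf ?C m v \<in> carrier_mat (cdim ?C (m + 1) v) (cdim ?C m v)" by (rule cpx_carrier(1)[OF C])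
    have e: "\<exists>t' \<in> carrier_vec (cdim ?C (m - 1) v). t = cdf ?C (m - 1) v *\<^sub>v t'"
      if "t \<in> carrier_vec (cdim ?C m v)" "cdf ?C m v *\<^sub>v t = 0\<^sub>v (cdim ?C (m + 1) v)" for t
      using cone_acyclic[OF X Y f q] that unfolding acyclic_def cocycles_def coboundaries_def by blast
    have "transpose_mat (cdf ?C (m - 1) v) *\<^sub>v (x @\<^sub>v y) = 0\<^sub>v (cdim ?C (m - 1) v)"
      using DT[of x "m - 1" v y] xy by (simp add: cone_sel(1)[OF X Y f]) (auto intro!: eq_vecI)
    moreover have "x @\<^sub>v y \<in> carrier_vec (cdim ?C m v)" using xy by (simp add: cone_sel(1)[OF X Y f])
    ultimately obtain t where t: "t \<in> carrier_vec (cdim ?C (m + 1) v)" "x @\<^sub>v y = transpose_mat (cdf ?C m v) *\<^sub>v t"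
      using exact_transpose[OF A B e] by blast
    from t(1) have "t \<in> carrier_vec (cdim X (m + 2) v + cdim Y (m + 1) v)" by (simp add: cone_sel(1)[OF X Y f])
    then obtain x' y' where x'y': "x' \<in> carrier_vec (cdim X (m + 2) v)" "y' \<in> carrier_vec (cdim Y (m + 1) v)" "t = x' @\<^sub>v y'"
      by (rule append_vecE)
    have "x = transpose_mat (f (m + 1) v) *\<^sub>v y' - transpose_mat (cdf X (m + 1) v) *\<^sub>v x' \<and> y = transpose_mat (cdf Y m v) *\<^sub>v y'"
      using t(2) unfolding x'y'(3) DT[OF x'y'(1,2)]
      by (subst (asm) append_vec_eq[OF xy(1)]) (auto intro!: carrier_vecI)
    with x'y' show ?thesis by blast
  qed
  have "coh_inj (dual_cpx Y) (dual_cpx X) (dual_cmap f)"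
    unfolding coh_inj_def
  proof (intro allI ballI impI)
    fix n v y assume y: "y \<in> cocycles (dual_cpx Y) n v" and b: "dual_cmap f n v *\<^sub>v y \<in> coboundaries (dual_cpx X) n v"
    let ?m = "- n" and ?w = "opv v"
    have yc: "y \<in> carrier_vec (cdim Y ?m ?w)" "transpose_mat (cdf Y (?m - 1) ?w) *\<^sub>v y = 0\<^sub>v (cdim Y (?m - 1) ?w)"
      using y by (auto simp: cocycles_def)
    obtain x where x: "x \<in> carrier_vec (cdim X (?m + 1) ?w)" "transpose_mat (f ?m ?w) *\<^sub>v y = transpose_mat (cdf X ?m ?w) *\<^sub>v x"
      using b by (auto simp: coboundaries_def dual_cmap_def)
    obtain y' where "y' \<in> carrier_vec (cdim Y (?m + 1) ?w)" "y = transpose_mat (cdf Y ?m ?w) *\<^sub>v y'"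
      using ex[OF x(1) yc(1) x(2) yc(2)] by blast
    then show "y \<in> coboundaries (dual_cpx Y) n v" by (simp add: coboundaries_def)
  qed
  moreover have "coh_surj (dual_cpx Y) (dual_cpx X) (dual_cmap f)"
    unfolding coh_surj_def
  proof (intro allI ballI)
    fix n v x assume x: "x \<in> cocycles (dual_cpx X) n v"
    let ?m = "- n" and ?w = "opv v"
    have xc: "x \<in> carrier_vec (cdim X ?m ?w)" "transpose_mat (cdf X (?m - 1) ?w) *\<^sub>v x = 0\<^sub>v (cdim X (?m - 1) ?w)"
      using x by (auto simp: cocycles_def)
    \<comment> \<open>Surjectivity is exactness one place further, for a pair whose \<open>Y\<close>
      component is 0.\<close>
    have "\<exists>x' \<in> carrier_vec (cdim X (?m + 1) ?w). \<exists>y' \<in> carrier_vec (cdim Y ?m ?w).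
      x = transpose_mat (f ?m ?w) *\<^sub>v y' - transpose_mat (cdf X ?m ?w) *\<^sub>v x' \<and> 0\<^sub>v (cdim Y (?m - 1) ?w) = transpose_mat (cdf Y (?m - 1) ?w) *\<^sub>v y'"
      using ex[of x "?m - 1" ?w "0\<^sub>v (cdim Y (?m - 1) ?w)"] xc cpx_carrier'[OF Y, of "?m - 1" ?w] by simp
    then obtain x' y' where x': "x' \<in> carrier_vec (cdim X (?m + 1) ?w)" and y': "y' \<in> carrier_vec (cdim Y ?m ?w)"
      and e: "x = transpose_mat (f ?m ?w) *\<^sub>v y' - transpose_mat (cdf X ?m ?w) *\<^sub>v x'"
      and y0: "0\<^sub>v (cdim Y (?m - 1) ?w) = transpose_mat (cdf Y (?m - 1) ?w) *\<^sub>v y'" by blast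
    have "y' \<in> cocycles (dual_cpx Y) n v" using y' y0 by (simp add: cocycles_def)
    moreover have "x - dual_cmap f n v *\<^sub>v y' \<in> coboundaries (dual_cpx X) n v"
    proof -
      have "x - transpose_mat (f ?m ?w) *\<^sub>v y' = transpose_mat (cdf X ?m ?w) *\<^sub>v (- x')"
        using mat_vec_distribs(5)[of "transpose_mat (cdf X ?m ?w)" x'] carrier_vecD[OF x'] cpx_carrier[OF X, of ?m ?w]
        unfolding e by (auto intro!: eq_vecI simp del: index_mult_mat_vec)
      then show ?thesis using x' by (auto simp: coboundaries_def dual_cmap_def)
    qed
    ultimately show "\<exists>y\<in>cocycles (dual_cpx Y) n v. x - dual_cmap f n v *\<^sub>v y \<in> coboundaries (dual_cpx X) n v" by blast
  qed
  ultimately show ?thesis by (simp add: quasi_iso_iff is_cmap_dual[OF X Y f])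
qed

lemma dual_shift:
  "is_cpx X \<Longrightarrow> dual_cpx (cpx_shift 2 X) = cpx_shift (-2) (dual_cpx X)"
  by (simp add: dual_cpx_def cpx_shift_def algebra_simps)

section \<open>Vanishing of morphism spaces\<close>

text \<open>Triviality of Hom(X, Y) in the derived category, stated on roofs so that no quotient is
  formed; \<open>Db_mor_trivial_iff\<close> makes the link.\<close>

definition hom_vanishes :: "'k :: field cpx \<Rightarrow> 'k cpx \<Rightarrow> bool" where
  "hom_vanishes X Y \<longleftrightarrow> (\<forall>W s f. is_cpx W \<longrightarrow> quasi_iso W X s \<longrightarrow> is_cmap W Y f \<longrightarrow>
     (\<exists>V u. is_cpx V \<and> quasi_iso V W u \<and> null_homotopic V Y (cmap_comp f u)))"

lemma quasi_iso_cmap: "quasi_iso X Y f \<Longrightarrow> is_cmap X Y f"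
  by (simp add: quasi_iso_iff)

lemma hom_vanishesE:
  assumes "hom_vanishes X Y" "is_cpx W" "quasi_iso W X s" "is_cmap W Y f"
  obtains V u where "is_cpx V" "quasi_iso V W u" "is_cmap V W u" "null_homotopic V Y (cmap_comp f u)"
  using assms quasi_iso_cmap unfolding hom_vanishes_def by blast

text \<open>Maps into \<open>N\<close> are killed on the cone. For maps out of \<open>N\<close> the
  apex of a roof is itself acyclic, so its identity can be killed.\<close>

lemma hom_vanishes_acyclic:
  assumes N: "is_cpx N" "acyclic N" and A: "is_cpx A"
  shows "hom_vanishes A N" "hom_vanishes N A"
proof -
  show "hom_vanishes A N" unfolding hom_vanishes_def using kill_into_acyclic[OF _ N] by metis
  show "hom_vanishes N A" unfolding hom_vanishes_def
  proof (intro allI impI)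
    fix W s f assume W: "is_cpx W" and s: "quasi_iso W N s" and f: "is_cmap W A f"
    have "acyclic W" using quasi_iso_acyclic[OF W N(1) s] N(2) by simp
    from kill_into_acyclic[OF W W this cmap_id_is_cmap[OF W]]
    obtain V u where V: "is_cpx V" and u: "quasi_iso V W u" and "null_homotopic V W (cmap_comp (cmap_id W) u)" .
    then have "null_homotopic V W u" using quasi_iso_cmap[OF u] by (simp add: cmap_comp_id)
    then have "null_homotopic V A (cmap_comp f u)" by (rule null_comp_left[OF V W A f])
    with V u show "\<exists>V u. is_cpx V \<and> quasi_iso V W u \<and> null_homotopic V A (cmap_comp f u)" by blast
  qed
qed

lemma null_quasi_iso_acyclic:
  assumes X: "is_cpx X" and Y: "is_cpx Y" and q: "quasi_iso X Y f" and n: "null_homotopic X Y f"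
  shows "acyclic Y"
  unfolding acyclic_def
proof (intro allI subsetI)
  fix n v y assume y: "y \<in> cocycles Y n v"
  have "coh_surj X Y f" using q by (simp add: quasi_iso_iff)
  from coh_surjD[OF this y] obtain x where x: "x \<in> cocycles X n v" "y - f n v *\<^sub>v x \<in> coboundaries Y n v" by blast
  show "y \<in> coboundaries Y n v"
    by (rule coboundary_cancel[OF Y x(2) null_coboundary[OF X Y \<open>null_homotopic X Y f\<close> x(1)] cocycleD(1)[OF y]])
qed

text \<open>Used in contrapositive form: an object with cohomology has a nonzero identity, the
  source of every nonvanishing statement about phases.\<close>

lemma hom_vanishes_self:
  assumes X: "is_cpx X" and "hom_vanishes X X" shows "acyclic X"
proof -
  obtain V u where V: "is_cpx V" and u: "quasi_iso V X u" and n: "null_homotopic V X (cmap_comp (cmap_id X) u)"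
    using hom_vanishesE[OF assms(2) X quasi_iso_id[OF X] cmap_id_is_cmap[OF X]] by blast
  then have "null_homotopic V X u" using quasi_iso_cmap[OF u] by (simp add: cmap_comp_id)
  then show ?thesis by (rule null_quasi_iso_acyclic[OF V X u])
qed

text \<open>An Ore square lifts a numerator from \<open>X\<close> back to \<open>W\<close>;
  conversely a map that dies after composition with \<open>s\<close> dies on a finer apex by
  cancellation.\<close>

lemma hom_vanishes_quasi_iso_right:
  assumes A: "is_cpx A" and W: "is_cpx W" and X: "is_cpx X" and s: "quasi_iso W X s"
  shows "hom_vanishes A W \<longleftrightarrow> hom_vanishes A X"
proof
  note sc = quasi_iso_cmap[OF s]
  assume z: "hom_vanishes A W"
  show "hom_vanishes A X" unfolding hom_vanishes_def
  proof (intro allI impI)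
    fix V t f assume V: "is_cpx V" and t: "quasi_iso V A t" and f: "is_cmap V X f"
    from ore_square[OF W X V s f] obtain V' u k where V': "is_cpx V'" and u: "quasi_iso V' V u" and k: "is_cmap V' W k"
      and h: "homotopic V' X (cmap_comp f u) (cmap_comp s k)" .
    note uc = quasi_iso_cmap[OF u] and tc = quasi_iso_cmap[OF t]
    obtain V'' u' where V'': "is_cpx V''" and u': "quasi_iso V'' V' u'" "is_cmap V'' V' u'" and n: "null_homotopic V'' W (cmap_comp k u')"
      using hom_vanishesE[OF z V' quasi_iso_comp[OF V' V A uc tc u t] k] .
    have fu: "is_cmap V' X (cmap_comp f u)" and sk: "is_cmap V' X (cmap_comp s k)"
      by (rule cmap_comp_is_cmap[OF V' V X uc f], rule cmap_comp_is_cmap[OF V' W X k sc])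
    have "null_homotopic V'' X (cmap_comp s (cmap_comp k u'))" by (rule null_comp_left[OF V'' W X sc n])
    then have "null_homotopic V'' X (cmap_comp (cmap_comp s k) u')" by (simp add: cmap_comp_assoc[OF u'(2) k sc])
    with homotopic_comp_right[OF V'' V' X fu sk u'(2) h]
    have "null_homotopic V'' X (cmap_comp (cmap_comp f u) u')"
      by (rule homotopic_null[OF V'' X cmap_comp_is_cmap[OF V'' V' X u'(2) fu] cmap_comp_is_cmap[OF V'' V' X u'(2) sk]])
    then have "null_homotopic V'' X (cmap_comp f (cmap_comp u u'))" by (simp add: cmap_comp_assoc[OF u'(2) uc f])
    with V'' quasi_iso_comp[OF V'' V' V u'(2) uc u'(1) u]
    show "\<exists>V' u. is_cpx V' \<and> quasi_iso V' V u \<and> null_homotopic V' X (cmap_comp f u)" by blast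
  qed
next
  note sc = quasi_iso_cmap[OF s]
  assume z: "hom_vanishes A X"
  show "hom_vanishes A W" unfolding hom_vanishes_def
  proof (intro allI impI)
    fix V t f assume V: "is_cpx V" and t: "quasi_iso V A t" and f: "is_cmap V W f"
    obtain V' u where V': "is_cpx V'" and u: "quasi_iso V' V u" "is_cmap V' V u" and n: "null_homotopic V' X (cmap_comp (cmap_comp s f) u)"
      using hom_vanishesE[OF z V t cmap_comp_is_cmap[OF V W X f sc]] .
    then have "null_homotopic V' X (cmap_comp s (cmap_comp f u))" by (simp add: cmap_comp_assoc[OF u(2) f sc])
    from ore_cancel[OF V' W X s cmap_comp_is_cmap[OF V' V W u(2) f] this]
    obtain V'' u' where V'': "is_cpx V''" and u': "quasi_iso V'' V' u'" and "null_homotopic V'' W (cmap_comp (cmap_comp f u) u')" .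
    moreover note u'c = quasi_iso_cmap[OF u']
    ultimately have "null_homotopic V'' W (cmap_comp f (cmap_comp u u'))" by (simp add: cmap_comp_assoc[OF u'c u(2) f])
    with V'' quasi_iso_comp[OF V'' V' V u'c u(2) u' u(1)]
    show "\<exists>V' u. is_cpx V' \<and> quasi_iso V' V u \<and> null_homotopic V' W (cmap_comp f u)" by blast
  qed
qed

text \<open>Roofs over \<open>W\<close> are roofs over \<open>X\<close> by composition. In the other
  direction an Ore square makes the apex map to \<open>W\<close>, and two-out-of-three turns that
  map into a quasi-isomorphism.\<close>

lemma hom_vanishes_quasi_iso_left:
  assumes A: "is_cpx A" and W: "is_cpx W" and X: "is_cpx X" and s: "quasi_iso W X s"
  shows "hom_vanishes W A \<longleftrightarrow> hom_vanishes X A"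
proof
  note sc = quasi_iso_cmap[OF s]
  assume z: "hom_vanishes X A"
  show "hom_vanishes W A" unfolding hom_vanishes_def
  proof (intro allI impI)
    fix V t f assume V: "is_cpx V" and t: "quasi_iso V W t" and f: "is_cmap V A f"
    show "\<exists>V' u. is_cpx V' \<and> quasi_iso V' V u \<and> null_homotopic V' A (cmap_comp f u)"
      using hom_vanishesE[OF z V quasi_iso_comp[OF V W X quasi_iso_cmap[OF t] sc t s] f] by blast
  qed
next
  note sc = quasi_iso_cmap[OF s]
  assume z: "hom_vanishes W A"
  show "hom_vanishes X A" unfolding hom_vanishes_def
  proof (intro allI impI)
    fix V t f assume V: "is_cpx V" and t: "quasi_iso V X t" and f: "is_cmap V A f"
    note tc = quasi_iso_cmap[OF t]
    from ore_square[OF W X V s tc] obtain V' u k where V': "is_cpx V'" and u: "quasi_iso V' V u" and k: "is_cmap V' W k"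
      and h: "homotopic V' X (cmap_comp t u) (cmap_comp s k)" .
    note uc = quasi_iso_cmap[OF u]
    have "quasi_iso V' X (cmap_comp s k)"
      by (rule quasi_iso_homotopic[OF V' X cmap_comp_is_cmap[OF V' V X uc tc] cmap_comp_is_cmap[OF V' W X k sc] h
            quasi_iso_comp[OF V' V X uc tc u t]])
    then have "quasi_iso V' W k" by (rule quasi_iso_first[OF V' W X k sc s])
    from hom_vanishesE[OF z V' this cmap_comp_is_cmap[OF V' V A uc f]]
    obtain V'' u' where V'': "is_cpx V''" and u': "quasi_iso V'' V' u'" "is_cmap V'' V' u'"
      and "null_homotopic V'' A (cmap_comp (cmap_comp f u) u')" .
    then have "null_homotopic V'' A (cmap_comp f (cmap_comp u u'))" by (simp add: cmap_comp_assoc[OF u'(2) uc f])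
    with V'' quasi_iso_comp[OF V'' V' V u'(2) uc u'(1) u]
    show "\<exists>V' u. is_cpx V' \<and> quasi_iso V' V u \<and> null_homotopic V' A (cmap_comp f u)" by blast
  qed
qed

lemma hom_vanishes_shift_aux:
  assumes X: "is_cpx X" and Y: "is_cpx Y" and z: "hom_vanishes X Y"
  shows "hom_vanishes (cpx_shift i X) (cpx_shift i Y)"
  unfolding hom_vanishes_def
proof (intro allI impI)
  fix W s f assume W: "is_cpx W" and s: "quasi_iso W (cpx_shift i X) s" and f: "is_cmap W (cpx_shift i Y) f"
  let ?W = "cpx_shift (- i) W"
  have W': "is_cpx ?W" by (rule is_cpx_shift[OF W])
  have s': "quasi_iso ?W X (cmap_shift (- i) s)"
    using quasi_iso_shift[OF W is_cpx_shift[OF X] s, of "- i"] by (simp add: cpx_shift_shift cpx_shift_0)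
  have f': "is_cmap ?W Y (cmap_shift (- i) f)"
    using is_cmap_shift[OF W is_cpx_shift[OF Y] f, of "- i"] by (simp add: cpx_shift_shift cpx_shift_0)
  obtain V u where V: "is_cpx V" and u: "quasi_iso V ?W u" and n: "null_homotopic V Y (cmap_comp (cmap_shift (- i) f) u)"
    using hom_vanishesE[OF z W' s' f'] by blast
  have "quasi_iso (cpx_shift i V) W (cmap_shift i u)"
    using quasi_iso_shift[OF V W' u, of i] by (simp add: cpx_shift_shift cpx_shift_0)
  moreover have "null_homotopic (cpx_shift i V) (cpx_shift i Y) (cmap_comp f (cmap_shift i u))"
    using null_shift[OF V Y n, of i] by (simp add: cmap_shift_comp cmap_shift_shift cmap_shift_0)
  ultimately show "\<exists>V u. is_cpx V \<and> quasi_iso V W u \<and> null_homotopic V (cpx_shift i Y) (cmap_comp f u)"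
    using is_cpx_shift[OF V] by blast
qed

lemma hom_vanishes_shift:
  assumes X: "is_cpx X" and Y: "is_cpx Y"
  shows "hom_vanishes (cpx_shift i X) (cpx_shift i Y) \<longleftrightarrow> hom_vanishes X Y"
  using hom_vanishes_shift_aux[OF X Y, of i]
    hom_vanishes_shift_aux[OF is_cpx_shift[OF X] is_cpx_shift[OF Y], of i i "- i"]
  by (auto simp: cpx_shift_shift cpx_shift_0)

text \<open>The same condition phrased with left fractions; the transposition duality exchanges the two,
  and the Ore conditions identify them.\<close>

definition cohom_vanishes :: "'k :: field cpx \<Rightarrow> 'k cpx \<Rightarrow> bool" where
  "cohom_vanishes X Y \<longleftrightarrow> (\<forall>V t g. is_cpx V \<longrightarrow> quasi_iso Y V t \<longrightarrow> is_cmap X V g \<longrightarrow>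
     (\<exists>V' t'. is_cpx V' \<and> quasi_iso V V' t' \<and> null_homotopic X V' (cmap_comp t' g)))"

lemma cohom_vanishes_dual:
  assumes X: "is_cpx X" and Y: "is_cpx Y" and z: "cohom_vanishes X Y"
  shows "hom_vanishes (dual_cpx Y) (dual_cpx X)"
  unfolding hom_vanishes_def
proof (intro allI impI)
  fix W s f assume W: "is_cpx W" and s: "quasi_iso W (dual_cpx Y) s" and f: "is_cmap W (dual_cpx X) f"
  have s': "quasi_iso Y (dual_cpx W) (dual_cmap s)" using quasi_iso_dual[OF W is_cpx_dual[OF Y] s] by simp
  have f': "is_cmap X (dual_cpx W) (dual_cmap f)" using is_cmap_dual[OF W is_cpx_dual[OF X] f] by simp
  obtain V' t' where V': "is_cpx V'" and t': "quasi_iso (dual_cpx W) V' t'" and n: "null_homotopic X V' (cmap_comp t' (dual_cmap f))"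
    using z s' f' is_cpx_dual[OF W] unfolding cohom_vanishes_def by blast
  have "quasi_iso (dual_cpx V') W (dual_cmap t')" using quasi_iso_dual[OF is_cpx_dual[OF W] V' t'] by simp
  moreover have "null_homotopic (dual_cpx V') (dual_cpx X) (cmap_comp f (dual_cmap t'))"
    using null_dual[OF X V' n] by (simp add: dual_cmap_comp[OF f' quasi_iso_cmap[OF t']])
  ultimately show "\<exists>V u. is_cpx V \<and> quasi_iso V W u \<and> null_homotopic V (dual_cpx X) (cmap_comp f u)"
    using is_cpx_dual[OF V'] by blast
qed

text \<open>Obtained from \<open>ore_cancel\<close> by transposition, since quasi-isomorphisms and
  homotopies survive it.\<close>

lemma ore_cancel_dual:
  assumes W: "is_cpx W" and X: "is_cpx X" and V: "is_cpx V" and s: "quasi_iso W X s" and g: "is_cmap X V g"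
    and n: "null_homotopic W V (cmap_comp g s)"
  obtains V' t where "is_cpx V'" "quasi_iso V V' t" "null_homotopic X V' (cmap_comp t g)"
proof -
  note sc = quasi_iso_cmap[OF s] and gd = is_cmap_dual[OF X V g]
  have "null_homotopic (dual_cpx V) (dual_cpx W) (cmap_comp (dual_cmap s) (dual_cmap g))"
    using null_dual[OF W V n] by (simp add: dual_cmap_comp[OF sc g])
  from ore_cancel[OF is_cpx_dual[OF V] is_cpx_dual[OF X] is_cpx_dual[OF W] quasi_iso_dual[OF W X s] gd this]
  obtain V' u where V': "is_cpx V'" and u: "quasi_iso V' (dual_cpx V) u"
    and nn: "null_homotopic V' (dual_cpx X) (cmap_comp (dual_cmap g) u)" .
  show ?thesis
  proof
    show "is_cpx (dual_cpx V')" by (rule is_cpx_dual[OF V'])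
    show "quasi_iso V (dual_cpx V') (dual_cmap u)" using quasi_iso_dual[OF V' is_cpx_dual[OF V] u] by simp
    show "null_homotopic X (dual_cpx V') (cmap_comp (dual_cmap u) g)"
      using null_dual[OF V' is_cpx_dual[OF X] nn] by (simp add: dual_cmap_comp[OF quasi_iso_cmap[OF u] gd])
  qed
qed

text \<open>An Ore square turns the left fraction into a right one, whose numerator can be killed on
  the source; cancellation then moves the killing quasi-isomorphism over to the target.\<close>

lemma hom_vanishes_imp_cohom_vanishes:
  assumes X: "is_cpx X" and Y: "is_cpx Y" and z: "hom_vanishes X Y"
  shows "cohom_vanishes X Y"
  unfolding cohom_vanishes_def
proof (intro allI impI)
  fix V t g assume V: "is_cpx V" and t: "quasi_iso Y V t" and g: "is_cmap X V g"
  note tc = quasi_iso_cmap[OF t]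
  from ore_square[OF Y V X t g] obtain W u k where W: "is_cpx W" and u: "quasi_iso W X u" and k: "is_cmap W Y k"
    and h: "homotopic W V (cmap_comp g u) (cmap_comp t k)" .
  note uc = quasi_iso_cmap[OF u]
  obtain W' u' where W': "is_cpx W'" and u': "quasi_iso W' W u'" "is_cmap W' W u'" and n: "null_homotopic W' Y (cmap_comp k u')"
    using hom_vanishesE[OF z W u k] .
  have gu: "is_cmap W V (cmap_comp g u)" and tk: "is_cmap W V (cmap_comp t k)"
    by (rule cmap_comp_is_cmap[OF W X V uc g], rule cmap_comp_is_cmap[OF W Y V k tc])
  have "null_homotopic W' V (cmap_comp t (cmap_comp k u'))" by (rule null_comp_left[OF W' Y V tc n])
  then have "null_homotopic W' V (cmap_comp (cmap_comp t k) u')" by (simp add: cmap_comp_assoc[OF u'(2) k tc])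
  with homotopic_comp_right[OF W' W V gu tk u'(2) h]
  have "null_homotopic W' V (cmap_comp (cmap_comp g u) u')"
    by (rule homotopic_null[OF W' V cmap_comp_is_cmap[OF W' W V u'(2) gu] cmap_comp_is_cmap[OF W' W V u'(2) tk]])
  then have "null_homotopic W' V (cmap_comp g (cmap_comp u u'))" by (simp add: cmap_comp_assoc[OF u'(2) uc g])
  from ore_cancel_dual[OF W' X V quasi_iso_comp[OF W' W X u'(2) uc u'(1) u] g this]
  show "\<exists>V' t'. is_cpx V' \<and> quasi_iso V V' t' \<and> null_homotopic X V' (cmap_comp t' g)" by metis
qed

lemma hom_vanishes_dual:
  assumes X: "is_cpx X" and Y: "is_cpx Y"
  shows "hom_vanishes (dual_cpx Y) (dual_cpx X) \<longleftrightarrow> hom_vanishes X Y"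
proof -
  have "hom_vanishes (dual_cpx Y) (dual_cpx X)" if "hom_vanishes X Y" "is_cpx X" "is_cpx Y" for X Y :: "'a cpx"
    using cohom_vanishes_dual[OF that(2,3) hom_vanishes_imp_cohom_vanishes[OF that(2,3,1)]] .
  from this[of X Y] this[of "dual_cpx Y" "dual_cpx X"] show ?thesis
    using X Y is_cpx_dual by auto
qed

text \<open>The loop closes through the dual: vanishing for left fractions gives vanishing for right
  fractions between duals, and \<open>hom_vanishes_dual\<close> returns to the original
  pair.\<close>

lemma cohom_vanishes_iff:
  assumes X: "is_cpx X" and Y: "is_cpx Y"
  shows "cohom_vanishes X Y \<longleftrightarrow> hom_vanishes X Y"
  using cohom_vanishes_dual[OF X Y] hom_vanishes_dual[OF X Y] hom_vanishes_imp_cohom_vanishes[OF X Y] by blast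

section \<open>Vanishing along mapping cones\<close>

context
  fixes X Y A :: "'k :: field cpx" and u
  assumes X: "is_cpx X" and Y: "is_cpx Y" and A: "is_cpx A" and u: "is_cmap X Y u"
begin

text \<open>Exactness of Hom(A, -) at the middle term: kill the image in the cone, lift through
  \<open>u\<close>, then kill the lift.\<close>

lemma hom_vanishes_into_middle:
  assumes zX: "hom_vanishes A X" and zC: "hom_vanishes A (cone X Y u)"
  shows "hom_vanishes A Y"
  unfolding hom_vanishes_def
proof (intro allI impI)
  fix W s f assume W: "is_cpx W" and s: "quasi_iso W A s" and f: "is_cmap W Y f"
  note C = is_cpx_cone[OF X Y u] and i = cone_in_cmap[OF X Y u]
  obtain V w where V: "is_cpx V" and w: "quasi_iso V W w" "is_cmap V W w"
    and n: "null_homotopic V (cone X Y u) (cmap_comp (cmap_comp (cone_in X Y) f) w)"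
    using hom_vanishesE[OF zC W s cmap_comp_is_cmap[OF W Y C f i]] .
  then have "null_homotopic V (cone X Y u) (cmap_comp (cone_in X Y) (cmap_comp f w))" by (simp add: cmap_comp_assoc[OF w(2) f i])
  note fw = cmap_comp_is_cmap[OF V W Y w(2) f]
  obtain k where k: "is_cmap V X k" and h: "homotopic V Y (cmap_comp f w) (cmap_comp u k)"
    using cone_lift_through[OF X Y u V fw \<open>null_homotopic V (cone X Y u) (cmap_comp (cone_in X Y) (cmap_comp f w))\<close>] .
  obtain V' w' where V': "is_cpx V'" and w': "quasi_iso V' V w'" "is_cmap V' V w'" and n': "null_homotopic V' X (cmap_comp k w')"
    using hom_vanishesE[OF zX V quasi_iso_comp[OF V W A w(2) quasi_iso_cmap[OF s] w(1) s] k] .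
  note uk = cmap_comp_is_cmap[OF V X Y k u]
  have "null_homotopic V' Y (cmap_comp u (cmap_comp k w'))" by (rule null_comp_left[OF V' X Y u n'])
  then have "null_homotopic V' Y (cmap_comp (cmap_comp u k) w')" by (simp add: cmap_comp_assoc[OF w'(2) k u])
  with homotopic_comp_right[OF V' V Y fw uk w'(2) h]
  have "null_homotopic V' Y (cmap_comp (cmap_comp f w) w')"
    by (rule homotopic_null[OF V' Y cmap_comp_is_cmap[OF V' V Y w'(2) fw] cmap_comp_is_cmap[OF V' V Y w'(2) uk]])
  then have "null_homotopic V' Y (cmap_comp f (cmap_comp w w'))" by (simp add: cmap_comp_assoc[OF w'(2) w(2) f])
  with V' quasi_iso_comp[OF V' V W w'(2) w(2) w'(1) w(1)]
  show "\<exists>V u. is_cpx V \<and> quasi_iso V W u \<and> null_homotopic V Y (cmap_comp f u)" by blast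
qed

text \<open>Exactness at the cone, with \<open>cone_factor\<close> in the role that
  \<open>cone_lift_through\<close> plays for the middle term.\<close>

lemma hom_vanishes_into_cone:
  assumes zY: "hom_vanishes A Y" and zX: "hom_vanishes A (cpx_shift 1 X)"
  shows "hom_vanishes A (cone X Y u)"
  unfolding hom_vanishes_def
proof (intro allI impI)
  fix W s f assume W: "is_cpx W" and s: "quasi_iso W A s" and f: "is_cmap W (cone X Y u) f"
  note C = is_cpx_cone[OF X Y u] and i = cone_in_cmap[OF X Y u] and o = cone_out_cmap[OF X Y u]
  obtain V w where V: "is_cpx V" and w: "quasi_iso V W w" "is_cmap V W w"
    and n: "null_homotopic V (cpx_shift 1 X) (cmap_comp (cmap_comp (cone_out X Y) f) w)"
    using hom_vanishesE[OF zX W s cmap_comp_is_cmap[OF W C is_cpx_shift[OF X] f o]] .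
  then have n: "null_homotopic V (cpx_shift 1 X) (cmap_comp (cone_out X Y) (cmap_comp f w))" by (simp add: cmap_comp_assoc[OF w(2) f o])
  note fw = cmap_comp_is_cmap[OF V W C w(2) f]
  obtain k where k: "is_cmap V Y k" and h: "homotopic V (cone X Y u) (cmap_comp f w) (cmap_comp (cone_in X Y) k)"
    using cone_factor[OF X Y u V fw n] .
  obtain V' w' where V': "is_cpx V'" and w': "quasi_iso V' V w'" "is_cmap V' V w'" and n': "null_homotopic V' Y (cmap_comp k w')"
    using hom_vanishesE[OF zY V quasi_iso_comp[OF V W A w(2) quasi_iso_cmap[OF s] w(1) s] k] .
  note ik = cmap_comp_is_cmap[OF V Y C k i]
  have "null_homotopic V' (cone X Y u) (cmap_comp (cone_in X Y) (cmap_comp k w'))" by (rule null_comp_left[OF V' Y C i n'])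
  then have "null_homotopic V' (cone X Y u) (cmap_comp (cmap_comp (cone_in X Y) k) w')" by (simp add: cmap_comp_assoc[OF w'(2) k i])
  with homotopic_comp_right[OF V' V C fw ik w'(2) h]
  have "null_homotopic V' (cone X Y u) (cmap_comp (cmap_comp f w) w')"
    by (rule homotopic_null[OF V' C cmap_comp_is_cmap[OF V' V C w'(2) fw] cmap_comp_is_cmap[OF V' V C w'(2) ik]])
  then have "null_homotopic V' (cone X Y u) (cmap_comp f (cmap_comp w w'))" by (simp add: cmap_comp_assoc[OF w'(2) w(2) f])
  with V' quasi_iso_comp[OF V' V W w'(2) w(2) w'(1) w(1)]
  show "\<exists>V' w. is_cpx V' \<and> quasi_iso V' W w \<and> null_homotopic V' (cone X Y u) (cmap_comp f w)" by blast
qed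

text \<open>Left fractions are the right form here: a map extended over the cone is killed by
  enlarging its target, which leaves the triangle on the source side untouched.\<close>

lemma hom_vanishes_from_middle:
  assumes "hom_vanishes X A" and "hom_vanishes (cone X Y u) A"
  shows "hom_vanishes Y A"
proof -
  note C = is_cpx_cone[OF X Y u] and i = cone_in_cmap[OF X Y u]
  have zX: "cohom_vanishes X A" and zC: "cohom_vanishes (cone X Y u) A"
    using assms cohom_vanishes_iff[OF X A] cohom_vanishes_iff[OF C A] by auto
  have "cohom_vanishes Y A" unfolding cohom_vanishes_def
  proof (intro allI impI)
    fix V t g assume V: "is_cpx V" and t: "quasi_iso A V t" and g: "is_cmap Y V g"
    obtain V1 t1 where V1: "is_cpx V1" and t1: "quasi_iso V V1 t1" and n1: "null_homotopic X V1 (cmap_comp t1 (cmap_comp g u))"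
      using zX V t cmap_comp_is_cmap[OF X Y V u g] unfolding cohom_vanishes_def by blast
    note t1c = quasi_iso_cmap[OF t1]
    have "null_homotopic X V1 (cmap_comp (cmap_comp t1 g) u)" using n1 by (simp add: cmap_comp_assoc[OF u g t1c])
    from cone_extend[OF X Y u V1 cmap_comp_is_cmap[OF Y V V1 g t1c] this]
    obtain F where F: "is_cmap (cone X Y u) V1 F" and Fi: "cmap_comp F (cone_in X Y) = cmap_comp t1 g" .
    obtain V2 t2 where V2: "is_cpx V2" and t2: "quasi_iso V1 V2 t2" and n2: "null_homotopic (cone X Y u) V2 (cmap_comp t2 F)"
      using zC V1 quasi_iso_comp[OF A V V1 quasi_iso_cmap[OF t] t1c t t1] F unfolding cohom_vanishes_def by blast
    note t2c = quasi_iso_cmap[OF t2]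
    have "null_homotopic Y V2 (cmap_comp (cmap_comp t2 F) (cone_in X Y))" by (rule null_comp_right[OF Y C V2 i n2])
    then have "null_homotopic Y V2 (cmap_comp (cmap_comp t2 t1) g)"
      by (simp add: cmap_comp_assoc[OF i F t2c] Fi cmap_comp_assoc[OF g t1c t2c])
    with V2 quasi_iso_comp[OF V V1 V2 t1c t2c t1 t2]
    show "\<exists>V' t'. is_cpx V' \<and> quasi_iso V V' t' \<and> null_homotopic Y V' (cmap_comp t' g)" by blast
  qed
  then show ?thesis using cohom_vanishes_iff[OF Y A] by simp
qed

end

declare One_nat_def [simp del]

section \<open>Indecomposable projective representations\<close>

definition colm :: "'k vec \<Rightarrow> 'k mat" where
  "colm x = mat (dim_vec x) 1 (\<lambda>(i, _). x $ i)"

lemma colm_sel [simp]: "dim_row (colm x) = dim_vec x" "dim_col (colm x) = 1" "col (colm x) 0 = x"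
  "i < dim_vec x \<Longrightarrow> colm x $$ (i, 0) = x $ i"
  by (auto simp: colm_def intro!: eq_vecI)

lemma mult_colm: "dim_col A = dim_vec x \<Longrightarrow> A * colm x = colm (A *\<^sub>v (x :: 'k :: semiring_0 vec))"
proof (rule eq_matI)
  assume d: "dim_col A = dim_vec x"
  have "vec (dim_vec x) (\<lambda>i. x $ i) = x" by auto
  then show "(A * colm x) $$ (i, j) = colm (A *\<^sub>v x) $$ (i, j)" if "i < dim_row (colm (A *\<^sub>v x))" "j < dim_col (colm (A *\<^sub>v x))" for i j
    using that d by (simp add: colm_def)
qed (simp_all add: colm_def)

lemma colm_col: "dim_col A = 1 \<Longrightarrow> colm (col A 0) = A"
  by (rule eq_matI) (auto simp: colm_def)

lemma colm_zero: "colm (0\<^sub>v n) = 0\<^sub>m n 1"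
  by (rule eq_matI) (auto simp: colm_def)

lemma empty_mat_eq: "dim_row A = dim_row B \<Longrightarrow> dim_col A = 0 \<Longrightarrow> dim_col B = 0 \<Longrightarrow> A = B"
  by (rule eq_matI) auto

definition vec2 :: "'k \<Rightarrow> 'k \<Rightarrow> 'k vec" where
  "vec2 a b = vec 1 (\<lambda>_. a) @\<^sub>v vec 1 (\<lambda>_. b)"

lemma dim_vec2 [simp]: "dim_vec (vec2 a b) = 2"
  by (simp add: vec2_def)

lemma hst_colm_vec2:
  "dim_vec p = dim_vec q \<Longrightarrow> hst (colm p) (colm q) *\<^sub>v vec2 a b = a \<cdot>\<^sub>v p + b \<cdot>\<^sub>v (q :: 'k :: comm_ring vec)"
  by (simp add: vec2_def hst_mult_vec) (auto intro!: eq_vecI simp: scalar_prod_def colm_def mult.commute One_nat_def)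

definition proj :: "vertex \<Rightarrow> 'k :: field rep" where
  "proj v = (case v of
     V1 \<Rightarrow> \<lparr>rdim = (\<lambda>u. case u of V1 \<Rightarrow> 1 | _ \<Rightarrow> 2),
            rmap = (\<lambda>a. case a of
              Alpha1 \<Rightarrow> vst (1\<^sub>m 1) (0\<^sub>m 1 1) | Beta1 \<Rightarrow> vst (0\<^sub>m 1 1) (1\<^sub>m 1)
            | Alpha2 \<Rightarrow> vst (hst (1\<^sub>m 1) (0\<^sub>m 1 1)) (hst (0\<^sub>m 1 1) (0\<^sub>m 1 1))
            | Beta2 \<Rightarrow> vst (hst (0\<^sub>m 1 1) (0\<^sub>m 1 1)) (hst (0\<^sub>m 1 1) (1\<^sub>m 1)))\<rparr>
   | V2 \<Rightarrow> \<lparr>rdim = (\<lambda>u. case u of V1 \<Rightarrow> 0 | V2 \<Rightarrow> 1 | V3 \<Rightarrow> 2),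
            rmap = (\<lambda>a. case a of
              Alpha2 \<Rightarrow> vst (1\<^sub>m 1) (0\<^sub>m 1 1) | Beta2 \<Rightarrow> vst (0\<^sub>m 1 1) (1\<^sub>m 1) | _ \<Rightarrow> 0\<^sub>m 1 0)\<rparr>
   | V3 \<Rightarrow> \<lparr>rdim = (\<lambda>u. case u of V3 \<Rightarrow> 1 | _ \<Rightarrow> 0),
            rmap = (\<lambda>a. case a of Alpha1 \<Rightarrow> 0\<^sub>m 0 0 | Beta1 \<Rightarrow> 0\<^sub>m 0 0 | _ \<Rightarrow> 0\<^sub>m 1 0)\<rparr>)"

text \<open>The map of the Yoneda lemma: the generator goes to \<open>x\<close>, and a path goes to
  its action on \<open>x\<close>.\<close>

definition pm :: "vertex \<Rightarrow> 'k :: field rep \<Rightarrow> 'k vec \<Rightarrow> vertex \<Rightarrow> 'k mat" where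
  "pm v M x = (case v of
     V1 \<Rightarrow> (\<lambda>u. case u of V1 \<Rightarrow> colm x
         | V2 \<Rightarrow> hst (colm (rmap M Alpha1 *\<^sub>v x)) (colm (rmap M Beta1 *\<^sub>v x))
         | V3 \<Rightarrow> hst (colm (rmap M Alpha2 *\<^sub>v (rmap M Alpha1 *\<^sub>v x))) (colm (rmap M Beta2 *\<^sub>v (rmap M Beta1 *\<^sub>v x))))
   | V2 \<Rightarrow> (\<lambda>u. case u of V1 \<Rightarrow> 0\<^sub>m (rdim M V1) 0 | V2 \<Rightarrow> colm x
         | V3 \<Rightarrow> hst (colm (rmap M Alpha2 *\<^sub>v x)) (colm (rmap M Beta2 *\<^sub>v x)))
   | V3 \<Rightarrow> (\<lambda>u. case u of V3 \<Rightarrow> colm x | _ \<Rightarrow> 0\<^sub>m (rdim M u) 0))"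

lemma proj_is_rep: "is_rep (proj v :: 'k :: field rep)"
proof -
  let ?P = "proj v :: 'k rep"
  have "rmap ?P a \<in> carrier_mat (rdim ?P (tgt a)) (rdim ?P (src a))" for a
    by (cases v; cases a) (auto simp: proj_def intro!: carrier_matI)
  moreover have "rmap ?P Beta2 * rmap ?P Alpha1 = 0\<^sub>m (rdim ?P V3) (rdim ?P V1)"
    "rmap ?P Alpha2 * rmap ?P Beta1 = 0\<^sub>m (rdim ?P V3) (rdim ?P V1)"
    by (cases v; auto simp: proj_def vst_mult hst_mult_vst vst_zero intro: empty_mat_eq)+
  ultimately show ?thesis by (simp add: is_rep_def)
qed

lemma rep_relations:
  assumes "is_rep M" "dim_vec x = rdim M V1"
  shows "rmap M Beta2 *\<^sub>v (rmap M Alpha1 *\<^sub>v x) = 0\<^sub>v (rdim M V3)" "rmap M Alpha2 *\<^sub>v (rmap M Beta1 *\<^sub>v x) = 0\<^sub>v (rdim M V3)"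
proof -
  note [simp] = rep_carrier[OF assms(1)] assms(2)
  have "rmap M Beta2 * rmap M Alpha1 *\<^sub>v x = 0\<^sub>v (rdim M V3)" "rmap M Alpha2 * rmap M Beta1 *\<^sub>v x = 0\<^sub>v (rdim M V3)"
    using assms(1) by (simp_all add: is_rep_def)
  then show "rmap M Beta2 *\<^sub>v (rmap M Alpha1 *\<^sub>v x) = 0\<^sub>v (rdim M V3)" "rmap M Alpha2 *\<^sub>v (rmap M Beta1 *\<^sub>v x) = 0\<^sub>v (rdim M V3)"
    by (simp_all add: mat_vec_assoc)
qed

lemma pm_is_hom:
  assumes M: "is_rep M" and x: "x \<in> carrier_vec (rdim M v)"
  shows "is_rep_hom (proj v) M (pm v M x)"
proof -
  note [simp] = rep_carrier[OF M] carrier_vecD[OF x]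
  have "pm v M x u \<in> carrier_mat (rdim M u) (rdim (proj v :: 'a rep) u)" for u
    by (cases v; cases u) (use carrier_vecD[OF x] in \<open>auto simp: pm_def proj_def intro!: carrier_matI\<close>)
  moreover have "pm v M x (tgt a) * rmap (proj v) a = rmap M a * pm v M x (src a)" for a
  proof (cases v)
    case V1
    with x have "dim_vec x = rdim M V1" by simp
    then show ?thesis using V1
      by (cases a) (auto simp: pm_def proj_def hst_mult_vst mult_hst hst_arith hst_zero mult_colm rep_relations[OF M] colm_zero)
  next
    case V2
    with x have "dim_vec x = rdim M V2" by simp
    then show ?thesis using V2
      by (cases a) (auto simp: pm_def proj_def hst_mult_vst mult_hst hst_arith hst_zero mult_colm intro: empty_mat_eq)
  next
    case V3
    with x have "dim_vec x = rdim M V3" by simp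
    then show ?thesis using V3
      by (cases a) (auto simp: pm_def proj_def intro!: empty_mat_eq)
  qed
  ultimately show ?thesis by (simp add: is_rep_hom_def)
qed

lemma proj_gen [simp]: "rdim (proj v) v = 1"
  by (cases v) (simp_all add: proj_def)

lemma pm_gen: "col (pm v M x v) 0 = x"
  by (cases v) (simp_all add: pm_def)

text \<open>Every basis path is obtained from the generator by arrows, so compatibility with the
  arrows determines all columns.\<close>

lemma hom_proj:
  assumes M: "is_rep M" and f: "is_rep_hom (proj v) M f"
  shows "f = pm v M (col (f v) 0)"
proof
  fix u
  note [simp] = rep_carrier[OF M]
  have d: "dim_row (f u) = rdim M u" "dim_col (f u) = rdim (proj v :: 'a rep) u" for u
    using hom_carrier[OF f, of u] by simp_all
  have g: "f v = colm (col (f v) 0)" using d[of v] by (simp add: colm_col)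
  have s: "hst (leftc 1 (f u)) (rightc 1 (f u)) = f u" if "rdim (proj v :: 'a rep) u = 2" for u
    using d[of u] that by (simp add: hst_left_right)
  have a: "f (tgt a) * rmap (proj v) a = rmap M a * f (src a)" for a by (rule hom_comm[OF f])
  \<comment> \<open>Multiplying by a unit column extracts the left or the right half, hence the
    value on one of the two paths.\<close>
  have two: "l = A * g \<and> r = B * g"
    if "hst l r * vst (1\<^sub>m 1) (0\<^sub>m 1 1) = A * g" "hst l r * vst (0\<^sub>m 1 1) (1\<^sub>m 1) = B * g"
      "dim_col l = 1" "dim_col r = 1" "dim_row r = dim_row l" for l r A B g :: "'a mat"
    using that by (simp add: hst_mult_vst)
  show "f u = pm v M (col (f v) 0) u"
  proof (cases v)
    case V1
    have x: "dim_vec (col (f V1) 0) = rdim M V1" using d by simp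
    have g: "f V1 = colm (col (f V1) 0)" using g V1 by simp
    have s2: "hst (leftc 1 (f V2)) (rightc 1 (f V2)) = f V2" and s3: "hst (leftc 1 (f V3)) (rightc 1 (f V3)) = f V3"
      using V1 by (simp_all add: s proj_def)
    have dd: "dim_row (f V2) = rdim M V2" "dim_col (f V2) = 2" "dim_row (f V3) = rdim M V3" "dim_col (f V3) = 2"
      using d V1 by (simp_all add: proj_def)
    have "leftc 1 (f V2) = rmap M Alpha1 * f V1 \<and> rightc 1 (f V2) = rmap M Beta1 * f V1"
      using a[of Alpha1] a[of Beta1] V1 dd by (intro two) (simp_all add: s2 proj_def)
    then have f2: "f V2 = hst (colm (rmap M Alpha1 *\<^sub>v col (f V1) 0)) (colm (rmap M Beta1 *\<^sub>v col (f V1) 0))"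
      using s2 g x by (metis mult_colm rep_carrier(3)[OF M] src.simps(1,2))
    have "hst (leftc 1 (f V3)) (rightc 1 (f V3)) * rmap (proj V1) Alpha2 = rmap M Alpha2 * f V2"
      using a[of Alpha2] V1 s3 by simp
    then have "hst (leftc 1 (f V3)) (0\<^sub>m (rdim M V3) 1) = rmap M Alpha2 * f V2"
      using dd by (simp add: proj_def hst_mult_vst mult_hst hst_arith)
    then have l3: "leftc 1 (f V3) = colm (rmap M Alpha2 *\<^sub>v (rmap M Alpha1 *\<^sub>v col (f V1) 0))"
      using x dd by (simp add: f2 mult_hst mult_colm hst_eq_iff)
    have "hst (leftc 1 (f V3)) (rightc 1 (f V3)) * rmap (proj V1) Beta2 = rmap M Beta2 * f V2"
      using a[of Beta2] V1 s3 by simp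
    then have "hst (0\<^sub>m (rdim M V3) 1) (rightc 1 (f V3)) = rmap M Beta2 * f V2"
      using dd by (simp add: proj_def hst_mult_vst mult_hst hst_arith)
    then have r3: "rightc 1 (f V3) = colm (rmap M Beta2 *\<^sub>v (rmap M Beta1 *\<^sub>v col (f V1) 0))"
      using x dd by (simp add: f2 mult_hst mult_colm hst_eq_iff)
    show ?thesis using V1 g f2 s3 l3 r3 by (cases u) (simp_all add: pm_def)
  next
    case V2
    have x: "dim_vec (col (f V2) 0) = rdim M V2" using d by simp
    have g: "f V2 = colm (col (f V2) 0)" using g V2 by simp
    have s3: "hst (leftc 1 (f V3)) (rightc 1 (f V3)) = f V3" using V2 by (simp add: s proj_def)
    have dd: "dim_row (f V3) = rdim M V3" "dim_col (f V3) = 2" using d V2 by (simp_all add: proj_def)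
    have "leftc 1 (f V3) = rmap M Alpha2 * f V2 \<and> rightc 1 (f V3) = rmap M Beta2 * f V2"
      using a[of Alpha2] a[of Beta2] V2 dd by (intro two) (simp_all add: s3 proj_def)
    then have "f V3 = hst (colm (rmap M Alpha2 *\<^sub>v col (f V2) 0)) (colm (rmap M Beta2 *\<^sub>v col (f V2) 0))"
      using s3 g x by (metis mult_colm rep_carrier(3)[OF M] src.simps(3,4))
    moreover have "f V1 = 0\<^sub>m (rdim M V1) 0" using d[of V1] V2 by (intro empty_mat_eq) (simp_all add: proj_def)
    ultimately show ?thesis using V2 g by (cases u) (simp_all add: pm_def)
  next
    case V3
    have "f V3 = colm (col (f V3) 0)" using g V3 by simp
    moreover have "f V1 = 0\<^sub>m (rdim M V1) 0" "f V2 = 0\<^sub>m (rdim M V2) 0"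
      using d[of V1] d[of V2] V3 by (auto intro!: empty_mat_eq simp: proj_def)
    ultimately show ?thesis using V3 by (cases u) (simp_all add: pm_def)
  qed
qed

lemma hom_proj_eqI:
  assumes "is_rep M" "is_rep_hom (proj v) M f" "is_rep_hom (proj v) M g" "col (f v) 0 = col (g v) 0"
  shows "f u = g u"
  using hom_proj[OF assms(1,2)] hom_proj[OF assms(1,3)] assms(4) by metis

text \<open>A projective multiplied by 0 or 1, according to the flag; with flag \<open>False\<close> its maps are
  indexed by vectors of length 0.\<close>

definition fdim :: "bool \<Rightarrow> nat \<Rightarrow> nat" where
  "fdim b n = (if b then n else 0)"

definition projf :: "bool \<Rightarrow> vertex \<Rightarrow> 'k :: field rep" where
  "projf b v = (if b then proj v else zero_rep)"

definition pmf :: "bool \<Rightarrow> vertex \<Rightarrow> 'k :: field rep \<Rightarrow> 'k vec \<Rightarrow> vertex \<Rightarrow> 'k mat" where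
  "pmf b v M x = (if b then pm v M x else (\<lambda>u. 0\<^sub>m (rdim M u) 0))"

definition genf :: "bool \<Rightarrow> vertex \<Rightarrow> (vertex \<Rightarrow> 'k :: field mat) \<Rightarrow> 'k vec" where
  "genf b v f = (if b then col (f v) 0 else 0\<^sub>v 0)"

lemma zero_rep_is_rep: "is_rep zero_rep"
  by (simp add: is_rep_def zero_rep_def)

lemma hom_from_zero_rep: "is_rep M \<Longrightarrow> (\<And>u. dim_row (f u) = rdim M u \<and> dim_col (f u) = 0) \<Longrightarrow> is_rep_hom zero_rep M f"
  using rep_carrier[of M] by (auto simp: is_rep_hom_def zero_rep_def intro!: empty_mat_eq carrier_matI)

lemma projf_is_rep: "is_rep (projf b v)"
  by (simp add: projf_def proj_is_rep zero_rep_is_rep)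

lemma pmf_is_hom: "is_rep M \<Longrightarrow> x \<in> carrier_vec (fdim b (rdim M v)) \<Longrightarrow> is_rep_hom (projf b v) M (pmf b v M x)"
  by (cases b) (simp_all add: projf_def pmf_def fdim_def pm_is_hom hom_from_zero_rep)

lemma genf_pmf: "x \<in> carrier_vec (fdim b n) \<Longrightarrow> genf b v (pmf b v M x) = x"
  by (cases b) (auto simp: genf_def pmf_def pm_gen fdim_def)

lemma genf_carrier: "is_rep_hom (projf b v) M f \<Longrightarrow> genf b v f \<in> carrier_vec (fdim b (rdim M v))"
  using hom_carrier[of "projf b v" M f v] col_dim[of "f v" 0] by (auto simp: genf_def projf_def fdim_def)

lemma hom_projf_eqI:
  assumes "is_rep M" "is_rep_hom (projf b v) M f" "is_rep_hom (projf b v) M g" "genf b v f = genf b v g"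
  shows "f u = g u"
proof (cases b)
  case True
  then show ?thesis using assms hom_proj_eqI[of M v f g] by (simp add: projf_def genf_def)
next
  case False
  then show ?thesis using hom_carrier[OF assms(2), of u] hom_carrier[OF assms(3), of u]
    by (intro empty_mat_eq) (simp_all add: projf_def zero_rep_def)
qed

lemma pmf_genf: "is_rep M \<Longrightarrow> is_rep_hom (projf b v) M f \<Longrightarrow> f u = pmf b v M (genf b v f) u"
  by (rule hom_projf_eqI) (auto simp: genf_pmf[OF genf_carrier] pmf_is_hom genf_carrier)

section \<open>Three-term complexes of projectives and Serre duality\<close>

text \<open>A test stands for the complex \<open>P\<^sub>3 \<rightarrow> P\<^sub>2 \<rightarrow> P\<^sub>1\<close> in degrees $-2,-1,0$ with maps $z\alpha_2 + w\beta_2$ and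
  $x\alpha_1 + y\beta_1$; the flags say whether the outer terms are present.\<close>

record 'k test =
  has1 :: bool
  has3 :: bool
  coef_a1 :: 'k
  coef_b1 :: 'k
  coef_a2 :: 'k
  coef_b2 :: 'k

definition is_test :: "'k :: field test \<Rightarrow> bool" where
  "is_test \<tau> \<longleftrightarrow> (has1 \<tau> \<and> has3 \<tau> \<longrightarrow> coef_a1 \<tau> * coef_a2 \<tau> = 0 \<and> coef_b1 \<tau> * coef_b2 \<tau> = 0)"

text \<open>Transposing the Hom complex exchanges the outer vertices, hence the two flags and the
  coefficients with index 1 and 2.\<close>

definition dual_test :: "'k test \<Rightarrow> 'k test" where
  "dual_test \<tau> = \<lparr>has1 = has3 \<tau>, has3 = has1 \<tau>, coef_a1 = coef_a2 \<tau>, coef_b1 = coef_b2 \<tau>, coef_a2 = coef_a1 \<tau>, coef_b2 = coef_b1 \<tau>\<rparr>"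

text \<open>An absent outer term contributes an empty matrix, so that all shapes of test complexes
  obey the same equations.\<close>

definition test_diff1 :: "'k :: field test \<Rightarrow> 'k cpx \<Rightarrow> int \<Rightarrow> 'k mat" where
  "test_diff1 \<tau> Y n = (if has1 \<tau> then cdf Y n V1 else 0\<^sub>m 0 0)"

definition test_diff3 :: "'k :: field test \<Rightarrow> 'k cpx \<Rightarrow> int \<Rightarrow> 'k mat" where
  "test_diff3 \<tau> Y n = (if has3 \<tau> then cdf Y n V3 else 0\<^sub>m 0 0)"

definition test_arrow1 :: "'k :: field test \<Rightarrow> 'k rep \<Rightarrow> 'k mat" where
  "test_arrow1 \<tau> M = (if has1 \<tau> then coef_a1 \<tau> \<cdot>\<^sub>m rmap M Alpha1 + coef_b1 \<tau> \<cdot>\<^sub>m rmap M Beta1 else 0\<^sub>m (rdim M V2) 0)"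

definition test_arrow2 :: "'k :: field test \<Rightarrow> 'k rep \<Rightarrow> 'k mat" where
  "test_arrow2 \<tau> M = (if has3 \<tau> then coef_a2 \<tau> \<cdot>\<^sub>m rmap M Alpha2 + coef_b2 \<tau> \<cdot>\<^sub>m rmap M Beta2 else 0\<^sub>m 0 (rdim M V2))"

text \<open>The Hom complex from \<open>testc \<tau>\<close> to \<open>Y\<close> is exact in degree
  0. By the Yoneda lemma a chain map is a triple \<open>y1\<close>, \<open>y2\<close>,
  \<open>y3\<close> of values on generators, and a homotopy is a triple \<open>x1\<close>,
  \<open>x2\<close>, \<open>x3\<close> of values one degree lower.\<close>

definition test_exact :: "'k :: field test \<Rightarrow> 'k cpx \<Rightarrow> bool" where
  "test_exact \<tau> Y \<longleftrightarrow> (\<forall>y1 \<in> carrier_vec (fdim (has1 \<tau>) (cdim Y 0 V1)). \<forall>y2 \<in> carrier_vec (cdim Y (-1) V2).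
     \<forall>y3 \<in> carrier_vec (fdim (has3 \<tau>) (cdim Y (-2) V3)).
     test_diff1 \<tau> Y 0 *\<^sub>v y1 = 0\<^sub>v (fdim (has1 \<tau>) (cdim Y 1 V1)) \<longrightarrow> test_arrow1 \<tau> (cob Y 0) *\<^sub>v y1 = cdf Y (-1) V2 *\<^sub>v y2 \<longrightarrow>
     test_arrow2 \<tau> (cob Y (-1)) *\<^sub>v y2 = test_diff3 \<tau> Y (-2) *\<^sub>v y3 \<longrightarrow>
     (\<exists>x1 \<in> carrier_vec (fdim (has1 \<tau>) (cdim Y (-1) V1)). \<exists>x2 \<in> carrier_vec (cdim Y (-2) V2).
      \<exists>x3 \<in> carrier_vec (fdim (has3 \<tau>) (cdim Y (-3) V3)).
        y1 = test_diff1 \<tau> Y (-1) *\<^sub>v x1 \<and> y2 = test_arrow1 \<tau> (cob Y (-1)) *\<^sub>v x1 + cdf Y (-2) V2 *\<^sub>v x2 \<and>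
        y3 = test_arrow2 \<tau> (cob Y (-2)) *\<^sub>v x2 + test_diff3 \<tau> Y (-3) *\<^sub>v x3))"

lemma is_test_dual: "is_test \<tau> \<Longrightarrow> is_test (dual_test \<tau>)"
  by (auto simp: is_test_def dual_test_def)

lemma dual_test_dual [simp]: "dual_test (dual_test \<tau>) = \<tau>"
  by (simp add: dual_test_def)

lemma test_dims:
  assumes "is_cpx Y"
  shows "dim_row (test_diff1 \<tau> Y n) = fdim (has1 \<tau>) (cdim Y (n + 1) V1)" "dim_col (test_diff1 \<tau> Y n) = fdim (has1 \<tau>) (cdim Y n V1)"
    "dim_row (test_diff3 \<tau> Y n) = fdim (has3 \<tau>) (cdim Y (n + 1) V3)" "dim_col (test_diff3 \<tau> Y n) = fdim (has3 \<tau>) (cdim Y n V3)"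
  using cpx_carrier[OF assms] by (auto simp: test_diff1_def test_diff3_def fdim_def)

lemma test_arrow_dims:
  assumes "is_rep M"
  shows "dim_row (test_arrow1 \<tau> M) = rdim M V2" "dim_col (test_arrow1 \<tau> M) = fdim (has1 \<tau>) (rdim M V1)"
    "dim_row (test_arrow2 \<tau> M) = fdim (has3 \<tau>) (rdim M V3)" "dim_col (test_arrow2 \<tau> M) = rdim M V2"
  using rep_carrier[OF assms, of Beta1] rep_carrier[OF assms, of Beta2] by (auto simp: test_arrow1_def test_arrow2_def fdim_def)

subsection \<open>Linear algebra\<close>

lemma append3E:
  assumes "t \<in> carrier_vec (a + (b + c))"
  obtains x y z where "x \<in> carrier_vec a" "y \<in> carrier_vec b" "z \<in> carrier_vec c" "t = x @\<^sub>v (y @\<^sub>v z)"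
  using assms by (metis append_vecE)

lemma append3_eq:
  assumes "x \<in> carrier_vec a" "x' \<in> carrier_vec a" "y \<in> carrier_vec b" "y' \<in> carrier_vec b"
  shows "x @\<^sub>v (y @\<^sub>v z) = x' @\<^sub>v (y' @\<^sub>v z') \<longleftrightarrow> x = x' \<and> y = y' \<and> z = z'"
  using append_vec_eq[OF assms(1,2)] append_vec_eq[OF assms(3,4)] by auto

text \<open>A total complex that is exact at one place stays so after transposition; the sign in the
  second differential makes the composite of the two maps vanish.\<close>

lemma exact_transpose3:
  fixes d1 d2 d3 a b e1 e2 e3 a' b' :: "'k :: field mat"
  assumes c: "d1 \<in> carrier_mat q1 p1" "d2 \<in> carrier_mat q2 p2" "d3 \<in> carrier_mat q3 p3"
    "a \<in> carrier_mat q2 p1" "b \<in> carrier_mat q3 p2"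
    "e1 \<in> carrier_mat r1 q1" "e2 \<in> carrier_mat r2 q2" "e3 \<in> carrier_mat r3 q3"
    "a' \<in> carrier_mat r2 q1" "b' \<in> carrier_mat r3 q2"
    and ex: "\<And>y1 y2 y3. y1 \<in> carrier_vec q1 \<Longrightarrow> y2 \<in> carrier_vec q2 \<Longrightarrow> y3 \<in> carrier_vec q3 \<Longrightarrow>
      e1 *\<^sub>v y1 = 0\<^sub>v r1 \<Longrightarrow> a' *\<^sub>v y1 = e2 *\<^sub>v y2 \<Longrightarrow> b' *\<^sub>v y2 = e3 *\<^sub>v y3 \<Longrightarrow>
      \<exists>x1 \<in> carrier_vec p1. \<exists>x2 \<in> carrier_vec p2. \<exists>x3 \<in> carrier_vec p3.
        y1 = d1 *\<^sub>v x1 \<and> y2 = a *\<^sub>v x1 + d2 *\<^sub>v x2 \<and> y3 = b *\<^sub>v x2 + d3 *\<^sub>v x3"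
    and z: "z1 \<in> carrier_vec q1" "z2 \<in> carrier_vec q2" "z3 \<in> carrier_vec q3"
      "transpose_mat d3 *\<^sub>v z3 = 0\<^sub>v p3" "transpose_mat b *\<^sub>v z3 = transpose_mat d2 *\<^sub>v z2"
      "transpose_mat a *\<^sub>v z2 = transpose_mat d1 *\<^sub>v z1"
  shows "\<exists>w3 \<in> carrier_vec r3. \<exists>w2 \<in> carrier_vec r2. \<exists>w1 \<in> carrier_vec r1.
    z3 = transpose_mat e3 *\<^sub>v w3 \<and> z2 = transpose_mat b' *\<^sub>v w3 + transpose_mat e2 *\<^sub>v w2 \<and>
    z1 = transpose_mat a' *\<^sub>v w2 + transpose_mat e1 *\<^sub>v w1"
proof -
  note [simp] = c[THEN carrier_matD(1)] c[THEN carrier_matD(2)]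
  define A where "A = vst (hst d1 (hst (0\<^sub>m q1 p2) (0\<^sub>m q1 p3))) (vst (hst a (hst d2 (0\<^sub>m q2 p3))) (hst (0\<^sub>m q3 p1) (hst b d3)))"
  define B where "B = vst (hst e1 (hst (0\<^sub>m r1 q2) (0\<^sub>m r1 q3))) (vst (hst a' (hst (- e2) (0\<^sub>m r2 q3))) (hst (0\<^sub>m r3 q1) (hst b' (- e3))))"
  have A: "A \<in> carrier_mat (q1 + (q2 + q3)) (p1 + (p2 + p3))" and B: "B \<in> carrier_mat (r1 + (r2 + r3)) (q1 + (q2 + q3))"
    by (auto simp: A_def B_def intro!: carrier_matI)
  have Av: "A *\<^sub>v (x1 @\<^sub>v (x2 @\<^sub>v x3)) = (d1 *\<^sub>v x1) @\<^sub>v ((a *\<^sub>v x1 + d2 *\<^sub>v x2) @\<^sub>v (b *\<^sub>v x2 + d3 *\<^sub>v x3))"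
    if "x1 \<in> carrier_vec p1" "x2 \<in> carrier_vec p2" "x3 \<in> carrier_vec p3" for x1 x2 x3
    using that[THEN carrier_vecD] by (simp add: A_def vst_mult_vec hst_mult_vec)
  have Bv: "B *\<^sub>v (y1 @\<^sub>v (y2 @\<^sub>v y3)) = (e1 *\<^sub>v y1) @\<^sub>v ((a' *\<^sub>v y1 - e2 *\<^sub>v y2) @\<^sub>v (b' *\<^sub>v y2 - e3 *\<^sub>v y3))"
    if "y1 \<in> carrier_vec q1" "y2 \<in> carrier_vec q2" "y3 \<in> carrier_vec q3" for y1 y2 y3
  proof -
    note [simp] = that[THEN carrier_vecD]
    have m: "p + - q = p - q" if "dim_vec p = dim_vec q" for p q :: "'k vec" using that by (intro eq_vecI) auto
    show ?thesis by (simp add: B_def vst_mult_vec hst_mult_vec m)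
  qed
  have AT: "transpose_mat A = vst (hst (transpose_mat d1) (hst (transpose_mat a) (0\<^sub>m p1 q3)))
      (vst (hst (0\<^sub>m p2 q1) (hst (transpose_mat d2) (transpose_mat b))) (hst (0\<^sub>m p3 q1) (hst (0\<^sub>m p3 q2) (transpose_mat d3))))"
    by (simp add: A_def transpose_vst transpose_hst vst_hst)
  have BT: "transpose_mat B = vst (hst (transpose_mat e1) (hst (transpose_mat a') (0\<^sub>m q1 r3)))
      (vst (hst (0\<^sub>m q2 r1) (hst (- transpose_mat e2) (transpose_mat b'))) (hst (0\<^sub>m q3 r1) (hst (0\<^sub>m q3 r2) (- transpose_mat e3))))"
    by (simp add: B_def transpose_vst transpose_hst vst_hst transpose_uminus)
  have diff0: "p - q = 0\<^sub>v n \<longleftrightarrow> p = q" if "dim_vec p = n" "dim_vec q = n" for p q :: "'k vec" and n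
    using that by (auto simp: vec_eq_iff)
  have exA: "\<exists>s \<in> carrier_vec (p1 + (p2 + p3)). t = A *\<^sub>v s"
    if t: "t \<in> carrier_vec (q1 + (q2 + q3))" "B *\<^sub>v t = 0\<^sub>v (r1 + (r2 + r3))" for t
  proof -
    obtain y1 y2 y3 where y: "y1 \<in> carrier_vec q1" "y2 \<in> carrier_vec q2" "y3 \<in> carrier_vec q3" "t = y1 @\<^sub>v (y2 @\<^sub>v y3)"
      using append3E[OF t(1)] .
    have "(e1 *\<^sub>v y1) @\<^sub>v ((a' *\<^sub>v y1 - e2 *\<^sub>v y2) @\<^sub>v (b' *\<^sub>v y2 - e3 *\<^sub>v y3)) = 0\<^sub>v r1 @\<^sub>v (0\<^sub>v r2 @\<^sub>v 0\<^sub>v r3)"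
      using t(2) unfolding y(4) Bv[OF y(1-3)] by auto
    then have "e1 *\<^sub>v y1 = 0\<^sub>v r1" "a' *\<^sub>v y1 - e2 *\<^sub>v y2 = 0\<^sub>v r2" "b' *\<^sub>v y2 - e3 *\<^sub>v y3 = 0\<^sub>v r3"
      by (subst (asm) append3_eq[of _ r1 _ _ r2]; auto intro!: carrier_vecI)+
    then obtain x1 x2 x3 where "x1 \<in> carrier_vec p1" "x2 \<in> carrier_vec p2" "x3 \<in> carrier_vec p3"
      "y1 = d1 *\<^sub>v x1" "y2 = a *\<^sub>v x1 + d2 *\<^sub>v x2" "y3 = b *\<^sub>v x2 + d3 *\<^sub>v x3"
      using ex[OF y(1-3)] by (auto simp: diff0)
    then show ?thesis using y(4) Av[of x1 x2 x3] by (intro bexI[of _ "x1 @\<^sub>v (x2 @\<^sub>v x3)"]) auto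
  qed
  \<comment> \<open>The matrix \<open>A\<close> has no signs, so the middle component is negated to
    make its transpose annihilate the vector.\<close>
  have zc: "z1 @\<^sub>v ((- z2) @\<^sub>v z3) \<in> carrier_vec (q1 + (q2 + q3))" using z by auto
  have "transpose_mat A *\<^sub>v (z1 @\<^sub>v ((- z2) @\<^sub>v z3)) = 0\<^sub>v (p1 + (p2 + p3))"
  proof -
    note [simp] = z(1-3)[THEN carrier_vecD]
    have m: "p + - p = 0\<^sub>v (dim_vec p)" "- p + p = 0\<^sub>v (dim_vec p)" for p :: "'k vec" by (auto intro!: eq_vecI)
    show ?thesis
      by (simp add: AT vst_mult_vec hst_mult_vec z(4-6) mat_vec_distribs m) auto
  qed
  from exact_transpose[OF A B exA zc this]
  obtain \<eta> where \<eta>: "\<eta> \<in> carrier_vec (r1 + (r2 + r3))" "z1 @\<^sub>v ((- z2) @\<^sub>v z3) = transpose_mat B *\<^sub>v \<eta>" by blast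
  obtain w1 w2 w3 where w: "w1 \<in> carrier_vec r1" "w2 \<in> carrier_vec r2" "w3 \<in> carrier_vec r3" "\<eta> = w1 @\<^sub>v (w2 @\<^sub>v w3)"
    using append3E[OF \<eta>(1)] .
  note wd [simp] = w(1-3)[THEN carrier_vecD]
  have "z1 @\<^sub>v ((- z2) @\<^sub>v z3) = (transpose_mat e1 *\<^sub>v w1 + transpose_mat a' *\<^sub>v w2) @\<^sub>v
    ((- (transpose_mat e2 *\<^sub>v w2) + transpose_mat b' *\<^sub>v w3) @\<^sub>v (- (transpose_mat e3 *\<^sub>v w3)))"
    unfolding \<eta>(2) w(4) by (simp add: BT vst_mult_vec hst_mult_vec)
  then have e: "z1 = transpose_mat e1 *\<^sub>v w1 + transpose_mat a' *\<^sub>v w2"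
    "- z2 = - (transpose_mat e2 *\<^sub>v w2) + transpose_mat b' *\<^sub>v w3" "z3 = - (transpose_mat e3 *\<^sub>v w3)"
    using z(1,2) by (subst (asm) append3_eq[of _ q1 _ _ q2]; auto intro!: carrier_vecI)+
  have "z3 = transpose_mat e3 *\<^sub>v (- w3)" unfolding e(3) by (simp add: mat_vec_distribs)
  moreover have "z2 = transpose_mat b' *\<^sub>v (- w3) + transpose_mat e2 *\<^sub>v w2"
  proof -
    have "z2 = - (- z2)" by simp
    also have "\<dots> = transpose_mat b' *\<^sub>v (- w3) + transpose_mat e2 *\<^sub>v w2"
      unfolding e(2) by (rule eq_vecI) (simp_all add: mat_vec_distribs del: index_mult_mat_vec)
    finally show ?thesis .
  qed
  moreover have "z1 = transpose_mat a' *\<^sub>v w2 + transpose_mat e1 *\<^sub>v w1"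
    unfolding e(1) by (rule eq_vecI) (simp_all add: add.commute del: index_mult_mat_vec)
  moreover have "- w3 \<in> carrier_vec r3" using w(3) by simp
  ultimately show ?thesis using w(1,2) by blast
qed

lemma smult_dims_mult:
  fixes A B :: "'k :: field mat"
  shows "dim_col A = dim_row B \<Longrightarrow> (k \<cdot>\<^sub>m A) * B = k \<cdot>\<^sub>m (A * B)" "dim_col A = dim_row B \<Longrightarrow> A * (k \<cdot>\<^sub>m B) = k \<cdot>\<^sub>m (A * B)"
  by (rule mult_smult_assoc_mat[of _ "dim_row A" "dim_row B" _ "dim_col B"]; auto intro: carrier_matI)
    (rule mult_smult_distrib[of _ "dim_row A" "dim_row B" _ "dim_col B"]; auto intro: carrier_matI)

lemma smult_mult_vec: "dim_col A = dim_vec x \<Longrightarrow> (k \<cdot>\<^sub>m A) *\<^sub>v x = k \<cdot>\<^sub>v (A *\<^sub>v (x :: 'k :: field vec))"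
  by (rule eq_vecI) auto

text \<open>Transposing the Hom complex reverses it and exchanges the vertices 1 and 3. Degrees 0,
  -1, -2 become 0, 1, 2, and the shift by 2 brings them back to -2, -1, 0: this is the 2 of Serre
  duality.\<close>

lemma test_exact_dual:
  assumes Y: "is_cpx Y" and ex: "test_exact \<tau> Y"
  shows "test_exact (dual_test \<tau>) (cpx_shift 2 (dual_cpx Y))"
proof -
  let ?Y = "cpx_shift 2 (dual_cpx Y)"
  have r: "is_rep (cob Y n)" for n by (rule cpx_rep[OF Y])
  have i: "- (n + 2) - 1 = - n - 3" "- (n + 2) = - n - 2" for n :: int by simp_all
  have D: "test_diff1 (dual_test \<tau>) ?Y 0 = transpose_mat (test_diff3 \<tau> Y (-3))" "test_diff1 (dual_test \<tau>) ?Y (-1) = transpose_mat (test_diff3 \<tau> Y (-2))"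
    "test_diff3 (dual_test \<tau>) ?Y (-2) = transpose_mat (test_diff1 \<tau> Y (-1))" "test_diff3 (dual_test \<tau>) ?Y (-3) = transpose_mat (test_diff1 \<tau> Y 0)"
    by (simp_all add: test_diff1_def test_diff3_def dual_test_def)
  have ts: "transpose_mat (k \<cdot>\<^sub>m A + l \<cdot>\<^sub>m B) = k \<cdot>\<^sub>m transpose_mat A + l \<cdot>\<^sub>m transpose_mat B"
    if "dim_row A = dim_row B" "dim_col A = dim_col B" for A B :: "'a mat" and k l
    using that by (intro eq_matI) auto
  have "test_arrow1 (dual_test \<tau>) (dual_rep M) = transpose_mat (test_arrow2 \<tau> M)" "test_arrow2 (dual_test \<tau>) (dual_rep M) = transpose_mat (test_arrow1 \<tau> M)" if "is_rep M" for M
    unfolding test_arrow1_def test_arrow2_def using rep_carrier[OF that] by (auto simp: ts dual_test_def)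
  with r have AB: "test_arrow1 (dual_test \<tau>) (cob ?Y n) = transpose_mat (test_arrow2 \<tau> (cob Y (- n - 2)))"
     "test_arrow2 (dual_test \<tau>) (cob ?Y n) = transpose_mat (test_arrow1 \<tau> (cob Y (- n - 2)))" for n
    by (simp_all only: cpx_shift_sel dual_cpx_sel i)
  have AB': "test_arrow1 (dual_test \<tau>) (cob ?Y 0) = transpose_mat (test_arrow2 \<tau> (cob Y (-2)))" "test_arrow1 (dual_test \<tau>) (cob ?Y (-1)) = transpose_mat (test_arrow2 \<tau> (cob Y (-1)))"
    "test_arrow2 (dual_test \<tau>) (cob ?Y (-1)) = transpose_mat (test_arrow1 \<tau> (cob Y (-1)))" "test_arrow2 (dual_test \<tau>) (cob ?Y (-2)) = transpose_mat (test_arrow1 \<tau> (cob Y 0))"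
    using AB[of 0] AB[of "-1"] AB[of "-2"] by simp_all
  have d2: "cdf ?Y (-1) V2 = transpose_mat (cdf Y (-2) V2)" "cdf ?Y (-2) V2 = transpose_mat (cdf Y (-1) V2)" by simp_all
  note [simp] = test_dims[OF Y] test_arrow_dims[OF r] cpx_carrier[OF Y]
  note ex3 = exact_transpose3[of "test_diff1 \<tau> Y (-1)" "fdim (has1 \<tau>) (cdim Y 0 V1)" "fdim (has1 \<tau>) (cdim Y (-1) V1)"
      "cdf Y (-2) V2" "cdim Y (-1) V2" "cdim Y (-2) V2" "test_diff3 \<tau> Y (-3)" "fdim (has3 \<tau>) (cdim Y (-2) V3)" "fdim (has3 \<tau>) (cdim Y (-3) V3)"
      "test_arrow1 \<tau> (cob Y (-1))" "test_arrow2 \<tau> (cob Y (-2))" "test_diff1 \<tau> Y 0" "fdim (has1 \<tau>) (cdim Y 1 V1)" "cdf Y (-1) V2" "cdim Y 0 V2"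
      "test_diff3 \<tau> Y (-2)" "fdim (has3 \<tau>) (cdim Y (-1) V3)" "test_arrow1 \<tau> (cob Y 0)" "test_arrow2 \<tau> (cob Y (-1))"]
  show ?thesis
    unfolding test_exact_def D AB' d2
  proof (intro ballI impI, goal_cases)
    case (1 z3 z2 z1)
    have "\<exists>w3 \<in> carrier_vec (fdim (has3 \<tau>) (cdim Y (-1) V3)). \<exists>w2 \<in> carrier_vec (cdim Y 0 V2). \<exists>w1 \<in> carrier_vec (fdim (has1 \<tau>) (cdim Y 1 V1)).
      z3 = transpose_mat (test_diff3 \<tau> Y (-2)) *\<^sub>v w3 \<and> z2 = transpose_mat (test_arrow2 \<tau> (cob Y (-1))) *\<^sub>v w3 + transpose_mat (cdf Y (-1) V2) *\<^sub>v w2 \<and>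
      z1 = transpose_mat (test_arrow1 \<tau> (cob Y 0)) *\<^sub>v w2 + transpose_mat (test_diff1 \<tau> Y 0) *\<^sub>v w1"
      by (rule ex3) (use 1 ex[unfolded test_exact_def] in \<open>auto intro!: carrier_matI simp: dual_test_def\<close>)
    then show ?case by (simp add: dual_test_def)
  qed
qed

lemma vec_diff_self [simp]: "x - x = 0\<^sub>v (dim_vec (x :: 'a :: ring vec))"
  by (rule eq_vecI) auto

text \<open>Bounded complexes of projectives have only null-homotopic maps into acyclic complexes.
  The homotopy is solved for at vertex 1, then 2, then 3, the error of one stage being a cocycle at
  the next.\<close>

lemma test_exact_acyclic:
  assumes g: "is_test \<tau>" and N: "is_cpx N" and a: "acyclic N"
  shows "test_exact \<tau> N"
  unfolding test_exact_def
proof (intro ballI impI)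
  fix y1 y2 y3
  assume y1: "y1 \<in> carrier_vec (fdim (has1 \<tau>) (cdim N 0 V1))" and y2: "y2 \<in> carrier_vec (cdim N (-1) V2)"
    and y3: "y3 \<in> carrier_vec (fdim (has3 \<tau>) (cdim N (-2) V3))"
    and e1: "test_diff1 \<tau> N 0 *\<^sub>v y1 = 0\<^sub>v (fdim (has1 \<tau>) (cdim N 1 V1))"
    and e2: "test_arrow1 \<tau> (cob N 0) *\<^sub>v y1 = cdf N (-1) V2 *\<^sub>v y2" and e3: "test_arrow2 \<tau> (cob N (-1)) *\<^sub>v y2 = test_diff3 \<tau> N (-2) *\<^sub>v y3"
  have r: "is_rep (cob N n)" for n by (rule cpx_rep[OF N])
  note [simp] = test_dims[OF N] test_arrow_dims[OF r] cpx_carrier[OF N] rep_carrier[OF r]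
  have ac: "\<exists>w \<in> carrier_vec (cdim N (n - 1) v). x = cdf N (n - 1) v *\<^sub>v w"
    if "dim_vec x = cdim N n v" "cdf N n v *\<^sub>v x = 0\<^sub>v (cdim N (n + 1) v)" for n v x
    using a carrier_vecI[OF that(1)] that(2) unfolding acyclic_def cocycles_def coboundaries_def by blast
  have cA: "test_arrow1 \<tau> (cob N (n + 1)) * test_diff1 \<tau> N n = cdf N n V2 * test_arrow1 \<tau> (cob N n)" for n
    using hom_comm[OF cpx_hom[OF N], of n Alpha1] hom_comm[OF cpx_hom[OF N], of n Beta1]
    by (auto simp: test_arrow1_def test_diff1_def mat_distribs smult_dims_mult)
  have cB: "test_arrow2 \<tau> (cob N (n + 1)) * cdf N n V2 = test_diff3 \<tau> N n * test_arrow2 \<tau> (cob N n)" for n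
    using hom_comm[OF cpx_hom[OF N], of n Alpha2] hom_comm[OF cpx_hom[OF N], of n Beta2]
    by (auto simp: test_arrow2_def test_diff3_def mat_distribs smult_dims_mult)
  \<comment> \<open>The mixed products vanish by the relations of the quiver, the other two by
    \<open>is_test\<close>. This makes the error at the last stage a cocycle.\<close>
  have BA: "test_arrow2 \<tau> (cob N n) * test_arrow1 \<tau> (cob N n) = 0\<^sub>m (fdim (has3 \<tau>) (cdim N n V3)) (fdim (has1 \<tau>) (cdim N n V1))" for n
  proof (cases "has1 \<tau> \<and> has3 \<tau>")
    case True
    then have "coef_a2 \<tau> * coef_a1 \<tau> = 0" "coef_b2 \<tau> * coef_b1 \<tau> = 0" using g by (auto simp: is_test_def)
    moreover have "rmap (cob N n) Beta2 * rmap (cob N n) Alpha1 = 0\<^sub>m (cdim N n V3) (cdim N n V1)"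
      "rmap (cob N n) Alpha2 * rmap (cob N n) Beta1 = 0\<^sub>m (cdim N n V3) (cdim N n V1)"
      using r[of n] by (simp_all add: is_rep_def)
    ultimately show ?thesis using True
      by (auto simp: test_arrow1_def test_arrow2_def fdim_def mat_distribs smult_dims_mult mult.assoc[symmetric] intro!: eq_matI simp del: index_mult_mat(1))
  next
    case False
    then show ?thesis by (intro eq_matI) (auto simp: fdim_def split: if_splits simp del: index_mult_mat(1))
  qed
  obtain x1 where x1: "x1 \<in> carrier_vec (fdim (has1 \<tau>) (cdim N (-1) V1))" and yx1: "y1 = test_diff1 \<tau> N (-1) *\<^sub>v x1"
  proof (cases "has1 \<tau>")
    case True
    then show ?thesis using ac[of y1 0 V1] y1 e1 that by (auto simp: fdim_def test_diff1_def)
  next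
    case False
    then have "y1 = 0\<^sub>v 0" using y1 by (intro eq_vecI) (auto simp: fdim_def)
    then show ?thesis using False that[of "0\<^sub>v 0"] by (auto simp: fdim_def test_diff1_def)
  qed
  note x1d [simp] = carrier_vecD[OF x1] and y2d [simp] = carrier_vecD[OF y2] and y3d [simp] = carrier_vecD[OF y3]
  have "cdf N (-1) V2 *\<^sub>v (test_arrow1 \<tau> (cob N (-1)) *\<^sub>v x1) = cdf N (-1) V2 *\<^sub>v y2"
    using cA[of "-1"] by (simp add: e2[symmetric] yx1 mat_vec_assoc[symmetric])
  then have "cdf N (-1) V2 *\<^sub>v (y2 - test_arrow1 \<tau> (cob N (-1)) *\<^sub>v x1) = 0\<^sub>v (cdim N 0 V2)"
    by (simp add: mat_vec_distribs)
  then obtain x2 where x2: "x2 \<in> carrier_vec (cdim N (-2) V2)" and yx2: "y2 - test_arrow1 \<tau> (cob N (-1)) *\<^sub>v x1 = cdf N (-2) V2 *\<^sub>v x2"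
    using ac[of "y2 - test_arrow1 \<tau> (cob N (-1)) *\<^sub>v x1" "-1" V2] by (auto intro: carrier_vecI)
  note x2d [simp] = carrier_vecD[OF x2]
  have y2': "y2 = test_arrow1 \<tau> (cob N (-1)) *\<^sub>v x1 + cdf N (-2) V2 *\<^sub>v x2"
    unfolding yx2[symmetric] by (rule eq_vecI) (simp_all del: index_mult_mat_vec)
  have "test_arrow2 \<tau> (cob N (-1)) *\<^sub>v (test_arrow1 \<tau> (cob N (-1)) *\<^sub>v x1) = 0\<^sub>v (fdim (has3 \<tau>) (cdim N (-1) V3))"
    by (simp add: mat_vec_assoc[symmetric] BA)
  moreover have "test_arrow2 \<tau> (cob N (-1)) *\<^sub>v (cdf N (-2) V2 *\<^sub>v x2) = test_diff3 \<tau> N (-2) *\<^sub>v (test_arrow2 \<tau> (cob N (-2)) *\<^sub>v x2)"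
    using cB[of "-2"] by (simp add: mat_vec_assoc[symmetric])
  ultimately have "test_diff3 \<tau> N (-2) *\<^sub>v (test_arrow2 \<tau> (cob N (-2)) *\<^sub>v x2) = test_diff3 \<tau> N (-2) *\<^sub>v y3"
    unfolding e3[symmetric] y2' by (simp add: mat_vec_distribs)
  then have z3: "test_diff3 \<tau> N (-2) *\<^sub>v (y3 - test_arrow2 \<tau> (cob N (-2)) *\<^sub>v x2) = 0\<^sub>v (fdim (has3 \<tau>) (cdim N (-1) V3))"
    by (simp add: mat_vec_distribs)
  obtain x3 where x3: "x3 \<in> carrier_vec (fdim (has3 \<tau>) (cdim N (-3) V3))" and yx3: "y3 - test_arrow2 \<tau> (cob N (-2)) *\<^sub>v x2 = test_diff3 \<tau> N (-3) *\<^sub>v x3"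
  proof (cases "has3 \<tau>")
    case True
    then show ?thesis using ac[of "y3 - test_arrow2 \<tau> (cob N (-2)) *\<^sub>v x2" "-2" V3] z3 that by (auto simp: fdim_def test_diff3_def intro: carrier_vecI)
  next
    case False
    then have "y3 - test_arrow2 \<tau> (cob N (-2)) *\<^sub>v x2 = 0\<^sub>v 0" by (intro eq_vecI) (auto simp: fdim_def)
    then show ?thesis using False that[of "0\<^sub>v 0"] by (auto simp: fdim_def test_diff3_def)
  qed
  have "y3 = test_arrow2 \<tau> (cob N (-2)) *\<^sub>v x2 + test_diff3 \<tau> N (-3) *\<^sub>v x3"
    unfolding yx3[symmetric] by (rule eq_vecI) (simp_all del: index_mult_mat_vec)
  with x1 x2 x3 yx1 y2' show "\<exists>x1 \<in> carrier_vec (fdim (has1 \<tau>) (cdim N (-1) V1)). \<exists>x2 \<in> carrier_vec (cdim N (-2) V2).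
      \<exists>x3 \<in> carrier_vec (fdim (has3 \<tau>) (cdim N (-3) V3)).
        y1 = test_diff1 \<tau> N (-1) *\<^sub>v x1 \<and> y2 = test_arrow1 \<tau> (cob N (-1)) *\<^sub>v x1 + cdf N (-2) V2 *\<^sub>v x2 \<and>
        y3 = test_arrow2 \<tau> (cob N (-2)) *\<^sub>v x2 + test_diff3 \<tau> N (-3) *\<^sub>v x3" by blast
qed

definition q1 :: "'k :: field test \<Rightarrow> vertex \<Rightarrow> 'k mat" where
  "q1 \<tau> = pmf True V2 (projf (has1 \<tau>) V1) (if has1 \<tau> then vec2 (coef_a1 \<tau>) (coef_b1 \<tau>) else 0\<^sub>v 0)"

definition q2 :: "'k :: field test \<Rightarrow> vertex \<Rightarrow> 'k mat" where
  "q2 \<tau> = pmf (has3 \<tau>) V3 (projf True V2) (if has3 \<tau> then vec2 (coef_a2 \<tau>) (coef_b2 \<tau>) else 0\<^sub>v 0)"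

definition testc_ob :: "'k :: field test \<Rightarrow> int \<Rightarrow> 'k rep" where
  "testc_ob \<tau> n = (if n = 0 then projf (has1 \<tau>) V1 else if n = -1 then projf True V2
     else if n = -2 then projf (has3 \<tau>) V3 else zero_rep)"

definition testc :: "'k :: field test \<Rightarrow> 'k cpx" where
  "testc \<tau> = \<lparr>cob = testc_ob \<tau>, cdf = (\<lambda>n. if n = -1 then q1 \<tau> else if n = -2 then q2 \<tau>
     else (\<lambda>v. 0\<^sub>m (rdim (testc_ob \<tau> (n + 1)) v) (rdim (testc_ob \<tau> n) v)))\<rparr>"

lemma zero_rep_dim [simp]: "rdim zero_rep v = 0"
  by (simp add: zero_rep_def)

lemma proj_dims [simp]: "rdim (proj V1 :: 'k :: field rep) V2 = 2" "rdim (proj V1 :: 'k rep) V3 = 2" "rdim (proj V2 :: 'k rep) V3 = 2"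
  by (simp_all add: proj_def)

lemma testc_sel:
  "cob (testc \<tau>) 0 = projf (has1 \<tau>) V1" "cob (testc \<tau>) (-1) = projf True V2" "cob (testc \<tau>) (-2) = projf (has3 \<tau>) V3"
  "cdf (testc \<tau>) (-1) = q1 \<tau>" "cdf (testc \<tau>) (-2) = q2 \<tau>"
  "n \<noteq> -1 \<Longrightarrow> n \<noteq> -2 \<Longrightarrow> cdf (testc \<tau>) n v = 0\<^sub>m (cdim (testc \<tau>) (n + 1) v) (cdim (testc \<tau>) n v)"
  "n \<noteq> 0 \<Longrightarrow> n \<noteq> -1 \<Longrightarrow> n \<noteq> -2 \<Longrightarrow> cob (testc \<tau>) n = zero_rep"
  by (simp_all add: testc_def testc_ob_def)

lemma q1_hom: "is_rep_hom (projf True V2) (projf (has1 \<tau>) V1) (q1 \<tau>)"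
  unfolding q1_def by (rule pmf_is_hom) (auto simp: proj_is_rep zero_rep_is_rep fdim_def projf_def intro: carrier_vecI)

lemma q2_hom: "is_rep_hom (projf (has3 \<tau>) V3) (projf True V2) (q2 \<tau>)"
  unfolding q2_def by (rule pmf_is_hom) (auto simp: proj_is_rep zero_rep_is_rep fdim_def projf_def intro: carrier_vecI)

lemma genf_comp:
  assumes "is_rep_hom (projf b v) N f" "is_rep_hom N M g"
  shows "genf b v (\<lambda>u. g u * f u) = (if b then g v *\<^sub>v genf b v f else 0\<^sub>v 0)"
proof (cases b)
  case True
  have "dim_col (f v) = 1" "dim_row (f v) = rdim N v" "dim_col (g v) = rdim N v"
    using hom_carrier[OF assms(1), of v] hom_carrier[OF assms(2), of v] True by (simp_all add: projf_def)
  then have "col (g v * f v) 0 = g v *\<^sub>v col (f v) 0" by (intro eq_vecI) simp_all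
  with True show ?thesis by (simp add: genf_def)
qed (simp add: genf_def)

lemma genf_add:
  assumes "is_rep_hom (projf b v) M f" "is_rep_hom (projf b v) M g"
  shows "genf b v (\<lambda>u. f u + g u) = genf b v f + genf b v g"
  using hom_carrier[OF assms(1), of v] hom_carrier[OF assms(2), of v]
  by (cases b) (auto simp: genf_def projf_def intro!: eq_vecI)

lemma genf_zero: "genf b v (\<lambda>u. 0\<^sub>m (rdim M u) (rdim (projf b v :: 'k :: field rep) u)) = (0\<^sub>v (fdim b (rdim M v)) :: 'k vec)"
  by (cases b) (auto simp: genf_def projf_def fdim_def intro!: eq_vecI)

text \<open>Under the Yoneda lemma, precomposition with a differential of the test complex is the
  same combination of arrows acting on the representation.\<close>

lemma genf_q1:
  assumes M: "is_rep M" and y: "y \<in> carrier_vec (fdim (has1 \<tau>) (rdim M V1))"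
  shows "genf True V2 (\<lambda>u. pmf (has1 \<tau>) V1 M y u * q1 \<tau> u) = test_arrow1 \<tau> M *\<^sub>v y"
proof -
  have "genf True V2 (\<lambda>u. pmf (has1 \<tau>) V1 M y u * q1 \<tau> u) = pmf (has1 \<tau>) V1 M y V2 *\<^sub>v genf True V2 (q1 \<tau>)"
    using genf_comp[OF q1_hom pmf_is_hom[OF M y]] by simp
  also have "genf True V2 (q1 \<tau>) = (if has1 \<tau> then vec2 (coef_a1 \<tau>) (coef_b1 \<tau>) else 0\<^sub>v 0)"
    unfolding q1_def by (rule genf_pmf[of _ _ "if has1 \<tau> then 2 else 0"]) (auto simp: fdim_def intro: carrier_vecI)
  finally show ?thesis
    using rep_carrier[OF M, of Alpha1] rep_carrier[OF M, of Beta1] carrier_vecD[OF y]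
    by (auto simp: pmf_def pm_def test_arrow1_def fdim_def hst_colm_vec2 mat_vec_distribs smult_mult_vec intro!: eq_vecI)
qed

lemma genf_q2:
  assumes M: "is_rep M" and y: "y \<in> carrier_vec (rdim M V2)"
  shows "genf (has3 \<tau>) V3 (\<lambda>u. pmf True V2 M y u * q2 \<tau> u) = test_arrow2 \<tau> M *\<^sub>v y"
proof -
  have y': "y \<in> carrier_vec (fdim True (rdim M V2))" using y by (simp add: fdim_def)
  have "genf (has3 \<tau>) V3 (\<lambda>u. pmf True V2 M y u * q2 \<tau> u) = (if has3 \<tau> then pmf True V2 M y V3 *\<^sub>v genf (has3 \<tau>) V3 (q2 \<tau>) else 0\<^sub>v 0)"
    using genf_comp[OF q2_hom pmf_is_hom[OF M y']] by simp
  moreover have "genf (has3 \<tau>) V3 (q2 \<tau>) = (if has3 \<tau> then vec2 (coef_a2 \<tau>) (coef_b2 \<tau>) else 0\<^sub>v 0)"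
    unfolding q2_def by (rule genf_pmf[of _ _ 2]) (auto simp: fdim_def intro: carrier_vecI)
  ultimately show ?thesis
    using rep_carrier[OF M, of Alpha2] rep_carrier[OF M, of Beta2] carrier_vecD[OF y]
    by (auto simp: pmf_def pm_def test_arrow2_def hst_colm_vec2 mat_vec_distribs smult_mult_vec intro!: eq_vecI)
qed

text \<open>Only the composite out of \<open>P\<^sub>3\<close> needs an argument, and a map out of a
  projective vanishes once it kills the generator.\<close>

lemma is_cpx_testc:
  assumes g: "is_test \<tau>" shows "is_cpx (testc \<tau>)"
proof -
  have r: "is_rep (cob (testc \<tau>) n)" for n
    by (simp add: testc_def testc_ob_def projf_is_rep zero_rep_is_rep)
  have h: "is_rep_hom (cob (testc \<tau>) n) (cob (testc \<tau>) (n + 1)) (cdf (testc \<tau>) n)" for n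
  proof -
    consider "n = -1" | "n = -2" | "n \<noteq> -1" "n \<noteq> -2" by blast
    then show ?thesis
    proof cases
      case 1 then show ?thesis using q1_hom by (simp add: testc_sel)
    next
      case 2 then show ?thesis using q2_hom by (simp add: testc_sel)
    next
      case 3
      then have "cdf (testc \<tau>) n = (\<lambda>v. 0\<^sub>m (cdim (testc \<tau>) (n + 1) v) (cdim (testc \<tau>) n v))" by (intro ext) (simp add: testc_sel)
      then show ?thesis using hom_zero[OF r r] by simp
    qed
  qed
  note d = hom_carrier[OF h]
  have "cdf (testc \<tau>) (n + 1) v * cdf (testc \<tau>) n v = 0\<^sub>m (cdim (testc \<tau>) (n + 2) v) (cdim (testc \<tau>) n v)" for n v
  proof (cases "n = -2")
    case True
    have "is_rep_hom (projf (has3 \<tau>) V3) (projf (has1 \<tau>) V1) (\<lambda>u. q1 \<tau> u * q2 \<tau> u)"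
      by (rule hom_comp[OF projf_is_rep projf_is_rep projf_is_rep q2_hom q1_hom])
    moreover have "genf (has3 \<tau>) V3 (\<lambda>u. q1 \<tau> u * q2 \<tau> u) = 0\<^sub>v (fdim (has3 \<tau>) (rdim (projf (has1 \<tau>) V1 :: 'a rep) V3))"
    proof (cases "has1 \<tau> \<and> has3 \<tau>")
      case True
      have p: "is_rep (proj V1 :: 'a rep)" by (rule proj_is_rep)
      have v: "vec2 (coef_a1 \<tau>) (coef_b1 \<tau>) \<in> carrier_vec (rdim (proj V1 :: 'a rep) V2)" by (simp add: carrier_vecI)
      have "genf (has3 \<tau>) V3 (\<lambda>u. q1 \<tau> u * q2 \<tau> u) = test_arrow2 \<tau> (proj V1) *\<^sub>v vec2 (coef_a1 \<tau>) (coef_b1 \<tau>)"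
        using genf_q2[OF p v, of \<tau>] True by (simp add: q1_def projf_def)
      also have "\<dots> = coef_a2 \<tau> \<cdot>\<^sub>v (vec 1 (\<lambda>_. coef_a1 \<tau>) @\<^sub>v 0\<^sub>v 1) + coef_b2 \<tau> \<cdot>\<^sub>v (0\<^sub>v 1 @\<^sub>v vec 1 (\<lambda>_. coef_b1 \<tau>))"
        using True by (simp add: test_arrow2_def proj_def mat_vec_distribs smult_mult_vec vst_mult_vec vec2_def hst_mult_vec)
      also have "\<dots> = 0\<^sub>v 2"
        using g True by (intro eq_vecI) (auto simp: is_test_def mult.commute)
      finally show ?thesis using True by (simp add: fdim_def projf_def)
    next
      case False
      then show ?thesis using genf_carrier[OF calculation] by (auto simp: fdim_def projf_def intro!: eq_vecI)
    qed
    ultimately have "q1 \<tau> v * q2 \<tau> v = 0\<^sub>m (rdim (projf (has1 \<tau>) V1 :: 'a rep) v) (rdim (projf (has3 \<tau>) V3 :: 'a rep) v)"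
      by (intro hom_projf_eqI[OF projf_is_rep _ hom_zero[OF projf_is_rep projf_is_rep]]) (simp_all add: genf_zero)
    then show ?thesis using True by (simp add: testc_sel)
  next
    case False
    show ?thesis
    proof (cases "n = -1")
      case True
      then show ?thesis using d(2)[of "-1" v] d(3)[of "-1" v] by (simp add: testc_sel(6)[of 0])
    next
      case n: False
      then show ?thesis using False d(3)[of "n + 1" v] d(2)[of "n + 1" v] by (simp add: testc_sel(6)[of n])
    qed
  qed
  moreover have "{n. \<exists>v. cdim (testc \<tau>) n v \<noteq> 0} \<subseteq> {0, -1, -2}"
    by (auto simp: testc_def testc_ob_def split: if_splits)
  then have "finite {n. \<exists>v. cdim (testc \<tau>) n v \<noteq> 0}" by (rule finite_subset) simp
  ultimately show ?thesis using r h by (simp add: is_cpx_def)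
qed

section \<open>Chain maps out of a test complex\<close>

definition all_null :: "'k :: field cpx \<Rightarrow> 'k cpx \<Rightarrow> bool" where
  "all_null X Y \<longleftrightarrow> (\<forall>f. is_cmap X Y f \<longrightarrow> null_homotopic X Y f)"

lemma zero_cols_mat: "dim_row A = r \<Longrightarrow> dim_col A = 0 \<Longrightarrow> A * 0\<^sub>m 0 c = 0\<^sub>m r c" for A :: "'k :: field mat"
  by (rule eq_matI) (auto simp: scalar_prod_def)

context
  fixes \<tau> :: "'k :: field test" and Y :: "'k cpx"
  assumes g: "is_test \<tau>" and Y: "is_cpx Y"
begin

private lemma r: "is_rep (cob Y n)" by (rule cpx_rep[OF Y])

private lemma Q: "is_cpx (testc \<tau>)" by (rule is_cpx_testc[OF g])

private lemmas hd = cpx_hom[OF Y, of 0, simplified] cpx_hom[OF Y, of "-1", simplified] cpx_hom[OF Y, of "-2", simplified] cpx_hom[OF Y, of "-3", simplified]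

lemma D1_genf: "is_rep_hom (projf (has1 \<tau>) V1) (cob Y n) f \<Longrightarrow> genf (has1 \<tau>) V1 (\<lambda>u. cdf Y n u * f u) = test_diff1 \<tau> Y n *\<^sub>v genf (has1 \<tau>) V1 f"
  using genf_comp[OF _ cpx_hom[OF Y]] by (auto simp: test_diff1_def genf_def)

lemma D3_genf: "is_rep_hom (projf (has3 \<tau>) V3) (cob Y n) f \<Longrightarrow> genf (has3 \<tau>) V3 (\<lambda>u. cdf Y n u * f u) = test_diff3 \<tau> Y n *\<^sub>v genf (has3 \<tau>) V3 f"
  using genf_comp[OF _ cpx_hom[OF Y]] by (auto simp: test_diff3_def genf_def)

lemma D2_genf: "is_rep_hom (projf True V2) (cob Y n) f \<Longrightarrow> genf True V2 (\<lambda>u. cdf Y n u * f u) = cdf Y n V2 *\<^sub>v genf True V2 f"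
  using genf_comp[OF _ cpx_hom[OF Y]] by auto

lemma AA_genf:
  assumes "is_rep_hom (projf (has1 \<tau>) V1) (cob Y n) f"
  shows "genf True V2 (\<lambda>u. f u * q1 \<tau> u) = test_arrow1 \<tau> (cob Y n) *\<^sub>v genf (has1 \<tau>) V1 f"
  using genf_q1[OF r genf_carrier[OF assms]] pmf_genf[OF r assms] by simp

lemma BB_genf:
  assumes "is_rep_hom (projf True V2) (cob Y n) f"
  shows "genf (has3 \<tau>) V3 (\<lambda>u. f u * q2 \<tau> u) = test_arrow2 \<tau> (cob Y n) *\<^sub>v genf True V2 f"
  using genf_q2[OF r, of "genf True V2 f" n \<tau>] genf_carrier[OF assms] pmf_genf[OF r assms] by (simp add: fdim_def)

private lemmas comp1 = hom_comp[OF projf_is_rep projf_is_rep r q1_hom]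
private lemmas comp2 = hom_comp[OF projf_is_rep projf_is_rep r q2_hom]

text \<open>All identities between maps out of projectives are checked on generators, where they
  become the equations of \<open>test_exact\<close>.\<close>

lemma test_exact_imp_all_null:
  assumes ex: "test_exact \<tau> Y" shows "all_null (testc \<tau>) Y"
  unfolding all_null_def
proof (intro allI impI)
  fix f assume f: "is_cmap (testc \<tau>) Y f"
  have f0: "is_rep_hom (projf (has1 \<tau>) V1) (cob Y 0) (f 0)" and f1: "is_rep_hom (projf True V2) (cob Y (-1)) (f (-1))"
    and f2: "is_rep_hom (projf (has3 \<tau>) V3) (cob Y (-2)) (f (-2))"
    using cmap_hom[OF f, of 0] cmap_hom[OF f, of "-1"] cmap_hom[OF f, of "-2"] by (simp_all add: testc_sel)
  let ?y1 = "genf (has1 \<tau>) V1 (f 0)" and ?y2 = "genf True V2 (f (-1))" and ?y3 = "genf (has3 \<tau>) V3 (f (-2))"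
  have "cdf Y 0 u * f 0 u = 0\<^sub>m (cdim Y 1 u) (rdim (projf (has1 \<tau>) V1 :: 'k rep) u)" for u
    using cmap_comm[OF f, of 0 u] cmap_carrier[OF f, of 1 u] zero_cols_mat[of "f 1 u" "cdim Y 1 u"] by (simp add: testc_sel)
  then have e1: "test_diff1 \<tau> Y 0 *\<^sub>v ?y1 = 0\<^sub>v (fdim (has1 \<tau>) (cdim Y 1 V1))"
    by (simp add: D1_genf[OF f0, symmetric] genf_zero)
  have e2: "test_arrow1 \<tau> (cob Y 0) *\<^sub>v ?y1 = cdf Y (-1) V2 *\<^sub>v ?y2"
    using cmap_comm[OF f, of "-1"] by (simp add: AA_genf[OF f0, symmetric] D2_genf[OF f1, symmetric] testc_sel)
  have e3: "test_arrow2 \<tau> (cob Y (-1)) *\<^sub>v ?y2 = test_diff3 \<tau> Y (-2) *\<^sub>v ?y3"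
    using cmap_comm[OF f, of "-2"] by (simp add: BB_genf[OF f1, symmetric] D3_genf[OF f2, symmetric] testc_sel)
  have "?y2 \<in> carrier_vec (cdim Y (-1) V2)" using genf_carrier[OF f1] by (simp add: fdim_def)
  with ex e1 e2 e3 obtain x1 x2 x3 where x1: "x1 \<in> carrier_vec (fdim (has1 \<tau>) (cdim Y (-1) V1))"
    and x2: "x2 \<in> carrier_vec (cdim Y (-2) V2)" and x3: "x3 \<in> carrier_vec (fdim (has3 \<tau>) (cdim Y (-3) V3))"
    and y1: "?y1 = test_diff1 \<tau> Y (-1) *\<^sub>v x1" and y2: "?y2 = test_arrow1 \<tau> (cob Y (-1)) *\<^sub>v x1 + cdf Y (-2) V2 *\<^sub>v x2"
    and y3: "?y3 = test_arrow2 \<tau> (cob Y (-2)) *\<^sub>v x2 + test_diff3 \<tau> Y (-3) *\<^sub>v x3"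
    unfolding test_exact_def using genf_carrier[OF f0] genf_carrier[OF f2] by blast
  define h0 where "h0 = pmf (has1 \<tau>) V1 (cob Y (-1)) x1"
  define h1 where "h1 = pmf True V2 (cob Y (-2)) x2"
  define h2 where "h2 = pmf (has3 \<tau>) V3 (cob Y (-3)) x3"
  have x2': "x2 \<in> carrier_vec (fdim True (cdim Y (-2) V2))" using x2 by (simp add: fdim_def)
  have h0: "is_rep_hom (projf (has1 \<tau>) V1) (cob Y (-1)) h0" and h1: "is_rep_hom (projf True V2) (cob Y (-2)) h1"
    and h2: "is_rep_hom (projf (has3 \<tau>) V3) (cob Y (-3)) h2"
    unfolding h0_def h1_def h2_def by (rule pmf_is_hom[OF r x1], rule pmf_is_hom[OF r x2'], rule pmf_is_hom[OF r x3])
  have gh: "genf (has1 \<tau>) V1 h0 = x1" "genf True V2 h1 = x2" "genf (has3 \<tau>) V3 h2 = x3"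
    unfolding h0_def h1_def h2_def using genf_pmf[OF x1] genf_pmf[OF x2'] genf_pmf[OF x3] by auto
  define h where "h n = (if n = 0 then h0 else if n = -1 then h1 else if n = -2 then h2
    else (\<lambda>u. 0\<^sub>m (cdim Y (n - 1) u) (cdim (testc \<tau>) n u)))" for n
  have hsel: "h 0 = h0" "h (-1) = h1" "h (-2) = h2" by (simp_all add: h_def)
  have hh: "is_rep_hom (cob (testc \<tau>) n) (cob Y (n - 1)) (h n)" for n
    using h0 h1 h2 hom_zero[OF cpx_rep[OF Q, of n] r[of "n - 1"]]
    by (cases "n = 0"; cases "n = -1"; cases "n = -2") (simp_all add: h_def testc_sel)
  have E0: "f 0 u = cdf Y (-1) u * h0 u" for u
    by (rule hom_projf_eqI[OF r f0 hom_comp[OF projf_is_rep r r h0 hd(2)]]) (simp add: D1_genf[OF h0] gh y1)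
  have E1: "f (-1) u = cdf Y (-2) u * h1 u + h0 u * q1 \<tau> u" for u
  proof (rule hom_projf_eqI[OF r f1])
    note c1 = hom_comp[OF projf_is_rep r r h1 hd(3)] and c2 = comp1[OF h0]
    show "is_rep_hom (projf True V2) (cob Y (-1)) (\<lambda>u. cdf Y (-2) u * h1 u + h0 u * q1 \<tau> u)"
      by (rule hom_add[OF projf_is_rep r c1 c2])
    have "test_arrow1 \<tau> (cob Y (-1)) *\<^sub>v x1 + cdf Y (-2) V2 *\<^sub>v x2 = cdf Y (-2) V2 *\<^sub>v x2 + test_arrow1 \<tau> (cob Y (-1)) *\<^sub>v x1"
      using test_arrow_dims[OF r, of \<tau> "-1"] cpx_carrier[OF Y, of "-2" V2]
      by (intro eq_vecI) (simp_all add: add.commute del: index_mult_mat_vec)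
    then show "genf True V2 (f (-1)) = genf True V2 (\<lambda>u. cdf Y (-2) u * h1 u + h0 u * q1 \<tau> u)"
      by (simp add: genf_add[OF c1 c2] D2_genf[OF h1] AA_genf[OF h0] gh y2)
  qed
  have E2: "f (-2) u = cdf Y (-3) u * h2 u + h1 u * q2 \<tau> u" for u
  proof (rule hom_projf_eqI[OF r f2])
    note c1 = hom_comp[OF projf_is_rep r r h2 hd(4)] and c2 = comp2[OF h1]
    show "is_rep_hom (projf (has3 \<tau>) V3) (cob Y (-2)) (\<lambda>u. cdf Y (-3) u * h2 u + h1 u * q2 \<tau> u)"
      by (rule hom_add[OF projf_is_rep r c1 c2])
    have "test_arrow2 \<tau> (cob Y (-2)) *\<^sub>v x2 + test_diff3 \<tau> Y (-3) *\<^sub>v x3 = test_diff3 \<tau> Y (-3) *\<^sub>v x3 + test_arrow2 \<tau> (cob Y (-2)) *\<^sub>v x2"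
      using test_arrow_dims[OF r, of \<tau> "-2"] test_dims[OF Y, of \<tau> "-3"]
      by (intro eq_vecI) (simp_all add: add.commute del: index_mult_mat_vec)
    then show "genf (has3 \<tau>) V3 (f (-2)) = genf (has3 \<tau>) V3 (\<lambda>u. cdf Y (-3) u * h2 u + h1 u * q2 \<tau> u)"
      by (simp add: genf_add[OF c1 c2] D3_genf[OF h2] BB_genf[OF h1] gh y3)
  qed
  note fd = cmap_carrier[OF f] and hd' = hom_carrier[OF hh] and yd = cpx_carrier[OF Y] and qd = cpx_carrier[OF Q]
  have "f n u = cdf Y (n - 1) u * h n u + h (n + 1) u * cdf (testc \<tau>) n u" for n u
  proof -
    consider "n = 0" | "n = -1" | "n = -2" | "n \<noteq> 0" "n \<noteq> -1" "n \<noteq> -2" by blast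
    then show ?thesis
    proof cases
      case 1
      have "h 1 u * cdf (testc \<tau>) 0 u = 0\<^sub>m (cdim Y 0 u) (cdim (testc \<tau>) 0 u)"
        using hd'[of 1 u] zero_cols_mat[of "h 1 u"] by (simp add: testc_sel)
      with 1 E0[of u] fd[of 0 u] show ?thesis by (simp add: hsel)
    next
      case 2 with E1[of u] show ?thesis by (simp add: hsel testc_sel)
    next
      case 3 with E2[of u] show ?thesis by (simp add: hsel testc_sel)
    next
      case 4
      then show ?thesis using fd[of n u] qd[of n u] yd[of "n - 1" u] hd'[of "n + 1" u]
        by (intro empty_mat_eq) (simp_all add: testc_sel)
    qed
  qed
  with hh show "null_homotopic (testc \<tau>) Y f" unfolding null_homotopic_def htpy_def by blast
qed

text \<open>A solution of the three equations defines a chain map; evaluating a null-homotopy of it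
  on generators gives the preimage.\<close>

lemma all_null_imp_test_exact:
  assumes an: "all_null (testc \<tau>) Y" shows "test_exact \<tau> Y"
  unfolding test_exact_def
proof (intro ballI impI)
  fix y1 y2 y3
  assume y1: "y1 \<in> carrier_vec (fdim (has1 \<tau>) (cdim Y 0 V1))" and y2: "y2 \<in> carrier_vec (cdim Y (-1) V2)"
    and y3: "y3 \<in> carrier_vec (fdim (has3 \<tau>) (cdim Y (-2) V3))"
    and e1: "test_diff1 \<tau> Y 0 *\<^sub>v y1 = 0\<^sub>v (fdim (has1 \<tau>) (cdim Y 1 V1))"
    and e2: "test_arrow1 \<tau> (cob Y 0) *\<^sub>v y1 = cdf Y (-1) V2 *\<^sub>v y2" and e3: "test_arrow2 \<tau> (cob Y (-1)) *\<^sub>v y2 = test_diff3 \<tau> Y (-2) *\<^sub>v y3"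
  define f0 where "f0 = pmf (has1 \<tau>) V1 (cob Y 0) y1"
  define f1 where "f1 = pmf True V2 (cob Y (-1)) y2"
  define f2 where "f2 = pmf (has3 \<tau>) V3 (cob Y (-2)) y3"
  have y2': "y2 \<in> carrier_vec (fdim True (cdim Y (-1) V2))" using y2 by (simp add: fdim_def)
  have f0: "is_rep_hom (projf (has1 \<tau>) V1) (cob Y 0) f0" and f1: "is_rep_hom (projf True V2) (cob Y (-1)) f1"
    and f2: "is_rep_hom (projf (has3 \<tau>) V3) (cob Y (-2)) f2"
    unfolding f0_def f1_def f2_def by (rule pmf_is_hom[OF r y1], rule pmf_is_hom[OF r y2'], rule pmf_is_hom[OF r y3])
  have gf: "genf (has1 \<tau>) V1 f0 = y1" "genf True V2 f1 = y2" "genf (has3 \<tau>) V3 f2 = y3"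
    unfolding f0_def f1_def f2_def using genf_pmf[OF y1] genf_pmf[OF y2'] genf_pmf[OF y3] by auto
  define f where "f n = (if n = 0 then f0 else if n = -1 then f1 else if n = -2 then f2
    else (\<lambda>u. 0\<^sub>m (cdim Y n u) (cdim (testc \<tau>) n u)))" for n
  have fsel: "f 0 = f0" "f (-1) = f1" "f (-2) = f2" by (simp_all add: f_def)
  have fh: "is_rep_hom (cob (testc \<tau>) n) (cob Y n) (f n)" for n
    using f0 f1 f2 hom_zero[OF cpx_rep[OF Q, of n] r[of n]]
    by (cases "n = 0"; cases "n = -1"; cases "n = -2") (simp_all add: f_def testc_sel)
  have E0: "cdf Y 0 u * f0 u = 0\<^sub>m (cdim Y 1 u) (rdim (projf (has1 \<tau>) V1 :: 'k rep) u)" for u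
    by (rule hom_projf_eqI[OF r hom_comp[OF projf_is_rep r r f0 hd(1)] hom_zero[OF projf_is_rep r]]) (simp add: D1_genf[OF f0] gf e1 genf_zero)
  have E1: "f0 u * q1 \<tau> u = cdf Y (-1) u * f1 u" for u
    by (rule hom_projf_eqI[OF r comp1[OF f0] hom_comp[OF projf_is_rep r r f1 hd(2)]]) (simp add: D2_genf[OF f1] AA_genf[OF f0] gf e2)
  have E2: "f1 u * q2 \<tau> u = cdf Y (-2) u * f2 u" for u
    by (rule hom_projf_eqI[OF r comp2[OF f1] hom_comp[OF projf_is_rep r r f2 hd(3)]]) (simp add: D3_genf[OF f2] BB_genf[OF f1] gf e3)
  note fd = hom_carrier[OF fh] and yd = cpx_carrier[OF Y] and qd = cpx_carrier[OF Q]
  have "f (n + 1) u * cdf (testc \<tau>) n u = cdf Y n u * f n u" for n u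
  proof -
    consider "n = 0" | "n = -1" | "n = -2" | "n \<noteq> 0" "n \<noteq> -1" "n \<noteq> -2" by blast
    then show ?thesis
    proof cases
      case 1
      have "f 1 u * cdf (testc \<tau>) 0 u = 0\<^sub>m (cdim Y 1 u) (cdim (testc \<tau>) 0 u)"
        using fd[of 1 u] zero_cols_mat[of "f 1 u"] by (simp add: testc_sel)
      with 1 E0[of u] show ?thesis by (simp add: fsel testc_sel)
    next
      case 2 with E1[of u] show ?thesis by (simp add: fsel testc_sel)
    next
      case 3 with E2[of u] show ?thesis by (simp add: fsel testc_sel)
    next
      case 4
      then show ?thesis using fd[of n u] qd[of n u] yd[of n u] fd[of "n + 1" u]
        by (intro empty_mat_eq) (simp_all add: testc_sel)
    qed
  qed
  with fh have "is_cmap (testc \<tau>) Y f" by (simp add: is_cmap_def)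
  with an obtain h where h: "htpy (testc \<tau>) Y h f" unfolding all_null_def null_homotopic_def by blast
  have h0: "is_rep_hom (projf (has1 \<tau>) V1) (cob Y (-1)) (h 0)" and h1: "is_rep_hom (projf True V2) (cob Y (-2)) (h (-1))"
    and h2: "is_rep_hom (projf (has3 \<tau>) V3) (cob Y (-3)) (h (-2))"
    using htpy_hom[OF h, of 0] htpy_hom[OF h, of "-1"] htpy_hom[OF h, of "-2"] by (simp_all add: testc_sel)
  let ?x1 = "genf (has1 \<tau>) V1 (h 0)" and ?x2 = "genf True V2 (h (-1))" and ?x3 = "genf (has3 \<tau>) V3 (h (-2))"
  have "f0 u = cdf Y (-1) u * h 0 u" for u
  proof -
    have "h 1 u * cdf (testc \<tau>) 0 u = 0\<^sub>m (cdim Y 0 u) (cdim (testc \<tau>) 0 u)"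
      using htpy_carrier[OF h, of 1 u] zero_cols_mat[of "h 1 u"] by (simp add: testc_sel)
    then show ?thesis using htpy_eq[OF h, of 0 u] yd[of "-1" u] htpy_carrier[OF h, of 0 u] by (simp add: fsel)
  qed
  then have "f0 = (\<lambda>u. cdf Y (-1) u * h 0 u)" by blast
  then have x1: "y1 = test_diff1 \<tau> Y (-1) *\<^sub>v ?x1" using D1_genf[OF h0] gf(1) by simp
  have "f1 = (\<lambda>u. cdf Y (-2) u * h (-1) u + h 0 u * q1 \<tau> u)"
    using htpy_eq[OF h, of "-1"] by (auto simp: fsel testc_sel)
  then have x2: "y2 = cdf Y (-2) V2 *\<^sub>v ?x2 + test_arrow1 \<tau> (cob Y (-1)) *\<^sub>v ?x1"
    using gf(2) genf_add[OF hom_comp[OF projf_is_rep r r h1 hd(3)] comp1[OF h0]] D2_genf[OF h1] AA_genf[OF h0] by simp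
  have "f2 = (\<lambda>u. cdf Y (-3) u * h (-2) u + h (-1) u * q2 \<tau> u)"
    using htpy_eq[OF h, of "-2"] by (auto simp: fsel testc_sel)
  then have x3: "y3 = test_diff3 \<tau> Y (-3) *\<^sub>v ?x3 + test_arrow2 \<tau> (cob Y (-2)) *\<^sub>v ?x2"
    using gf(3) genf_add[OF hom_comp[OF projf_is_rep r r h2 hd(4)] comp2[OF h1]] D3_genf[OF h2] BB_genf[OF h1] by simp
  have c: "p + q = q + p" if "dim_vec p = dim_vec q" for p q :: "'k vec" using that by (auto simp: add.commute)
  have "y2 = test_arrow1 \<tau> (cob Y (-1)) *\<^sub>v ?x1 + cdf Y (-2) V2 *\<^sub>v ?x2"
    unfolding x2 by (rule c) (use test_arrow_dims[OF r, of \<tau> "-1"] yd[of "-2" V2] in simp)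
  moreover have "y3 = test_arrow2 \<tau> (cob Y (-2)) *\<^sub>v ?x2 + test_diff3 \<tau> Y (-3) *\<^sub>v ?x3"
    unfolding x3 by (rule c) (use test_arrow_dims[OF r, of \<tau> "-2"] test_dims[OF Y, of \<tau> "-3"] in simp)
  moreover have "?x2 \<in> carrier_vec (cdim Y (-2) V2)" using genf_carrier[OF h1] by (simp add: fdim_def)
  ultimately show "\<exists>x1 \<in> carrier_vec (fdim (has1 \<tau>) (cdim Y (-1) V1)). \<exists>x2 \<in> carrier_vec (cdim Y (-2) V2).
      \<exists>x3 \<in> carrier_vec (fdim (has3 \<tau>) (cdim Y (-3) V3)).
        y1 = test_diff1 \<tau> Y (-1) *\<^sub>v x1 \<and> y2 = test_arrow1 \<tau> (cob Y (-1)) *\<^sub>v x1 + cdf Y (-2) V2 *\<^sub>v x2 \<and>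
        y3 = test_arrow2 \<tau> (cob Y (-2)) *\<^sub>v x2 + test_diff3 \<tau> Y (-3) *\<^sub>v x3"
    using x1 genf_carrier[OF h0] genf_carrier[OF h2] by blast
qed

lemma all_null_testc_iff: "all_null (testc \<tau>) Y \<longleftrightarrow> test_exact \<tau> Y"
  using all_null_imp_test_exact test_exact_imp_all_null by blast

end

text \<open>The hypothesis \<open>KP\<close> is a form of homotopical projectivity. Maps out of
  \<open>Q\<close> then lift through quasi-isomorphisms up to homotopy, so fractions can be replaced
  by chain maps.\<close>

lemma all_null_hom_vanishes:
  assumes KP: "\<And>N. is_cpx N \<Longrightarrow> acyclic N \<Longrightarrow> all_null Q N"
    and Q: "is_cpx Q" and X: "is_cpx X" and Y: "is_cpx Y" and q: "quasi_iso Q X q"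
  shows "all_null Q Y \<longleftrightarrow> hom_vanishes X Y"
proof -
  note qc = quasi_iso_cmap[OF q]
  \<comment> \<open>The obstruction to the lift is a map from \<open>Q\<close> to an acyclic cone,
    null-homotopic by \<open>KP\<close>.\<close>
  have lift: "\<exists>k. is_cmap Q W k \<and> homotopic Q V g (cmap_comp s k)"
    if W: "is_cpx W" and V: "is_cpx V" and s: "quasi_iso W V s" and gm: "is_cmap Q V g" for W V s g
  proof -
    note sc = quasi_iso_cmap[OF s]
    have "null_homotopic Q (cone W V s) (cmap_comp (cone_in W V) g)"
      using KP[OF is_cpx_cone[OF W V sc] cone_acyclic[OF W V sc s]]
        cmap_comp_is_cmap[OF Q V is_cpx_cone[OF W V sc] gm cone_in_cmap[OF W V sc]] by (simp add: all_null_def)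
    from cone_lift_through[OF W V sc Q gm this] show ?thesis by metis
  qed
  show ?thesis
  proof
    assume an: "all_null Q Y"
    show "hom_vanishes X Y" unfolding hom_vanishes_def
    proof (intro allI impI)
      fix W s f assume W: "is_cpx W" and s: "quasi_iso W X s" and f: "is_cmap W Y f"
      obtain k where k: "is_cmap Q W k" and h: "homotopic Q X q (cmap_comp s k)" using lift[OF W X s qc] by blast
      note sc = quasi_iso_cmap[OF s]
      have "quasi_iso Q X (cmap_comp s k)"
        by (rule quasi_iso_homotopic[OF Q X qc cmap_comp_is_cmap[OF Q W X k sc] h q])
      then have "quasi_iso Q W k" by (rule quasi_iso_first[OF Q W X k sc s])
      moreover have "null_homotopic Q Y (cmap_comp f k)"
        using an cmap_comp_is_cmap[OF Q W Y k f] by (simp add: all_null_def)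
      ultimately show "\<exists>V u. is_cpx V \<and> quasi_iso V W u \<and> null_homotopic V Y (cmap_comp f u)" using Q by blast
    qed
  next
    assume z: "hom_vanishes X Y"
    show "all_null Q Y" unfolding all_null_def
    proof (intro allI impI)
      fix f assume f: "is_cmap Q Y f"
      obtain V u where V: "is_cpx V" and u: "quasi_iso V Q u" "is_cmap V Q u" and n: "null_homotopic V Y (cmap_comp f u)"
        using hom_vanishesE[OF z Q q f] .
      \<comment> \<open>Lifting the identity gives a section of \<open>u\<close> up to homotopy,
        which carries the null-homotopy on \<open>V\<close> back to \<open>Q\<close>.\<close>
      obtain k where k: "is_cmap Q V k" and h: "homotopic Q Q (cmap_id Q) (cmap_comp u k)"
        using lift[OF V Q u(1) cmap_id_is_cmap[OF Q]] by blast
      have "homotopic Q Y (cmap_comp f (cmap_id Q)) (cmap_comp f (cmap_comp u k))"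
        by (rule homotopic_comp_left[OF Q Q Y cmap_id_is_cmap[OF Q] cmap_comp_is_cmap[OF Q V Q k u(2)] f h])
      then have "homotopic Q Y f (cmap_comp (cmap_comp f u) k)"
        by (simp add: cmap_comp_id[OF f] cmap_comp_assoc[OF k u(2) f])
      moreover have "null_homotopic Q Y (cmap_comp (cmap_comp f u) k)" by (rule null_comp_right[OF Q V Y k n])
      ultimately show "null_homotopic Q Y f"
        using homotopic_null[OF Q Y f cmap_comp_is_cmap[OF Q V Y k cmap_comp_is_cmap[OF V Q Y u(2) f]]] by blast
    qed
  qed
qed

lemma test_exact_hom_vanishes:
  assumes g: "is_test \<tau>" and X: "is_cpx X" and Y: "is_cpx Y" and q: "quasi_iso (testc \<tau>) X q"
  shows "hom_vanishes X Y \<longleftrightarrow> test_exact \<tau> Y"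
  using all_null_hom_vanishes[OF _ is_cpx_testc[OF g] X Y q] all_null_testc_iff[OF g Y]
    all_null_testc_iff[OF g] test_exact_acyclic[OF g] by blast

text \<open>Serre duality: the total complex computing morphisms from \<open>testc \<tau>\<close> to \<open>Y\<close> is, after transposition,
  the one computing morphisms from \<open>testc (dual_test \<tau>)\<close> to the dual of \<open>Y\<close>, shifted by 2.\<close>

lemma hom_vanishes_serre:
  assumes g: "is_test \<tau>" and X: "is_cpx X" and q: "quasi_iso (testc \<tau>) X q"
    and X': "is_cpx X'" and q': "quasi_iso (testc (dual_test \<tau>)) X' q'"
    and Y: "is_cpx Y" and z: "hom_vanishes X Y"
  shows "hom_vanishes (cpx_shift (-2) Y) (dual_cpx X')"
proof -
  let ?Y = "cpx_shift 2 (dual_cpx Y)"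
  have Y': "is_cpx ?Y" by (rule is_cpx_shift[OF is_cpx_dual[OF Y]])
  have "test_exact (dual_test \<tau>) ?Y"
    using test_exact_dual[OF Y] z test_exact_hom_vanishes[OF g X Y q] by blast
  then have "hom_vanishes X' ?Y" using test_exact_hom_vanishes[OF is_test_dual[OF g] X' Y' q'] by blast
  then have "hom_vanishes (dual_cpx ?Y) (dual_cpx X')" using hom_vanishes_dual[OF X' Y'] by blast
  then show ?thesis by (simp add: dual_shift[OF is_cpx_dual[OF Y]])
qed

text \<open>The converse is the forward direction for the dual test, applied to the dual of
  \<open>Y\<close> shifted by 2.\<close>

lemma hom_vanishes_serre_iff:
  assumes g: "is_test \<tau>" and X: "is_cpx X" and q: "quasi_iso (testc \<tau>) X q"
    and X': "is_cpx X'" and q': "quasi_iso (testc (dual_test \<tau>)) X' q'" and Y: "is_cpx Y"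
  shows "hom_vanishes X Y \<longleftrightarrow> hom_vanishes (cpx_shift (-2) Y) (dual_cpx X')"
proof
  assume "hom_vanishes (cpx_shift (-2) Y) (dual_cpx X')"
  then have "hom_vanishes (dual_cpx (dual_cpx X')) (dual_cpx (cpx_shift (-2) Y))"
    using hom_vanishes_dual[OF is_cpx_shift[OF Y] is_cpx_dual[OF X']] by blast
  moreover have "dual_cpx (cpx_shift (-2) Y) = cpx_shift 2 (dual_cpx Y)"
    by (simp add: dual_cpx_def cpx_shift_def algebra_simps)
  ultimately have "hom_vanishes (cpx_shift (-2) (cpx_shift 2 (dual_cpx Y))) (dual_cpx X)"
    using hom_vanishes_serre[OF is_test_dual[OF g] X' q' X _ is_cpx_shift[OF is_cpx_dual[OF Y]]] q by simp
  then show "hom_vanishes X Y" using hom_vanishes_dual[OF X Y] by (simp add: cpx_shift_shift cpx_shift_0)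
qed (rule hom_vanishes_serre[OF g X q X' q' Y])

section \<open>Modules as complexes\<close>

definition conc :: "int \<Rightarrow> 'k :: field rep \<Rightarrow> 'k cpx" where
  "conc m V = \<lparr>cob = (\<lambda>n. if n = m then V else zero_rep),
     cdf = (\<lambda>n v. 0\<^sub>m (if n + 1 = m then rdim V v else 0) (if n = m then rdim V v else 0))\<rparr>"

lemma conc_sel [simp]: "cob (conc m V) n = (if n = m then V else zero_rep)"
  "cdf (conc m V) n v = 0\<^sub>m (if n + 1 = m then rdim V v else 0) (if n = m then rdim V v else 0)"
  by (simp_all add: conc_def)

lemma is_cpx_conc: "is_rep V \<Longrightarrow> is_cpx (conc m V)"
proof -
  assume V: "is_rep V"
  have r: "is_rep (cob (conc m V) n)" for n by (simp add: V zero_rep_is_rep)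
  have "is_rep_hom (cob (conc m V) n) (cob (conc m V) (n + 1)) (cdf (conc m V) n)" for n
  proof -
    have "cdf (conc m V) n = (\<lambda>v. 0\<^sub>m (cdim (conc m V) (n + 1) v) (cdim (conc m V) n v))" by (intro ext) simp
    then show ?thesis using hom_zero[OF r r] by metis
  qed
  moreover have "cdf (conc m V) (n + 1) v * cdf (conc m V) n v = 0\<^sub>m (cdim (conc m V) (n + 2) v) (cdim (conc m V) n v)" for n v
    by (simp add: eq_matI)
  moreover have "{n. \<exists>v. cdim (conc m V) n v \<noteq> 0} \<subseteq> {m}" by (auto split: if_splits)
  then have "finite {n. \<exists>v. cdim (conc m V) n v \<noteq> 0}" by (rule finite_subset) simp
  ultimately show ?thesis using r by (simp only: is_cpx_def) blast
qed

lemma cpx_shift_conc: "cpx_shift i (conc m V) = conc (m - i) V"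
  by (auto simp: cpx_shift_def conc_def intro!: ext)

lemma dual_zero_rep: "dual_rep zero_rep = zero_rep"
  by (simp add: dual_rep_def zero_rep_def)

lemma dual_conc: "dual_cpx (conc m V) = conc (- m) (dual_rep V)"
proof -
  have "- n = m \<longleftrightarrow> n = - m" "- n - 1 + 1 = m \<longleftrightarrow> n = - m" "- n - 1 = m \<longleftrightarrow> n + 1 = - m" for n by auto
  then show ?thesis by (auto simp: dual_cpx_def conc_def dual_zero_rep intro!: ext)
qed

lemma conc_coboundaries: "coboundaries (conc m V) n v = {0\<^sub>v (cdim (conc m V) n v)}"
  by (auto simp: coboundaries_def intro!: image_eqI[OF _ zero_carrier_vec])

lemma conc_cocycles: "cocycles (conc m V) n v = carrier_vec (cdim (conc m V) n v)"
  by (auto simp: cocycles_def)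

lemma quasi_iso_conc:
  fixes Q :: "'k :: field cpx"
  assumes Q: "is_cpx Q" and V: "is_rep V" and f: "is_cmap Q (conc m V) f"
    and ex: "\<And>n v x. n \<noteq> m \<Longrightarrow> x \<in> cocycles Q n v \<Longrightarrow> x \<in> coboundaries Q n v"
    and inj: "\<And>v x. x \<in> cocycles Q m v \<Longrightarrow> f m v *\<^sub>v x = 0\<^sub>v (rdim V v) \<Longrightarrow> x \<in> coboundaries Q m v"
    and sur: "\<And>v y. y \<in> carrier_vec (rdim V v) \<Longrightarrow> \<exists>x \<in> cocycles Q m v. f m v *\<^sub>v x = y"
  shows "quasi_iso Q (conc m V) f"
proof -
  have "coh_inj Q (conc m V) f"
    unfolding coh_inj_def conc_coboundaries
  proof (intro allI ballI impI)
    fix n v x assume "x \<in> cocycles Q n v" "f n v *\<^sub>v x \<in> {0\<^sub>v (cdim (conc m V) n v)}"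
    then show "x \<in> coboundaries Q n v" using ex[of n x v] inj[of x v] by (cases "n = m") auto
  qed
  moreover have "coh_surj Q (conc m V) f"
    unfolding coh_surj_def conc_coboundaries conc_cocycles
  proof (intro allI ballI)
    fix n v and y :: "'k vec" assume y: "y \<in> carrier_vec (cdim (conc m V) n v)"
    show "\<exists>x\<in>cocycles Q n v. y - f n v *\<^sub>v x \<in> {0\<^sub>v (cdim (conc m V) n v)}"
    proof (cases "n = m")
      case True
      then obtain x where x: "x \<in> cocycles Q m v" "f m v *\<^sub>v x = y" using sur y by force
      show ?thesis by (rule bexI[OF _ x(1)[folded True]]) (use True y x in auto)
    next
      case False
      then show ?thesis using y zero_coboundary[OF Q, of n v] coboundaries_cocycles[OF Q] cmap_carrier[OF f, of n v]
        by (intro bexI[of _ "0\<^sub>v (cdim Q n v)"]) (auto intro!: eq_vecI)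
    qed
  qed
  ultimately show ?thesis by (simp add: quasi_iso_iff f)
qed

definition sv :: "'k \<Rightarrow> 'k vec" where
  "sv a = vec 1 (\<lambda>_. a)"

lemma vec2_sv: "vec2 a b = sv a @\<^sub>v sv b"
  by (simp add: vec2_def sv_def)

lemma sv_simps [simp]:
  fixes a b :: "'k :: field"
  shows "dim_vec (sv a) = 1" "sv a = sv b \<longleftrightarrow> a = b" "sv a + sv b = sv (a + b)" "sv a - sv b = sv (a - b)" "- sv a = sv (- a)"
    "c \<cdot>\<^sub>v sv a = sv (c * a)" "1\<^sub>m 1 *\<^sub>v sv a = sv a" "0\<^sub>m 1 1 *\<^sub>v sv a = sv 0" "0\<^sub>v 1 = sv (0 :: 'k)"
    "sv a \<in> carrier_vec 1"
  by (auto simp: sv_def vec_eq_iff intro!: carrier_vecI)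

lemma vec2_index: "vec2 a b $ 0 = a" "vec2 a b $ 1 = b"
  by (simp_all add: vec2_def)

lemma vec2_eq: "dim_vec x = 2 \<Longrightarrow> dim_vec y = 2 \<Longrightarrow> x = y \<longleftrightarrow> x $ 0 = y $ 0 \<and> x $ 1 = y $ 1"
  by (auto simp: vec_eq_iff less_2_cases_iff One_nat_def)

lemma vec2_simps [simp]:
  fixes a b :: "'k :: field"
  shows "vec2 a b = vec2 c d \<longleftrightarrow> a = c \<and> b = d" "vec2 a b + vec2 c d = vec2 (a + c) (b + d)" "vec2 a b - vec2 c d = vec2 (a - c) (b - d)"
    "- vec2 a b = vec2 (- a) (- b)"
    "c \<cdot>\<^sub>v vec2 a b = vec2 (c * a) (c * b)" "0\<^sub>v 2 = vec2 0 (0 :: 'k)" "vec2 a b \<in> carrier_vec 2"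
  by (auto simp: vec2_eq vec2_index intro!: carrier_vecI)

lemma carrier_vec_small:
  "x \<in> carrier_vec 0 \<longleftrightarrow> x = 0\<^sub>v 0" "x \<in> carrier_vec 1 \<longleftrightarrow> (\<exists>a. x = sv a)" "x \<in> carrier_vec 2 \<longleftrightarrow> (\<exists>a b. x = vec2 a (b :: 'k :: field))"
proof -
  show "x \<in> carrier_vec 0 \<longleftrightarrow> x = 0\<^sub>v 0" by auto
  show "x \<in> carrier_vec 1 \<longleftrightarrow> (\<exists>a. x = sv a)"
  proof
    assume "x \<in> carrier_vec 1"
    then have "x = sv (x $ 0)" by (auto simp: sv_def vec_eq_iff)
    then show "\<exists>a. x = sv a" ..
  qed auto
  show "x \<in> carrier_vec 2 \<longleftrightarrow> (\<exists>a b. x = vec2 a b)"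
  proof
    assume "x \<in> carrier_vec 2"
    then have "x = vec2 (x $ 0) (x $ 1)" by (simp add: vec2_eq vec2_index)
    then show "\<exists>a b. x = vec2 a b" by blast
  qed auto
qed

lemma block_vec2:
  fixes A B :: "'k :: field mat"
  shows "dim_col A = 1 \<Longrightarrow> dim_col B = 1 \<Longrightarrow> dim_row B = dim_row A \<Longrightarrow> hst A B *\<^sub>v vec2 a b = A *\<^sub>v sv a + B *\<^sub>v sv b"
    "dim_col A = 1 \<Longrightarrow> dim_col B = 1 \<Longrightarrow> vst A B *\<^sub>v sv a = A *\<^sub>v sv a @\<^sub>v B *\<^sub>v sv a"
    "dim_col A = 2 \<Longrightarrow> dim_col B = 2 \<Longrightarrow> vst A B *\<^sub>v vec2 a b = A *\<^sub>v vec2 a b @\<^sub>v B *\<^sub>v vec2 a b"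
    "colm x *\<^sub>v sv a = a \<cdot>\<^sub>v x"
  by (simp_all add: vec2_sv hst_mult_vec vst_mult_vec)
    (auto intro!: eq_vecI simp: colm_def sv_def scalar_prod_def One_nat_def mult.commute)

lemmas small_vec = carrier_vec_small block_vec2 vec2_sv[symmetric] hst_colm_vec2

section \<open>Resolutions of the representations P, P', M and N\<close>

definition P'_rep :: "'k :: field rep" where
  "P'_rep = \<lparr>rdim = (\<lambda>_. 1),
      rmap = (\<lambda>a. case a of Alpha1 \<Rightarrow> 0\<^sub>m 1 1 | Alpha2 \<Rightarrow> 0\<^sub>m 1 1 | Beta1 \<Rightarrow> 1\<^sub>m 1 | Beta2 \<Rightarrow> 1\<^sub>m 1)\<rparr>"

definition M_rep :: "'k :: field rep" where
  "M_rep = \<lparr>rdim = (\<lambda>v. case v of V3 \<Rightarrow> 0 | _ \<Rightarrow> 1),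
      rmap = (\<lambda>a. case a of Alpha1 \<Rightarrow> 1\<^sub>m 1 | Beta1 \<Rightarrow> 1\<^sub>m 1 | _ \<Rightarrow> 0\<^sub>m 0 1)\<rparr>"

definition N_rep :: "'k :: field rep" where
  "N_rep = \<lparr>rdim = (\<lambda>v. case v of V1 \<Rightarrow> 0 | _ \<Rightarrow> 1),
      rmap = (\<lambda>a. case a of Alpha2 \<Rightarrow> 1\<^sub>m 1 | Beta2 \<Rightarrow> 1\<^sub>m 1 | _ \<Rightarrow> 0\<^sub>m 1 0)\<rparr>"

lemma arrow_all: "(\<forall>a. Q a) \<longleftrightarrow> Q Alpha1 \<and> Q Beta1 \<and> Q Alpha2 \<and> Q Beta2"
  by (metis arrow.exhaust)

lemma small_reps: "is_rep P_rep" "is_rep P'_rep" "is_rep M_rep" "is_rep N_rep"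
  by (auto simp: is_rep_def arrow_all P_rep_def P'_rep_def M_rep_def N_rep_def intro!: empty_mat_eq)

lemma dual_small_reps: "dual_rep P_rep = P_rep" "dual_rep P'_rep = P'_rep" "dual_rep M_rep = N_rep"
proof -
  have e: "A = B" if "rdim A = rdim B" "rmap A = rmap B" for A B :: "'k rep" using that by (cases A; cases B) simp
  show "dual_rep P_rep = P_rep" "dual_rep P'_rep = P'_rep" "dual_rep M_rep = N_rep"
    by (rule e; (rule ext, rename_tac x, case_tac x; simp add: P_rep_def P'_rep_def M_rep_def N_rep_def))+
qed

definition test_P :: "'k :: field test" where
  "test_P = \<lparr>has1 = True, has3 = True, coef_a1 = 0, coef_b1 = 1, coef_a2 = 1, coef_b2 = 0\<rparr>"

definition test_M :: "'k :: field test" where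
  "test_M = \<lparr>has1 = True, has3 = False, coef_a1 = 1, coef_b1 = -1, coef_a2 = 0, coef_b2 = 0\<rparr>"

lemma good_tests: "is_test test_P" "is_test test_M"
  by (simp_all add: is_test_def test_P_def test_M_def)

lemma testc_vec:
  fixes \<tau> :: "'k :: field test"
  shows "has1 \<tau> \<Longrightarrow> q1 \<tau> V2 *\<^sub>v sv t = vec2 (t * coef_a1 \<tau>) (t * coef_b1 \<tau>)"
    "has1 \<tau> \<Longrightarrow> q1 \<tau> V3 *\<^sub>v vec2 s t = vec2 (s * coef_a1 \<tau>) (t * coef_b1 \<tau>)"
    "has3 \<tau> \<Longrightarrow> q2 \<tau> V3 *\<^sub>v sv t = vec2 (t * coef_a2 \<tau>) (t * coef_b2 \<tau>)"
  by (simp_all add: q1_def q2_def pmf_def pm_def projf_def proj_def small_vec)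

lemma testc_dims:
  fixes \<tau> :: "'k :: field test"
  shows "cdim (testc \<tau>) 0 V1 = (if has1 \<tau> then 1 else 0)" "cdim (testc \<tau>) 0 V2 = (if has1 \<tau> then 2 else 0)"
    "cdim (testc \<tau>) 0 V3 = (if has1 \<tau> then 2 else 0)" "cdim (testc \<tau>) (-1) V1 = 0" "cdim (testc \<tau>) (-1) V2 = 1" "cdim (testc \<tau>) (-1) V3 = 2"
    "cdim (testc \<tau>) (-2) V1 = 0" "cdim (testc \<tau>) (-2) V2 = 0" "cdim (testc \<tau>) (-2) V3 = (if has3 \<tau> then 1 else 0)"
    "n \<noteq> 0 \<Longrightarrow> n \<noteq> -1 \<Longrightarrow> n \<noteq> -2 \<Longrightarrow> cdim (testc \<tau>) n v = 0"
  by (simp_all add: testc_sel) (auto simp: projf_def proj_def)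

lemmas testc_d = testc_sel(4,5,6)

lemma coboundary_zero_dim: "is_cpx X \<Longrightarrow> cdim X n v = 0 \<Longrightarrow> x \<in> cocycles X n v \<Longrightarrow> x \<in> coboundaries X n v"
  using zero_coboundary[of X n v] by (simp add: cocycles_def carrier_vec_small)

text \<open>The augmentation of a test complex, given by an element of the representation at the generator.\<close>

lemma augment0:
  fixes \<tau> :: "'k :: field test"
  assumes g: "is_test \<tau>" and V: "is_rep V" and t: "has1 \<tau>" and e: "e \<in> carrier_vec (rdim V V1)"
    and z: "test_arrow1 \<tau> V *\<^sub>v e = 0\<^sub>v (rdim V V2)"
  defines "f \<equiv> \<lambda>n. if n = 0 then pmf True V1 V e else (\<lambda>v. 0\<^sub>m 0 (cdim (testc \<tau>) n v))"
  shows "is_cmap (testc \<tau>) (conc 0 V) f"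
proof -
  have e': "e \<in> carrier_vec (fdim (has1 \<tau>) (rdim V V1))" using e t by (simp add: fdim_def)
  have r: "is_rep (cob (testc \<tau>) n)" for n by (rule cpx_rep[OF is_cpx_testc[OF g]])
  have p: "is_rep_hom (projf True V1) V (pmf True V1 V e)" using pmf_is_hom[OF V e'] t by simp
  have h: "is_rep_hom (cob (testc \<tau>) n) (cob (conc 0 V) n) (f n)" for n
    using p t hom_zero[OF r[of n] zero_rep_is_rep] by (auto simp: f_def testc_sel)
  have qh: "is_rep_hom (projf True V2) V (\<lambda>u. pmf True V1 V e u * q1 \<tau> u)"
    using hom_comp[OF projf_is_rep projf_is_rep V q1_hom, of \<tau> "pmf True V1 V e"] p t by simp
  have "pmf True V1 V e u * q1 \<tau> u = 0\<^sub>m (rdim V u) (rdim (projf True V2 :: 'k rep) u)" for u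
    using genf_q1[OF V e'] t z
    by (intro hom_projf_eqI[OF V qh hom_zero[OF projf_is_rep V]]) (simp add: genf_zero[where 'k = 'k] fdim_def)
  then have "f (n + 1) u * cdf (testc \<tau>) n u = cdf (conc 0 V) n u * f n u" for n u
    using hom_carrier[OF h, of "n + 1" u] hom_carrier[OF h, of n u] cpx_carrier[OF is_cpx_testc[OF g], of n u]
    by (cases "n = -1") (auto simp: f_def testc_sel intro!: eq_matI split: if_splits)
  with h show ?thesis by (simp add: is_cmap_def)
qed

text \<open>The swap of the two families of arrows is carried along by the flag \<open>s\<close>.\<close>

lemma quasi_iso_test_P:
  fixes s :: bool
  defines "\<tau> \<equiv> if s then dual_test test_P else (test_P :: 'k :: field test)" and "V \<equiv> if s then P'_rep else P_rep"
  shows "\<exists>q. quasi_iso (testc \<tau>) (conc 0 V) q"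
proof -
  let ?f = "\<lambda>n. if n = 0 then pmf True V1 V (sv 1) else (\<lambda>v. 0\<^sub>m 0 (cdim (testc \<tau>) n v))"
  have \<tau> [simp]: "has1 \<tau>" "has3 \<tau>" "coef_a1 \<tau> = (if s then 1 else 0)" "coef_b1 \<tau> = (if s then 0 else 1)"
    "coef_a2 \<tau> = (if s then 0 else 1)" "coef_b2 \<tau> = (if s then 1 else 0)" by (simp_all add: \<tau>_def test_P_def dual_test_def)
  have V: "is_rep V" by (simp add: V_def small_reps)
  have g: "is_test \<tau>" by (simp add: is_test_def)
  have Q: "is_cpx (testc \<tau>)" by (rule is_cpx_testc[OF g])
  have rd: "rdim V v = 1" for v by (simp add: V_def P_rep_def P'_rep_def)
  have f: "is_cmap (testc \<tau>) (conc 0 V) ?f"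
    by (rule augment0[OF g V]; cases s) (simp_all add: test_arrow1_def rd V_def P_rep_def P'_rep_def mat_vec_distribs smult_mult_vec)
  have fv: "pmf True V1 V (sv 1) V1 *\<^sub>v sv a = sv a" "pmf True V1 V (sv 1) V2 *\<^sub>v vec2 a b = sv (if s then b else a)"
    "pmf True V1 V (sv 1) V3 *\<^sub>v vec2 a b = sv (if s then b else a)" for a b
    by (cases s; simp add: pmf_def pm_def V_def P_rep_def P'_rep_def small_vec)+
  have "quasi_iso (testc \<tau>) (conc 0 V) ?f"
  proof (rule quasi_iso_conc[OF Q V f])
    fix n v x assume n: "n \<noteq> 0" and x: "x \<in> cocycles (testc \<tau>) n v"
    consider "n = -1" "v = V2" | "n = -1" "v = V3" | "n = -2" "v = V3" | "cdim (testc \<tau>) n v = 0"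
      using n by (cases v; cases "n = -1"; cases "n = -2") (auto simp: testc_dims)
    then show "x \<in> coboundaries (testc \<tau>) n v"
    proof cases
      case 1
      with x have "x = 0\<^sub>v 1" by (auto simp: cocycles_def testc_dims small_vec testc_d testc_vec split: if_splits)
      then show ?thesis using zero_coboundary[OF Q, of n v] 1 by (simp add: testc_dims)
    next
      case 2
      with x obtain a where "x = vec2 (if s then 0 else a) (if s then a else 0)"
        by (auto simp: cocycles_def testc_dims small_vec testc_d testc_vec split: if_splits)
      then show ?thesis using 2
        by (auto simp: coboundaries_def testc_d testc_dims testc_vec intro!: image_eqI[of _ _ "sv a"])
    next
      case 3
      with x have "x = 0\<^sub>v 1" by (auto simp: cocycles_def testc_dims small_vec testc_d testc_vec split: if_splits)
      then show ?thesis using zero_coboundary[OF Q, of n v] 3 by (simp add: testc_dims)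
    qed (rule coboundary_zero_dim[OF Q _ x])
  next
    fix v x assume x: "x \<in> cocycles (testc \<tau>) 0 v" and z: "?f 0 v *\<^sub>v x = 0\<^sub>v (rdim V v)"
    show "x \<in> coboundaries (testc \<tau>) 0 v"
    proof (cases v)
      case V1
      with x z have "x = 0\<^sub>v 1" by (auto simp: cocycles_def testc_dims small_vec fv rd)
      then show ?thesis using zero_coboundary[OF Q, of 0 v] V1 by (simp add: testc_dims)
    next
      case V2
      with x z obtain b where "x = vec2 (if s then b else 0) (if s then 0 else b)"
        by (auto simp: cocycles_def testc_dims small_vec fv rd split: if_splits)
      then show ?thesis using V2
        by (auto simp: coboundaries_def testc_d testc_dims testc_vec intro!: image_eqI[of _ _ "sv b"])
    next
      case V3
      with x z obtain b where "x = vec2 (if s then b else 0) (if s then 0 else b)"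
        by (auto simp: cocycles_def testc_dims small_vec fv rd split: if_splits)
      \<comment> \<open>Exactly one diagonal coefficient of \<open>q1\<close> is nonzero; writing
        \<open>b\<close> in both coordinates covers both values of \<open>s\<close>.\<close>
      then show ?thesis using V3
        by (auto simp: coboundaries_def testc_d testc_dims testc_vec intro!: image_eqI[of _ _ "vec2 b b"])
    qed
  next
    fix v and y :: "'k vec" assume "y \<in> carrier_vec (rdim V v)"
    then obtain a where y: "y = sv a" by (auto simp: rd small_vec)
    have c: "x \<in> carrier_vec (cdim (testc \<tau>) 0 v) \<Longrightarrow> x \<in> cocycles (testc \<tau>) 0 v" for x
      by (cases v) (simp_all add: cocycles_def testc_d testc_dims)
    show "\<exists>x \<in> cocycles (testc \<tau>) 0 v. ?f 0 v *\<^sub>v x = y"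
    proof (cases v)
      case V1 then show ?thesis using c[of "sv a"] fv y by (intro bexI[of _ "sv a"]) (auto simp: testc_dims)
    next
      case V2 then show ?thesis using c[of "vec2 a a"] fv y by (intro bexI[of _ "vec2 a a"]) (auto simp: testc_dims)
    next
      case V3 then show ?thesis using c[of "vec2 a a"] fv y by (intro bexI[of _ "vec2 a a"]) (auto simp: testc_dims)
    qed
  qed
  then show ?thesis by blast
qed

text \<open>At \<open>V2\<close> the augmentation is the sum of coordinates and its kernel is
  spanned by the image of \<open>q1\<close>; at \<open>V3\<close> the differential is bijective, in
  accordance with M vanishing there.\<close>

lemma quasi_iso_test_M: "\<exists>q. quasi_iso (testc test_M) (conc 0 (M_rep :: 'k :: field rep)) q"
proof -
  let ?\<tau> = "test_M :: 'k test" and ?V = "M_rep :: 'k rep"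
  let ?f = "\<lambda>n. if n = 0 then pmf True V1 ?V (sv 1) else (\<lambda>v. 0\<^sub>m 0 (cdim (testc ?\<tau>) n v))"
  have \<tau> [simp]: "has1 ?\<tau>" "\<not> has3 ?\<tau>" "coef_a1 ?\<tau> = 1" "coef_b1 ?\<tau> = -1" by (simp_all add: test_M_def)
  have Q: "is_cpx (testc ?\<tau>)" by (rule is_cpx_testc[OF good_tests(2)])
  have rd: "rdim ?V V1 = 1" "rdim ?V V2 = 1" "rdim ?V V3 = 0" by (simp_all add: M_rep_def)
  have f: "is_cmap (testc ?\<tau>) (conc 0 ?V) ?f"
    by (rule augment0[OF good_tests(2) small_reps(3)]) (simp_all add: test_arrow1_def M_rep_def mat_vec_distribs smult_mult_vec)
  have fv: "pmf True V1 ?V (sv 1) V1 *\<^sub>v sv a = sv a" "pmf True V1 ?V (sv 1) V2 *\<^sub>v vec2 a b = sv (a + b)" for a b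
    by (simp_all add: pmf_def pm_def M_rep_def small_vec)
  have "quasi_iso (testc ?\<tau>) (conc 0 ?V) ?f"
  proof (rule quasi_iso_conc[OF Q small_reps(3) f])
    fix n v x assume n: "n \<noteq> 0" and x: "x \<in> cocycles (testc ?\<tau>) n v"
    consider "n = -1" "v = V2" | "n = -1" "v = V3" | "cdim (testc ?\<tau>) n v = 0"
      using n by (cases v; cases "n = -1"; cases "n = -2") (auto simp: testc_dims)
    then show "x \<in> coboundaries (testc ?\<tau>) n v"
    proof cases
      case 1
      with x have "x = 0\<^sub>v 1" by (auto simp: cocycles_def testc_dims small_vec testc_d testc_vec)
      then show ?thesis using zero_coboundary[OF Q, of n v] 1 by (simp add: testc_dims)
    next
      case 2
      with x have "x = 0\<^sub>v 2" by (auto simp: cocycles_def testc_dims small_vec testc_d testc_vec)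
      then show ?thesis using zero_coboundary[OF Q, of n v] 2 by (simp add: testc_dims)
    qed (rule coboundary_zero_dim[OF Q _ x])
  next
    fix v x assume x: "x \<in> cocycles (testc ?\<tau>) 0 v" and z: "?f 0 v *\<^sub>v x = 0\<^sub>v (rdim ?V v)"
    show "x \<in> coboundaries (testc ?\<tau>) 0 v"
    proof (cases v)
      case V1
      with x z have "x = 0\<^sub>v 1" by (auto simp: cocycles_def testc_dims small_vec fv rd)
      then show ?thesis using zero_coboundary[OF Q, of 0 v] V1 by (simp add: testc_dims)
    next
      case V2
      with x z obtain a where "x = vec2 a (- a)"
        by (auto simp: cocycles_def testc_dims small_vec fv rd add_eq_0_iff)
      then show ?thesis using V2
        by (auto simp: coboundaries_def testc_d testc_dims testc_vec intro!: image_eqI[of _ _ "sv a"])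
    next
      case V3
      with x obtain a b where "x = vec2 a b" by (auto simp: cocycles_def testc_dims small_vec)
      then show ?thesis using V3
        by (auto simp: coboundaries_def testc_d testc_dims testc_vec intro!: image_eqI[of _ _ "vec2 a (- b)"])
    qed
  next
    fix v and y :: "'k vec" assume y: "y \<in> carrier_vec (rdim ?V v)"
    have c: "x \<in> carrier_vec (cdim (testc ?\<tau>) 0 v) \<Longrightarrow> x \<in> cocycles (testc ?\<tau>) 0 v" for x
      by (cases v) (simp_all add: cocycles_def testc_d testc_dims)
    show "\<exists>x \<in> cocycles (testc ?\<tau>) 0 v. ?f 0 v *\<^sub>v x = y"
    proof (cases v)
      case V1 with y obtain a where "y = sv a" by (auto simp: rd small_vec)
      then show ?thesis using V1 c[of "sv a"] fv by (intro bexI[of _ "sv a"]) (auto simp: testc_dims)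
    next
      case V2 with y obtain a where "y = sv a" by (auto simp: rd small_vec)
      then show ?thesis using V2 c[of "vec2 a 0"] fv by (intro bexI[of _ "vec2 a 0"]) (auto simp: testc_dims)
    next
      case V3
      have "?f 0 V3 *\<^sub>v vec2 0 0 = y" using cmap_carrier[OF f, of 0 V3] y V3 by (intro eq_vecI) (auto simp: rd)
      then show ?thesis using V3 c[of "vec2 0 0"] by (intro bexI[of _ "vec2 0 0"]) (auto simp: testc_dims)
    qed
  qed
  then show ?thesis by blast
qed

text \<open>The dual test has no term in degree 0, so its augmentation ends in degree -1. This
  displacement lowers the shift for M from 2 to 1.\<close>

lemma quasi_iso_test_N: "\<exists>q. quasi_iso (testc (dual_test test_M)) (conc (-1) (N_rep :: 'k :: field rep)) q"
proof -
  let ?\<tau> = "dual_test test_M :: 'k test" and ?V = "N_rep :: 'k rep"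
  let ?p = "pmf True V2 ?V (sv 1)"
  let ?f = "\<lambda>n. if n = -1 then ?p else (\<lambda>v. 0\<^sub>m 0 (cdim (testc ?\<tau>) n v))"
  have \<tau> [simp]: "\<not> has1 ?\<tau>" "has3 ?\<tau>" "coef_a2 ?\<tau> = 1" "coef_b2 ?\<tau> = -1" by (simp_all add: test_M_def dual_test_def)
  have g: "is_test ?\<tau>" by (rule is_test_dual[OF good_tests(2)])
  have Q: "is_cpx (testc ?\<tau>)" by (rule is_cpx_testc[OF g])
  have rd: "rdim ?V V1 = 0" "rdim ?V V2 = 1" "rdim ?V V3 = 1" by (simp_all add: N_rep_def)
  have V: "is_rep ?V" by (rule small_reps(4))
  have p: "is_rep_hom (projf True V2) ?V ?p" by (rule pmf_is_hom[OF V]) (simp add: fdim_def rd)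
  have r: "is_rep (cob (testc ?\<tau>) n)" for n by (rule cpx_rep[OF Q])
  have h: "is_rep_hom (cob (testc ?\<tau>) n) (cob (conc (-1) ?V) n) (?f n)" for n
    using p hom_zero[OF r[of n] zero_rep_is_rep] by (auto simp: testc_sel)
  have qh: "is_rep_hom (projf True V3) ?V (\<lambda>u. ?p u * q2 ?\<tau> u)"
    using hom_comp[OF projf_is_rep projf_is_rep V q2_hom p, of ?\<tau>] by simp
  have "genf True V3 (\<lambda>u. ?p u * q2 ?\<tau> u) = test_arrow2 ?\<tau> ?V *\<^sub>v sv 1"
    using genf_q2[OF V, of "sv 1" ?\<tau>] by (simp add: rd)
  also have "\<dots> = sv 0" by (simp add: test_arrow2_def N_rep_def mat_vec_distribs smult_mult_vec)
  finally have "?p u * q2 ?\<tau> u = 0\<^sub>m (rdim ?V u) (rdim (projf True V3 :: 'k rep) u)" for u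
    by (intro hom_projf_eqI[OF V qh hom_zero[OF projf_is_rep V]]) (simp add: genf_zero[where 'k = 'k] fdim_def rd)
  then have "?f (n + 1) u * cdf (testc ?\<tau>) n u = cdf (conc (-1) ?V) n u * ?f n u" for n u
    using hom_carrier[OF h, of "n + 1" u] hom_carrier[OF h, of n u] cpx_carrier[OF Q, of n u]
    by (cases "n = -2") (auto simp: testc_sel intro!: eq_matI split: if_splits)
  with h have f: "is_cmap (testc ?\<tau>) (conc (-1) ?V) ?f" unfolding is_cmap_def by blast
  have fv: "?p V2 *\<^sub>v sv a = sv a" "?p V3 *\<^sub>v vec2 a b = sv (a + b)" for a b
    by (simp_all add: pmf_def pm_def N_rep_def small_vec)
  have "quasi_iso (testc ?\<tau>) (conc (-1) ?V) ?f"
  proof (rule quasi_iso_conc[OF Q V f])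
    fix n v x assume n: "n \<noteq> -1" and x: "x \<in> cocycles (testc ?\<tau>) n v"
    consider "n = -2" "v = V3" | "cdim (testc ?\<tau>) n v = 0"
      using n by (cases v; cases "n = 0"; cases "n = -2") (auto simp: testc_dims)
    then show "x \<in> coboundaries (testc ?\<tau>) n v"
    proof cases
      case 1
      with x have "x = 0\<^sub>v 1" by (auto simp: cocycles_def testc_dims small_vec testc_d testc_vec)
      then show ?thesis using zero_coboundary[OF Q, of n v] 1 by (simp add: testc_dims)
    qed (rule coboundary_zero_dim[OF Q _ x])
  next
    fix v x assume x: "x \<in> cocycles (testc ?\<tau>) (-1) v" and z: "?f (-1) v *\<^sub>v x = 0\<^sub>v (rdim ?V v)"
    show "x \<in> coboundaries (testc ?\<tau>) (-1) v"
    proof (cases v)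
      case V1
      then show ?thesis using x by (intro coboundary_zero_dim[OF Q]) (simp_all add: testc_dims)
    next
      case V2
      with x z have "x = 0\<^sub>v 1" by (auto simp: cocycles_def testc_dims small_vec fv rd)
      then show ?thesis using zero_coboundary[OF Q, of "-1" v] V2 by (simp add: testc_dims)
    next
      case V3
      with x z obtain a where "x = vec2 a (- a)"
        by (auto simp: cocycles_def testc_dims small_vec fv rd add_eq_0_iff)
      then show ?thesis using V3
        by (auto simp: coboundaries_def testc_d testc_dims testc_vec intro!: image_eqI[of _ _ "sv a"])
    qed
  next
    fix v and y :: "'k vec" assume y: "y \<in> carrier_vec (rdim ?V v)"
    have c: "x \<in> carrier_vec (cdim (testc ?\<tau>) (-1) v) \<Longrightarrow> x \<in> cocycles (testc ?\<tau>) (-1) v" for x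
      using cpx_carrier[OF Q, of "-1" v] testc_dims(1-3)[of ?\<tau>] by (cases v) (auto simp: cocycles_def intro!: eq_vecI)
    show "\<exists>x \<in> cocycles (testc ?\<tau>) (-1) v. ?f (-1) v *\<^sub>v x = y"
    proof (cases v)
      case V1
      have "?f (-1) V1 *\<^sub>v 0\<^sub>v 0 = y" using cmap_carrier[OF f, of "-1" V1] y V1 by (intro eq_vecI) (auto simp: rd)
      then show ?thesis using V1 c[of "0\<^sub>v 0"] by (intro bexI[of _ "0\<^sub>v 0"]) (auto simp: testc_dims)
    next
      case V2 with y obtain a where "y = sv a" by (auto simp: rd small_vec)
      then show ?thesis using V2 c[of "sv a"] fv by (intro bexI[of _ "sv a"]) (auto simp: testc_dims)
    next
      case V3 with y obtain a where "y = sv a" by (auto simp: rd small_vec)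
      then show ?thesis using V3 c[of "vec2 a 0"] fv by (intro bexI[of _ "vec2 a 0"]) (auto simp: testc_dims)
    qed
  qed
  then show ?thesis by blast
qed

section \<open>Serre duality for P, P' and M\<close>

text \<open>The dual of the resolution of P resolves P', and transposition fixes both
  representations: the Serre functor of the whole derived category exchanges P and P' up to the
  shift by 2.\<close>

lemma serre_P:
  assumes "is_cpx Y"
  shows "hom_vanishes (conc 0 P_rep) Y \<longleftrightarrow> hom_vanishes (cpx_shift (-2) Y) (conc 0 P'_rep)"
    "hom_vanishes (conc 0 P'_rep) Y \<longleftrightarrow> hom_vanishes (cpx_shift (-2) Y) (conc 0 P_rep)"
proof -
  obtain q q' where q: "quasi_iso (testc test_P) (conc 0 (P_rep :: 'a rep)) q"
    and q': "quasi_iso (testc (dual_test test_P)) (conc 0 (P'_rep :: 'a rep)) q'"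
    using quasi_iso_test_P[of False] quasi_iso_test_P[of True] by auto
  note c = is_cpx_conc[OF small_reps(1), of 0] is_cpx_conc[OF small_reps(2), of 0]
  show "hom_vanishes (conc 0 P_rep) Y \<longleftrightarrow> hom_vanishes (cpx_shift (-2) Y) (conc 0 P'_rep)"
    using hom_vanishes_serre_iff[OF good_tests(1) c(1) q c(2) q' assms] by (simp add: dual_conc dual_small_reps)
  show "hom_vanishes (conc 0 P'_rep) Y \<longleftrightarrow> hom_vanishes (cpx_shift (-2) Y) (conc 0 P_rep)"
    using hom_vanishes_serre_iff[OF is_test_dual[OF good_tests(1)] c(2) q' c(1) _ assms] q by (simp add: dual_conc dual_small_reps)
qed

text \<open>N in degree -1 transposes to M in degree 1, and a shift by 2 then leaves M in degree -1,
  which is \<open>cpx_shift 1\<close> of M in degree 0.\<close>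

lemma serre_M:
  assumes Y: "is_cpx Y"
  shows "hom_vanishes (conc 0 M_rep) Y \<longleftrightarrow> hom_vanishes Y (cpx_shift 1 (conc 0 M_rep))"
proof -
  obtain q q' where q: "quasi_iso (testc test_M) (conc 0 (M_rep :: 'a rep)) q"
    and q': "quasi_iso (testc (dual_test test_M)) (conc (-1) (N_rep :: 'a rep)) q'"
    using quasi_iso_test_M quasi_iso_test_N by blast
  have "dual_rep N_rep = (M_rep :: 'a rep)" using dual_rep_dual[of "M_rep :: 'a rep"] by (simp add: dual_small_reps)
  then have "hom_vanishes (conc 0 M_rep) Y \<longleftrightarrow> hom_vanishes (cpx_shift (-2) Y) (conc 1 M_rep)"
    using hom_vanishes_serre_iff[OF good_tests(2) is_cpx_conc[OF small_reps(3)] q is_cpx_conc[OF small_reps(4)] q' Y] by (simp add: dual_conc)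
  also have "\<dots> \<longleftrightarrow> hom_vanishes (cpx_shift 2 (cpx_shift (-2) Y)) (cpx_shift 2 (conc 1 M_rep))"
    by (rule hom_vanishes_shift[OF is_cpx_shift[OF Y] is_cpx_conc[OF small_reps(3)], symmetric])
  finally show ?thesis by (simp add: cpx_shift_shift cpx_shift_0 cpx_shift_conc)
qed

definition rep_exact :: "'k :: field rep \<Rightarrow> bool" where
  "rep_exact V \<longleftrightarrow> (\<forall>x \<in> carrier_vec (rdim V V1). rmap V Beta1 *\<^sub>v x = 0\<^sub>v (rdim V V2) \<longrightarrow> x = 0\<^sub>v (rdim V V1)) \<and>
     (\<forall>y \<in> carrier_vec (rdim V V2). rmap V Alpha2 *\<^sub>v y = 0\<^sub>v (rdim V V3) \<longrightarrow> (\<exists>x \<in> carrier_vec (rdim V V1). y = rmap V Beta1 *\<^sub>v x)) \<and>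
     (\<forall>z \<in> carrier_vec (rdim V V3). \<exists>y \<in> carrier_vec (rdim V V2). rmap V Alpha2 *\<^sub>v y = z)"

lemma arrow_cdf_vec:
  assumes "is_cpx Y" "dim_vec x = cdim Y n (src a)"
  shows "rmap (cob Y (n + 1)) a *\<^sub>v (cdf Y n (src a) *\<^sub>v x) = cdf Y n (tgt a) *\<^sub>v (rmap (cob Y n) a *\<^sub>v x)"
  using hom_comm[OF cpx_hom[OF assms(1)], of n a] assms(2) cpx_carrier[OF assms(1)]
    rep_carrier[OF cpx_rep[OF assms(1)]]
  by (simp add: mat_vec_assoc[symmetric])

lemma rep_exact_hom_vanishes:
  assumes Y: "is_cpx Y" and ex: "\<And>n. rep_exact (cob Y n)"
  shows "hom_vanishes (conc 0 P_rep) Y"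
proof -
  obtain q where q: "quasi_iso (testc test_P) (conc 0 (P_rep :: 'a rep)) q" using quasi_iso_test_P[of False] by auto
  have r: "is_rep (cob Y n)" for n by (rule cpx_rep[OF Y])
  note [simp] = cpx_carrier[OF Y] rep_carrier[OF r]
  have A: "test_arrow1 test_P (cob Y n) *\<^sub>v x = rmap (cob Y n) Beta1 *\<^sub>v x" if "dim_vec x = cdim Y n V1" for n x
    using that by (simp add: test_arrow1_def test_P_def mat_vec_distribs smult_mult_vec) (auto intro!: eq_vecI)
  have B: "test_arrow2 test_P (cob Y n) *\<^sub>v x = rmap (cob Y n) Alpha2 *\<^sub>v x" if "dim_vec x = cdim Y n V2" for n x
    using that by (simp add: test_arrow2_def test_P_def mat_vec_distribs smult_mult_vec) (auto intro!: eq_vecI)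
  have t: "has1 (test_P :: 'a test)" "has3 (test_P :: 'a test)" by (simp_all add: test_P_def)
  have D: "test_diff1 test_P Y n = cdf Y n V1" "test_diff3 test_P Y n = cdf Y n V3" for n by (simp_all add: test_diff1_def test_diff3_def test_P_def)
  have "test_exact test_P Y" unfolding test_exact_def
  proof (intro ballI impI)
    fix y1 y2 y3
    assume "y1 \<in> carrier_vec (fdim (has1 (test_P :: 'a test)) (cdim Y 0 V1))" and y2: "y2 \<in> carrier_vec (cdim Y (-1) V2)"
      and "y3 \<in> carrier_vec (fdim (has3 (test_P :: 'a test)) (cdim Y (-2) V3))"
      and e2: "test_arrow1 test_P (cob Y 0) *\<^sub>v y1 = cdf Y (-1) V2 *\<^sub>v y2" and e3: "test_arrow2 test_P (cob Y (-1)) *\<^sub>v y2 = test_diff3 test_P Y (-2) *\<^sub>v y3"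
    then have y1: "y1 \<in> carrier_vec (cdim Y 0 V1)" and y3: "y3 \<in> carrier_vec (cdim Y (-2) V3)" by (simp_all add: fdim_def t)
    note yd [simp] = carrier_vecD[OF y1] carrier_vecD[OF y2] carrier_vecD[OF y3]
    obtain u where u: "u \<in> carrier_vec (cdim Y (-2) V2)" "rmap (cob Y (-2)) Alpha2 *\<^sub>v u = y3"
      using ex[of "-2"] y3 unfolding rep_exact_def by blast
    note ud [simp] = carrier_vecD[OF u(1)]
    have "rmap (cob Y (-1)) Alpha2 *\<^sub>v (y2 - cdf Y (-2) V2 *\<^sub>v u) = 0\<^sub>v (cdim Y (-1) V3)"
      using arrow_cdf_vec[OF Y, of u "-2" Alpha2] e3 by (simp add: mat_vec_distribs u(2) B D)
    moreover have "y2 - cdf Y (-2) V2 *\<^sub>v u \<in> carrier_vec (cdim Y (-1) V2)" by (rule carrier_vecI) simp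
    ultimately obtain w where w: "w \<in> carrier_vec (cdim Y (-1) V1)" "y2 - cdf Y (-2) V2 *\<^sub>v u = rmap (cob Y (-1)) Beta1 *\<^sub>v w"
      using ex[of "-1"] unfolding rep_exact_def by blast
    note wd [simp] = carrier_vecD[OF w(1)]
    have "cdf Y (-1) V2 * cdf Y (-2) V2 = 0\<^sub>m (cdim Y 0 V2) (cdim Y (-2) V2)" using cpx_sq[OF Y, of "-2" V2] by simp
    then have dd: "cdf Y (-1) V2 *\<^sub>v (cdf Y (-2) V2 *\<^sub>v u) = 0\<^sub>v (cdim Y 0 V2)" by (simp add: mat_vec_assoc[symmetric])
    have "rmap (cob Y 0) Beta1 *\<^sub>v (y1 - cdf Y (-1) V1 *\<^sub>v w) = 0\<^sub>v (cdim Y 0 V2)"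
      using arrow_cdf_vec[OF Y, of w "-1" Beta1] e2 by (simp add: mat_vec_distribs w(2)[symmetric] A dd)
    moreover have "y1 - cdf Y (-1) V1 *\<^sub>v w \<in> carrier_vec (cdim Y 0 V1)" by (rule carrier_vecI) simp
    ultimately have z: "y1 - cdf Y (-1) V1 *\<^sub>v w = 0\<^sub>v (cdim Y 0 V1)" using ex[of 0] unfolding rep_exact_def by blast
    have "y1 = cdf Y (-1) V1 *\<^sub>v w"
    proof (rule eq_vecI)
      fix i assume "i < dim_vec (cdf Y (-1) V1 *\<^sub>v w)"
      then show "y1 $ i = (cdf Y (-1) V1 *\<^sub>v w) $ i"
        using arg_cong[OF z, of "\<lambda>x. x $ i"] by (simp del: index_mult_mat_vec)
    qed simp
    moreover have "y2 = rmap (cob Y (-1)) Beta1 *\<^sub>v w + cdf Y (-2) V2 *\<^sub>v u"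
      unfolding w(2)[symmetric] by (rule eq_vecI) (simp_all del: index_mult_mat_vec)
    moreover have "y3 = rmap (cob Y (-2)) Alpha2 *\<^sub>v u + cdf Y (-3) V3 *\<^sub>v 0\<^sub>v (cdim Y (-3) V3)" using u(2) by simp
    ultimately show "\<exists>x1 \<in> carrier_vec (fdim (has1 (test_P :: 'a test)) (cdim Y (-1) V1)). \<exists>x2 \<in> carrier_vec (cdim Y (-2) V2).
      \<exists>x3 \<in> carrier_vec (fdim (has3 (test_P :: 'a test)) (cdim Y (-3) V3)).
        y1 = test_diff1 test_P Y (-1) *\<^sub>v x1 \<and> y2 = test_arrow1 test_P (cob Y (-1)) *\<^sub>v x1 + cdf Y (-2) V2 *\<^sub>v x2 \<and>
        y3 = test_arrow2 test_P (cob Y (-2)) *\<^sub>v x2 + test_diff3 test_P Y (-3) *\<^sub>v x3"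
      using w(1) u(1) by (intro bexI[of _ w] bexI[of _ u] bexI[of _ "0\<^sub>v (cdim Y (-3) V3)"]) (simp_all add: fdim_def t D A B)
  qed
  then show ?thesis using test_exact_hom_vanishes[OF good_tests(1) is_cpx_conc[OF small_reps(1)] Y q] by blast
qed

section \<open>The object B and its triangle\<close>

definition E0_rep :: "'k :: field rep" where
  "E0_rep = \<lparr>rdim = (\<lambda>v. case v of V2 \<Rightarrow> 2 | _ \<Rightarrow> 1),
      rmap = (\<lambda>a. case a of Alpha1 \<Rightarrow> vst (0\<^sub>m 1 1) (0\<^sub>m 1 1) | Beta1 \<Rightarrow> vst (1\<^sub>m 1) (0\<^sub>m 1 1)
        | Alpha2 \<Rightarrow> hst (0\<^sub>m 1 1) (1\<^sub>m 1) | Beta2 \<Rightarrow> hst (1\<^sub>m 1) (0\<^sub>m 1 1))\<rparr>"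

definition E1_rep :: "'k :: field rep" where
  "E1_rep = \<lparr>rdim = (\<lambda>v. case v of V2 \<Rightarrow> 2 | _ \<Rightarrow> 1),
      rmap = (\<lambda>a. case a of Alpha1 \<Rightarrow> vst (1\<^sub>m 1) (0\<^sub>m 1 1) | Beta1 \<Rightarrow> vst (0\<^sub>m 1 1) (1\<^sub>m 1)
        | Alpha2 \<Rightarrow> hst (1\<^sub>m 1) (0\<^sub>m 1 1) | Beta2 \<Rightarrow> hst (0\<^sub>m 1 1) (0\<^sub>m 1 1))\<rparr>"

definition B_map :: "vertex \<Rightarrow> 'k :: field mat" where
  "B_map v = (case v of V2 \<Rightarrow> vst (hst (0\<^sub>m 1 1) (0\<^sub>m 1 1)) (hst (0\<^sub>m 1 1) (1\<^sub>m 1)) | _ \<Rightarrow> 0\<^sub>m 1 1)"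

definition B_ob :: "int \<Rightarrow> 'k :: field rep" where
  "B_ob n = (if n = 0 then E0_rep else if n = 1 then E1_rep else zero_rep)"

definition B_dim :: "int \<Rightarrow> vertex \<Rightarrow> nat" where
  "B_dim n v = (if n = 0 \<or> n = 1 then (case v of V2 \<Rightarrow> 2 | _ \<Rightarrow> 1) else 0)"

text \<open>The 3-spherical object: an extension of $P[-1]$ by the representation \<open>P'_rep\<close>, obtained from \<open>P_rep\<close> by exchanging
  the roles of $\alpha$ and $\beta$.\<close>

definition B_cpx :: "'k :: field cpx" where
  "B_cpx = \<lparr>cob = B_ob, cdf = (\<lambda>n. if n = 0 then B_map else (\<lambda>v. 0\<^sub>m (B_dim (n + 1) v) (B_dim n v)))\<rparr>"

lemma B_dim_sel [simp]: "B_dim 0 V1 = 1" "B_dim 0 V2 = 2" "B_dim 0 V3 = 1" "B_dim 1 V1 = 1" "B_dim 1 V2 = 2" "B_dim 1 V3 = 1"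
  "n \<noteq> 0 \<Longrightarrow> n \<noteq> 1 \<Longrightarrow> B_dim n v = 0"
  by (simp_all add: B_dim_def)

lemma B_ob_dim [simp]: "rdim (B_ob n) v = B_dim n v"
  by (cases v) (simp_all add: B_ob_def B_dim_def E0_rep_def E1_rep_def)

lemma E_reps: "is_rep E0_rep" "is_rep E1_rep"
  by (auto simp: is_rep_def arrow_all E0_rep_def E1_rep_def hst_mult_vst intro!: carrier_matI)

lemma E_dims [simp]: "rdim E0_rep V1 = 1" "rdim E0_rep V2 = 2" "rdim E0_rep V3 = 1"
  "rdim E1_rep V1 = 1" "rdim E1_rep V2 = 2" "rdim E1_rep V3 = 1"
  by (simp_all add: E0_rep_def E1_rep_def)

lemma B_sel: "cob B_cpx n = B_ob n" "cdf B_cpx 0 = B_map"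
  "n \<noteq> 0 \<Longrightarrow> cdf (B_cpx :: 'k :: field cpx) n v = 0\<^sub>m (B_dim (n + 1) v) (B_dim n v)"
  by (simp_all add: B_cpx_def)

lemma B_ob_sel: "B_ob 0 = E0_rep" "B_ob 1 = E1_rep" "n \<noteq> 0 \<Longrightarrow> n \<noteq> 1 \<Longrightarrow> B_ob n = zero_rep"
  by (simp_all add: B_ob_def)

lemma B_ob_is_rep: "is_rep (B_ob n)"
  by (simp add: B_ob_def E_reps zero_rep_is_rep)

lemma is_rep_homI:
  assumes "\<And>v. dim_row (f v) = rdim N v \<and> dim_col (f v) = rdim M v" "\<And>a. f (tgt a) * rmap M a = rmap N a * f (src a)"
  shows "is_rep_hom M N f"
  using assms by (auto simp: is_rep_hom_def intro!: carrier_matI)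

lemma B_map_hom: "is_rep_hom E0_rep E1_rep B_map"
proof (rule is_rep_homI)
  fix v show "dim_row (B_map v :: 'a mat) = rdim (E1_rep :: 'a rep) v \<and> dim_col (B_map v :: 'a mat) = rdim (E0_rep :: 'a rep) v"
    by (cases v) (simp_all add: B_map_def)
next
  fix a show "B_map (tgt a) * rmap E0_rep a = rmap E1_rep a * (B_map (src a) :: 'a mat)"
    by (cases a) (simp_all add: B_map_def E0_rep_def E1_rep_def hst_mult_vst mult_hst vst_mult hst_arith hst_zero vst_zero)
qed

lemma is_cpx_B: "is_cpx (B_cpx :: 'k :: field cpx)"
proof -
  have h: "is_rep_hom (cob (B_cpx :: 'k cpx) n) (cob B_cpx (n + 1)) (cdf B_cpx n)" for n
  proof (cases "n = 0")
    case True then show ?thesis using B_map_hom by (simp add: B_sel B_ob_sel)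
  next
    case False
    then have "cdf (B_cpx :: 'k cpx) n = (\<lambda>v. 0\<^sub>m (B_dim (n + 1) v) (B_dim n v))" by (intro ext) (simp add: B_sel)
    then show ?thesis using hom_zero[OF B_ob_is_rep B_ob_is_rep] by (simp add: B_sel)
  qed
  note d = hom_carrier[OF h]
  have "cdf (B_cpx :: 'k cpx) (n + 1) v * cdf B_cpx n v = 0\<^sub>m (cdim B_cpx (n + 2) v) (cdim B_cpx n v)" for n v
    using d(2,3)[of n v] d(2,3)[of "n + 1" v] by (cases "n = 0") (simp_all add: B_sel)
  moreover have "{n. \<exists>v. cdim (B_cpx :: 'k cpx) n v \<noteq> 0} \<subseteq> {0, 1}" by (auto simp: B_sel B_ob_def split: if_splits)
  then have "finite {n. \<exists>v. cdim (B_cpx :: 'k cpx) n v \<noteq> 0}" by (rule finite_subset) simp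
  ultimately show ?thesis using h by (simp add: is_cpx_def B_sel B_ob_is_rep)
qed

lemma rep_exacts: "rep_exact (zero_rep :: 'a :: field rep)" "rep_exact (M_rep :: 'a rep)" "rep_exact (E0_rep :: 'a rep)" "rep_exact (E1_rep :: 'a rep)"
proof -
  show "rep_exact (zero_rep :: 'a rep)" by (auto simp: rep_exact_def carrier_vec_small zero_rep_def)
  show "rep_exact (M_rep :: 'a rep)" by (auto simp: rep_exact_def carrier_vec_small M_rep_def)
  have ex: "(\<exists>x \<in> carrier_vec 1. Q x) \<longleftrightarrow> (\<exists>a. Q (sv a))" "(\<exists>x \<in> carrier_vec 2. R x) \<longleftrightarrow> (\<exists>a b. R (vec2 a b))" for Q R :: "'a vec \<Rightarrow> bool"
    by (metis carrier_vec_small(2)) (metis carrier_vec_small(3))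
  show "rep_exact (E0_rep :: 'a rep)" by (simp add: rep_exact_def E0_rep_def ex) (auto simp: small_vec)
  show "rep_exact (E1_rep :: 'a rep)" by (simp add: rep_exact_def E1_rep_def ex) (auto simp: small_vec)
qed

lemma perp_M: "hom_vanishes (conc 0 P_rep) (cpx_shift i (conc 0 M_rep))"
  by (rule rep_exact_hom_vanishes[OF is_cpx_shift[OF is_cpx_conc[OF small_reps(3)]]]) (simp add: rep_exacts)

lemma perp_B: "hom_vanishes (conc 0 P_rep) (cpx_shift i B_cpx)"
  by (rule rep_exact_hom_vanishes[OF is_cpx_shift[OF is_cpx_B]]) (simp add: rep_exacts B_sel B_ob_def)

lemma not_acyclic_M: "\<not> acyclic (conc 0 M_rep :: 'k :: field cpx)"
proof
  assume "acyclic (conc 0 M_rep :: 'k cpx)"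
  then have "carrier_vec 1 \<subseteq> {0\<^sub>v 1 :: 'k vec}"
    unfolding acyclic_def conc_cocycles conc_coboundaries by (auto simp: M_rep_def dest!: spec[of _ 0] spec[of _ V1])
  moreover have "sv (1 :: 'k) \<in> carrier_vec 1" by simp
  ultimately have "sv (1 :: 'k) = 0\<^sub>v 1" by blast
  then show False by simp
qed

lemma not_acyclic_B: "\<not> acyclic (B_cpx :: 'k :: field cpx)"
proof
  assume "acyclic (B_cpx :: 'k cpx)"
  \<comment> \<open>\<open>B_map\<close> is zero at \<open>V1\<close>, so the degree 1 term survives
    there in cohomology.\<close>
  moreover have "sv (1 :: 'k) \<in> cocycles B_cpx 1 V1" by (auto simp: cocycles_def B_sel B_ob_sel)
  ultimately have "sv (1 :: 'k) \<in> coboundaries B_cpx 1 V1" by (auto simp: acyclic_def)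
  then show False by (auto simp: coboundaries_def B_sel B_ob_sel B_map_def small_vec)
qed

text \<open>The inclusion of P' as the kernel of \<open>B_map\<close>; \<open>B_out\<close> below is
  the projection onto its cokernel P in degree 1.\<close>

definition B_in :: "'k :: field cmap" where
  "B_in n v = (if n = 0 then (case v of V2 \<Rightarrow> vst (1\<^sub>m 1) (0\<^sub>m 1 1) | _ \<Rightarrow> 1\<^sub>m 1)
     else 0\<^sub>m (B_dim n v) 0)"

definition B_out :: "'k :: field cmap" where
  "B_out n v = (if n = 1 then (case v of V2 \<Rightarrow> hst (1\<^sub>m 1) (0\<^sub>m 1 1) | _ \<Rightarrow> 1\<^sub>m 1)
     else 0\<^sub>m 0 (B_dim n v))"

lemma P_dims [simp]: "rdim P_rep v = 1" "rdim P'_rep v = 1"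
  by (simp_all add: P_rep_def P'_rep_def)

lemma B_in_cmap: "is_cmap (conc 0 P'_rep) B_cpx B_in"
proof -
  have "is_rep_hom P'_rep E0_rep (B_in 0 :: vertex \<Rightarrow> 'a mat)"
  proof (rule is_rep_homI)
    fix v show "dim_row (B_in 0 v :: 'a mat) = rdim (E0_rep :: 'a rep) v \<and> dim_col (B_in 0 v :: 'a mat) = rdim (P'_rep :: 'a rep) v"
      by (cases v) (simp_all add: B_in_def)
  next
    fix a show "B_in 0 (tgt a) * rmap P'_rep a = rmap E0_rep a * (B_in 0 (src a) :: 'a mat)"
      by (cases a) (simp_all add: B_in_def E0_rep_def P'_rep_def hst_mult_vst mult_hst vst_mult vst_zero)
  qed
  then have h: "is_rep_hom (cob (conc 0 P'_rep) n) (cob B_cpx n) (B_in n :: vertex \<Rightarrow> 'a mat)" for n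
    by (cases "n = 0") (auto simp: B_sel B_ob_sel B_in_def[abs_def] intro!: hom_from_zero_rep B_ob_is_rep)
  have "B_in (n + 1) v * cdf (conc 0 P'_rep) n v = cdf B_cpx n v * (B_in n v :: 'a mat)" for n v
  proof (cases "n = 0")
    case True
    then show ?thesis
      by (cases v) (auto simp: B_sel B_in_def B_map_def B_ob_sel vst_mult hst_mult_vst vst_zero intro!: eq_matI simp: scalar_prod_def)
  next
    case False
    then show ?thesis using hom_carrier[OF h, of n v] hom_carrier[OF h, of "n + 1" v]
      by (intro empty_mat_eq) (auto simp: cpx_carrier[OF is_cpx_B])
  qed
  with h show ?thesis by (simp add: is_cmap_def)
qed

text \<open>Exhibits the triangle P' -> B -> P[-1]. The comparison map is \<open>B_out\<close> on
  the summand B and zero on the other one; it is a chain map because \<open>B_out\<close> vanishes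
  on the images of \<open>B_in\<close> and of the differential.\<close>

lemma cone_B_quasi_iso: "\<exists>f. quasi_iso (cone (conc 0 P'_rep) B_cpx (B_in :: 'k :: field cmap)) (conc 1 P_rep) f"
proof -
  let ?X = "conc 0 P'_rep :: 'k cpx" and ?B = "B_cpx :: 'k cpx" and ?C = "cone (conc 0 P'_rep) B_cpx (B_in :: 'k :: field cmap)"
  have X: "is_cpx ?X" by (rule is_cpx_conc[OF small_reps(2)])
  have B: "is_cpx ?B" by (rule is_cpx_B)
  have i: "is_cmap ?X ?B B_in" by (rule B_in_cmap)
  have C: "is_cpx ?C" by (rule is_cpx_cone[OF X B i])
  have "is_rep_hom E1_rep P_rep (B_out 1 :: vertex \<Rightarrow> 'k mat)"
  proof (rule is_rep_homI)
    fix v show "dim_row (B_out 1 v :: 'k mat) = rdim (P_rep :: 'k rep) v \<and> dim_col (B_out 1 v :: 'k mat) = rdim (E1_rep :: 'k rep) v"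
      by (cases v) (simp_all add: B_out_def B_ob_def)
  next
    fix a show "B_out 1 (tgt a) * rmap E1_rep a = rmap P_rep a * (B_out 1 (src a) :: 'k mat)"
      by (cases a) (simp_all add: B_out_def E1_rep_def P_rep_def hst_mult_vst mult_hst vst_mult hst_zero)
  qed
  then have h: "is_rep_hom (cob ?B n) (cob (conc 1 P_rep) n) (B_out n)" for n
    using hom_zero[OF B_ob_is_rep zero_rep_is_rep, of n] by (cases "n = 1") (auto simp: B_sel B_ob_sel B_out_def[abs_def])
  have oi: "B_out n v * (B_in n v :: 'k mat) = 0\<^sub>m (cdim (conc 1 P_rep :: 'k cpx) n v) (cdim ?X n v)" for n v
    using hom_carrier[OF h, of n v] cmap_carrier[OF i, of n v] by (intro eq_matI) (auto split: if_splits)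
  have od: "B_out (n + 1) v * cdf ?B n v = 0\<^sub>m (cdim (conc 1 P_rep :: 'k cpx) (n + 1) v) (cdim ?B n v)" for n v
  proof (cases "n = 0")
    case True
    then show ?thesis
      by (cases v) (auto simp: B_out_def B_sel B_ob_sel B_map_def hst_mult_vst mult_hst hst_arith hst_zero)
  next
    case False
    then show ?thesis using hom_carrier[OF h, of "n + 1" v] cpx_carrier[OF B, of n v] by (intro eq_matI) auto
  qed
  let ?f = "\<lambda>n v. hst (0\<^sub>m (cdim (conc 1 P_rep :: 'k cpx) n v) (cdim ?X (n + 1) v)) (B_out n v)"
  have r: "is_rep (cob ?X n)" "is_rep (cob ?B n)" "is_rep (cob (conc 1 P_rep) n)" for n
    using X B is_cpx_conc[OF small_reps(1), of 1] by (auto simp del: conc_sel intro: cpx_rep)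
  have fh: "is_rep_hom (cob ?C n) (cob (conc 1 P_rep) n) (?f n)" for n
  proof -
    have "is_rep_hom (rep_sum (cob ?X (n + 1)) (cob ?B n)) (cob (conc 1 P_rep) n) (?f n)"
      by (subst hom_hst_iff[OF r(3) r(1) r(2)]) (use h[of n] hom_carrier[OF h, of n] hom_zero[OF r(1) r(3), of "n + 1" n] in \<open>auto simp del: conc_sel\<close>)
    then show ?thesis by (simp only: cone_sel(1)[OF X B i])
  qed
  have "?f (n + 1) v * cdf ?C n v = cdf (conc 1 P_rep) n v * ?f n v" for n v
  proof -
    note d = hom_carrier[OF h, of "n + 1" v] hom_carrier[OF h, of n v] cmap_carrier[OF i, of "n + 1" v] cpx_carrier[OF X, of "n + 1" v] cpx_carrier[OF B, of n v]
    have "?f (n + 1) v * cdf ?C n v = hst (B_out (n + 1) v * B_in (n + 1) v - 0\<^sub>m (cdim (conc 1 P_rep :: 'k cpx) (n + 1) v) (cdim ?X (n + 2) v) * cdf ?X (n + 1) v)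
      (B_out (n + 1) v * cdf ?B n v)"
      using d by (subst hst_mult_cone[OF X B i]) (simp_all del: conc_sel add: add.assoc)
    also have "\<dots> = 0\<^sub>m (cdim (conc 1 P_rep :: 'k cpx) (n + 1) v) (cdim ?X (n + 1) v + cdim ?B n v)"
      using d by (simp add: oi od hst_zero add.assoc del: conc_sel)
    also have "\<dots> = cdf (conc 1 P_rep) n v * ?f n v"
      using d by (intro eq_matI) (auto simp: scalar_prod_def)
    finally show ?thesis .
  qed
  with fh have f: "is_cmap ?C (conc 1 P_rep) ?f" unfolding is_cmap_def by blast
  have ev: "B_map V1 *\<^sub>v sv a = sv 0" "B_map V3 *\<^sub>v sv a = sv 0" "B_map V2 *\<^sub>v vec2 a b = vec2 0 b"
    "B_in 0 V1 *\<^sub>v sv a = sv a" "B_in 0 V3 *\<^sub>v sv a = sv a" "B_in 0 V2 *\<^sub>v sv a = vec2 a 0"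
    "B_out 1 V1 *\<^sub>v sv a = sv a" "B_out 1 V3 *\<^sub>v sv a = sv a" "B_out 1 V2 *\<^sub>v vec2 a b = sv a" for a b :: 'k
    by (simp_all add: B_map_def B_in_def B_out_def small_vec)
  have "quasi_iso ?C (conc 1 P_rep) ?f"
  proof (rule quasi_iso_conc[OF C small_reps(1) f])
    fix n v t assume n: "n \<noteq> 1" and t: "t \<in> cocycles ?C n v"
    obtain x y where x: "x \<in> carrier_vec (cdim ?X (n + 1) v)" and y: "y \<in> carrier_vec (cdim ?B n v)" and tt: "t = x @\<^sub>v y"
      and c: "B_in (n + 1) v *\<^sub>v x + cdf ?B n v *\<^sub>v y = 0\<^sub>v (cdim ?B (n + 1) v)"
      using cone_cocycleE[OF X B i t] by blast
    \<comment> \<open>The cone is P' in degree -1, \<open>E0_rep\<close> in degree 0 and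
      \<open>E1_rep\<close> in degree 1: degree -1 needs injectivity of \<open>B_in\<close>, and
      degree 0 needs that the kernel of \<open>B_map\<close> is the image of
      \<open>B_in\<close>.\<close>
    consider "n = -1" | "n = 0" | "n \<noteq> 0" "n \<noteq> -1" by blast
    then show "t \<in> coboundaries ?C n v"
    proof cases
      case 1
      have y0: "y = 0\<^sub>v 0" using y 1 by (simp add: B_sel B_ob_sel carrier_vec_small)
      have "cdf ?B (-1) v *\<^sub>v y = 0\<^sub>v (cdim ?B 0 v)" using y0 by (simp add: B_sel)
      then have "B_in 0 v *\<^sub>v x = 0\<^sub>v (cdim ?B 0 v)" using c 1 cmap_carrier[OF i, of 0 v] by simp
      with x 1 have "x = 0\<^sub>v 1" by (cases v) (auto simp: small_vec ev B_sel B_ob_sel)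
      then have "t = 0\<^sub>v (cdim ?C n v)" using y0 tt 1 by (simp add: cone_sel(1)[OF X B i] B_sel B_ob_sel) (auto intro!: eq_vecI simp: sv_def)
      then show ?thesis using zero_coboundary[OF C] by simp
    next
      case 2
      have x0: "x = 0\<^sub>v 0" using x 2 by (simp add: carrier_vec_small)
      have "B_in 1 v *\<^sub>v x = 0\<^sub>v (cdim ?B 1 v)" using x0 by (simp add: B_in_def B_sel)
      then have "B_map v *\<^sub>v y = 0\<^sub>v (cdim ?B 1 v)" using c 2 cpx_carrier[OF B, of 0 v] by (simp add: B_sel)
      have "\<exists>w \<in> carrier_vec 1. y = B_in 0 v *\<^sub>v w"
      proof (cases v)
        case V1
        with y 2 obtain a where "y = sv a" by (auto simp: small_vec B_sel B_ob_sel)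
        with V1 show ?thesis by (intro bexI[of _ "sv a"]) (auto simp: ev)
      next
        case V2
        with y 2 obtain a b where ab: "y = vec2 a b" by (auto simp: small_vec B_sel B_ob_sel)
        with \<open>B_map v *\<^sub>v y = 0\<^sub>v (cdim ?B 1 v)\<close> V2 have "b = 0" by (auto simp: small_vec ev B_sel B_ob_sel)
        with ab V2 show ?thesis by (intro bexI[of _ "sv a"]) (auto simp: ev)
      next
        case V3
        with y 2 obtain a where "y = sv a" by (auto simp: small_vec B_sel B_ob_sel)
        with V3 show ?thesis by (intro bexI[of _ "sv a"]) (auto simp: ev)
      qed
      then obtain w where w: "w \<in> carrier_vec (cdim ?X 0 v)" "y = B_in 0 v *\<^sub>v w" by auto
      have "y = B_in 0 v *\<^sub>v w + cdf ?B (-1) v *\<^sub>v 0\<^sub>v (cdim ?B (-1) v)"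
        using w cpx_carrier[OF B, of "-1" v] cmap_carrier[OF i, of 0 v] by simp
      moreover have "x = - (cdf ?X 0 v *\<^sub>v w)" using x0 w by (intro eq_vecI) auto
      ultimately have "\<exists>w \<in> carrier_vec (cdim ?X n v). \<exists>z \<in> carrier_vec (cdim ?B (n - 1) v).
          x = - (cdf ?X n v *\<^sub>v w) \<and> y = B_in n v *\<^sub>v w + cdf ?B (n - 1) v *\<^sub>v z"
        using 2 w(1) zero_carrier_vec[of "cdim ?B (-1) v"]
        by (intro bexI[of _ w] bexI[of _ "0\<^sub>v (cdim ?B (n - 1) v)"] conjI) (simp_all del: conc_sel)
      then show ?thesis unfolding tt cone_coboundary_iff[OF X B i x y] by blast
    next
      case 3
      then have "cdim ?C n v = 0" using n by (simp add: cone_sel(1)[OF X B i] B_sel B_ob_sel)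
      then show ?thesis by (rule coboundary_zero_dim[OF C _ t])
    qed
  next
    fix v t assume t: "t \<in> cocycles ?C 1 v" and z: "?f 1 v *\<^sub>v t = 0\<^sub>v (rdim P_rep v)"
    obtain x y where x: "x \<in> carrier_vec (cdim ?X (1 + 1) v)" and y: "y \<in> carrier_vec (cdim ?B 1 v)" and tt: "t = x @\<^sub>v y"
      using cone_cocycleE[OF X B i t] by blast
    have x0: "x = 0\<^sub>v 0" using x by (simp add: carrier_vec_small)
    have "B_out 1 v *\<^sub>v y \<in> carrier_vec 1"
      using hom_carrier[OF h, of 1 v] by (intro carrier_dim_vec[THEN iffD2]) (auto simp: B_sel)
    moreover have "0\<^sub>v 1 + B_out 1 v *\<^sub>v y = 0\<^sub>v 1"
      using z x x0 y hom_carrier[OF h, of 1 v] unfolding tt by (subst (asm) hst_mult_vec) auto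
    ultimately have "B_out 1 v *\<^sub>v y = 0\<^sub>v 1" by (metis left_zero_vec)
    with y have "\<exists>w \<in> carrier_vec (cdim ?B 0 v). y = B_map v *\<^sub>v w"
    proof (cases v)
      case V1 with y \<open>B_out 1 v *\<^sub>v y = 0\<^sub>v 1\<close> have "y = sv 0" by (auto simp: small_vec ev B_sel B_ob_sel)
      then show ?thesis using V1 by (intro bexI[of _ "sv 0"]) (auto simp: ev B_sel B_ob_sel)
    next
      case V3 with y \<open>B_out 1 v *\<^sub>v y = 0\<^sub>v 1\<close> have "y = sv 0" by (auto simp: small_vec ev B_sel B_ob_sel)
      then show ?thesis using V3 by (intro bexI[of _ "sv 0"]) (auto simp: ev B_sel B_ob_sel)
    next
      case V2 with y \<open>B_out 1 v *\<^sub>v y = 0\<^sub>v 1\<close> obtain b where "y = vec2 0 b" by (auto simp: small_vec ev B_sel B_ob_sel)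
      then show ?thesis using V2 by (intro bexI[of _ "vec2 0 b"]) (auto simp: ev B_sel B_ob_sel)
    qed
    then obtain w where w: "w \<in> carrier_vec (cdim ?B 0 v)" "y = B_map v *\<^sub>v w" by blast
    have "y = B_in 1 v *\<^sub>v 0\<^sub>v (cdim ?X 1 v) + cdf ?B (1 - 1) v *\<^sub>v w"
      using w cmap_carrier[OF i, of 1 v] cpx_carrier[OF B, of 0 v] by (simp add: B_sel del: conc_sel)
    moreover have "x = - (cdf ?X 1 v *\<^sub>v 0\<^sub>v (cdim ?X 1 v))" using x0 by (intro eq_vecI) auto
    ultimately have "\<exists>w' \<in> carrier_vec (cdim ?X 1 v). \<exists>z \<in> carrier_vec (cdim ?B (1 - 1) v).
        x = - (cdf ?X 1 v *\<^sub>v w') \<and> y = B_in 1 v *\<^sub>v w' + cdf ?B (1 - 1) v *\<^sub>v z"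
      using w(1) by (intro bexI[of _ "0\<^sub>v (cdim ?X 1 v)"] bexI[of _ w] conjI) (simp_all del: conc_sel)
    then show "t \<in> coboundaries ?C 1 v" unfolding tt cone_coboundary_iff[OF X B i x y] by blast
  next
    fix v and p :: "'k vec" assume "p \<in> carrier_vec (rdim P_rep v)"
    then obtain a where p: "p = sv a" by (auto simp: small_vec)
    have "\<exists>y \<in> carrier_vec (cdim ?B 1 v). B_out 1 v *\<^sub>v y = p"
      unfolding p by (cases v; rule bexI[of _ "if v = V2 then vec2 a 0 else sv a"]) (auto simp: ev B_sel B_ob_sel)
    then obtain y where y: "y \<in> carrier_vec (cdim ?B 1 v)" "B_out 1 v *\<^sub>v y = p" by blast
    have x: "0\<^sub>v 0 \<in> carrier_vec (cdim ?X (1 + 1) v)" by simp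
    have "0\<^sub>v 0 @\<^sub>v y \<in> cocycles ?C 1 v"
      using y(1) cmap_carrier[OF i, of 2 v] cpx_carrier[OF B, of 1 v]
      by (subst cone_cocycle_iff[OF X B i x y(1)]) (auto simp: B_sel B_ob_sel intro!: eq_vecI)
    moreover have "?f 1 v *\<^sub>v (0\<^sub>v 0 @\<^sub>v y) = p"
      using y hom_carrier[OF h, of 1 v] by (subst hst_mult_vec) (auto simp: p)
    ultimately show "\<exists>x \<in> cocycles ?C 1 v. ?f 1 v *\<^sub>v x = p" by blast
  qed
  then show ?thesis by blast
qed

text \<open>Serre duality for the two factors \<open>P'_rep\<close> and $P[-1]$ of \<open>B_cpx\<close>, glued along the triangle; that \<open>Y\<close> is orthogonal to $P$ removes
  the terms that do not match.\<close>

lemma serre_B: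
  assumes Y: "is_cpx Y" and perp: "\<And>i. hom_vanishes (conc 0 P_rep) (cpx_shift i Y)"
    and z: "hom_vanishes Y (cpx_shift 3 B_cpx)"
  shows "hom_vanishes B_cpx Y"
proof -
  let ?X = "conc 0 P'_rep :: 'a cpx" and ?P = "conc 0 P_rep :: 'a cpx" and ?C = "cone (conc 0 P'_rep) B_cpx (B_in :: 'a cmap)"
  have X: "is_cpx ?X" and P: "is_cpx ?P" and P1: "is_cpx (conc 1 P_rep :: 'a cpx)" by (simp_all add: is_cpx_conc small_reps)
  have B: "is_cpx (B_cpx :: 'a cpx)" by (rule is_cpx_B)
  have i: "is_cmap ?X B_cpx B_in" by (rule B_in_cmap)
  note C = is_cpx_cone[OF X B i]
  let ?Y = "cpx_shift (-3) Y"
  have Y': "is_cpx ?Y" by (rule is_cpx_shift[OF Y])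
  have "hom_vanishes ?Y B_cpx"
    using z hom_vanishes_shift[OF Y is_cpx_shift[OF B], of "-3" 3] by (simp add: cpx_shift_shift cpx_shift_0)
  \<comment> \<open>Serre duality for P translates orthogonality of \<open>Y\<close> into the
    absence of maps from shifts of \<open>Y\<close> to P', hence on the target side B may be
    replaced by P[-1].\<close>
  moreover have "hom_vanishes (cpx_shift k Y) ?X" for k
    using perp[of "k + 2"] serre_P(1)[OF is_cpx_shift[OF Y, of "k + 2"]] by (simp add: cpx_shift_shift)
  then have "hom_vanishes ?Y (cpx_shift 1 ?X)"
    using hom_vanishes_shift[OF is_cpx_shift[OF Y] X, of 1 "-4"] by (simp add: cpx_shift_shift)
  ultimately have "hom_vanishes ?Y ?C" by (rule hom_vanishes_into_cone[OF X B Y' i])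
  obtain f where f: "quasi_iso ?C (conc 1 P_rep) f" using cone_B_quasi_iso by blast
  have "hom_vanishes ?Y (conc 1 P_rep)"
    using hom_vanishes_quasi_iso_right[OF Y' C P1 f] \<open>hom_vanishes ?Y ?C\<close> by blast
  \<comment> \<open>A map from Y[-3] to P[-1] is one from Y[-2] to P, the Serre dual of a map from
    P' to Y. The 3 is thus 2 from duality and 1 from the position of P in B.\<close>
  then have "hom_vanishes (cpx_shift (-2) Y) ?P"
    using hom_vanishes_shift[OF Y' P1, of 1] by (simp add: cpx_shift_shift cpx_shift_conc)
  then have XY: "hom_vanishes ?X Y" using serre_P(2)[OF Y] by blast
  have "hom_vanishes (conc 1 P_rep) Y"
    using perp[of 1] hom_vanishes_shift[OF P1 Y, of 1] by (simp add: cpx_shift_conc)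
  then have "hom_vanishes ?C Y" using hom_vanishes_quasi_iso_left[OF Y C P1 f] by blast
  with XY show ?thesis by (rule hom_vanishes_from_middle[OF X B Y i])
qed

section \<open>Morphisms in the derived category\<close>

definition arr :: "'k :: field cpx \<Rightarrow> 'k cpx \<Rightarrow> 'k cmap \<Rightarrow> bool" where
  "arr X Y f \<longleftrightarrow> is_cpx X \<and> is_cpx Y \<and> is_cmap X Y f"

text \<open>Carries the side conditions along with the homotopy, so that calculations with roofs can
  be chained by transitivity.\<close>

definition heq :: "'k :: field cpx \<Rightarrow> 'k cpx \<Rightarrow> 'k cmap \<Rightarrow> 'k cmap \<Rightarrow> bool" where
  "heq X Y f g \<longleftrightarrow> arr X Y f \<and> arr X Y g \<and> homotopic X Y f g"

lemma arr_comp: "arr X Y f \<Longrightarrow> arr Y Z g \<Longrightarrow> arr X Z (cmap_comp g f)"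
  by (auto simp: arr_def intro: cmap_comp_is_cmap)

lemma arr_assoc: "arr X Y f \<Longrightarrow> arr Y Z g \<Longrightarrow> arr Z T h \<Longrightarrow> cmap_comp (cmap_comp h g) f = cmap_comp h (cmap_comp g f)"
  by (auto simp: arr_def intro: cmap_comp_assoc)

lemma heq_refl: "arr X Y f \<Longrightarrow> heq X Y f f"
  by (auto simp: heq_def arr_def intro: homotopic_refl)

lemma heq_sym: "heq X Y f g \<Longrightarrow> heq X Y g f"
  by (auto simp: heq_def arr_def intro: homotopic_sym)

lemma heq_trans [trans]: "heq X Y f g \<Longrightarrow> heq X Y g h \<Longrightarrow> heq X Y f h"
  unfolding heq_def arr_def using homotopic_trans[of X Y f g h] by blast

lemma heq_left: "heq X Y f g \<Longrightarrow> arr Y Z k \<Longrightarrow> heq X Z (cmap_comp k f) (cmap_comp k g)"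
  by (auto simp: heq_def arr_def intro: homotopic_comp_left cmap_comp_is_cmap)

lemma heq_right: "heq X Y f g \<Longrightarrow> arr W X k \<Longrightarrow> heq W Y (cmap_comp f k) (cmap_comp g k)"
  by (auto simp: heq_def arr_def intro: homotopic_comp_right cmap_comp_is_cmap)

lemma heq_comp_right:
  assumes "heq W X (cmap_comp f u) (cmap_comp g v)" "arr W A u" "arr A X f" "arr W B v" "arr B X g" "arr V W t"
  shows "heq V X (cmap_comp f (cmap_comp u t)) (cmap_comp g (cmap_comp v t))"
  using heq_right[OF assms(1,6)] arr_assoc[OF assms(6,2,3)] arr_assoc[OF assms(6,4,5)] by simp

lemma quasi_iso_heq: "quasi_iso X Y f \<Longrightarrow> heq X Y f g \<Longrightarrow> quasi_iso X Y g"
  unfolding heq_def arr_def using quasi_iso_homotopic[of X Y f g] by blast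

lemma coh_inj_heq: "coh_inj X Y f \<Longrightarrow> heq X Y f g \<Longrightarrow> coh_inj X Y g"
  unfolding heq_def arr_def using coh_inj_homotopic[of X Y f g] by blast

lemma coh_surj_heq: "coh_surj X Y f \<Longrightarrow> heq X Y f g \<Longrightarrow> coh_surj X Y g"
  unfolding heq_def arr_def using coh_surj_homotopic[of X Y f g] by blast

lemma heq_of_null: "is_cpx X \<Longrightarrow> is_cpx Y \<Longrightarrow> is_cmap X Y f \<Longrightarrow> is_cmap X Y g \<Longrightarrow> null_homotopic X Y f \<Longrightarrow> null_homotopic X Y g
    \<Longrightarrow> heq X Y f g"
  by (simp add: heq_def arr_def homotopic_iff null_arith(2))

lemma heq_zero_null: "heq X Y f (cmap_zero X Y) \<Longrightarrow> null_homotopic X Y f"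
  unfolding heq_def arr_def using homotopic_zero_iff by blast

lemma arr_id: "is_cpx X \<Longrightarrow> arr X X (cmap_id X)"
  by (simp add: arr_def cmap_id_is_cmap)

lemma arr_comp_id: "arr X Y f \<Longrightarrow> cmap_comp f (cmap_id X) = f" "arr X Y f \<Longrightarrow> cmap_comp (cmap_id Y) f = f"
  unfolding arr_def using cmap_comp_id by blast+

lemma ore_squareE:
  assumes "quasi_iso W X s" "arr W X s" "arr V X f"
  obtains V' u k where "is_cpx V'" "quasi_iso V' V u" "arr V' V u" "arr V' W k" "heq V' X (cmap_comp f u) (cmap_comp s k)"
proof -
  have W: "is_cpx W" and X: "is_cpx X" and V: "is_cpx V" and f: "is_cmap V X f" using assms(2,3) by (auto simp: arr_def)
  from ore_square[OF W X V assms(1) f] obtain V' u k where V': "is_cpx V'" and u: "quasi_iso V' V u" and k: "is_cmap V' W k"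
    and h: "homotopic V' X (cmap_comp f u) (cmap_comp s k)" .
  have a: "arr V' V u" "arr V' W k" using V V' W u k by (auto simp: arr_def quasi_iso_cmap)
  show thesis
    using that[OF V' u a] h arr_comp[OF a(1) assms(3)] arr_comp[OF a(2) assms(2)] by (simp add: heq_def)
qed

lemma P_cpx_conc: "P_cpx = conc 0 P_rep"
  by (auto simp: P_cpx_def conc_def fun_eq_iff P_rep_def zero_rep_def)

context
  fixes X Y :: "'k :: field cpx"
  assumes X: "is_cpx X" and Y: "is_cpx Y"
begin

lemma roofs_iff: "(W, s, f) \<in> roofs X Y \<longleftrightarrow> quasi_iso W X s \<and> arr W X s \<and> arr W Y f"
  using X Y by (auto simp: roofs_def arr_def quasi_iso_cmap)

text \<open>The definition asks only that the composite with \<open>s1\<close> be a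
  quasi-isomorphism; two-out-of-three and homotopy invariance give it for \<open>u1\<close> and
  \<open>u2\<close> separately.\<close>

lemma roof_relE:
  assumes "((W1, s1, f1), (W2, s2, f2)) \<in> roof_rel X Y"
  obtains W u1 u2 where "arr W W1 u1" "arr W W2 u2" "quasi_iso W W1 u1" "quasi_iso W W2 u2"
    "heq W X (cmap_comp s1 u1) (cmap_comp s2 u2)" "heq W Y (cmap_comp f1 u1) (cmap_comp f2 u2)"
proof -
  from assms obtain W u1 u2 where r: "(W1, s1, f1) \<in> roofs X Y" "(W2, s2, f2) \<in> roofs X Y"
    and u: "is_cpx W" "is_cmap W W1 u1" "is_cmap W W2 u2"
    and q: "quasi_iso W X (cmap_comp s1 u1)" and h: "homotopic W X (cmap_comp s1 u1) (cmap_comp s2 u2)" "homotopic W Y (cmap_comp f1 u1) (cmap_comp f2 u2)"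
    by (auto simp: roof_rel_def)
  note r' = r[unfolded roofs_iff]
  have W1: "is_cpx W1" and W2: "is_cpx W2" using r' by (auto simp: arr_def)
  have a: "arr W W1 u1" "arr W W2 u2" using u W1 W2 by (auto simp: arr_def)
  have hs: "heq W X (cmap_comp s1 u1) (cmap_comp s2 u2)" "heq W Y (cmap_comp f1 u1) (cmap_comp f2 u2)"
    using h r' a by (auto simp: heq_def intro: arr_comp)
  have "quasi_iso W W1 u1" by (rule quasi_iso_first[OF u(1) W1 X u(2)]) (use r' q in \<open>auto simp: arr_def\<close>)
  moreover have "quasi_iso W W2 u2"
    by (rule quasi_iso_first[OF u(1) W2 X u(3)]) (use r' quasi_iso_heq[OF q hs(1)] in \<open>auto simp: arr_def\<close>)
  ultimately show thesis using that a hs by blast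
qed

lemma roof_relI:
  assumes "(W1, s1, f1) \<in> roofs X Y" "(W2, s2, f2) \<in> roofs X Y" "arr W W2 u2" "quasi_iso W W1 u1"
    "heq W X (cmap_comp s1 u1) (cmap_comp s2 u2)" "heq W Y (cmap_comp f1 u1) (cmap_comp f2 u2)"
  shows "((W1, s1, f1), (W2, s2, f2)) \<in> roof_rel X Y"
proof -
  have c: "is_cpx W" "is_cpx W1" "is_cmap W W1 u1" "is_cmap W1 X s1" using assms by (auto simp: arr_def roofs_iff quasi_iso_cmap)
  have "quasi_iso W X (cmap_comp s1 u1)"
    by (rule quasi_iso_comp[OF c(1,2) X c(3,4) assms(4)]) (use assms(1) in \<open>simp add: roofs_iff\<close>)
  then show ?thesis using assms c by (auto simp: roof_rel_def arr_def heq_def)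
qed

lemma roof_rel_roofs: "(r, q) \<in> roof_rel X Y \<Longrightarrow> r \<in> roofs X Y \<and> q \<in> roofs X Y"
  by (auto simp: roof_rel_def)

lemma roof_rel_refl: "r \<in> roofs X Y \<Longrightarrow> (r, r) \<in> roof_rel X Y"
proof -
  assume r: "r \<in> roofs X Y"
  obtain W s f where rw: "r = (W, s, f)" by (cases r)
  have W: "is_cpx W" "arr W X s" "arr W Y f" using r by (auto simp: rw roofs_iff arr_def)
  show ?thesis
    unfolding rw using r arr_id[OF W(1)] quasi_iso_id[OF W(1)]
    by (intro roof_relI) (auto simp: rw arr_comp_id[OF W(2)] arr_comp_id[OF W(3)] W intro: heq_refl)
qed

lemma zero_roof: "(X, cmap_id X, cmap_zero X Y) \<in> roofs X Y"
  using X Y by (simp add: roofs_def quasi_iso_id cmap_zero_is_cmap)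

lemma Db_of_cmap_mor: "is_cmap X Y f \<Longrightarrow> Db_of_cmap X Y f \<in> Db_mor X Y"
  using X Y by (auto simp: Db_of_cmap_def Db_mor_def roofs_def quasi_iso_id intro!: quotientI)

lemma Db_zero_mor: "Db_of_cmap X Y (cmap_zero X Y) \<in> Db_mor X Y"
  by (rule Db_of_cmap_mor[OF cmap_zero_is_cmap[OF X Y]])

text \<open>Both numerators are killed on finer apexes, and an Ore square over \<open>X\<close>
  joins these. The common refinement is built directly, without an appeal to transitivity of
  \<open>roof_rel\<close>.\<close>

lemma roofs_related:
  assumes z: "hom_vanishes X Y" and "r \<in> roofs X Y" "q \<in> roofs X Y"
  shows "(r, q) \<in> roof_rel X Y"
proof -
  obtain W1 s1 f1 W2 s2 f2 where r: "r = (W1, s1, f1)" and q: "q = (W2, s2, f2)" by (cases r, cases q) blast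
  note r1 = assms(2)[unfolded r roofs_iff] and r2 = assms(3)[unfolded q roofs_iff]
  have W: "is_cpx W1" "is_cpx W2" and f: "is_cmap W1 Y f1" "is_cmap W2 Y f2" and s: "quasi_iso W1 X s1" "quasi_iso W2 X s2"
    using r1 r2 by (auto simp: arr_def)
  obtain V1 u1 where V1: "is_cpx V1" and u1: "quasi_iso V1 W1 u1" "is_cmap V1 W1 u1" and n1: "null_homotopic V1 Y (cmap_comp f1 u1)"
    by (rule hom_vanishesE[OF z W(1) s(1) f(1)])
  obtain V2 u2 where V2: "is_cpx V2" and u2: "quasi_iso V2 W2 u2" "is_cmap V2 W2 u2" and n2: "null_homotopic V2 Y (cmap_comp f2 u2)"
    by (rule hom_vanishesE[OF z W(2) s(2) f(2)])
  have a: "arr V1 W1 u1" "arr V2 W2 u2" using V1 V2 W u1 u2 by (auto simp: arr_def)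
  have q2: "quasi_iso V2 X (cmap_comp s2 u2)"
    by (rule quasi_iso_comp[OF V2 W(2) X u2(2) _ u2(1)]) (use r2 in \<open>auto simp: arr_def\<close>)
  obtain V t k where V: "is_cpx V" and t: "quasi_iso V V1 t" "arr V V1 t" and k: "arr V V2 k"
    and h: "heq V X (cmap_comp (cmap_comp s1 u1) t) (cmap_comp (cmap_comp s2 u2) k)"
    using ore_squareE[OF q2 arr_comp[OF a(2)] arr_comp[OF a(1)], of s1] r1 r2 by metis
  have qt: "quasi_iso V W1 (cmap_comp u1 t)"
    by (rule quasi_iso_comp[OF V V1 W(1) _ u1(2) t(1) u1(1)]) (use t in \<open>simp add: arr_def\<close>)
  have hs: "heq V X (cmap_comp s1 (cmap_comp u1 t)) (cmap_comp s2 (cmap_comp u2 k))"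
    using h arr_assoc[OF t(2) a(1)] arr_assoc[OF k a(2)] r1 r2 by metis
  have "null_homotopic V Y (cmap_comp (cmap_comp f1 u1) t)"
    by (rule null_comp_right[OF V V1 Y _ n1]) (use t in \<open>simp add: arr_def\<close>)
  moreover have "null_homotopic V Y (cmap_comp (cmap_comp f2 u2) k)"
    by (rule null_comp_right[OF V V2 Y _ n2]) (use k in \<open>simp add: arr_def\<close>)
  moreover have "arr V Y (cmap_comp f1 (cmap_comp u1 t))" "arr V Y (cmap_comp f2 (cmap_comp u2 k))"
    using arr_comp[OF arr_comp[OF t(2) a(1)]] arr_comp[OF arr_comp[OF k a(2)]] r1 r2 by blast+
  ultimately have "heq V Y (cmap_comp f1 (cmap_comp u1 t)) (cmap_comp f2 (cmap_comp u2 k))"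
    using arr_assoc[OF t(2) a(1)] arr_assoc[OF k a(2)] r1 r2
    by (intro heq_of_null) (auto simp: arr_def)
  then show ?thesis
    unfolding r q using roof_relI[OF _ _ arr_comp[OF k a(2)] qt hs] assms(2,3) r q by blast
qed

lemma roof_class_vanishing:
  assumes "hom_vanishes X Y" "R \<inter> roofs X Y \<noteq> {}"
  shows "roof_rel X Y `` R = roofs X Y"
proof
  show "roof_rel X Y `` R \<subseteq> roofs X Y" by (auto simp: roof_rel_def)
  obtain r where "r \<in> R" "r \<in> roofs X Y" using assms(2) by blast
  then show "roofs X Y \<subseteq> roof_rel X Y `` R" using roofs_related[OF assms(1)] by blast
qed

text \<open>The link between the literal Hom set and the chain-level condition: if all roofs are
  related there is one class, that of the zero roof.\<close>

lemma Db_mor_trivial_iff: "Db_mor X Y = {Db_of_cmap X Y (cmap_zero X Y)} \<longleftrightarrow> hom_vanishes X Y"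
proof
  assume m: "Db_mor X Y = {Db_of_cmap X Y (cmap_zero X Y)}"
  show "hom_vanishes X Y"
    unfolding hom_vanishes_def
  proof (intro allI impI)
    fix W s f assume w: "is_cpx W" "quasi_iso W X s" "is_cmap W Y f"
    then have r: "(W, s, f) \<in> roofs X Y" by (simp add: roofs_def)
    have "(X, Y, roof_rel X Y `` {(W, s, f)}) \<in> Db_mor X Y"
      unfolding Db_mor_def using quotientI[OF r] by blast
    then have "roof_rel X Y `` {(W, s, f)} = roof_rel X Y `` {(X, cmap_id X, cmap_zero X Y)}"
      using m by (auto simp: Db_of_cmap_def)
    \<comment> \<open>By reflexivity the roof lies in its own class, which is also the class of the
      zero roof; this makes the two roofs related.\<close>
    with roof_rel_refl[OF r] have "((X, cmap_id X, cmap_zero X Y), (W, s, f)) \<in> roof_rel X Y" by blast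
    then obtain V u1 u2 where u: "arr V X u1" "arr V W u2" "quasi_iso V W u2"
      and h: "heq V Y (cmap_comp (cmap_zero X Y) u1) (cmap_comp f u2)" by (rule roof_relE)
    have "cmap_comp (cmap_zero X Y) u1 = cmap_zero V Y" using u(1) by (simp add: arr_def cmap_comp_zero)
    with heq_sym[OF h] have "null_homotopic V Y (cmap_comp f u2)" by (intro heq_zero_null) simp
    then show "\<exists>V u. is_cpx V \<and> quasi_iso V W u \<and> null_homotopic V Y (cmap_comp f u)" using u by (auto simp: arr_def)
  qed
next
  assume z: "hom_vanishes X Y"
  have "roofs X Y // roof_rel X Y = {roofs X Y}"
    using roof_class_vanishing[OF z] zero_roof by (auto simp: quotient_def)
  moreover have "Db_of_cmap X Y (cmap_zero X Y) = (X, Y, roofs X Y)"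
    using roof_class_vanishing[OF z] zero_roof by (auto simp: Db_of_cmap_def)
  ultimately show "Db_mor X Y = {Db_of_cmap X Y (cmap_zero X Y)}" by (auto simp: Db_mor_def)
qed

text \<open>Needed to see that a linear functional on a one-element Hom set takes the value
  0.\<close>

lemma Db_scale_zero:
  assumes "hom_vanishes X Y"
  shows "Db_scale 0 (Db_of_cmap X Y (cmap_zero X Y)) = Db_of_cmap X Y (cmap_zero X Y)"
proof -
  have c: "Db_of_cmap X Y (cmap_zero X Y) = (X, Y, roofs X Y)"
    using roof_class_vanishing[OF assms] zero_roof by (auto simp: Db_of_cmap_def)
  have "(\<lambda>n v. 0 \<cdot>\<^sub>m cmap_zero X Y n v) = cmap_zero X Y" by (simp add: cmap_zero_def fun_eq_iff)
  then have "(X, cmap_id X, cmap_zero X Y) \<in> {(W, s, \<lambda>n v. 0 \<cdot>\<^sub>m f n v) | W s f. (W, s, f) \<in> roofs X Y}"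
    using zero_roof by (intro CollectI exI[of _ X] exI[of _ "cmap_id X"] exI[of _ "cmap_zero X Y"]) simp
  then have "roof_rel X Y `` {(W, s, \<lambda>n v. 0 \<cdot>\<^sub>m f n v) | W s f. (W, s, f) \<in> roofs X Y} = roofs X Y"
    using zero_roof by (intro roof_class_vanishing[OF assms]) blast
  then show ?thesis unfolding c by (simp add: Db_scale_def)
qed

text \<open>Being injective or surjective on cohomology is a property of the class: related
  numerators agree up to homotopy after quasi-isomorphisms on their sources.\<close>

lemma roof_rel_coh:
  assumes "((W1, s1, f1), (W2, s2, f2)) \<in> roof_rel X Y"
  shows "coh_inj W1 Y f1 \<longleftrightarrow> coh_inj W2 Y f2" "coh_surj W1 Y f1 \<longleftrightarrow> coh_surj W2 Y f2"
proof -
  from assms obtain W u1 u2 where u: "arr W W1 u1" "arr W W2 u2" "quasi_iso W W1 u1" "quasi_iso W W2 u2"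
    and h: "heq W Y (cmap_comp f1 u1) (cmap_comp f2 u2)" by (rule roof_relE)
  have f: "arr W1 Y f1" "arr W2 Y f2" using roof_rel_roofs[OF assms] by (auto simp: roofs_iff)
  have c: "coh_inj V Y f \<longleftrightarrow> coh_inj W Y (cmap_comp f u)" "coh_surj V Y f \<longleftrightarrow> coh_surj W Y (cmap_comp f u)"
    if "arr W V u" "quasi_iso W V u" "arr V Y f" for V u f
  proof -
    have a: "is_cpx W" "is_cpx V" "is_cpx Y" "is_cmap W V u" "is_cmap V Y f" "coh_inj W V u" "coh_surj W V u"
      using that by (auto simp: arr_def quasi_iso_iff)
    show "coh_inj V Y f \<longleftrightarrow> coh_inj W Y (cmap_comp f u)" "coh_surj V Y f \<longleftrightarrow> coh_surj W Y (cmap_comp f u)"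
      using coh_inj_comp[OF a(1-5)] coh_inj_second[OF a(1-5)] coh_surj_comp[OF a(1-5)] coh_surj_second[OF a(1-5)] a(6,7) by blast+
  qed
  show "coh_inj W1 Y f1 \<longleftrightarrow> coh_inj W2 Y f2"
    using c(1)[OF u(1,3) f(1)] c(1)[OF u(2,4) f(2)] coh_inj_heq[OF _ h] coh_inj_heq[OF _ heq_sym[OF h]] by blast
  show "coh_surj W1 Y f1 \<longleftrightarrow> coh_surj W2 Y f2"
    using c(2)[OF u(1,3) f(1)] c(2)[OF u(2,4) f(2)] coh_surj_heq[OF _ h] coh_surj_heq[OF _ heq_sym[OF h]] by blast
qed

end

text \<open>A roof of the composite is related to the identity, so its numerator \<open>g\<close>
  after \<open>v\<close> is a quasi-isomorphism. Hence \<open>g\<close> is surjective and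
  \<open>v\<close> injective on cohomology, and the Ore square carries injectivity over to
  \<open>f\<close>.\<close>

lemma Db_comp_id_coh:
  assumes X: "is_cpx X" and Y: "is_cpx Y" and c: "c \<subseteq> roofs X Y" and d: "d \<subseteq> roofs Y X"
    and e: "Db_comp (Y, X, d) (X, Y, c) = Db_of_cmap X X (cmap_id X)"
  shows "(\<exists>W s f. (W, s, f) \<in> c \<and> coh_inj W Y f) \<and> (\<exists>W s f. (W, s, f) \<in> d \<and> coh_surj W X f)"
proof -
  have "(X, cmap_id X, cmap_id X) \<in> roofs X X" using X by (simp add: roofs_def quasi_iso_id cmap_id_is_cmap)
  then have "(X, cmap_id X, cmap_id X) \<in> roof_rel X X `` {(X, cmap_id X, cmap_id X)}" using roof_rel_refl[OF X X] by blast
  then have "(X, cmap_id X, cmap_id X) \<in> snd (snd (Db_comp (Y, X, d) (X, Y, c)))" unfolding e by (simp add: Db_of_cmap_def)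
  then obtain W u v W1 s f W2 t g where cd: "(W1, s, f) \<in> c" "(W2, t, g) \<in> d"
    and W: "is_cpx W" "quasi_iso W W1 u" "is_cmap W W2 v" "homotopic W Y (cmap_comp f u) (cmap_comp t v)"
    and rel: "((W, cmap_comp s u, cmap_comp g v), (X, cmap_id X, cmap_id X)) \<in> roof_rel X X"
    unfolding Db_comp_def by auto
  have rc: "quasi_iso W1 X s" "arr W1 X s" "arr W1 Y f" using cd(1) c by (auto simp: roofs_iff[OF X Y])
  have rd: "quasi_iso W2 Y t" "arr W2 Y t" "arr W2 X g" using cd(2) d by (auto simp: roofs_iff[OF Y X])
  have W12: "is_cpx W1" "is_cpx W2" using rc rd by (auto simp: arr_def)
  have m: "is_cmap W W1 u" "is_cmap W W2 v" "is_cmap W1 Y f" "is_cmap W2 Y t" "is_cmap W2 X g"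
    using W rc rd by (auto simp: arr_def quasi_iso_cmap)
  have au: "arr W W1 u" and av: "arr W W2 v" using W W12 m by (auto simp: arr_def)
  obtain V w1 w2 where w: "arr V W w1" "arr V X w2" "quasi_iso V W w1" "quasi_iso V X w2"
    and h: "heq V X (cmap_comp (cmap_comp g v) w1) (cmap_comp (cmap_id X) w2)" by (rule roof_relE[OF X X rel])
  have "quasi_iso V X (cmap_comp (cmap_comp g v) w1)"
    by (rule quasi_iso_heq[OF _ heq_sym[OF h]]) (simp add: arr_comp_id[OF w(2)] w(4))
  then have q: "quasi_iso W X (cmap_comp g v)"
    using quasi_iso_second[of V W X w1 "cmap_comp g v"] w X W(1) arr_comp[OF av rd(3)] by (auto simp: arr_def)
  have "coh_surj W2 X g" using coh_surj_second[OF W(1) W12(2) X m(2,5)] q by (simp add: quasi_iso_iff)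
  moreover have "coh_inj W W2 v" using coh_inj_first[OF W(1) W12(2) X m(2,5)] q by (simp add: quasi_iso_iff)
  then have "coh_inj W Y (cmap_comp t v)" using coh_inj_comp[OF W(1) W12(2) Y m(2,4)] rd(1) by (simp add: quasi_iso_iff)
  moreover have h': "heq W Y (cmap_comp f u) (cmap_comp t v)"
    using W(4) arr_comp[OF au rc(3)] arr_comp[OF av rd(2)] by (simp add: heq_def)
  ultimately have "coh_inj W Y (cmap_comp f u)" using coh_inj_heq[OF _ heq_sym[OF h']] by blast
  then have "coh_inj W1 Y f" using coh_inj_second[OF W(1) W12(1) Y m(1,3)] W(2) by (simp add: quasi_iso_iff)
  with \<open>coh_surj W2 X g\<close> cd show ?thesis by blast
qed

section \<open>Isomorphisms and zero objects of the derived category\<close>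

text \<open>One composite with the inverse makes the numerator injective on cohomology, the other
  surjective. These properties come for different representatives and are transported to a single
  roof of the class.\<close>

lemma isomorphic_quasi_iso:
  assumes X: "is_cpx X" and Y: "is_cpx Y" and "isomorphic Db_pretri X Y"
  obtains W s f where "is_cpx W" "quasi_iso W X s" "quasi_iso W Y f"
proof -
  from assms(3) obtain a b where a: "a \<in> Db_mor X Y" and b: "b \<in> Db_mor Y X"
    and e: "Db_comp b a = Db_of_cmap X X (cmap_id X)" "Db_comp a b = Db_of_cmap Y Y (cmap_id Y)"
    by (auto simp: isomorphic_def is_iso_mor_def Db_pretri_def)
  from a obtain r where r: "r \<in> roofs X Y" and ac: "a = (X, Y, roof_rel X Y `` {r})" by (auto simp: Db_mor_def quotient_def)
  from b obtain q where q: "q \<in> roofs Y X" and bc: "b = (Y, X, roof_rel Y X `` {q})" by (auto simp: Db_mor_def quotient_def)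
  obtain W s f where rw: "r = (W, s, f)" by (cases r)
  have sub: "roof_rel X Y `` {r} \<subseteq> roofs X Y" "roof_rel Y X `` {q} \<subseteq> roofs Y X" by (auto simp: roof_rel_def)
  from Db_comp_id_coh[OF X Y sub e(1)[unfolded ac bc]] obtain W1 s1 f1
    where "((W, s, f), (W1, s1, f1)) \<in> roof_rel X Y" "coh_inj W1 Y f1" unfolding rw by blast
  then have "coh_inj W Y f" using roof_rel_coh(1)[OF X Y] by blast
  moreover from Db_comp_id_coh[OF Y X sub(2,1) e(2)[unfolded ac bc]] obtain W2 s2 f2
    where "((W, s, f), (W2, s2, f2)) \<in> roof_rel X Y" "coh_surj W2 Y f2" unfolding rw by blast
  then have "coh_surj W Y f" using roof_rel_coh(2)[OF X Y] by blast
  ultimately show thesis using that[of W s f] r unfolding rw roofs_def by (auto simp: quasi_iso_iff)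
qed

lemma hom_vanishes_isomorphic:
  assumes X: "is_cpx X" and Y: "is_cpx Y" and A: "is_cpx A" and "isomorphic Db_pretri X Y"
  shows "hom_vanishes A X \<longleftrightarrow> hom_vanishes A Y" "hom_vanishes X A \<longleftrightarrow> hom_vanishes Y A"
proof -
  obtain W s f where W: "is_cpx W" and s: "quasi_iso W X s" and f: "quasi_iso W Y f"
    by (rule isomorphic_quasi_iso[OF X Y assms(4)])
  show "hom_vanishes A X \<longleftrightarrow> hom_vanishes A Y"
    using hom_vanishes_quasi_iso_right[OF A W X s] hom_vanishes_quasi_iso_right[OF A W Y f] by blast
  show "hom_vanishes X A \<longleftrightarrow> hom_vanishes Y A"
    using hom_vanishes_quasi_iso_left[OF A W X s] hom_vanishes_quasi_iso_left[OF A W Y f] by blast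
qed

lemma dtri_hom_vanishes:
  assumes "(X, Y, Z, f, g, h) \<in> dtri Db" and T: "is_cpx T"
  shows "hom_vanishes T X \<Longrightarrow> hom_vanishes T Z \<Longrightarrow> hom_vanishes T Y"
    "hom_vanishes X T \<Longrightarrow> hom_vanishes Z T \<Longrightarrow> hom_vanishes Y T"
proof -
  from assms(1) obtain A B u a b c' where c: "is_cpx X" "is_cpx Y" "is_cpx Z" and A: "is_cpx A" and B: "is_cpx B" and u: "is_cmap A B u"
    and i': "is_iso_mor Db_pretri X A a" "is_iso_mor Db_pretri Y B b" "is_iso_mor Db_pretri Z (cone A B u) c'"
    unfolding Db_def by simp blast
  then have i: "isomorphic Db_pretri X A" "isomorphic Db_pretri Y B" "isomorphic Db_pretri Z (cone A B u)"
    unfolding isomorphic_def by blast+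
  note C = is_cpx_cone[OF A B u]
  note iX = hom_vanishes_isomorphic[OF c(1) A T i(1)] and iY = hom_vanishes_isomorphic[OF c(2) B T i(2)]
    and iZ = hom_vanishes_isomorphic[OF c(3) C T i(3)]
  show "hom_vanishes T X \<Longrightarrow> hom_vanishes T Z \<Longrightarrow> hom_vanishes T Y"
    using hom_vanishes_into_middle[OF A B T u] iX iY iZ by blast
  show "hom_vanishes X T \<Longrightarrow> hom_vanishes Z T \<Longrightarrow> hom_vanishes Y T"
    using hom_vanishes_from_middle[OF A B T u] iX iY iZ by blast
qed

text \<open>If the identity roof is related to the zero roof, some quasi-isomorphism to
  \<open>X\<close> is null-homotopic.\<close>

lemma zero_object_acyclic:
  assumes X: "is_cpx X" and "Db_of_cmap X X (cmap_id X) = Db_of_cmap X X (cmap_zero X X)"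
  shows "acyclic X"
proof -
  have r: "(X, cmap_id X, cmap_id X) \<in> roofs X X" using X by (simp add: roofs_def quasi_iso_id cmap_id_is_cmap)
  then have "(X, cmap_id X, cmap_id X) \<in> roof_rel X X `` {(X, cmap_id X, cmap_id X)}" using roof_rel_refl[OF X X] by blast
  then have "((X, cmap_id X, cmap_zero X X), (X, cmap_id X, cmap_id X)) \<in> roof_rel X X"
    using assms(2) unfolding Db_of_cmap_def by blast
  then obtain W u1 u2 where u: "arr W X u1" "arr W X u2" "quasi_iso W X u2"
    and h: "heq W X (cmap_comp (cmap_zero X X) u1) (cmap_comp (cmap_id X) u2)" by (rule roof_relE[OF X X])
  have "cmap_comp (cmap_zero X X) u1 = cmap_zero W X" using u(1) by (simp add: arr_def cmap_comp_zero)
  with heq_sym[OF h] have "null_homotopic W X u2" by (intro heq_zero_null) (simp add: arr_comp_id[OF u(2)])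
  then show ?thesis using null_quasi_iso_acyclic[OF _ X u(3)] u by (simp add: arr_def)
qed

section \<open>The identity morphism\<close>

context
  fixes X :: "'k :: field cpx"
  assumes X: "is_cpx X"
begin

text \<open>This set turns out to be the equivalence class of the identity roof.\<close>

definition id_roofs :: "'k roof set" where
  "id_roofs = {(W, s, f) \<in> roofs X X. \<exists>V u. quasi_iso V W u \<and> arr V W u \<and> heq V X (cmap_comp f u) (cmap_comp s u)}"

lemma id_roofs_iff: "(W, s, f) \<in> id_roofs \<longleftrightarrow> quasi_iso W X s \<and> arr W X s \<and> arr W X f \<and>
    (\<exists>V u. quasi_iso V W u \<and> arr V W u \<and> heq V X (cmap_comp f u) (cmap_comp s u))"
  by (auto simp: id_roofs_def roofs_iff[OF X X])

text \<open>An Ore square refines both the apex on which \<open>f1\<close> and \<open>s1\<close>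
  agree and the apex comparing the two roofs; there \<open>f2\<close> agrees with
  \<open>s2\<close>.\<close>

lemma id_roofs_closed:
  assumes "((W1, s1, f1), (W2, s2, f2)) \<in> roof_rel X X" "(W1, s1, f1) \<in> id_roofs"
  shows "(W2, s2, f2) \<in> id_roofs"
proof -
  have r: "arr W1 X s1" "arr W1 X f1" "quasi_iso W2 X s2" "arr W2 X s2" "arr W2 X f2"
    using roof_rel_roofs[OF X X assms(1)] by (auto simp: roofs_iff[OF X X])
  obtain A a where a: "quasi_iso A W1 a" "arr A W1 a" and h: "heq A X (cmap_comp f1 a) (cmap_comp s1 a)"
    using assms(2) by (auto simp: id_roofs_iff)
  obtain W u1 u2 where u: "arr W W1 u1" "arr W W2 u2" "quasi_iso W W1 u1" "quasi_iso W W2 u2"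
    and hs: "heq W X (cmap_comp s1 u1) (cmap_comp s2 u2)" and hf: "heq W X (cmap_comp f1 u1) (cmap_comp f2 u2)"
    by (rule roof_relE[OF X X assms(1)])
  obtain V t k where V: "is_cpx V" and t: "quasi_iso V W t" "arr V W t" and k: "arr V A k"
    and o: "heq V W1 (cmap_comp u1 t) (cmap_comp a k)" by (rule ore_squareE[OF a u(1)])
  have "heq V X (cmap_comp f2 (cmap_comp u2 t)) (cmap_comp f1 (cmap_comp u1 t))"
    by (rule heq_comp_right[OF heq_sym[OF hf] u(2) r(5) u(1) r(2) t(2)])
  also have "heq V X \<dots> (cmap_comp f1 (cmap_comp a k))" by (rule heq_left[OF o r(2)])
  also have "heq V X \<dots> (cmap_comp s1 (cmap_comp a k))" by (rule heq_comp_right[OF h a(2) r(2) a(2) r(1) k])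
  also have "heq V X \<dots> (cmap_comp s1 (cmap_comp u1 t))" by (rule heq_left[OF heq_sym[OF o] r(1)])
  also have "heq V X \<dots> (cmap_comp s2 (cmap_comp u2 t))" by (rule heq_comp_right[OF hs u(1) r(1) u(2) r(4) t(2)])
  finally have "heq V X (cmap_comp f2 (cmap_comp u2 t)) (cmap_comp s2 (cmap_comp u2 t))" .
  moreover have "quasi_iso V W2 (cmap_comp u2 t)"
    using quasi_iso_comp[OF V, of W W2 t u2] t u by (auto simp: arr_def)
  ultimately show ?thesis using r arr_comp[OF t(2) u(2)] by (auto simp: id_roofs_iff)
qed

text \<open>An Ore square of the denominators also matches the numerators, which are homotopic to
  the denominators after refinement.\<close>

lemma id_roofs_related:
  assumes "(W1, s1, f1) \<in> id_roofs" "(W2, s2, f2) \<in> id_roofs"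
  shows "((W1, s1, f1), (W2, s2, f2)) \<in> roof_rel X X"
proof -
  obtain A a where a: "quasi_iso A W1 a" "arr A W1 a" and ha: "heq A X (cmap_comp f1 a) (cmap_comp s1 a)"
    using assms(1) by (auto simp: id_roofs_iff)
  obtain B b where b: "quasi_iso B W2 b" "arr B W2 b" and hb: "heq B X (cmap_comp f2 b) (cmap_comp s2 b)"
    using assms(2) by (auto simp: id_roofs_iff)
  have r1: "quasi_iso W1 X s1" "arr W1 X s1" "arr W1 X f1" using assms(1) by (auto simp: id_roofs_iff)
  have r2: "quasi_iso W2 X s2" "arr W2 X s2" "arr W2 X f2" using assms(2) by (auto simp: id_roofs_iff)
  have q: "quasi_iso B X (cmap_comp s2 b)" using quasi_iso_comp[of B W2 X b s2] b r2 by (auto simp: arr_def)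
  obtain V t k where V: "is_cpx V" and t: "quasi_iso V A t" "arr V A t" and k: "arr V B k"
    and o: "heq V X (cmap_comp (cmap_comp s1 a) t) (cmap_comp (cmap_comp s2 b) k)"
    by (rule ore_squareE[OF q arr_comp[OF b(2) r2(2)] arr_comp[OF a(2) r1(2)]])
  have o': "heq V X (cmap_comp s1 (cmap_comp a t)) (cmap_comp s2 (cmap_comp b k))"
    using o by (simp add: arr_assoc[OF t(2) a(2) r1(2)] arr_assoc[OF k b(2) r2(2)])
  have "heq V X (cmap_comp f1 (cmap_comp a t)) (cmap_comp s1 (cmap_comp a t))"
    by (rule heq_comp_right[OF ha a(2) r1(3) a(2) r1(2) t(2)])
  also note o'
  also have "heq V X (cmap_comp s2 (cmap_comp b k)) (cmap_comp f2 (cmap_comp b k))"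
    by (rule heq_comp_right[OF heq_sym[OF hb] b(2) r2(2) b(2) r2(3) k])
  finally have "heq V X (cmap_comp f1 (cmap_comp a t)) (cmap_comp f2 (cmap_comp b k))" .
  moreover have "quasi_iso V W1 (cmap_comp a t)" using quasi_iso_comp[OF V, of A W1 t a] t a by (auto simp: arr_def)
  ultimately show ?thesis using roof_relI[OF X X _ _ arr_comp[OF k b(2)] _ o'] assms by (auto simp: id_roofs_def)
qed

lemma id_roof: "(X, cmap_id X, cmap_id X) \<in> id_roofs"
  using arr_id[OF X] quasi_iso_id[OF X] heq_refl[OF arr_comp[OF arr_id[OF X] arr_id[OF X]]] unfolding id_roofs_iff by blast

lemma id_roofs_class: "R \<subseteq> id_roofs \<Longrightarrow> R \<noteq> {} \<Longrightarrow> roof_rel X X `` R = id_roofs"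
  using id_roofs_closed id_roofs_related by fast

text \<open>Composition in the derived category collects all choices of representatives and squares;
  here every choice for identity composed with identity is seen to stay in the class. Two Ore
  squares give an apex on which numerator and denominator agree for both factors.\<close>

lemma id_roofs_comp:
  assumes c: "(W1, s, f) \<in> id_roofs" and d: "(W2, t, g) \<in> id_roofs" and W: "quasi_iso W W1 u" "arr W W1 u" "arr W W2 v"
    and h: "homotopic W X (cmap_comp f u) (cmap_comp t v)"
  shows "(W, cmap_comp s u, cmap_comp g v) \<in> id_roofs"
proof -
  obtain A a where a: "quasi_iso A W1 a" "arr A W1 a" and ha: "heq A X (cmap_comp f a) (cmap_comp s a)"
    using c by (auto simp: id_roofs_iff)
  obtain B b where b: "quasi_iso B W2 b" "arr B W2 b" and hb: "heq B X (cmap_comp g b) (cmap_comp t b)"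
    using d by (auto simp: id_roofs_iff)
  have r1: "quasi_iso W1 X s" "arr W1 X s" "arr W1 X f" using c by (auto simp: id_roofs_iff)
  have r2: "arr W2 X t" "arr W2 X g" using d by (auto simp: id_roofs_iff)
  have h': "heq W X (cmap_comp f u) (cmap_comp t v)" using h W r1 r2 by (auto simp: heq_def intro: arr_comp)
  obtain U p k where U: "is_cpx U" and p: "quasi_iso U W p" "arr U W p" and k: "arr U A k"
    and o1: "heq U W1 (cmap_comp u p) (cmap_comp a k)" by (rule ore_squareE[OF a W(2)])
  obtain V q l where V: "is_cpx V" and q: "quasi_iso V U q" "arr V U q" and l: "arr V B l"
    and o2: "heq V W2 (cmap_comp (cmap_comp v p) q) (cmap_comp b l)" by (rule ore_squareE[OF b arr_comp[OF p(2) W(3)]])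
  let ?p = "cmap_comp p q"
  have P: "arr V W ?p" by (rule arr_comp[OF q(2) p(2)])
  have o1': "heq V W1 (cmap_comp u ?p) (cmap_comp a (cmap_comp k q))"
    by (rule heq_comp_right[OF o1 p(2) W(2) k a(2) q(2)])
  have o2': "heq V W2 (cmap_comp v ?p) (cmap_comp b l)" using o2 by (simp add: arr_assoc[OF q(2) p(2) W(3)])
  have kq: "arr V A (cmap_comp k q)" by (rule arr_comp[OF q(2) k])
  have "heq V X (cmap_comp g (cmap_comp v ?p)) (cmap_comp g (cmap_comp b l))" by (rule heq_left[OF o2' r2(2)])
  also have "heq V X \<dots> (cmap_comp t (cmap_comp b l))" by (rule heq_comp_right[OF hb b(2) r2(2) b(2) r2(1) l])
  also have "heq V X \<dots> (cmap_comp t (cmap_comp v ?p))" by (rule heq_left[OF heq_sym[OF o2'] r2(1)])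
  also have "heq V X \<dots> (cmap_comp f (cmap_comp u ?p))" by (rule heq_comp_right[OF heq_sym[OF h'] W(3) r2(1) W(2) r1(3) P])
  also have "heq V X \<dots> (cmap_comp f (cmap_comp a (cmap_comp k q)))" by (rule heq_left[OF o1' r1(3)])
  also have "heq V X \<dots> (cmap_comp s (cmap_comp a (cmap_comp k q)))" by (rule heq_comp_right[OF ha a(2) r1(3) a(2) r1(2) kq])
  also have "heq V X \<dots> (cmap_comp s (cmap_comp u ?p))" by (rule heq_left[OF heq_sym[OF o1'] r1(2)])
  finally have "heq V X (cmap_comp (cmap_comp g v) ?p) (cmap_comp (cmap_comp s u) ?p)"
    by (simp add: arr_assoc[OF P W(3) r2(2)] arr_assoc[OF P W(2) r1(2)])
  moreover have "quasi_iso V W ?p" using quasi_iso_comp[of V U W q p] p q by (auto simp: arr_def)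
  moreover have "quasi_iso W X (cmap_comp s u)" using quasi_iso_comp[of W W1 X u s] W r1 by (auto simp: arr_def)
  ultimately show ?thesis using P arr_comp[OF W(2) r1(2)] arr_comp[OF W(3) r2(2)] by (auto simp: id_roofs_iff)
qed

text \<open>An essential image contains the object FX itself only if FX is isomorphic to itself; as
  no category laws are at hand, this requires computing the square of the identity.\<close>

lemma isomorphic_refl: "isomorphic Db_pretri X X"
proof -
  let ?S = "{(W, cmap_comp s u, cmap_comp g v) | W u v W1 s f W2 t g.
     (W1, s, f) \<in> id_roofs \<and> (W2, t, g) \<in> id_roofs \<and> is_cpx W \<and> quasi_iso W W1 u \<and> is_cmap W W2 v \<and>
     homotopic W X (cmap_comp f u) (cmap_comp t v)}"
  have id: "Db_of_cmap X X (cmap_id X) = (X, X, id_roofs)"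
    using id_roofs_class[of "{(X, cmap_id X, cmap_id X)}"] id_roof by (simp add: Db_of_cmap_def)
  have "(W, cmap_comp s u, cmap_comp g v) \<in> id_roofs" if "(W1, s, f) \<in> id_roofs" "(W2, t, g) \<in> id_roofs" "is_cpx W"
    "quasi_iso W W1 u" "is_cmap W W2 v" "homotopic W X (cmap_comp f u) (cmap_comp t v)" for W u v W1 s f W2 t g
    using that by (intro id_roofs_comp[of W1 s f W2 t g]) (auto simp: id_roofs_iff arr_def quasi_iso_cmap)
  then have "?S \<subseteq> id_roofs" by blast
  moreover have "(X, cmap_comp (cmap_id X) (cmap_id X), cmap_comp (cmap_id X) (cmap_id X)) \<in> ?S"
    using id_roof X quasi_iso_id[OF X] cmap_id_is_cmap[OF X]
      homotopic_refl[OF X X cmap_comp_is_cmap[OF X X X cmap_id_is_cmap[OF X] cmap_id_is_cmap[OF X]]] by blast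
  ultimately have "roof_rel X X `` ?S = id_roofs" by (intro id_roofs_class) blast+
  then have "Db_comp (Db_of_cmap X X (cmap_id X)) (Db_of_cmap X X (cmap_id X)) = Db_of_cmap X X (cmap_id X)"
    unfolding id by (simp add: Db_comp_def)
  then show ?thesis
    unfolding isomorphic_def is_iso_mor_def Db_pretri_def
    using Db_of_cmap_mor[OF X X cmap_id_is_cmap[OF X]] by (intro exI[of _ "Db_of_cmap X X (cmap_id X)"]) auto
qed

end

section \<open>The right orthogonal\<close>

lemma P_perp_sel [simp]:
  "mor P_perp = Db_mor" "idt P_perp = idt Db_pretri" "cmp P_perp = Db_comp" "mzero P_perp = (\<lambda>X Y. Db_of_cmap X Y (cmap_zero X Y))"
  "mscale P_perp = Db_scale" "shift P_perp = cpx_shift"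
  by (simp_all add: P_perp_def right_orth_def full_sub_def Db_def Db_pretri_def)

lemma P_perp_dtri: "t \<in> dtri P_perp \<Longrightarrow> t \<in> dtri Db"
  by (auto simp: P_perp_def right_orth_def full_sub_def)

lemma P_perp_obj_iff: "T \<in> obj P_perp \<longleftrightarrow> is_cpx T \<and> (\<forall>i. hom_vanishes (conc 0 P_rep) (cpx_shift i T))"
proof -
  have P: "is_cpx (P_cpx :: 'a cpx)" by (simp add: P_cpx_conc is_cpx_conc small_reps)
  have "T \<in> obj P_perp \<longleftrightarrow> is_cpx T \<and> (\<forall>i. Db_mor P_cpx (cpx_shift i T) = {Db_of_cmap P_cpx (cpx_shift i T) (cmap_zero P_cpx (cpx_shift i T))})"
    by (auto simp: P_perp_def right_orth_def full_sub_def Db_def Db_pretri_def)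
  also have "\<dots> \<longleftrightarrow> is_cpx T \<and> (\<forall>i. hom_vanishes P_cpx (cpx_shift i T))"
    using Db_mor_trivial_iff[OF P is_cpx_shift[of T]] by blast
  finally show ?thesis by (simp only: P_cpx_conc)
qed

lemma P_perp_cpx: "T \<in> obj P_perp \<Longrightarrow> is_cpx T"
  by (simp add: P_perp_obj_iff)

lemma P_perp_shift: "T \<in> obj P_perp \<Longrightarrow> cpx_shift i T \<in> obj P_perp"
  by (simp add: P_perp_obj_iff is_cpx_shift cpx_shift_shift)

lemma P_perp_isomorphic: "isomorphic P_perp X Y \<longleftrightarrow> isomorphic Db_pretri X Y"
  by (simp add: isomorphic_def is_iso_mor_def) (simp add: Db_pretri_def)

lemma P_perp_zero_object:
  assumes "zero_object P_perp X" shows "is_cpx X" "acyclic X"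
proof -
  show X: "is_cpx X" using assms by (simp add: zero_object_def P_perp_cpx)
  show "acyclic X" by (rule zero_object_acyclic[OF X]) (use assms in \<open>simp add: zero_object_def Db_pretri_def\<close>)
qed

lemma P_perp_objects: "conc 0 M_rep \<in> obj P_perp" "B_cpx \<in> obj P_perp"
  by (simp_all add: P_perp_obj_iff perp_M perp_B is_cpx_conc small_reps is_cpx_B)

text \<open>The dual of a trivial Hom space has at most one element, so the bijection of Serre
  duality leaves room for one morphism from \<open>X\<close> to \<open>Y\<close>, and the zero
  morphism is one.\<close>

lemma serre_functor_hom_vanishes:
  assumes S: "serre_functor P_perp S" and X: "X \<in> obj P_perp" and Y: "Y \<in> obj P_perp" and SX: "is_cpx (fob S X)"
    and z: "hom_vanishes Y (fob S X)"
  shows "hom_vanishes X Y"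
proof -
  note cX = P_perp_cpx[OF X] and cY = P_perp_cpx[OF Y]
  define e where "e = Db_of_cmap Y (fob S X) (cmap_zero Y (fob S X))"
  have m: "Db_mor Y (fob S X) = {e}" using Db_mor_trivial_iff[OF cY SX] z unfolding e_def by blast
  have e0: "Db_scale 0 e = e" unfolding e_def by (rule Db_scale_zero[OF cY SX z])
  \<comment> \<open>The scalar 0 fixes the only morphism and forces the value 0; extensionality
    settles the values elsewhere.\<close>
  have "\<xi> = (\<lambda>f \<in> {e}. 0)" if "\<xi> \<in> dual_mor P_perp Y (fob S X)" for \<xi>
  proof -
    have "\<xi> \<in> extensional {e}" "\<forall>c. \<xi> (Db_scale c e) = c * \<xi> e" using that by (auto simp: dual_mor_def m)
    moreover from this(2)[rule_format, of 0] have "\<xi> e = 0" by (simp add: e0)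
    ultimately show ?thesis by (auto simp: extensional_def fun_eq_iff)
  qed
  then have one: "\<xi> = \<zeta>" if "\<xi> \<in> dual_mor P_perp Y (fob S X)" "\<zeta> \<in> dual_mor P_perp Y (fob S X)" for \<xi> \<zeta>
    using that by metis
  from S obtain \<theta> where "bij_betw (\<theta> X Y) (mor P_perp X Y) (dual_mor P_perp Y (fob S X))"
    unfolding serre_functor_def using X Y by blast
  then have b: "bij_betw (\<theta> X Y) (Db_mor X Y) (dual_mor P_perp Y (fob S X))" by simp
  have "f = g" if "f \<in> Db_mor X Y" "g \<in> Db_mor X Y" for f g
    using one[OF bij_betwE[OF b, rule_format, OF that(1)] bij_betwE[OF b, rule_format, OF that(2)]]
      bij_betw_imp_inj_on[OF b] that by (simp add: inj_on_def)
  then have "Db_mor X Y = {Db_of_cmap X Y (cmap_zero X Y)}" using Db_zero_mor[OF cX cY] by blast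
  then show ?thesis using Db_mor_trivial_iff[OF cX cY] by blast
qed

section \<open>Serre-invariant stability conditions\<close>

text \<open>Near the top of \<open>U\<close> the displacement of \<open>f\<close> is below $d +
  1/2$, near the bottom of \<open>L\<close> it is above $e - 1/2$. Monotonicity and periodicity let
  displacements at two points differ by less than 1, so $e < d + 2$.\<close>

lemma shift_invariant_sets_absurd:
  fixes f :: "real \<Rightarrow> real" and d e :: real
  assumes mono: "strict_mono f" and per: "\<And>x. f (x + 1) = f x + 1"
    and U: "U \<noteq> {}" "bdd_above U" "\<And>x. x \<in> U \<Longrightarrow> f x - d \<in> U"
    and L: "L \<noteq> {}" "bdd_below L" "\<And>x. x \<in> L \<Longrightarrow> f x - e \<in> L" and "d + 2 \<le> e"
  shows False
proof -
  have per_nat: "f (x + real n) = f x + real n" for x n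
  proof (induction n)
    case (Suc n)
    then show ?case using per[of "x + real n"] by (simp add: algebra_simps)
  qed simp
  have per_int: "f (x + of_int j) = f x + of_int j" for x j
  proof (cases "j \<ge> 0")
    case True
    then show ?thesis using per_nat[of x "nat j"] by simp
  next
    case False
    then show ?thesis using per_nat[of "x + of_int j" "nat (- j)"] by simp
  qed
  obtain x where x: "x \<in> U" "Sup U - 1/2 < x" using less_cSup_iff[OF U(1,2), of "Sup U - 1/2"] by auto
  obtain y where y: "y \<in> L" "y < Inf L + 1/2" using cInf_less_iff[OF L(1,2), of "Inf L + 1/2"] by auto
  \<comment> \<open>The integer translate of \<open>x\<close> that is the first to reach
    \<open>y\<close>; it overshoots by less than 1.\<close>
  define j where "j = \<lceil>y - x\<rceil>"
  have j: "y \<le> x + of_int j" "x + of_int j < y + 1" unfolding j_def by linarith+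
  have "f y \<le> f x + of_int j" using strict_mono_mono[OF mono] j(1) per_int[of x j] by (metis monoD)
  moreover have "f x - d \<le> Sup U" by (rule cSup_upper[OF U(3)[OF x(1)] U(2)])
  moreover have "Inf L \<le> f y - e" by (rule cInf_lower[OF L(3)[OF y(1)] L(2)])
  ultimately show False using x y j \<open>d + 2 \<le> e\<close> by linarith
qed

context
  fixes \<sigma> :: "'k :: field cpx stab"
  assumes st: "stability_condition (P_perp :: ('k cpx, 'k dmor, 'k) tricat) \<sigma>"
begin

lemma slice_obj: "A \<in> slice \<sigma> \<phi> \<Longrightarrow> A \<in> obj P_perp"
proof -
  have "additive_strict_subcat P_perp (slice \<sigma> \<phi>)" using st unfolding stability_condition_def by blast
  then show "A \<in> slice \<sigma> \<phi> \<Longrightarrow> A \<in> obj P_perp" unfolding additive_strict_subcat_def by blast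
qed

text \<open>Slices are literal images under the shift, so an object is desuspended by an equality
  and not just up to isomorphism.\<close>

lemma slice_shift: "A \<in> slice \<sigma> \<phi> \<Longrightarrow> \<exists>A' \<in> slice \<sigma> (\<phi> - 1). A = cpx_shift 1 A'"
proof -
  have "\<forall>\<phi>. slice \<sigma> (\<phi> + 1) = shift P_perp 1 ` slice \<sigma> \<phi>" using st unfolding stability_condition_def by blast
  from this[rule_format, of "\<phi> - 1"] have "slice \<sigma> \<phi> = cpx_shift 1 ` slice \<sigma> (\<phi> - 1)" by simp
  then show "A \<in> slice \<sigma> \<phi> \<Longrightarrow> \<exists>A' \<in> slice \<sigma> (\<phi> - 1). A = cpx_shift 1 A'" by auto
qed

lemma slice_hom_vanishes:
  assumes "\<psi> < \<phi>" "A \<in> slice \<sigma> \<phi>" "B \<in> slice \<sigma> \<psi>"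
  shows "hom_vanishes A B"
proof -
  have "mor P_perp A B = {mzero P_perp A B}" using st assms unfolding stability_condition_def by blast
  then have "Db_mor A B = {Db_of_cmap A B (cmap_zero A B)}" by simp
  then show ?thesis using Db_mor_trivial_iff[OF P_perp_cpx[OF slice_obj[OF assms(2)]] P_perp_cpx[OF slice_obj[OF assms(3)]]] by blast
qed

text \<open>Vanishing propagates up the filtration, triangle by triangle, from the acyclic bottom
  term.\<close>

lemma hn_hom_vanishes:
  assumes hn: "hn_filtration P_perp (slice \<sigma>) X n \<phi> E A" and T: "is_cpx T"
  shows "(\<And>i. i < n \<Longrightarrow> hom_vanishes (A i) T) \<Longrightarrow> hom_vanishes X T"
    "(\<And>i. i < n \<Longrightarrow> hom_vanishes T (A i)) \<Longrightarrow> hom_vanishes T X"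
proof -
  have z: "zero_object P_perp (E 0)" and X: "E n = X" using hn by (simp_all add: hn_filtration_def)
  have t: "\<exists>f g h. (E i, E (Suc i), A i, f, g, h) \<in> dtri Db" if "i < n" for i
    using hn that P_perp_dtri unfolding hn_filtration_def by blast
  note zero = hom_vanishes_acyclic[OF P_perp_zero_object[OF z] T]
  have "i \<le> n \<Longrightarrow> hom_vanishes (E i) T" if "\<And>i. i < n \<Longrightarrow> hom_vanishes (A i) T" for i
  proof (induction i)
    case (Suc i)
    then show ?case using t[of i] dtri_hom_vanishes(2)[OF _ T] that[of i] by (meson Suc_le_lessD less_imp_le)
  qed (use zero in simp)
  then show "(\<And>i. i < n \<Longrightarrow> hom_vanishes (A i) T) \<Longrightarrow> hom_vanishes X T" using X by blast
  have "i \<le> n \<Longrightarrow> hom_vanishes T (E i)" if "\<And>i. i < n \<Longrightarrow> hom_vanishes T (A i)" for i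
  proof (induction i)
    case (Suc i)
    then show ?case using t[of i] dtri_hom_vanishes(1)[OF _ T] that[of i] by (meson Suc_le_lessD less_imp_le)
  qed (use zero in simp)
  then show "(\<And>i. i < n \<Longrightarrow> hom_vanishes T (A i)) \<Longrightarrow> hom_vanishes T X" using X by blast
qed

text \<open>As Hom(X, X) is nonzero, some Harder-Narasimhan factor maps to \<open>X\<close> and some
  factor receives a map from it. A semistable object of phase above all factors has no map to any of
  them, hence none to \<open>X\<close>; dually below.\<close>

lemma phases_bounded:
  assumes X: "X \<in> obj P_perp" and na: "\<not> acyclic X"
  shows "{\<phi>. \<exists>A \<in> slice \<sigma> \<phi>. \<not> hom_vanishes A X} \<noteq> {}" "bdd_above {\<phi>. \<exists>A \<in> slice \<sigma> \<phi>. \<not> hom_vanishes A X}"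
    "{\<phi>. \<exists>A \<in> slice \<sigma> \<phi>. \<not> hom_vanishes X A} \<noteq> {}" "bdd_below {\<phi>. \<exists>A \<in> slice \<sigma> \<phi>. \<not> hom_vanishes X A}"
proof -
  have "\<not> zero_object (P_perp :: ('k cpx, 'k dmor, 'k) tricat) X" using na P_perp_zero_object(2) by blast
  moreover have "\<forall>X \<in> obj P_perp. \<not> zero_object (P_perp :: ('k cpx, 'k dmor, 'k) tricat) X \<longrightarrow>
      (\<exists>n \<phi> E A. hn_filtration (P_perp :: ('k cpx, 'k dmor, 'k) tricat) (slice \<sigma>) X n \<phi> E A)"
    using st unfolding stability_condition_def by (elim conjE) assumption
  ultimately obtain n \<phi> E A where hn: "hn_filtration (P_perp :: ('k cpx, 'k dmor, 'k) tricat) (slice \<sigma>) X n \<phi> E A"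
    using X by metis
  note cX = P_perp_cpx[OF X]
  have A: "A i \<in> slice \<sigma> (\<phi> i)" if "i < n" for i using hn that by (simp add: hn_filtration_def)
  have desc: "\<phi> (n - 1) \<le> \<phi> i \<and> \<phi> i \<le> \<phi> 0" if "i < n" for i
  proof -
    have less: "\<phi> i > \<phi> j" if "i < j" "j < n" for i j using hn that by (simp add: hn_filtration_def)
    have "i = 0 \<or> 0 < i" "i = n - 1 \<or> i < n - 1" using that by auto
    then show ?thesis using less[of 0 i] less[of i "n - 1"] that by force
  qed
  have nX: "\<not> hom_vanishes X X" using hom_vanishes_self[OF cX] na by blast
  have "\<exists>i<n. \<not> hom_vanishes (A i) X"
  proof (rule ccontr)
    assume "\<not> ?thesis"
    then have "hom_vanishes X X" by (intro hn_hom_vanishes(1)[OF hn cX]) simp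
    with nX show False by blast
  qed
  moreover have "\<exists>i<n. \<not> hom_vanishes X (A i)"
  proof (rule ccontr)
    assume "\<not> ?thesis"
    then have "hom_vanishes X X" by (intro hn_hom_vanishes(2)[OF hn cX]) simp
    with nX show False by blast
  qed
  ultimately show "{\<phi>. \<exists>A \<in> slice \<sigma> \<phi>. \<not> hom_vanishes A X} \<noteq> {}" "{\<phi>. \<exists>A \<in> slice \<sigma> \<phi>. \<not> hom_vanishes X A} \<noteq> {}"
    using A by blast+
  have "\<psi> \<le> \<phi> 0" if "A' \<in> slice \<sigma> \<psi>" "\<not> hom_vanishes A' X" for \<psi> A'
  proof (rule ccontr)
    assume "\<not> \<psi> \<le> \<phi> 0"
    then have "hom_vanishes A' (A i)" if "i < n" for i
      using desc[OF that] by (intro slice_hom_vanishes[OF _ \<open>A' \<in> slice \<sigma> \<psi>\<close> A[OF that]]) linarith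
    then show False using hn_hom_vanishes(2)[OF hn P_perp_cpx[OF slice_obj[OF that(1)]]] that(2) by blast
  qed
  then show "bdd_above {\<phi>. \<exists>A \<in> slice \<sigma> \<phi>. \<not> hom_vanishes A X}" by (intro bdd_aboveI[of _ "\<phi> 0"]) blast
  have "\<phi> (n - 1) \<le> \<psi>" if "A' \<in> slice \<sigma> \<psi>" "\<not> hom_vanishes X A'" for \<psi> A'
  proof (rule ccontr)
    assume "\<not> \<phi> (n - 1) \<le> \<psi>"
    then have "hom_vanishes (A i) A'" if "i < n" for i
      using desc[OF that] by (intro slice_hom_vanishes[OF _ A[OF that] \<open>A' \<in> slice \<sigma> \<psi>\<close>]) linarith
    then show False using hn_hom_vanishes(1)[OF hn P_perp_cpx[OF slice_obj[OF that(1)]]] that(2) by blast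
  qed
  then show "bdd_below {\<phi>. \<exists>A \<in> slice \<sigma> \<phi>. \<not> hom_vanishes X A}" by (intro bdd_belowI[of _ "\<phi> (n - 1)"]) blast
qed

lemma not_serre_invariant: "\<not> serre_invariant (P_perp :: ('k cpx, 'k dmor, 'k) tricat) \<sigma>"
proof
  assume "serre_invariant (P_perp :: ('k cpx, 'k dmor, 'k) tricat) \<sigma>"
  then obtain S T f where S: "serre_functor (P_perp :: ('k cpx, 'k dmor, 'k) tricat) S" and g: "(T, f) \<in> GL2plus_cover"
    and e: "auteq_act (P_perp :: ('k cpx, 'k dmor, 'k) tricat) S \<sigma> = GL2plus_act P_perp \<sigma> (T, f)"
    by (auto simp: serre_invariant_def)
  from e have "slice (auteq_act (P_perp :: ('k cpx, 'k dmor, 'k) tricat) S \<sigma>) = slice (GL2plus_act (P_perp :: ('k cpx, 'k dmor, 'k) tricat) \<sigma> (T, f))" by simp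
  then have sl: "{X \<in> obj P_perp. \<exists>Y \<in> slice \<sigma> \<phi>. isomorphic P_perp (fob S Y) X} = slice \<sigma> (f \<phi>)" for \<phi>
    by (simp add: auteq_act_def GL2plus_act_def fun_eq_iff)
  have So: "fob S X \<in> obj P_perp" if "X \<in> obj P_perp" for X
    using S that by (auto simp: serre_functor_def autoequivalence_def exact_functor_def linear_functor_def)
  \<comment> \<open>Equality of the two actions identifies the slice at \<open>f \<phi>\<close> with
    the essential image of the slice at \<open>\<phi>\<close>.\<close>
  have SA: "fob S A \<in> slice \<sigma> (f \<phi>)" if "A \<in> slice \<sigma> \<phi>" for A \<phi>
    using that So[OF slice_obj[OF that]] isomorphic_refl[OF P_perp_cpx[OF So[OF slice_obj[OF that]]]]
    unfolding sl[symmetric] P_perp_isomorphic by blast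
  let ?M = "conc 0 M_rep :: 'k cpx" and ?B = "B_cpx :: 'k cpx"
  have M: "is_cpx ?M" and B: "is_cpx ?B" using P_perp_objects by (auto intro: P_perp_cpx)
  let ?U = "{\<phi>. \<exists>A \<in> slice \<sigma> \<phi>. \<not> hom_vanishes A ?M}" and ?L = "{\<phi>. \<exists>A \<in> slice \<sigma> \<phi>. \<not> hom_vanishes ?B A}"
  have U: "f \<phi> - 1 \<in> ?U" if p: "\<phi> \<in> ?U" for \<phi>
  proof -
    obtain A where A: "A \<in> slice \<sigma> \<phi>" "\<not> hom_vanishes A ?M" using p by blast
    note Ao = slice_obj[OF A(1)]
    note c = P_perp_cpx[OF So[OF Ao]]
    obtain A' where A': "A' \<in> slice \<sigma> (f \<phi> - 1)" "fob S A = cpx_shift 1 A'" using slice_shift[OF SA[OF A(1)]] by blast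
    \<comment> \<open>A nonzero map from A to M gives one from M to SA, and then one from SA to
      M[1]; removing one shift lowers the phase of SA by 1.\<close>
    have "\<not> hom_vanishes ?M (fob S A)"
      using serre_functor_hom_vanishes[OF S Ao P_perp_objects(1) c] A(2) by blast
    then have "\<not> hom_vanishes (fob S A) (cpx_shift 1 ?M)" using serre_M[OF c] by blast
    then have "\<not> hom_vanishes A' ?M"
      unfolding A'(2) using hom_vanishes_shift[OF P_perp_cpx[OF slice_obj[OF A'(1)]] M] by blast
    then show ?thesis using A'(1) by blast
  qed
  have L: "f \<phi> - 3 \<in> ?L" if p: "\<phi> \<in> ?L" for \<phi>
  proof -
    obtain A where A: "A \<in> slice \<sigma> \<phi>" "\<not> hom_vanishes ?B A" using p by blast
    note Ao = slice_obj[OF A(1)]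
    note c = P_perp_cpx[OF So[OF Ao]]
    obtain A1 A2 A' where "fob S A = cpx_shift 1 A1" "A1 = cpx_shift 1 A2" "A2 = cpx_shift 1 A'" and A': "A' \<in> slice \<sigma> (f \<phi> - 1 - 1 - 1)"
      using slice_shift[OF SA[OF A(1)]] slice_shift[of _ "f \<phi> - 1"] slice_shift[of _ "f \<phi> - 1 - 1"] by blast
    then have e: "fob S A = cpx_shift 3 A'" by (simp add: cpx_shift_shift)
    \<comment> \<open>The order is reversed here: duality for B comes first and leads from A to
      B[3], then the Serre functor leads from B[3] to SA, whose three shifts cancel.\<close>
    have "\<not> hom_vanishes A (cpx_shift 3 ?B)"
      using serre_B[OF P_perp_cpx[OF Ao]] Ao A(2) by (auto simp: P_perp_obj_iff)
    then have "\<not> hom_vanishes (cpx_shift 3 ?B) (fob S A)"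
      using serre_functor_hom_vanishes[OF S Ao P_perp_shift[OF P_perp_objects(2)] c] by blast
    then have "\<not> hom_vanishes ?B A'"
      unfolding e using hom_vanishes_shift[OF B P_perp_cpx[OF slice_obj[OF A']]] by blast
    moreover have "f \<phi> - 1 - 1 - 1 = f \<phi> - 3" by simp
    ultimately show ?thesis using A' by auto
  qed
  have f: "strict_mono f" "\<And>x. f (x + 1) = f x + 1" using g by (auto simp: GL2plus_cover_def)
  show False
    by (rule shift_invariant_sets_absurd[OF f phases_bounded(1,2)[OF P_perp_objects(1) not_acyclic_M] U
          phases_bounded(3,4)[OF P_perp_objects(2) not_acyclic_B] L]) simp_all
qed

end

theorem corollary3p4:
  shows "\<not> (\<exists>\<sigma>. stability_condition (P_perp :: ('k :: {alg_closed_field, field_char_0} cpx, 'k dmor, 'k) tricat) \<sigma>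
              \<and> serre_invariant (P_perp :: ('k cpx, 'k dmor, 'k) tricat) \<sigma>)"
  using not_serre_invariant by blast

end
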